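(* Let $G$ be a second countable compact group, and let $\alpha$ be a faithful minimal action of $G$ on a separable unital C$^*$-algebra $A$ whose fixed point algebra $A^\alpha$ is a Kirchberg algebra. Let $\nu:A\to A$ be a $G$-equivariant unital completely positive map. Then for every finite set $F\subset A$ and every $\varepsilon>0$, there exists $V\in A^\alpha$ such that $\|\nu(x)-V^*xV\|<\varepsilon$ for all $x\in F$.
   Context: An action of $G$ on $A$ is a homomorphism $\alpha:G\to\mathrm{Aut}(A)$ continuous in the point-norm topology; it is faithful if injective. $A^\alpha$ is the fixed point algebra. The action is minimal if the relative commutant $(A^\alpha)'\cap M(A)$ is trivial ($=\mathbb{C}1$), where $M(A)$ is the multiplier algebra (equal to $A$ here). A Kirchberg algebra is a separable nuclear simple purely infinite C$^*$-algebra. $G$-equivariant means $\nu\circ\alpha_g=\alpha_g\circ\nu$ for all $g\in G$. *)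

theory Defs
  imports
    "HOL-Analysis.Analysis"
    "HOL-Library.Groups_Big_Fun"
    "HOL-Algebra.Group"
begin

section \<open>Complex star-algebras and C*-algebras\<close>

class complex_star_algebra = real_algebra +
  fixes scaleC :: "complex \<Rightarrow> 'a \<Rightarrow> 'a" (infixr \<open>*\<^sub>C\<close> 75)
    and star :: "'a \<Rightarrow> 'a"
  assumes scaleC_add_right: "c *\<^sub>C (x + y) = c *\<^sub>C x + c *\<^sub>C y"
    and scaleC_add_left: "(c + d) *\<^sub>C x = c *\<^sub>C x + d *\<^sub>C x"
    and scaleC_scaleC: "c *\<^sub>C d *\<^sub>C x = (c * d) *\<^sub>C x"
    and scaleC_of_real: "complex_of_real r *\<^sub>C x = r *\<^sub>R x"
    and mult_scaleC_left: "(c *\<^sub>C x) * y = c *\<^sub>C (x * y)"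
    and mult_scaleC_right: "x * (c *\<^sub>C y) = c *\<^sub>C (x * y)"
    and star_star: "star (star x) = x"
    and star_add: "star (x + y) = star x + star y"
    and star_scaleC: "star (c *\<^sub>C x) = cnj c *\<^sub>C star x"
    and star_mult: "star (x * y) = star y * star x"

lemma scaleC_zero_right: "c *\<^sub>C (0::'a::complex_star_algebra) = 0"
  using scaleC_add_right[of c "0::'a" 0] by simp

lemma star_zero: "star (0::'a::complex_star_algebra) = 0"
  using star_add[of "0::'a" 0] by simp

lemma scaleC_sum: "c *\<^sub>C sum f A = (\<Sum>x\<in>A. c *\<^sub>C (f x :: 'a::complex_star_algebra))"
  by (induction A rule: infinite_finite_induct) (simp_all add: scaleC_zero_right scaleC_add_right)

lemma star_sum: "star (sum f A) = (\<Sum>x\<in>A. star (f x :: 'a::complex_star_algebra))"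
  by (induction A rule: infinite_finite_induct) (simp_all add: star_zero star_add)

class unital_cstar_algebra = complex_star_algebra + real_normed_algebra_1 + banach +
  assumes norm_scaleC: "norm (c *\<^sub>C x) = cmod c * norm x"
    and cstar_identity: "norm (star x * x) = (norm x)\<^sup>2"

instantiation complex :: unital_cstar_algebra
begin

definition scaleC_complex :: "complex \<Rightarrow> complex \<Rightarrow> complex"
  where "scaleC_complex c z = c * z"

definition star_complex :: "complex \<Rightarrow> complex"
  where "star_complex = cnj"

instance
  by standard
    (simp_all add: scaleC_complex_def star_complex_def algebra_simps scaleR_conv_of_real
      norm_mult power2_eq_square)

end

definition cstar_subalgebra :: "'a::unital_cstar_algebra set \<Rightarrow> bool"
  where "cstar_subalgebra B \<longleftrightarrow>
    closed B \<and> 0 \<in> B \<and>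
    (\<forall>x\<in>B. \<forall>y\<in>B. x + y \<in> B \<and> x * y \<in> B) \<and>
    (\<forall>c. \<forall>x\<in>B. c *\<^sub>C x \<in> B) \<and>
    (\<forall>x\<in>B. star x \<in> B)"

text \<open>Positive elements of a star-algebra \<open>B\<close> are those of the form \<open>y\<^sup>*y\<close> with \<open>y\<close> in \<open>B\<close>.\<close>

definition positive_in :: "'a::complex_star_algebra set \<Rightarrow> 'a \<Rightarrow> bool"
  where "positive_in B x \<longleftrightarrow> (\<exists>y\<in>B. x = star y * y)"


section \<open>Matrices over star-algebras\<close>

text \<open>
  The type \<open>'a fmat\<close> consists of the infinite matrices over \<open>'a\<close> with finitely many nonzero
  entries. It is a star-algebra, and it contains every \<open>M\<^sub>n('a)\<close> as its upper left \<open>n \<times> n\<close>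
  corner. The size \<open>n\<close> can thus be quantified over, and the construction can be iterated, as in
  \<open>M\<^sub>n(M\<^sub>k(\<complex>))\<close>.
\<close>

typedef (overloaded) 'a fmat =
  "{X :: nat \<Rightarrow> nat \<Rightarrow> 'a::zero. \<exists>n. \<forall>i j. n \<le> i \<or> n \<le> j \<longrightarrow> X i j = 0}"
  morphisms entry Abs_fmat
  by (rule exI[of _ "\<lambda>_ _. 0"]) simp

setup_lifting type_definition_fmat

lemma fmat_eqI: "(\<And>i j. entry X i j = entry Y i j) \<Longrightarrow> X = Y"
  by (metis entry_inject ext)

lemma Sum_any_eq_sum_lessThan:
  assumes "\<And>k. (n::nat) \<le> k \<Longrightarrow> f k = 0"
  shows "Sum_any f = (\<Sum>k<n. f k)"
  by (rule Sum_any.expand_superset) (use assms in \<open>auto simp: not_less[symmetric]\<close>)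

instantiation fmat :: (complex_star_algebra) complex_star_algebra
begin

lift_definition zero_fmat :: "'a fmat" is "\<lambda>_ _. 0"
  by simp

lift_definition plus_fmat :: "'a fmat \<Rightarrow> 'a fmat \<Rightarrow> 'a fmat" is "\<lambda>X Y i j. X i j + Y i j"
proof -
  fix X Y :: "nat \<Rightarrow> nat \<Rightarrow> 'a"
  assume "\<exists>n. \<forall>i j. n \<le> i \<or> n \<le> j \<longrightarrow> X i j = 0" "\<exists>n. \<forall>i j. n \<le> i \<or> n \<le> j \<longrightarrow> Y i j = 0"
  then obtain m n where "\<forall>i j. m \<le> i \<or> m \<le> j \<longrightarrow> X i j = 0" "\<forall>i j. n \<le> i \<or> n \<le> j \<longrightarrow> Y i j = 0"
    by blast
  then show "\<exists>n. \<forall>i j. n \<le> i \<or> n \<le> j \<longrightarrow> X i j + Y i j = 0"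
    by (intro exI[of _ "max m n"]) auto
qed

lift_definition uminus_fmat :: "'a fmat \<Rightarrow> 'a fmat" is "\<lambda>X i j. - X i j"
  by simp

definition minus_fmat :: "'a fmat \<Rightarrow> 'a fmat \<Rightarrow> 'a fmat"
  where "minus_fmat X Y = X + (- Y)"

lift_definition times_fmat :: "'a fmat \<Rightarrow> 'a fmat \<Rightarrow> 'a fmat"
  is "\<lambda>X Y i j. Sum_any (\<lambda>k. X i k * Y k j)"
proof -
  fix X Y :: "nat \<Rightarrow> nat \<Rightarrow> 'a"
  assume "\<exists>n. \<forall>i j. n \<le> i \<or> n \<le> j \<longrightarrow> X i j = 0" "\<exists>n. \<forall>i j. n \<le> i \<or> n \<le> j \<longrightarrow> Y i j = 0"
  then obtain m n where "\<forall>i j. m \<le> i \<or> m \<le> j \<longrightarrow> X i j = 0" "\<forall>i j. n \<le> i \<or> n \<le> j \<longrightarrow> Y i j = 0"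
    by blast
  then show "\<exists>n. \<forall>i j. n \<le> i \<or> n \<le> j \<longrightarrow> Sum_any (\<lambda>k. X i k * Y k j) = 0"
    by (intro exI[of _ "max m n"]) auto
qed

lift_definition scaleR_fmat :: "real \<Rightarrow> 'a fmat \<Rightarrow> 'a fmat" is "\<lambda>r X i j. r *\<^sub>R X i j"
  by fastforce

lift_definition scaleC_fmat :: "complex \<Rightarrow> 'a fmat \<Rightarrow> 'a fmat" is "\<lambda>c X i j. c *\<^sub>C X i j"
  by (metis scaleC_zero_right)

lift_definition star_fmat :: "'a fmat \<Rightarrow> 'a fmat" is "\<lambda>X i j. star (X j i)"
  by (metis star_zero)

lemma fmat_bound: "\<exists>n. \<forall>i j. n \<le> i \<or> n \<le> j \<longrightarrow> entry X i j = 0"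
  using entry by auto

lemma fmat_bounds:
  obtains n where "\<And>i j. n \<le> i \<or> n \<le> j \<Longrightarrow> entry (X::'a fmat) i j = 0"
    "\<And>i j. n \<le> i \<or> n \<le> j \<Longrightarrow> entry (Y::'a fmat) i j = 0"
    "\<And>i j. n \<le> i \<or> n \<le> j \<Longrightarrow> entry (Z::'a fmat) i j = 0"
proof -
  obtain a where a: "\<forall>i j. a \<le> i \<or> a \<le> j \<longrightarrow> entry X i j = 0"
    using fmat_bound by blast
  obtain b where b: "\<forall>i j. b \<le> i \<or> b \<le> j \<longrightarrow> entry Y i j = 0"
    using fmat_bound by blast
  obtain c where c: "\<forall>i j. c \<le> i \<or> c \<le> j \<longrightarrow> entry Z i j = 0"
    using fmat_bound by blast
  show ?thesis
  proof (rule that[of "a + b + c"])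
    fix i j
    assume "a + b + c \<le> i \<or> a + b + c \<le> j"
    then have "a \<le> i \<or> a \<le> j" "b \<le> i \<or> b \<le> j" "c \<le> i \<or> c \<le> j"
      by linarith+
    then show "entry X i j = 0" "entry Y i j = 0" "entry Z i j = 0"
      using a b c by blast+
  qed
qed

lemma entry_times:
  assumes "\<And>i j. n \<le> i \<or> n \<le> j \<Longrightarrow> entry X i j = 0"
  shows "entry (X * Y) i j = (\<Sum>k<n. entry X i k * entry Y k j)"
  by (simp add: times_fmat.rep_eq, rule Sum_any_eq_sum_lessThan) (simp add: assms)

lemma entry_times':
  assumes "\<And>i j. n \<le> i \<or> n \<le> j \<Longrightarrow> entry Y i j = 0"
  shows "entry (X * Y) i j = (\<Sum>k<n. entry X i k * entry Y k j)"
  by (simp add: times_fmat.rep_eq, rule Sum_any_eq_sum_lessThan) (simp add: assms)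

instance
proof
  fix X Y Z :: "'a fmat" and c d :: complex and r s :: real
  obtain n where bX: "\<And>i j. n \<le> i \<or> n \<le> j \<Longrightarrow> entry X i j = 0"
    and bY: "\<And>i j. n \<le> i \<or> n \<le> j \<Longrightarrow> entry Y i j = 0"
    and bZ: "\<And>i j. n \<le> i \<or> n \<le> j \<Longrightarrow> entry Z i j = 0"
    by (rule fmat_bounds[of X Y Z]) blast
  note E = plus_fmat.rep_eq zero_fmat.rep_eq uminus_fmat.rep_eq minus_fmat_def scaleR_fmat.rep_eq
    scaleC_fmat.rep_eq star_fmat.rep_eq
  show "X + Y + Z = X + (Y + Z)" "X + Y = Y + X" "0 + X = X" "- X + X = 0" "X - Y = X + - Y"
    by (rule fmat_eqI, simp add: E algebra_simps)+
  show "r *\<^sub>R (X + Y) = r *\<^sub>R X + r *\<^sub>R Y" "(r + s) *\<^sub>R X = r *\<^sub>R X + s *\<^sub>R X"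
    "r *\<^sub>R s *\<^sub>R X = (r * s) *\<^sub>R X" "1 *\<^sub>R X = X"
    by (rule fmat_eqI, simp add: E algebra_simps)+
  show "c *\<^sub>C (X + Y) = c *\<^sub>C X + c *\<^sub>C Y" "(c + d) *\<^sub>C X = c *\<^sub>C X + d *\<^sub>C X"
    "c *\<^sub>C d *\<^sub>C X = (c * d) *\<^sub>C X" "complex_of_real r *\<^sub>C X = r *\<^sub>R X"
    by (rule fmat_eqI,
        simp add: E scaleC_add_right scaleC_add_left scaleC_scaleC scaleC_of_real)+
  show "star (star X) = X" "star (X + Y) = star X + star Y" "star (c *\<^sub>C X) = cnj c *\<^sub>C star X"
    by (rule fmat_eqI, simp add: E star_star star_add star_scaleC)+
  show "X * Y * Z = X * (Y * Z)"
  proof (rule fmat_eqI)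
    fix i j
    have "entry (X * Y * Z) i j = (\<Sum>l<n. \<Sum>k<n. entry X i k * entry Y k l * entry Z l j)"
      by (simp add: entry_times'[OF bZ] entry_times[OF bX] sum_distrib_right)
    also have "\<dots> = (\<Sum>k<n. \<Sum>l<n. entry X i k * entry Y k l * entry Z l j)"
      by (rule sum.swap)
    also have "\<dots> = entry (X * (Y * Z)) i j"
      by (simp add: entry_times'[OF bZ] entry_times[OF bX] sum_distrib_left mult.assoc)
    finally show "entry (X * Y * Z) i j = entry (X * (Y * Z)) i j" .
  qed
  show "(X + Y) * Z = X * Z + Y * Z"
    by (rule fmat_eqI) (simp add: E entry_times'[OF bZ] distrib_right sum.distrib)
  show "X * (Y + Z) = X * Y + X * Z"
    by (rule fmat_eqI) (simp add: E entry_times[OF bX] distrib_left sum.distrib)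
  show "r *\<^sub>R X * Y = r *\<^sub>R (X * Y)"
    by (rule fmat_eqI) (simp add: E entry_times'[OF bY] scaleR_sum_right)
  show "X * r *\<^sub>R Y = r *\<^sub>R (X * Y)"
    by (rule fmat_eqI) (simp add: E entry_times[OF bX] scaleR_sum_right)
  show "(c *\<^sub>C X) * Y = c *\<^sub>C (X * Y)"
    by (rule fmat_eqI) (simp add: E entry_times'[OF bY] scaleC_sum mult_scaleC_left)
  show "X * (c *\<^sub>C Y) = c *\<^sub>C (X * Y)"
    by (rule fmat_eqI) (simp add: E entry_times[OF bX] scaleC_sum mult_scaleC_right)
  show "star (X * Y) = star Y * star X"
  proof (rule fmat_eqI)
    fix i j
    have "\<And>i j. n \<le> i \<or> n \<le> j \<Longrightarrow> entry (star Y) i j = 0"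
      using bY by (auto simp: E star_zero)
    from entry_times[of n "star Y", OF this]
    show "entry (star (X * Y)) i j = entry (star Y * star X) i j"
      by (simp add: E entry_times[OF bX] star_sum star_mult)
  qed
qed

end

definition matrices_over :: "nat \<Rightarrow> 'a::zero set \<Rightarrow> 'a fmat set"
  where "matrices_over n B =
    {X. (\<forall>i<n. \<forall>j<n. entry X i j \<in> B) \<and> (\<forall>i j. n \<le> i \<or> n \<le> j \<longrightarrow> entry X i j = 0)}"

definition amplification :: "nat \<Rightarrow> ('a::zero \<Rightarrow> 'b::zero) \<Rightarrow> 'a fmat \<Rightarrow> 'b fmat"
  where "amplification n \<phi> X =
    Abs_fmat (\<lambda>i j. if i < n \<and> j < n then \<phi> (entry X i j) else 0)"

lemma entry_amplification:
  "entry (amplification n \<phi> X) i j = (if i < n \<and> j < n then \<phi> (entry X i j) else 0)"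
  unfolding amplification_def by (subst Abs_fmat_inverse) (auto intro: exI[of _ n])

text \<open>The operator norm of a \<open>k \<times> k\<close> matrix acting on the Hilbert space \<open>\<complex>\<^sup>k\<close>.\<close>

definition complex_matrix_norm :: "nat \<Rightarrow> complex fmat \<Rightarrow> real"
  where "complex_matrix_norm k X =
    (SUP \<xi>\<in>{\<xi> :: nat \<Rightarrow> complex. L2_set (\<lambda>j. cmod (\<xi> j)) {..<k} \<le> 1}.
      L2_set (\<lambda>i. cmod (\<Sum>j<k. entry X i j * \<xi> j)) {..<k})"


section \<open>Completely positive maps\<close>

definition complex_linear_on ::
    "'a::complex_star_algebra set \<Rightarrow> ('a \<Rightarrow> 'b::complex_star_algebra) \<Rightarrow> bool"
  where "complex_linear_on B \<phi> \<longleftrightarrow>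
    (\<forall>x\<in>B. \<forall>y\<in>B. \<phi> (x + y) = \<phi> x + \<phi> y) \<and>
    (\<forall>c. \<forall>x\<in>B. \<phi> (c *\<^sub>C x) = c *\<^sub>C \<phi> x)"

definition completely_positive ::
    "'a::complex_star_algebra set \<Rightarrow> 'b::complex_star_algebra set \<Rightarrow> ('a \<Rightarrow> 'b) \<Rightarrow> bool"
  where "completely_positive B C \<phi> \<longleftrightarrow>
    \<phi> ` B \<subseteq> C \<and> complex_linear_on B \<phi> \<and>
    (\<forall>n. \<forall>X\<in>matrices_over n B. positive_in (matrices_over n B) X \<longrightarrow>
      positive_in (matrices_over n C) (amplification n \<phi> X))"


section \<open>Kirchberg algebras\<close>

text \<open>
  Nuclearity: the identity map is a point-norm limit of compositions of contractive completely
  positive maps through matrix algebras. The clause with finite sets \<open>F\<close> is the existence of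
  an approximating net.
\<close>

definition nuclear_cstar :: "'a::unital_cstar_algebra set \<Rightarrow> bool"
  where "nuclear_cstar B \<longleftrightarrow>
    (\<forall>F \<epsilon>. finite F \<and> F \<subseteq> B \<and> 0 < \<epsilon> \<longrightarrow>
      (\<exists>k (\<phi> :: 'a \<Rightarrow> complex fmat) (\<psi> :: complex fmat \<Rightarrow> 'a).
        completely_positive B (matrices_over k UNIV) \<phi> \<and>
        (\<forall>x\<in>B. complex_matrix_norm k (\<phi> x) \<le> norm x) \<and>
        completely_positive (matrices_over k UNIV) B \<psi> \<and>
        (\<forall>X\<in>matrices_over k UNIV. norm (\<psi> X) \<le> complex_matrix_norm k X) \<and>
        (\<forall>x\<in>F. norm (\<psi> (\<phi> x) - x) < \<epsilon>)))"

definition closed_two_sided_ideal ::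
    "'a::unital_cstar_algebra set \<Rightarrow> 'a set \<Rightarrow> bool"
  where "closed_two_sided_ideal B I \<longleftrightarrow>
    I \<subseteq> B \<and> closed I \<and> 0 \<in> I \<and>
    (\<forall>x\<in>I. \<forall>y\<in>I. x + y \<in> I) \<and> (\<forall>c. \<forall>x\<in>I. c *\<^sub>C x \<in> I) \<and>
    (\<forall>b\<in>B. \<forall>x\<in>I. b * x \<in> I \<and> x * b \<in> I)"

definition simple_cstar :: "'a::unital_cstar_algebra set \<Rightarrow> bool"
  where "simple_cstar B \<longleftrightarrow>
    B \<noteq> {0} \<and> (\<forall>I. closed_two_sided_ideal B I \<longrightarrow> I = {0} \<or> I = B)"

definition hereditary_subalgebra ::
    "'a::unital_cstar_algebra set \<Rightarrow> 'a set \<Rightarrow> bool"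
  where "hereditary_subalgebra B H \<longleftrightarrow>
    cstar_subalgebra H \<and> H \<subseteq> B \<and>
    (\<forall>h\<in>H. \<forall>b\<in>B. positive_in B b \<and> positive_in B (h - b) \<longrightarrow> b \<in> H)"

definition projection_in :: "'a::complex_star_algebra set \<Rightarrow> 'a \<Rightarrow> bool"
  where "projection_in B p \<longleftrightarrow> p \<in> B \<and> star p = p \<and> p * p = p"

text \<open>
  Pure infiniteness (for simple algebras): every nonzero hereditary C*-subalgebra contains an
  infinite projection. A projection is infinite if it is Murray-von Neumann equivalent to a proper
  subprojection of itself; \<open>q\<close> is a subprojection of \<open>p\<close> iff
  \<open>p * q = q\<close>.
\<close>

definition infinite_projection ::
    "'a::complex_star_algebra set \<Rightarrow> 'a \<Rightarrow> bool"
  where "infinite_projection B p \<longleftrightarrow>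
    projection_in B p \<and>
    (\<exists>q v. projection_in B q \<and> p * q = q \<and> q \<noteq> p \<and>
      v \<in> B \<and> star v * v = p \<and> v * star v = q)"

definition purely_infinite :: "'a::unital_cstar_algebra set \<Rightarrow> bool"
  where "purely_infinite B \<longleftrightarrow>
    (\<forall>H. hereditary_subalgebra B H \<and> H \<noteq> {0} \<longrightarrow> (\<exists>p\<in>H. infinite_projection B p))"

definition kirchberg_algebra :: "'a::unital_cstar_algebra set \<Rightarrow> bool"
  where "kirchberg_algebra B \<longleftrightarrow>
    cstar_subalgebra B \<and> separable_space (top_of_set B) \<and>
    nuclear_cstar B \<and> simple_cstar B \<and> purely_infinite B"


section \<open>Compact groups and their actions\<close>

locale topological_group = group G
  for G :: "('g, 'm) monoid_scheme" (structure) and T :: "'g topology" +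
  assumes topspace_eq_carrier: "topspace T = carrier G"
    and continuous_mult: "continuous_map (prod_topology T T) T (\<lambda>(x, y). x \<otimes> y)"
    and continuous_inv: "continuous_map T T (\<lambda>x. inv x)"

definition compact_group :: "('g, 'm) monoid_scheme \<Rightarrow> 'g topology \<Rightarrow> bool"
  where "compact_group G T \<longleftrightarrow> topological_group G T \<and> compact_space T \<and> Hausdorff_space T"

definition Aut_group :: "('a::unital_cstar_algebra \<Rightarrow> 'a) monoid"
  where "Aut_group =
    \<lparr>carrier = {\<theta>. bij \<theta> \<and> complex_linear_on UNIV \<theta> \<and>
        (\<forall>x y. \<theta> (x * y) = \<theta> x * \<theta> y) \<and> (\<forall>x. \<theta> (star x) = star (\<theta> x))},
      mult = (\<circ>), one = id\<rparr>"

definition group_action_on_cstar ::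
    "('g, 'm) monoid_scheme \<Rightarrow> 'g topology \<Rightarrow> ('g \<Rightarrow> 'a::unital_cstar_algebra \<Rightarrow> 'a) \<Rightarrow> bool"
  where "group_action_on_cstar G T \<alpha> \<longleftrightarrow>
    \<alpha> \<in> hom G Aut_group \<and> (\<forall>x. continuous_map T euclidean (\<lambda>g. \<alpha> g x))"

definition faithful_action :: "('g, 'm) monoid_scheme \<Rightarrow> ('g \<Rightarrow> 'a \<Rightarrow> 'a) \<Rightarrow> bool"
  where "faithful_action G \<alpha> \<longleftrightarrow> inj_on \<alpha> (carrier G)"

definition fixed_point_algebra :: "('g, 'm) monoid_scheme \<Rightarrow> ('g \<Rightarrow> 'a \<Rightarrow> 'a) \<Rightarrow> 'a set"
  where "fixed_point_algebra G \<alpha> = {x. \<forall>g\<in>carrier G. \<alpha> g x = x}"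

definition relative_commutant :: "'a::unital_cstar_algebra set \<Rightarrow> 'a set"
  where "relative_commutant B = {x. \<forall>b\<in>B. x * b = b * x}"

text \<open>C*-algebras of this class are unital, so they coincide with their multiplier algebras.\<close>

definition minimal_action ::
    "('g, 'm) monoid_scheme \<Rightarrow> ('g \<Rightarrow> 'a::unital_cstar_algebra \<Rightarrow> 'a) \<Rightarrow> bool"
  where "minimal_action G \<alpha> \<longleftrightarrow>
    relative_commutant (fixed_point_algebra G \<alpha>) = range (\<lambda>c. c *\<^sub>C 1)"

definition unital_completely_positive :: "('a::unital_cstar_algebra \<Rightarrow> 'a) \<Rightarrow> bool"
  where "unital_completely_positive \<nu> \<longleftrightarrow> completely_positive UNIV UNIV \<nu> \<and> \<nu> 1 = 1"

definition equivariant :: "('g, 'm) monoid_scheme \<Rightarrow> ('g \<Rightarrow> 'a \<Rightarrow> 'a) \<Rightarrow> ('a \<Rightarrow> 'a) \<Rightarrow> bool"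
  where "equivariant G \<alpha> \<nu> \<longleftrightarrow> (\<forall>g\<in>carrier G. \<nu> \<circ> \<alpha> g = \<alpha> g \<circ> \<nu>)"

end

theory Submission
  imports Defs
begin

text \<open>
  Let \<open>B = A\<^sup>\<alpha>\<close> and let \<open>E\<close> be the conditional expectation onto \<open>B\<close>. Since \<open>B\<close> is simple and purely
  infinite with trivial relative commutant, \<open>A\<close> carries a state \<open>\<omega>\<close> with
  \<open>S\<^sub>n\<^sup>*yS\<^sub>n \<rightarrow> \<omega>(y)1\<close> for isometries \<open>S\<^sub>n\<close> in \<open>B\<close>. Together with the nuclearity of \<open>B\<close> this shows
  that for a completely positive map \<open>\<theta>\<close> into \<open>B\<close> there is \<open>W\<close> in \<open>B\<close> with
  \<open>W\<^sup>*zW \<approx> \<theta>(E(z))\<close> for \<open>z\<close> in a given finite set.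

  An element \<open>s\<close> of \<open>A\<close> implements a function \<open>k\<close> on \<open>G\<close> if
  \<open>\<alpha>\<^sub>g(s)\<^sup>*\<alpha>\<^sub>h(s) \<approx> k(g\<^sup>-\<^sup>1h)1\<close> for all \<open>g\<close> and \<open>h\<close>. Such functions are closed under products, and some
  of them are concentrated on the set of those \<open>g\<close> that hardly move \<open>\<nu>(x)\<close>. For an \<open>s\<close> that implements a
  high power of such a function and a \<open>W\<close> that belongs to \<open>\<theta>(b) = E(s \<nu>(s\<^sup>*bs) s\<^sup>*)\<close>, let
  \<open>V = E(s\<^sup>*Ws)\<close>. By equivariance, \<open>V\<^sup>*xV\<close> is approximately the integral of
  \<open>k(g\<^sup>-\<^sup>1c) k(c\<^sup>-\<^sup>1ag) k(h\<^sup>-\<^sup>1a\<^sup>-\<^sup>1c) k(c\<^sup>-\<^sup>1h) \<alpha>\<^sub>a(\<nu>(x))\<close> over \<open>g\<close>, \<open>h\<close>, \<open>c\<close> and \<open>a\<close>. The factor in front of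
  \<open>\<alpha>\<^sub>a(\<nu>(x))\<close> is concentrated on those \<open>a\<close> that hardly move \<open>\<nu>(x)\<close>, so a multiple of \<open>V\<close> is as required.
\<close>

section \<open>Elementary C*-algebra theory\<close>

text \<open>An element \<open>W\<close> chosen in \<open>B\<close> realises a map that factors
  through \<open>E\<close>, and \<open>E(x)\<close> has forgotten what \<open>x\<close> does outside
  \<open>B\<close>. Placing translates of \<open>s\<close> around \<open>x\<close> carries that
  information into \<open>B\<close>: the expectations of
  \<open>\<alpha> g s * x * star (\<alpha> h s)\<close> still depend on all of \<open>x\<close>, and
  the factors \<open>star s\<close> and \<open>s\<close> inside \<open>\<nu>\<close> turn these
  translates back into scalars. What returns is a superposition of the \<alpha>_a(x), and
  equivariance lets \<nu> act on each of them.

  The obstacle is quantitative. Concentration costs mass: the mean of the fourfold product may be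
  tiny, and every error has to be small against it. Hence the mass is bounded below by a quantity
  that is known before the accuracies of \<open>s\<close> and \<open>W\<close> are chosen, and the
  normalising factor is read off from V^*V with \<omega> instead of being computed.

  Integrals over the group are means of almost periodic functions, that is, limits of uniform
  averages over finite lists of group elements; norm compactness of the orbits suffices for them.
  Square roots come from a fixed point equation and replace functional calculus throughout.\<close>

lemma scaleC_zero_left [simp]: "0 *\<^sub>C (x::'a::complex_star_algebra) = 0"
  using scaleC_of_real[of 0 x] by simp

lemma scaleC_sum_left: "sum f I *\<^sub>C (x::'a::complex_star_algebra) = (\<Sum>i\<in>I. f i *\<^sub>C x)"
  by (induction I rule: infinite_finite_induct) (simp_all add: scaleC_add_left)

lemma scaleC_one [simp]: "1 *\<^sub>C (x::'a::complex_star_algebra) = x"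
  using scaleC_of_real[of 1 x] by simp

lemma scaleC_minus_left: "(- c) *\<^sub>C (x::'a::complex_star_algebra) = - (c *\<^sub>C x)"
  using scaleC_add_left[of c "- c" x] by (simp add: eq_neg_iff_add_eq_0 add.commute)

lemma scaleC_minus_right: "c *\<^sub>C (- x::'a::complex_star_algebra) = - (c *\<^sub>C x)"
  using scaleC_add_right[of c x "- x"] by (simp add: scaleC_zero_right eq_neg_iff_add_eq_0 add.commute)

lemma scaleC_diff_right: "c *\<^sub>C (x - y::'a::complex_star_algebra) = c *\<^sub>C x - c *\<^sub>C y"
  using scaleC_add_right[of c x "- y"] by (simp add: scaleC_minus_right)

lemma scaleC_diff_left: "(c - d) *\<^sub>C (x::'a::complex_star_algebra) = c *\<^sub>C x - d *\<^sub>C x"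
  using scaleC_add_left[of c "- d" x] by (simp add: scaleC_minus_left)

lemma scaleC_scaleR: "c *\<^sub>C (r *\<^sub>R x::'a::complex_star_algebra) = r *\<^sub>R (c *\<^sub>C x)"
  unfolding scaleC_of_real[symmetric] by (simp add: scaleC_scaleC mult.commute)

lemma star_minus: "star (- x::'a::complex_star_algebra) = - star x"
  using star_add[of x "- x"] by (simp add: star_zero eq_neg_iff_add_eq_0 add.commute)

lemma star_diff: "star (x - y::'a::complex_star_algebra) = star x - star y"
  using star_add[of x "- y"] by (simp add: star_minus)

lemma star_scaleR: "star (r *\<^sub>R x::'a::complex_star_algebra) = r *\<^sub>R star x"
  unfolding scaleC_of_real[symmetric] by (simp add: star_scaleC)

lemma star_one [simp]: "star (1::'a::unital_cstar_algebra) = 1"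
  by (metis mult.left_neutral mult.right_neutral star_mult star_star)

lemma star_of_real [simp]: "star (of_real r::'a::unital_cstar_algebra) = of_real r"
  by (simp add: of_real_def star_scaleR)

lemma star_of_nat [simp]: "star (of_nat n::'a::unital_cstar_algebra) = of_nat n"
  using star_of_real[of "real n"] by simp

lemma star_power: "star (x ^ n) = star (x::'a::unital_cstar_algebra) ^ n"
  by (induction n) (simp_all add: star_mult power_commutes)

lemma norm_star [simp]: "norm (star (x::'a::unital_cstar_algebra)) = norm x"
proof -
  have *: "norm y \<le> norm (star y)" for y :: 'a
  proof (cases "y = 0")
    case False
    have "(norm y)\<^sup>2 \<le> norm (star y) * norm y"
      by (metis cstar_identity norm_mult_ineq)
    with False show ?thesis
      by (simp add: power2_eq_square)
  qed simp
  show ?thesis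
    using *[of x] *[of "star x"] by (simp add: star_star)
qed

lemma cstar_identity': "norm (x * star x) = (norm (x::'a::unital_cstar_algebra))\<^sup>2"
  using cstar_identity[of "star x"] by (simp add: star_star)

lemma star_mult_self_eq_0: "star x * x = 0 \<longleftrightarrow> (x::'a::unital_cstar_algebra) = 0"
  using cstar_identity[of x] by auto

lemma norm_selfadjoint_square: "star x = x \<Longrightarrow> norm (x * x) = (norm (x::'a::unital_cstar_algebra))\<^sup>2"
  using cstar_identity[of x] by simp

lemma bounded_linear_star: "bounded_linear (star :: 'a::unital_cstar_algebra \<Rightarrow> 'a)"
  by (rule bounded_linear_intro[of _ 1]) (simp_all add: star_add star_scaleR)

lemma bounded_linear_scaleC: "bounded_linear (\<lambda>x::'a::unital_cstar_algebra. c *\<^sub>C x)"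
  by (rule bounded_linear_intro[of _ "cmod c"])
    (simp_all add: scaleC_add_right scaleC_scaleR norm_scaleC)

lemmas star_simps = star_add star_diff star_minus star_mult star_scaleC star_scaleR star_star star_zero

lemmas scaleC_simps = mult_scaleC_left mult_scaleC_right scaleC_scaleC

section \<open>Unital C*-subalgebras and square roots near the unit\<close>

locale unital_subalgebra =
  fixes B :: "'a::unital_cstar_algebra set"
  assumes subalgebra: "cstar_subalgebra B"
    and one_in [simp]: "1 \<in> B"
begin

lemma closed: "closed B"
  and zero_in [simp]: "0 \<in> B"
  and add_in: "x \<in> B \<Longrightarrow> y \<in> B \<Longrightarrow> x + y \<in> B"
  and mult_in: "x \<in> B \<Longrightarrow> y \<in> B \<Longrightarrow> x * y \<in> B"
  and scaleC_in: "x \<in> B \<Longrightarrow> c *\<^sub>C x \<in> B"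
  and star_in: "x \<in> B \<Longrightarrow> star x \<in> B"
  using subalgebra by (auto simp: cstar_subalgebra_def)

lemma scaleR_in: "x \<in> B \<Longrightarrow> r *\<^sub>R x \<in> B"
  by (metis scaleC_in scaleC_of_real)

lemma of_real_in [simp]: "of_real r \<in> B"
  by (simp add: of_real_def scaleR_in)

lemma minus_in: "x \<in> B \<Longrightarrow> - x \<in> B"
  using scaleR_in[of x "-1"] by simp

lemma diff_in: "x \<in> B \<Longrightarrow> y \<in> B \<Longrightarrow> x - y \<in> B"
  using add_in minus_in by fastforce

lemma power_in: "x \<in> B \<Longrightarrow> x ^ n \<in> B"
  by (induction n) (auto intro: mult_in)

lemma sum_in: "(\<And>i. i \<in> I \<Longrightarrow> f i \<in> B) \<Longrightarrow> sum f I \<in> B"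
  by (induction I rule: infinite_finite_induct) (auto intro: add_in)

lemmas closure_rules = add_in mult_in scaleC_in star_in scaleR_in minus_in diff_in power_in sum_in

end

lemma unital_subalgebraI:
  assumes "closed B" "1 \<in> B"
    and "\<And>x y. x \<in> B \<Longrightarrow> y \<in> B \<Longrightarrow> x + y \<in> B" "\<And>x y. x \<in> B \<Longrightarrow> y \<in> B \<Longrightarrow> x * y \<in> B"
    and "\<And>c x. x \<in> B \<Longrightarrow> c *\<^sub>C x \<in> B" "\<And>x. x \<in> B \<Longrightarrow> star x \<in> B"
  shows "unital_subalgebra B"
proof -
  have "0 \<in> B"
    using assms(5)[of 1 0] assms(2) by simp
  with assms show ?thesis
    by unfold_locales (auto simp: cstar_subalgebra_def)
qed

lemma unital_subalgebra_UNIV: "unital_subalgebra UNIV"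
  by (rule unital_subalgebraI) auto

lemma unital_subalgebra_Int:
  assumes "unital_subalgebra B" "unital_subalgebra C"
  shows "unital_subalgebra (B \<inter> C)"
proof -
  interpret B: unital_subalgebra B by fact
  interpret C: unital_subalgebra C by fact
  show ?thesis
    by (rule unital_subalgebraI)
      (auto intro: B.closure_rules C.closure_rules simp: B.closed C.closed closed_Int)
qed

text \<open>Since this is again a C*-algebra, a square root can be extracted inside it. This is how
  roots are made to commute with prescribed elements.\<close>

lemma unital_subalgebra_relative_commutant:
  assumes "\<And>x. x \<in> X \<Longrightarrow> star x \<in> X"
  shows "unital_subalgebra (relative_commutant X)"
proof (rule unital_subalgebraI)
  have "relative_commutant X = (\<Inter>x\<in>X. {z. z * x = x * z})"
    by (auto simp: relative_commutant_def)
  moreover have "closed {z. z * x = x * z}" for x :: 'a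
    by (intro closed_Collect_eq continuous_intros)
  ultimately show "closed (relative_commutant X)"
    by auto
  show "x * y \<in> relative_commutant X"
    if "x \<in> relative_commutant X" "y \<in> relative_commutant X" for x y
    using that unfolding relative_commutant_def by clarsimp (metis mult.assoc)
  show "star z \<in> relative_commutant X" if "z \<in> relative_commutant X" for z
    using that assms unfolding relative_commutant_def by clarsimp (metis star_mult star_star)
qed (auto simp: relative_commutant_def distrib_left distrib_right scaleC_simps)

context unital_subalgebra
begin

text \<open>For a root of the form 1 - y the equation reads y = (x + y^2)/2. Its right-hand side
  contracts the ball of radius \<open>norm x\<close> in \<open>B\<close> by the factor
  \<open>norm x\<close>, and uniqueness of the fixed point makes the root self-adjoint when
  \<open>x\<close> is.\<close>

lemma sqrt_one_minus:
  assumes "x \<in> B" "norm x < 1"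
  obtains c where "c \<in> B" "c * c = 1 - x" "norm (1 - c) \<le> norm x" "star x = x \<longrightarrow> star c = c"
proof -
  define S where "S = B \<inter> cball 0 (norm x)"
  define f where "f y = (1/2) *\<^sub>R (x + y * y)" for y
  have "complete S"
    unfolding S_def complete_eq_closed using closed by auto
  moreover have "0 \<in> S"
    by (simp add: S_def)
  then have "S \<noteq> {}" by blast
  moreover have "f ` S \<subseteq> S"
  proof (rule image_subsetI)
    fix y assume "y \<in> S"
    then have y: "y \<in> B" "norm y \<le> norm x" by (auto simp: S_def)
    have "norm (y * y) \<le> norm x * 1"
      using y assms by (intro order.trans[OF norm_mult_ineq] mult_mono) auto
    then have "norm (f y) \<le> norm x"
      using norm_triangle_ineq[of x "y * y"] by (simp add: f_def)
    with y assms show "f y \<in> S"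
      by (auto simp: S_def f_def intro!: scaleR_in add_in mult_in)
  qed
  moreover have "dist (f y) (f z) \<le> norm x * dist y z" if "y \<in> S" "z \<in> S" for y z
  proof -
    have yz: "norm y \<le> norm x" "norm z \<le> norm x"
      using that by (auto simp: S_def)
    have eq: "f y - f z = (1/2) *\<^sub>R (y * (y - z) + (y - z) * z)"
      by (simp add: f_def algebra_simps)
    have "norm (y * (y - z) + (y - z) * z) \<le> norm x * norm (y - z) + norm (y - z) * norm x"
      by (intro order.trans[OF norm_triangle_ineq] add_mono order.trans[OF norm_mult_ineq]
          mult_mono yz) auto
    then show ?thesis
      by (simp add: dist_norm eq)
  qed
  ultimately have "\<exists>!y. y \<in> S \<and> f y = y"
    using Banach_fix[of S "norm x" f] assms by auto
  then obtain y where y: "y \<in> S" "f y = y" and uniq: "\<And>z. z \<in> S \<Longrightarrow> f z = z \<Longrightarrow> z = y"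
    by metis
  have eq: "2 *\<^sub>R y = x + y * y"
    using arg_cong[OF y(2), of "\<lambda>z. 2 *\<^sub>R z"] by (simp add: f_def)
  show thesis
  proof (rule that[of "1 - y"])
    show "1 - y \<in> B" "norm (1 - (1 - y)) \<le> norm x"
      using y by (auto simp: S_def intro: diff_in)
    have "(1 - y) * (1 - y) = 1 - 2 *\<^sub>R y + y * y"
      by (simp add: algebra_simps scaleR_2)
    then show "(1 - y) * (1 - y) = 1 - x"
      using eq by simp
    show "star x = x \<longrightarrow> star (1 - y) = 1 - y"
    proof
      assume "star x = x"
      then have "star y \<in> S" "f (star y) = star (f y)"
        using y(1) by (auto simp: S_def f_def star_simps intro: star_in)
      then have "star y = y"
        using y uniq by metis
      then show "star (1 - y) = 1 - y"
        by (simp add: star_diff)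
    qed
  qed
qed

end

text \<open>For self-adjoint x the inequality says that the spectrum lies in [0, 2t]. In this form
  sums of positive elements are positive by the triangle inequality, whereas for elements
  \<open>star y * y\<close> that would be a theorem. The equivalence of both notions is
  \<open>cpos_iff_star_mult_self\<close>.\<close>

definition cpos :: "'a::unital_cstar_algebra \<Rightarrow> bool"
  where "cpos x \<longleftrightarrow> star x = x \<and> (\<exists>t\<ge>0. norm (of_real t - x) \<le> t)"

lemma cpos_selfadjoint: "cpos x \<Longrightarrow> star x = x"
  by (simp add: cpos_def)

lemma cpos_of_real: "cpos (of_real t) \<longleftrightarrow> 0 \<le> t"
proof
  assume "cpos (of_real t :: 'a)"
  then obtain s where "norm (of_real s - of_real t :: 'a) \<le> s"
    by (auto simp: cpos_def)
  then have "\<bar>s - t\<bar> \<le> s"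
    by (metis norm_of_real of_real_diff)
  then show "0 \<le> t" by linarith
qed (auto simp: cpos_def intro!: exI[of _ t])

lemma cpos_0 [simp]: "cpos 0" and cpos_1 [simp]: "cpos 1"
  using cpos_of_real[of 0] cpos_of_real[of 1] by auto

lemma cpos_add:
  assumes "cpos x" "cpos y"
  shows "cpos (x + y)"
proof -
  obtain s t where st: "0 \<le> s" "norm (of_real s - x) \<le> s" "0 \<le> t" "norm (of_real t - y) \<le> t"
    using assms by (auto simp: cpos_def)
  have "of_real (s + t) - (x + y) = (of_real s - x) + (of_real t - y)"
    by simp
  then have "norm (of_real (s + t) - (x + y)) \<le> s + t"
    using st norm_triangle_ineq[of "of_real s - x" "of_real t - y"] by (metis add_mono order_trans)
  then show ?thesis
    using assms st by (auto simp: cpos_def star_simps intro!: exI[of _ "s + t"])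
qed

lemma cpos_scaleR:
  assumes "cpos x" "0 \<le> r"
  shows "cpos (r *\<^sub>R x)"
proof -
  obtain t where t: "0 \<le> t" "norm (of_real t - x) \<le> t"
    using assms by (auto simp: cpos_def)
  have "of_real (r * t) - r *\<^sub>R x = r *\<^sub>R (of_real t - x)"
    by (simp add: of_real_def scaleR_diff_right)
  then have "norm (of_real (r * t) - r *\<^sub>R x) \<le> r * t"
    using t assms by (simp add: mult_left_mono)
  then show ?thesis
    using assms t by (auto simp: cpos_def star_simps intro!: exI[of _ "r * t"])
qed

lemma cpos_sum: "(\<And>i. i \<in> I \<Longrightarrow> cpos (f i)) \<Longrightarrow> cpos (sum f I)"
  by (induction I rule: infinite_finite_induct) (auto intro: cpos_add)

lemma unital_subalgebra_relative_commutant_selfadjoint: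
  "star x = x \<Longrightarrow> unital_subalgebra (relative_commutant {x})"
  "star x = x \<Longrightarrow> star y = y \<Longrightarrow> unital_subalgebra (relative_commutant {x, y})"
  by (rule unital_subalgebra_relative_commutant, auto)+

text \<open>Here \<open>h + i\<cdot>s\<close> with \<open>s\<^sup>2 = 1 - h\<^sup>2\<close> is unitary, which replaces the spectral theorem.\<close>

lemma norm_one_minus_square:
  assumes "star h = h" "norm (h::'a::unital_cstar_algebra) < 1"
  shows "norm (1 - h * h) \<le> 1"
proof -
  interpret C: unital_subalgebra "relative_commutant {h}"
    using assms by (intro unital_subalgebra_relative_commutant_selfadjoint)
  have "norm (h * h) < 1"
    using assms by (simp add: norm_selfadjoint_square power_less_one_iff abs_square_less_1)
  moreover have "h * h \<in> relative_commutant {h}"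
    by (simp add: relative_commutant_def mult.assoc)
  ultimately obtain s where s: "s \<in> relative_commutant {h}" "s * s = 1 - h * h" "star s = s"
    using C.sqrt_one_minus[of "h * h"] assms by (auto simp: star_mult)
  define u where "u = h + \<i> *\<^sub>C s"
  have "star u = h - \<i> *\<^sub>C s"
    using assms s by (simp add: u_def star_simps scaleC_minus_left)
  moreover have "s * h = h * s"
    using s by (simp add: relative_commutant_def)
  ultimately have "star u * u = 1"
    using s(2) by (simp add: u_def[symmetric])
      (simp add: u_def algebra_simps scaleC_simps scaleC_minus_left scaleC_add_right scaleC_diff_right)
  then have "norm u = 1"
    using cstar_identity[of u] by (simp add: power2_eq_1_iff) (use norm_ge_zero[of u] in linarith)
  have "2 *\<^sub>R s = - \<i> *\<^sub>C (u - star u)"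
    using \<open>star u = _\<close> by (simp add: u_def scaleC_simps scaleC_minus_left scaleC_add_right scaleR_2)
  then have "norm (2 *\<^sub>R s) \<le> norm (u - star u)"
    by (simp add: norm_scaleC)
  also have "\<dots> \<le> 2"
    using norm_triangle_ineq4[of u "star u"] \<open>norm u = 1\<close> by simp
  finally have "norm s \<le> 1" by simp
  then have "(norm s)\<^sup>2 \<le> 1"
    by (simp add: power_le_one)
  with s show ?thesis
    using norm_selfadjoint_square[of s] by simp
qed

text \<open>Once h is scaled to norm below 1, the bound norm(1 - h^2) \<le> 1 is the defining
  condition with t = 1.\<close>

lemma cpos_square:
  assumes "star h = (h::'a::unital_cstar_algebra)"
  shows "cpos (h * h)"
proof -
  define r where "r = norm h + 1"
  have r: "0 < r" "norm h < r"
    by (auto simp: r_def add_nonneg_pos)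
  have "norm ((1/r) *\<^sub>R h) < 1"
    using r by simp
  then have "norm (1 - ((1/r) *\<^sub>R h) * ((1/r) *\<^sub>R h)) \<le> 1"
    using assms by (intro norm_one_minus_square) (simp_all add: star_simps)
  then have "cpos (((1/r) *\<^sub>R h) * ((1/r) *\<^sub>R h))"
    using assms by (auto simp: cpos_def star_simps intro!: exI[of _ 1])
  then have "cpos ((r * r) *\<^sub>R (((1/r) *\<^sub>R h) * ((1/r) *\<^sub>R h)))"
    using r by (intro cpos_scaleR) auto
  then show ?thesis
    using r by simp
qed

context unital_subalgebra
begin

text \<open>The shift by \<open>e\<close> is what makes the contraction applicable: (x + e)/(t + e)
  has distance at most t/(t + e) < 1 from the unit, whereas x/t may have distance 1.\<close>

lemma cpos_add_of_real_sqrt: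
  assumes "x \<in> B" "cpos x" "0 < e"
  obtains c where "c \<in> B" "cpos c" "c * c = x + of_real e"
proof -
  obtain t where t: "0 \<le> t" "norm (of_real t - x) \<le> t"
    using assms by (auto simp: cpos_def)
  define r where "r = t + e"
  have r: "0 < r"
    using assms t by (simp add: r_def)
  define y where "y = 1 - (1/r) *\<^sub>R (x + of_real e)"
  have "y = (1/r) *\<^sub>R (of_real t - x)"
    using r by (simp add: y_def r_def of_real_def algebra_simps flip: scaleR_add_left)
      (simp add: add_divide_distrib[symmetric])
  then have "norm y = norm (of_real t - x) / r"
    using r by simp
  then have "norm y < 1"
    using t r assms by (simp add: r_def)
  moreover have "y \<in> B" "star y = y"
    using assms by (auto simp: y_def star_simps cpos_selfadjoint intro!: closure_rules)
  ultimately obtain d where d: "d \<in> B" "d * d = 1 - y" "norm (1 - d) \<le> norm y" "star d = d"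
    using sqrt_one_minus[of y] by auto
  show thesis
  proof (rule that[of "sqrt r *\<^sub>R d"])
    have "cpos d"
      using d \<open>norm y < 1\<close> by (auto simp: cpos_def intro!: exI[of _ 1])
    then show "sqrt r *\<^sub>R d \<in> B" "cpos (sqrt r *\<^sub>R d)"
      using d r by (auto intro: scaleR_in cpos_scaleR)
    show "sqrt r *\<^sub>R d * sqrt r *\<^sub>R d = x + of_real e"
      using d r by (simp add: y_def)
  qed
qed

end

text \<open>If \<open>c\<^sup>2 + b\<^sup>2 = s\<close> with commuting \<open>b\<close> and \<open>c\<close>, then \<open>c + i\<cdot>b\<close> is \<open>\<surd>s\<close> times a unitary.\<close>

lemma cpos_norm_le:
  assumes "cpos x" "cpos (of_real s - x)"
  shows "norm (x::'a::unital_cstar_algebra) \<le> s"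
proof (rule field_le_epsilon)
  fix \<delta> :: real assume "0 < \<delta>"
  \<comment> \<open>Two of the three parts are the shifts of \<open>x\<close> and of
    \<open>s - x\<close> that their roots require, and the third pays for passing from
    \<open>x + of_real e\<close> back to \<open>x\<close>.\<close>
  define e where "e = \<delta> / 3"
  have e: "0 < e" "\<delta> = 3 * e"
    using \<open>0 < \<delta>\<close> by (auto simp: e_def)
  have "cpos (of_real s :: 'a)"
    using cpos_add[OF assms] by simp
  then have "0 \<le> s"
    by (simp add: cpos_of_real)
  have x: "star x = x"
    using assms by (simp add: cpos_selfadjoint)
  interpret C: unital_subalgebra "relative_commutant {x}"
    using x by (rule unital_subalgebra_relative_commutant_selfadjoint)
  have "x \<in> relative_commutant {x}"
    by (simp add: relative_commutant_def)
  then obtain c where c: "c \<in> relative_commutant {x}" "cpos c" "c * c = x + of_real e"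
    using C.cpos_add_of_real_sqrt[of x e] assms e by blast
  have sc: "star c = c"
    using c by (simp add: cpos_selfadjoint)
  interpret D: unital_subalgebra "relative_commutant {x, c}"
    using x sc by (rule unital_subalgebra_relative_commutant_selfadjoint)
  have "x \<in> relative_commutant {x, c}"
    using c by (simp add: relative_commutant_def)
  then have "of_real s - x \<in> relative_commutant {x, c}"
    by (intro D.diff_in) auto
  then obtain b where b: "b \<in> relative_commutant {x, c}" "cpos b" "b * b = of_real s - x + of_real e"
    using D.cpos_add_of_real_sqrt[of "of_real s - x" e] assms e by blast
  have sb: "star b = b" "b * c = c * b"
    using b by (auto simp: cpos_selfadjoint relative_commutant_def)
  define u where "u = c + \<i> *\<^sub>C b"
  have su: "star u = c - \<i> *\<^sub>C b"
    using sb sc by (simp add: u_def star_simps scaleC_minus_left)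
  have "star u * u = c * c + b * b"
    unfolding su using sb
    by (simp add: u_def algebra_simps scaleC_simps scaleC_minus_left scaleC_add_right scaleC_diff_right)
  also have "\<dots> = of_real s + (of_real e + of_real e)"
    unfolding b(3) c(3) by simp
  also have "\<dots> = of_real (s + 2 * e)"
    by (metis mult_2 of_real_add)
  finally have "(norm u)\<^sup>2 = \<bar>s + 2 * e\<bar>"
    by (metis cstar_identity norm_of_real)
  then have nu: "(norm u)\<^sup>2 = s + 2 * e"
    using \<open>0 \<le> s\<close> e by simp
  have "2 *\<^sub>R c = u + star u"
    using su by (simp add: u_def scaleR_2)
  then have "norm (2 *\<^sub>R c) \<le> 2 * norm u"
    using norm_triangle_ineq[of u "star u"] by simp
  then have "(norm c)\<^sup>2 \<le> (norm u)\<^sup>2"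
    by (intro power_mono) auto
  then have "norm (x + of_real e) \<le> s + 2 * e"
    using c sc nu norm_selfadjoint_square[of c] by simp
  moreover have "norm x \<le> norm (x + of_real e) + e"
    using norm_triangle_ineq4[of "x + of_real e" "of_real e"] e by simp
  ultimately show "norm x \<le> s + \<delta>"
    using e by linarith
qed

section \<open>Norm, order and limits of positive elements\<close>

lemma cpos_norm_minus: "star x = x \<Longrightarrow> norm x \<le> t \<Longrightarrow> cpos (of_real t - x)"
  unfolding cpos_def using order.trans[OF norm_ge_zero]
  by (auto simp: star_simps intro!: exI[of _ t])

text \<open>The witness t in \<open>cpos\<close> may be any bound of the norm. With t = norm x the
  condition becomes closed, which gives the limit lemma below.\<close>

lemma cpos_norm_diff_le:
  assumes "cpos x" "norm x \<le> t"
  shows "norm (of_real t - x) \<le> t"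
proof (rule cpos_norm_le)
  show "cpos (of_real t - x)"
    using assms by (intro cpos_norm_minus cpos_selfadjoint)
qed (use assms in simp)

lemma cpos_norm_mono:
  assumes "cpos x" "cpos (y - x)"
  shows "norm x \<le> norm y"
proof (rule cpos_norm_le)
  have "cpos y"
    using cpos_add[OF assms] by simp
  then have "cpos (of_real (norm y) - y)"
    by (intro cpos_norm_minus cpos_selfadjoint) auto
  from cpos_add[OF this assms(2)] show "cpos (of_real (norm y) - x)"
    by simp
qed fact

lemma cpos_LIMSEQ:
  assumes "\<And>n::nat. cpos (X n)" "X \<longlonglongrightarrow> x"
  shows "cpos x"
proof -
  have "(\<lambda>n. star (X n)) \<longlonglongrightarrow> star x"
    by (rule bounded_linear.tendsto[OF bounded_linear_star assms(2)])
  then have s: "star x = x"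
    using assms by (simp add: cpos_selfadjoint LIMSEQ_unique)
  have "(\<lambda>n. norm (of_real (norm (X n)) - X n)) \<longlonglongrightarrow> norm (of_real (norm x) - x)"
    using assms(2) by (intro tendsto_intros)
  moreover have "(\<lambda>n. norm (X n)) \<longlonglongrightarrow> norm x"
    using assms(2) by (intro tendsto_intros)
  ultimately have "norm (of_real (norm x) - x) \<le> norm x"
    using cpos_norm_diff_le[OF assms(1)] by (intro LIMSEQ_le) auto
  with s show ?thesis
    unfolding cpos_def using norm_ge_zero[of x] by blast
qed

lemma cpos_antisym: "cpos x \<Longrightarrow> cpos (- x) \<Longrightarrow> x = 0"
  using cpos_norm_le[of x 0] by simp

text \<open>If c and d are commuting positive roots of the slightly shifted factors, then the
  shifted product is the square of the self-adjoint element c d. The shift is removed in the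
  limit.\<close>

lemma cpos_mult_commute:
  assumes "cpos x" "cpos y" "x * y = y * x"
  shows "cpos (x * y)"
proof (rule cpos_LIMSEQ)
  show "cpos ((x + of_real (1 / real (Suc n))) * (y + of_real (1 / real (Suc n))))" for n
  proof -
    define e where "e = 1 / real (Suc n)"
    have e: "0 < e" by (simp add: e_def)
    interpret C: unital_subalgebra "relative_commutant {y}"
      using assms by (intro unital_subalgebra_relative_commutant_selfadjoint cpos_selfadjoint)
    have "x \<in> relative_commutant {y}"
      using assms by (simp add: relative_commutant_def)
    then obtain c where c: "c \<in> relative_commutant {y}" "cpos c" "c * c = x + of_real e"
      using C.cpos_add_of_real_sqrt e assms by blast
    interpret D: unital_subalgebra "relative_commutant {c}"
      using c by (intro unital_subalgebra_relative_commutant_selfadjoint cpos_selfadjoint)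
    have "y \<in> relative_commutant {c}"
      using c by (simp add: relative_commutant_def)
    then obtain d where d: "d \<in> relative_commutant {c}" "cpos d" "d * d = y + of_real e"
      using D.cpos_add_of_real_sqrt e assms by blast
    have dc: "d * c = c * d"
      using d by (simp add: relative_commutant_def)
    have "(x + of_real e) * (y + of_real e) = c * (c * d) * d"
      using c d by (simp flip: c(3) d(3) add: mult.assoc)
    also have "\<dots> = (c * d) * (c * d)"
      by (metis dc mult.assoc)
    also have "cpos \<dots>"
      using c d dc by (intro cpos_square) (simp add: star_mult cpos_selfadjoint)
    finally show ?thesis by (simp add: e_def)
  qed
  have "(\<lambda>n. (x + of_real (1 / real (Suc n))) * (y + of_real (1 / real (Suc n))))
      \<longlonglongrightarrow> (x + of_real 0) * (y + of_real 0)"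
    by (intro tendsto_intros LIMSEQ_Suc[OF lim_1_over_n])
  then show "(\<lambda>n. (x + of_real (1 / real (Suc n))) * (y + of_real (1 / real (Suc n)))) \<longlonglongrightarrow> x * y"
    by simp
qed

text \<open>With \<open>d = x - y\<close>, one has \<open>0 \<le> d\<^sup>4 \<le> (x + y)\<^sup>2 d\<^sup>2\<close>.\<close>

lemma cpos_norm_diff_square_le:
  assumes "cpos x" "cpos y" "x * y = y * x"
  shows "(norm (x - y))\<^sup>2 \<le> norm (x * x - y * y)"
proof -
  define d where "d = x - y"
  have sx: "star x = x" "star y = y"
    using assms by (auto simp: cpos_selfadjoint)
  have sd: "star d = d"
    using sx by (simp add: d_def star_simps)
  have d2: "cpos (d * d)"
    using sd by (rule cpos_square)
  have de: "d * (x + y) = x * x - y * y" "(x + y) * d = x * x - y * y"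
    using assms(3) by (simp_all add: d_def algebra_simps)
  have "cpos (x * y)"
    using assms by (rule cpos_mult_commute)
  moreover have "(x * y) * d = d * (x * y)"
    using assms(3) by (simp add: d_def algebra_simps) (metis assms(3) mult.assoc)
  then have "(x * y) * (d * d) = (d * d) * (x * y)"
    by (metis mult.assoc)
  ultimately have xyd: "cpos ((x * y) * (d * d))"
    using d2 cpos_mult_commute by blast
  have "(x + y) * (x + y) - d * d = 4 *\<^sub>R (x * y)"
    using assms(3) scaleR_add_left[of 2 2 "y * x"] by (simp add: d_def algebra_simps scaleR_2)
  then have "4 *\<^sub>R ((x * y) * (d * d)) = (x + y) * (x + y) * (d * d) - (d * d) * (d * d)"
    by (metis left_diff_distrib mult_scaleR_left)
  also have "(x + y) * (x + y) * (d * d) = (x * x - y * y) * (x * x - y * y)"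
    by (metis de mult.assoc)
  finally have "cpos ((x * x - y * y) * (x * x - y * y) - (d * d) * (d * d))"
    using cpos_scaleR[OF xyd, of 4] by simp
  moreover have "cpos ((d * d) * (d * d))"
    by (rule cpos_square[OF cpos_selfadjoint[OF d2]])
  ultimately have "norm ((d * d) * (d * d)) \<le> norm ((x * x - y * y) * (x * x - y * y))"
    by (intro cpos_norm_mono)
  then have "((norm d)\<^sup>2)\<^sup>2 \<le> (norm (x * x - y * y))\<^sup>2"
    using sx sd by (simp add: norm_selfadjoint_square star_simps)
  then show ?thesis
    unfolding d_def[symmetric] by (rule power2_le_imp_le) simp
qed

text \<open>The roots of x + 1/(n+1) commute with each other, so
  \<open>cpos_norm_diff_square_le\<close> makes them a Cauchy sequence. Choosing them in the double
  commutant of x yields the last clause, on which later commutation arguments rely.\<close>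

lemma (in unital_subalgebra) cpos_sqrt:
  assumes "x \<in> B" "cpos x"
  obtains c where "c \<in> B" "cpos c" "c * c = x" "\<And>z. z * x = x * z \<Longrightarrow> z * c = c * z"
proof -
  have sx: "star x = x"
    using assms by (simp add: cpos_selfadjoint)
  interpret C: unital_subalgebra "relative_commutant {x}"
    using sx by (rule unital_subalgebra_relative_commutant_selfadjoint)
  interpret D: unital_subalgebra "relative_commutant (relative_commutant {x})"
    by (rule unital_subalgebra_relative_commutant) (rule C.star_in)
  interpret BD: unital_subalgebra "B \<inter> relative_commutant (relative_commutant {x})"
    by (intro unital_subalgebra_Int) unfold_locales
  have x: "x \<in> B \<inter> relative_commutant (relative_commutant {x})"
    using assms by (simp add: relative_commutant_def)
  define e where "e n = 1 / real (Suc n)" for n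
  have e: "0 < e n" for n by (simp add: e_def)
  have "\<forall>n. \<exists>c. c \<in> B \<inter> relative_commutant (relative_commutant {x}) \<and> cpos c \<and> c * c = x + of_real (e n)"
    using BD.cpos_add_of_real_sqrt[OF x assms(2) e] by blast
  then obtain c where c: "\<And>n. c n \<in> B \<inter> relative_commutant (relative_commutant {x})"
    "\<And>n. cpos (c n)" "\<And>n. c n * c n = x + of_real (e n)"
    by metis
  have comm: "z * c n = c n * z" if "z * x = x * z" for z n
    using c(1)[of n] that by (auto simp: relative_commutant_def)
  have "c n * x = x * c n" for n
    by (rule comm[symmetric]) simp
  then have cc: "c m * c n = c n * c m" for m n
    by (intro comm)
  have bound: "(norm (c m - c n))\<^sup>2 \<le> \<bar>e m - e n\<bar>" for m n
  proof -
    have "c m * c m - c n * c n = of_real (e m - e n)"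
      using c(3) by simp
    then have "norm (c m * c m - c n * c n) = \<bar>e m - e n\<bar>"
      by (metis norm_of_real)
    then show ?thesis
      using cpos_norm_diff_square_le[OF c(2) c(2) cc] by metis
  qed
  have elim: "e \<longlonglongrightarrow> 0"
    unfolding e_def by (rule LIMSEQ_Suc[OF lim_1_over_n])
  have "Cauchy c"
  proof (rule metric_CauchyI)
    fix \<delta> :: real assume "0 < \<delta>"
    then have "Cauchy e" "0 < \<delta>\<^sup>2"
      using elim by (auto simp: LIMSEQ_imp_Cauchy)
    then obtain M where M: "\<And>m n. M \<le> m \<Longrightarrow> M \<le> n \<Longrightarrow> dist (e m) (e n) < \<delta>\<^sup>2"
      by (meson metric_CauchyD)
    have "dist (c m) (c n) < \<delta>" if "M \<le> m" "M \<le> n" for m n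
    proof -
      have "(norm (c m - c n))\<^sup>2 < \<delta>\<^sup>2"
        using bound[of m n] M[OF that] by (simp add: dist_norm)
      then show ?thesis
        using \<open>0 < \<delta>\<close> by (simp add: dist_norm power_less_imp_less_base)
    qed
    then show "\<exists>M. \<forall>m\<ge>M. \<forall>n\<ge>M. dist (c m) (c n) < \<delta>"
      by blast
  qed
  then obtain l where l: "c \<longlonglongrightarrow> l"
    by (auto simp: Cauchy_convergent_iff convergent_def)
  show thesis
  proof (rule that[of l])
    show "l \<in> B"
      using closed_sequentially[OF closed _ l] c(1) by blast
    show "cpos l"
      using c(2) l by (rule cpos_LIMSEQ)
    have "(\<lambda>n. c n * c n) \<longlonglongrightarrow> l * l"
      using l by (intro tendsto_intros)
    moreover have "(\<lambda>n. x + of_real (e n)) \<longlonglongrightarrow> x + of_real 0"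
      by (intro tendsto_intros elim)
    ultimately show "l * l = x"
      using c(3) by (simp add: LIMSEQ_unique)
    show "z * l = l * z" if "z * x = x * z" for z
    proof -
      have "(\<lambda>n. z * c n) \<longlonglongrightarrow> z * l" "(\<lambda>n. c n * z) \<longlonglongrightarrow> l * z"
        using l by (auto intro!: tendsto_intros)
      then show ?thesis
        using comm[OF that] by (simp add: LIMSEQ_unique)
    qed
  qed
qed

section \<open>Positive and negative parts\<close>

lemma cpos_sqrt_unique:
  assumes "cpos x" "cpos y" "x * y = y * x" "x * x = y * y"
  shows "x = y"
  using cpos_norm_diff_square_le[OF assms(1-3)] assms(4) by simp

lemma selfadjoint_square_eq_0: "star x = x \<Longrightarrow> x * x = 0 \<Longrightarrow> (x::'a::unital_cstar_algebra) = 0"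
  using star_mult_self_eq_0[of x] by simp

text \<open>With c = |x| the parts are (c + x)/2 and (c - x)/2, which are self-adjoint with product
  0. The work lies in their positivity: with P = |p| and N = |n|, uniqueness of roots gives P + N =
  c, and from this P = p and N = n.\<close>

lemma (in unital_subalgebra) pos_neg_parts:
  assumes "x \<in> B" "star x = x"
  obtains p n where "p \<in> B" "n \<in> B" "cpos p" "cpos n" "x = p - n" "p * n = 0" "n * p = 0"
proof -
  obtain c where c: "c \<in> B" "cpos c" "c * c = x * x" "\<And>z. z * (x * x) = (x * x) * z \<Longrightarrow> z * c = c * z"
    by (rule cpos_sqrt[OF mult_in[OF assms(1,1)] cpos_square[OF assms(2)]]) (rule that)
  have xc: "x * c = c * x"
    by (rule c(4)) (rule mult.assoc[symmetric])
  have sc: "star c = c"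
    using c(2) by (rule cpos_selfadjoint)
  define p where "p = (1/2) *\<^sub>R (c + x)"
  define n where "n = (1/2) *\<^sub>R (c - x)"
  have B: "p \<in> B" "n \<in> B"
    using assms(1) c(1) by (auto simp: p_def n_def intro!: closure_rules)
  have sp: "star p = p" "star n = n"
    unfolding p_def n_def by (simp_all add: star_simps assms(2) sc)
  have pn: "p * n = 0" "n * p = 0"
    using c(3) xc by (simp_all add: p_def n_def algebra_simps)
  have pnc: "p + n = c" "x = p - n"
    by (simp_all add: p_def n_def flip: scaleR_add_right scaleR_diff_right)
  obtain P where P: "P \<in> B" "cpos P" "P * P = p * p" "\<And>z. z * (p * p) = (p * p) * z \<Longrightarrow> z * P = P * z"
    by (rule cpos_sqrt[OF mult_in[OF B(1,1)] cpos_square[OF sp(1)]]) (rule that)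
  obtain N where N: "N \<in> B" "cpos N" "N * N = n * n" "\<And>z. z * (n * n) = (n * n) * z \<Longrightarrow> z * N = N * z"
    by (rule cpos_sqrt[OF mult_in[OF B(2,2)] cpos_square[OF sp(2)]]) (rule that)
  have sP: "star P = P" "star N = N"
    using P(2) N(2) by (auto intro: cpos_selfadjoint)
  have comm: "p * P = P * p" "n * N = N * n"
    by (rule P(4) N(4), rule mult.assoc[symmetric])+
  have npp: "n * (p * p) = 0" "(p * p) * n = 0" "p * (n * n) = 0" "(n * n) * p = 0"
    using pn by (metis mult.assoc mult_zero_left mult_zero_right)+
  have comm2: "n * P = P * n" "p * N = N * p"
    by (rule P(4) N(4), simp add: npp)+
  have comm3: "P * N = N * P"
    by (rule N(4)) (metis comm2(1) mult.assoc)
  have "star (P * N) = P * N"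
    using sP comm3 by (simp add: star_mult)
  moreover have "(P * N) * (P * N) = (p * p) * (n * n)"
    by (metis P(3) N(3) comm3 mult.assoc)
  then have "(P * N) * (P * N) = 0"
    by (metis npp(1) mult.assoc mult_zero_right npp(2) mult_zero_left)
  ultimately have PN: "P * N = 0"
    by (rule selfadjoint_square_eq_0)
  have sum: "P + N = c"
  proof (rule cpos_sqrt_unique)
    show "cpos (P + N)" "cpos c"
      using P(2) N(2) c(2) by (auto intro: cpos_add)
    show "(P + N) * c = c * (P + N)"
      using comm comm2 by (simp add: pnc(1)[symmetric] algebra_simps)
    show "(P + N) * (P + N) = c * c"
      using PN comm3 P(3) N(3) pn by (simp add: pnc(1)[symmetric] algebra_simps)
  qed
  \<comment> \<open>Once p N = 0 is known, p (P + N) = p c = p (p + n) reduces to p P = p^2. As P^2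
    = p^2 too, the square of P - p vanishes.\<close>
  have "star (p * N) = p * N"
    using sP sp comm2 by (simp add: star_mult)
  moreover have "(p * N) * (p * N) = (p * p) * (n * n)"
    by (metis comm2(2) N(3) mult.assoc)
  then have "(p * N) * (p * N) = 0"
    by (metis npp(2) mult.assoc mult_zero_left)
  ultimately have "p * N = 0"
    by (rule selfadjoint_square_eq_0)
  then have "p * P = p * p"
    using sum pnc pn by (metis add.right_neutral distrib_left)
  then have "(P - p) * (P - p) = 0"
    using comm P(3) by (simp add: algebra_simps)
  then have "P = p"
    using selfadjoint_square_eq_0[of "P - p"] by (simp add: star_diff sP sp)
  moreover have "N = n"
    using sum pnc(1) \<open>P = p\<close> by (metis add_left_imp_eq)
  ultimately show thesis
    using that[of p n] B P(2) N(2) pnc(2) pn by blast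
qed

text \<open>
  Positivity of \<open>w\<^sup>*w\<close>: with \<open>z = w n\<close> for the negative part \<open>n\<close> of \<open>w\<^sup>*w\<close>, the element
  \<open>Q = - z\<^sup>*z\<close> is positive, and so is \<open>P = zz\<^sup>*\<close>. Then \<open>(1 - P/T)\<^sup>m z = z (1 + Q/T)\<^sup>m\<close> is bounded
  in \<open>m\<close>, which forces \<open>Q = 0\<close>.
\<close>

lemma cpos_star_mult_self_eq_0:
  assumes "cpos (- (star z * z))"
  shows "z = 0"
proof -
  define Q where "Q = - (star z * z)"
  define P where "P = z * star z"
  define a where "a = (1/2) *\<^sub>R (z + star z)"
  define b where "b = (- \<i> / 2) *\<^sub>C (z - star z)"
  have sa: "star a = a" "star b = b"
    by (simp_all add: a_def b_def star_simps add.commute flip: scaleC_minus_right scaleC_minus_left)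
      (simp add: scaleC_diff_right scaleC_minus_left)
  have z: "z = a + \<i> *\<^sub>C b"
    by (simp add: a_def b_def scaleC_simps scaleC_of_real[of "1/2", simplified] flip: scaleR_add_right)
  have sz: "star z = a - \<i> *\<^sub>C b"
    unfolding z by (simp add: sa star_simps scaleC_minus_left)
  \<comment> \<open>The left side is z z^* + z^* z, where the mixed terms of the Cartesian
    decomposition cancel. So positivity of Q passes to P.\<close>
  have "P - Q = 2 *\<^sub>R (a * a) + 2 *\<^sub>R (b * b)"
    unfolding P_def Q_def sz unfolding z
    by (simp add: algebra_simps scaleC_simps scaleC_minus_left scaleC_add_right scaleC_diff_right scaleR_2)
  then have "P = 2 *\<^sub>R (a * a) + 2 *\<^sub>R (b * b) + Q"
    by (simp only: diff_eq_eq)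
  moreover have Q: "cpos Q"
    using assms by (simp add: Q_def)
  then have "cpos (2 *\<^sub>R (a * a) + 2 *\<^sub>R (b * b) + Q)"
    using sa by (intro cpos_add cpos_scaleR cpos_square) auto
  ultimately have P: "cpos P"
    by (simp only:)
  define T where "T = norm P + 1"
  have T: "0 < T" by (simp add: T_def add_nonneg_pos)
  define X where "X = (1/T) *\<^sub>R Q"
  define Y where "Y = 1 - (1/T) *\<^sub>R P"
  have X: "cpos X"
    using Q T by (simp add: X_def cpos_scaleR)
  have "Y = (1/T) *\<^sub>R (of_real T - P)"
    using T by (simp add: Y_def of_real_def scaleR_diff_right)
  moreover have "norm (of_real T - P) \<le> T"
    using P by (intro cpos_norm_diff_le) (auto simp: T_def)
  ultimately have "norm Y \<le> 1"
    using T by simp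
  have "Y * z = z * (1 + X)"
    by (simp add: X_def Y_def P_def Q_def algebra_simps)
  then have Yz: "Y ^ m * z = z * (1 + X) ^ m" for m
  proof (induction m)
    case (Suc m)
    then show ?case
      by (metis mult.assoc power_Suc)
  qed simp
  have sX: "star (X ^ j) = X ^ j" for j
    by (simp add: star_power cpos_selfadjoint[OF X])
  have Xpow: "cpos (X ^ k)" for k
  proof (cases "even k")
    case True
    then obtain j where "k = j + j" by (auto elim: evenE simp: mult_2)
    then show ?thesis
      using cpos_square[OF sX] by (simp add: power_add)
  next
    case False
    then obtain j where "k = Suc (j + j)" by (auto elim: oddE simp: mult_2)
    moreover have "X * (X ^ j * X ^ j) = (X ^ j * X ^ j) * X"
      by (metis power_add power_commutes)
    then have "cpos (X * (X ^ j * X ^ j))"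
      by (intro cpos_mult_commute[OF X cpos_square[OF sX]])
    ultimately show ?thesis
      by (simp add: power_add)
  qed
  \<comment> \<open>These are the first two terms of the expansion of (1 + X)^m X; what is left over
    is a sum of powers of X. The factor \<open>X ^ k\<close> keeps the induction going, because the
    step multiplies by 1 + X.\<close>
  have binom: "cpos (((1 + X) ^ m * X - X - real m *\<^sub>R (X * X)) * X ^ k)" for m k
  proof (induction m arbitrary: k)
    case (Suc m)
    define W where "W = (1 + X) ^ m * X"
    have "(1 + X) ^ Suc m * X = W + W * X"
      unfolding power_Suc2 by (simp add: W_def algebra_simps)
    moreover have "X ^ (k + 3) = X * (X * (X * X ^ k))"
      by (simp add: numeral_3_eq_3)
    ultimately have "((1 + X) ^ Suc m * X - X - real (Suc m) *\<^sub>R (X * X)) * X ^ k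
      = (W - X - real m *\<^sub>R (X * X)) * X ^ k
        + (W - X - real m *\<^sub>R (X * X)) * X ^ Suc k + real m *\<^sub>R X ^ (k + 3)"
      by (simp add: algebra_simps)
    then show ?case
      using Suc[of k] Suc[of "Suc k"] Xpow unfolding W_def
      by (simp del: power_Suc add: cpos_add cpos_scaleR)
  qed simp
  have bound: "real m * norm (X * X) \<le> (norm z)\<^sup>2 / T" for m
  proof -
    have "cpos ((1 + X) ^ (m + m) * X - real (m + m) *\<^sub>R (X * X))"
      using cpos_add[OF binom[of "m + m" 0] X] by simp
    moreover have "cpos (real (m + m) *\<^sub>R (X * X))"
      using X by (intro cpos_scaleR cpos_square cpos_selfadjoint) auto
    ultimately have "norm (real (m + m) *\<^sub>R (X * X)) \<le> norm ((1 + X) ^ (m + m) * X)"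
      by (rule cpos_norm_mono[rotated])
    also have "star (z * (1 + X) ^ m) * (z * (1 + X) ^ m) = - (T *\<^sub>R ((1 + X) ^ (m + m) * X))"
    proof -
      have comm: "Q * (1 + X) ^ m = (1 + X) ^ m * Q"
        by (simp add: X_def power_commuting_commutes algebra_simps)
      have "star (z * (1 + X) ^ m) * (z * (1 + X) ^ m) = (1 + X) ^ m * (star z * z) * (1 + X) ^ m"
        using X by (simp add: star_simps star_power cpos_selfadjoint mult.assoc)
      also have "\<dots> = - ((1 + X) ^ m * (Q * (1 + X) ^ m))"
        by (simp add: Q_def mult.assoc)
      also have "\<dots> = - ((1 + X) ^ (m + m) * Q)"
        by (simp add: comm power_add mult.assoc)
      finally show ?thesis
        using T by (simp add: X_def)
    qed
    then have "norm ((1 + X) ^ (m + m) * X) = (norm (z * (1 + X) ^ m))\<^sup>2 / T"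
      using T cstar_identity[of "z * (1 + X) ^ m"] by (simp add: eq_divide_eq mult.commute)
    also have "z * (1 + X) ^ m = Y ^ m * z"
      by (simp add: Yz)
    also have "norm (Y ^ m * z) \<le> 1 * norm z"
      using \<open>norm Y \<le> 1\<close>
      by (intro order.trans[OF norm_mult_ineq] mult_right_mono order.trans[OF norm_power_ineq] power_le_one) auto
    then have "(norm (Y ^ m * z))\<^sup>2 / T \<le> (norm z)\<^sup>2 / T"
      using T by (intro divide_right_mono power_mono) auto
    finally have "real (m + m) * norm (X * X) \<le> (norm z)\<^sup>2 / T"
      by simp
    moreover have "real m * norm (X * X) \<le> real (m + m) * norm (X * X)"
      by (intro mult_right_mono) auto
    ultimately show ?thesis by linarith
  qed
  have "norm (X * X) = 0"
  proof (rule ccontr)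
    assume "norm (X * X) \<noteq> 0"
    then obtain m where "(norm z)\<^sup>2 / T < real m * norm (X * X)"
      using reals_Archimedean3[of "norm (X * X)"] by auto
    with bound[of m] show False by simp
  qed
  then have "X = 0"
    using X selfadjoint_square_eq_0[of X] by (simp add: cpos_selfadjoint)
  then have "star z * z = 0"
    using T by (simp add: X_def Q_def)
  then show ?thesis
    by (simp add: star_mult_self_eq_0)
qed

theorem cpos_star_mult_self: "cpos (star w * w)"
proof -
  interpret unital_subalgebra UNIV
    by (rule unital_subalgebra_UNIV)
  obtain p n where pn: "cpos p" "cpos n" "star w * w = p - n" "p * n = 0" "n * p = 0"
    by (rule pos_neg_parts[of "star w * w"]) (auto simp: star_simps)
  have "- (star (w * n) * (w * n)) = - (n * (star w * w) * n)"
    by (simp add: star_mult cpos_selfadjoint[OF pn(2)] mult.assoc)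
  also have "\<dots> = n * n * n"
    unfolding pn(3) by (simp add: algebra_simps pn(4,5))
  finally have "cpos (- (star (w * n) * (w * n)))"
    using pn by (simp add: mult.assoc cpos_mult_commute cpos_square cpos_selfadjoint)
  then have "w * n = 0"
    by (rule cpos_star_mult_self_eq_0)
  then have "star w * w * n = 0"
    by (simp add: mult.assoc)
  then have "n * n = 0"
    using pn by (simp add: algebra_simps)
  then have "n = 0"
    using pn selfadjoint_square_eq_0[of n] by (simp add: cpos_selfadjoint)
  with pn show ?thesis by simp
qed

section \<open>Order inequalities and inverse square roots\<close>

lemma cpos_mult_star_self: "cpos (w * star w)"
  using cpos_star_mult_self[of "star w"] by (simp add: star_star)

text \<open>This connects \<open>cpos\<close> with the positivity used for completely positive maps
  and hereditary subalgebras. As \<open>cpos\<close> does not refer to \<open>B\<close>, an element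
  of \<open>B\<close> that is positive in the whole algebra is positive in \<open>B\<close>.\<close>

lemma (in unital_subalgebra) cpos_iff_star_mult_self:
  assumes "x \<in> B"
  shows "cpos x \<longleftrightarrow> positive_in B x"
proof
  assume "cpos x"
  with assms obtain c where "c \<in> B" "cpos c" "c * c = x"
    using cpos_sqrt by blast
  then show "positive_in B x"
    unfolding positive_in_def by (metis cpos_selfadjoint)
qed (auto simp: positive_in_def cpos_star_mult_self)

lemma cpos_conj: "cpos x \<Longrightarrow> cpos (star a * x * a)"
proof -
  assume "cpos x"
  then obtain y where "x = star y * y"
    using unital_subalgebra.cpos_iff_star_mult_self[OF unital_subalgebra_UNIV, of x]
    by (auto simp: positive_in_def)
  then have "star a * x * a = star (y * a) * (y * a)"
    by (simp add: star_mult mult.assoc)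
  then show ?thesis
    by (simp only: cpos_star_mult_self)
qed

text \<open>Operator form of the Cauchy-Schwarz inequality: the difference is half the sum of |u_i -
  u_j|^2 over all pairs.\<close>

lemma cpos_sum_square_le:
  fixes u :: "'i \<Rightarrow> 'a::unital_cstar_algebra"
  assumes "finite I"
  shows "cpos (real (card I) *\<^sub>R (\<Sum>i\<in>I. star (u i) * u i) - star (\<Sum>i\<in>I. u i) * (\<Sum>i\<in>I. u i))"
proof -
  have of_nat: "of_nat k * x = real k *\<^sub>R x" for k and x :: 'a
    by (simp add: scaleR_conv_of_real)
  have two: "(2 * r) *\<^sub>R x = r *\<^sub>R x + r *\<^sub>R x" "(r * 2) *\<^sub>R x = r *\<^sub>R x + r *\<^sub>R x" for r and x :: 'a
    by (metis mult_2 mult_2_right scaleR_add_left)+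
  have "(\<Sum>i\<in>I. \<Sum>j\<in>I. star (u i - u j) * (u i - u j))
    = 2 *\<^sub>R (real (card I) *\<^sub>R (\<Sum>i\<in>I. star (u i) * u i) - star (\<Sum>i\<in>I. u i) * (\<Sum>i\<in>I. u i))"
    by (simp add: star_diff algebra_simps sum.distrib sum_subtractf scaleR_2 star_sum
        sum_distrib_left sum_distrib_right sum_constant_scaleR scaleR_sum_right)
      (subst (2) sum.swap,
        simp add: of_nat two sum.distrib[symmetric])
  moreover have "cpos (\<Sum>i\<in>I. \<Sum>j\<in>I. star (u i - u j) * (u i - u j))"
    by (intro cpos_sum cpos_star_mult_self)
  ultimately show ?thesis
    using cpos_scaleR[of "\<Sum>i\<in>I. \<Sum>j\<in>I. star (u i - u j) * (u i - u j)" "1/2"] by simp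
qed

lemma cpos_conj_norm_le:
  "cpos ((norm x)\<^sup>2 *\<^sub>R (star y * y) - star (x * y) * (x * (y::'a::unital_cstar_algebra)))"
proof -
  have "cpos (of_real ((norm x)\<^sup>2) - star x * x)"
    by (intro cpos_norm_minus) (simp_all add: star_simps cstar_identity)
  from cpos_conj[OF this, of y] show ?thesis
    by (simp add: algebra_simps star_mult of_real_def)
qed

lemma cpos_scaleR_diff: "cpos x \<Longrightarrow> r \<le> s \<Longrightarrow> cpos (s *\<^sub>R x - r *\<^sub>R x)"
  using cpos_scaleR[of x "s - r"] by (simp add: scaleR_diff_left)

lemma norm_isometry:
  assumes "star S * S = (1::'a::unital_cstar_algebra)"
  shows "norm S = 1"
  using cstar_identity[of S] assms by (simp add: power2_eq_1_iff) (use norm_ge_zero[of S] in linarith)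

lemma (in unital_subalgebra) neumann_inverse:
  assumes "y \<in> B" "norm y < 1" "star y = y"
  obtains w where "w \<in> B" "star w = w" "(1 - y) * w = 1" "w * (1 - y) = 1"
proof -
  have sm: "summable (\<lambda>n. y ^ n)"
    using assms by (intro complete_algebra_summable_geometric)
  define w where "w = suminf (\<lambda>n. y ^ n)"
  have lim: "(\<lambda>n. \<Sum>i<n. y ^ i) \<longlonglongrightarrow> w"
    using sm unfolding w_def by (rule summable_LIMSEQ)
  have y0: "(\<lambda>n. y ^ n) \<longlonglongrightarrow> 0"
    by (rule summable_LIMSEQ_zero[OF sm])
  have left: "(1 - y) * (\<Sum>i<n. y ^ i) = 1 - y ^ n" for n
    by (induction n) (simp_all add: distrib_left, simp add: left_diff_distrib)
  have right: "(\<Sum>i<n. y ^ i) * (1 - y) = 1 - y ^ n" for n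
    by (induction n) (simp_all add: distrib_right, simp add: right_diff_distrib power_commutes)
  show thesis
  proof (rule that[of w])
    show "w \<in> B"
      using closed_sequentially[OF closed _ lim] assms by (auto intro!: sum_in power_in)
    have "(\<lambda>n. star (\<Sum>i<n. y ^ i)) \<longlonglongrightarrow> star w"
      by (rule bounded_linear.tendsto[OF bounded_linear_star lim])
    then show "star w = w"
      using lim assms by (simp add: star_sum star_power LIMSEQ_unique)
    have "(\<lambda>n. (1 - y) * (\<Sum>i<n. y ^ i)) \<longlonglongrightarrow> (1 - y) * w"
      using lim by (intro tendsto_intros)
    moreover have "(\<lambda>n. (1 - y) * (\<Sum>i<n. y ^ i)) \<longlonglongrightarrow> 1 - 0"
      unfolding left by (intro tendsto_diff tendsto_const y0)
    ultimately show "(1 - y) * w = 1"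
      by (simp add: LIMSEQ_unique)
    have "(\<lambda>n. (\<Sum>i<n. y ^ i) * (1 - y)) \<longlonglongrightarrow> w * (1 - y)"
      using lim by (intro tendsto_intros)
    moreover have "(\<lambda>n. (\<Sum>i<n. y ^ i) * (1 - y)) \<longlonglongrightarrow> 1 - 0"
      unfolding right by (intro tendsto_diff tendsto_const y0)
    ultimately show "w * (1 - y) = 1"
      by (simp add: LIMSEQ_unique)
  qed
qed

text \<open>Divided by C \<ge> norm c, the element has distance at most 1 - \<mu>/C from the unit,
  and so has its root d. The Neumann series inverts d, and g is its inverse divided by the root of
  C.\<close>

lemma (in unital_subalgebra) cpos_inverse_sqrt:
  assumes "c \<in> B" "0 < \<mu>" "cpos (c - of_real \<mu>)"
  obtains g where "g \<in> B" "star g = g" "g * c * g = 1"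
proof -
  define C where "C = norm c + 1"
  have C: "0 < C" "norm c \<le> C"
    by (auto simp: C_def add_nonneg_pos)
  have c: "cpos c"
    using cpos_add[OF assms(3), of "of_real \<mu>"] assms(2) by (simp add: cpos_of_real)
  define y where "y = 1 - (1/C) *\<^sub>R c"
  have y: "y = (1/C) *\<^sub>R (of_real C - c)"
    using C by (simp add: y_def of_real_def scaleR_diff_right)
  have sy: "star y = y"
    using c by (simp add: y_def star_simps cpos_selfadjoint)
  have "cpos (of_real C - c)"
    using c C by (intro cpos_norm_minus cpos_selfadjoint)
  then have "norm (of_real C - c) \<le> C - \<mu>"
    by (rule cpos_norm_le) (use assms in simp)
  moreover have "norm y = norm (of_real C - c) / C"
    using C by (simp add: y)
  ultimately have ny: "norm y < 1"
    using C assms(2) by simp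
  have "y \<in> B"
    unfolding y_def using assms by (intro closure_rules) auto
  then obtain d where d: "d \<in> B" "d * d = 1 - y" "norm (1 - d) \<le> norm y" "star d = d"
    using sqrt_one_minus[OF _ ny] sy by metis
  obtain w where w: "w \<in> B" "star w = w" "d * w = 1" "w * d = 1"
    using neumann_inverse[of "1 - d"] d ny by (auto simp: star_diff diff_in)
  show thesis
  proof (rule that[of "(1 / sqrt C) *\<^sub>R w"])
    have "w * (d * d) * w = 1"
      using w by (metis mult.assoc mult.right_neutral)
    then have "w * ((1/C) *\<^sub>R c) * w = 1"
      using d by (simp add: y_def)
    then show "(1 / sqrt C) *\<^sub>R w * c * (1 / sqrt C) *\<^sub>R w = 1"
      using C by (simp add: field_simps)
  qed (use w in \<open>auto simp: star_scaleR intro: scaleR_in\<close>)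
qed

lemma norm_star_conj_le:
  fixes w :: "'a::unital_cstar_algebra"
  shows "norm (star w * x * w) \<le> (norm w)\<^sup>2 * norm x"
proof -
  have "norm (star w * x * w) \<le> norm (star w) * norm x * norm w"
    by (intro order.trans[OF norm_mult_ineq] mult_right_mono norm_mult_ineq norm_ge_zero)
  then show ?thesis
    by (simp add: power2_eq_square mult_ac)
qed

lemma norm_mult_diff_le:
  fixes a b :: "'a::real_normed_algebra"
  assumes "norm (a - a') \<le> \<tau>" "norm (b - b') \<le> \<tau>" "norm a' \<le> C" "norm b \<le> C"
  shows "norm (a * b - a' * b') \<le> 2 * C * \<tau>"
proof -
  have "a * b - a' * b' = (a - a') * b + a' * (b - b')"
    by (simp add: algebra_simps)
  also have "norm \<dots> \<le> norm (a - a') * norm b + norm a' * norm (b - b')"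
    by (intro norm_triangle_le add_mono norm_mult_ineq)
  also have "\<dots> \<le> \<tau> * C + C * \<tau>"
    using assms by (intro add_mono mult_mono) (auto intro: order.trans[OF norm_ge_zero])
  finally show ?thesis by simp
qed

section \<open>Isometries in simple purely infinite algebras\<close>

locale pi_subalgebra = unital_subalgebra +
  assumes simple: "simple_cstar B"
    and purely_infinite: "purely_infinite B"
begin

definition isometries :: "'a set"
  where "isometries = {S \<in> B. star S * S = 1}"

lemma isometriesD: "S \<in> isometries \<Longrightarrow> S \<in> B" "S \<in> isometries \<Longrightarrow> star S * S = 1"
  by (auto simp: isometries_def)

lemma isometries_one [simp]: "1 \<in> isometries"
  by (simp add: isometries_def)

lemma isometries_mult: "S \<in> isometries \<Longrightarrow> R \<in> isometries \<Longrightarrow> S * R \<in> isometries"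
  unfolding isometries_def by (auto simp: star_mult mult_in) (metis mult.assoc mult.left_neutral)

lemma isometries_norm: "S \<in> isometries \<Longrightarrow> norm S = 1"
  by (rule norm_isometry) (rule isometriesD)

text \<open>By simplicity the ideal generated by e contains some x = \<Sum> a_l e b_l close to 1.
  Then x^*x is bounded below, and it is dominated by a multiple of c = \<Sum> b_l^* e b_l. Hence c
  is invertible, and its inverse root normalises the b_l.\<close>

lemma full_projection:
  assumes "e \<in> B" "star e = e" "e * e = e" "e \<noteq> 0"
  obtains m :: nat and z where "\<And>l. l < m \<Longrightarrow> z l \<in> B" "(\<Sum>l<m. star (z l) * e * z l) = 1"
proof -
  \<comment> \<open>With sums over lists, closure under addition is concatenation.\<close>
  define J where "J = {\<Sum>(x, y)\<leftarrow>xs. x * e * y |xs. set xs \<subseteq> B \<times> B}"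
  have J_add: "x + y \<in> J" if "x \<in> J" "y \<in> J" for x y
  proof -
    obtain xs ys where "set xs \<subseteq> B \<times> B" "x = (\<Sum>(x, y)\<leftarrow>xs. x * e * y)"
      "set ys \<subseteq> B \<times> B" "y = (\<Sum>(x, y)\<leftarrow>ys. x * e * y)"
      using \<open>x \<in> J\<close> \<open>y \<in> J\<close> unfolding J_def by blast
    then show ?thesis
      unfolding J_def by (auto intro!: exI[of _ "xs @ ys"])
  qed
  have J_mult: "a * x * b \<in> J" if "x \<in> J" "a \<in> B" "b \<in> B" for x a b
  proof -
    obtain xs where xs: "set xs \<subseteq> B \<times> B" "x = (\<Sum>(x, y)\<leftarrow>xs. x * e * y)"
      using \<open>x \<in> J\<close> unfolding J_def by blast
    have "a * (\<Sum>(x, y)\<leftarrow>ys. x * e * y) * b = (\<Sum>(x, y)\<leftarrow>map (\<lambda>(x, y). (a * x, y * b)) ys. x * e * y)" for ys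
      by (induction ys) (auto simp: algebra_simps)
    then show ?thesis
      unfolding J_def using xs that by (auto intro!: exI[of _ "map (\<lambda>(x, y). (a * x, y * b)) xs"] mult_in)
  qed
  have J_B: "J \<subseteq> B"
  proof -
    have "(\<Sum>(x, y)\<leftarrow>xs. x * e * y) \<in> B" if "set xs \<subseteq> B \<times> B" for xs
      using that assms by (induction xs) (auto intro!: add_in mult_in)
    then show ?thesis by (auto simp: J_def)
  qed
  have "e \<in> J"
    unfolding J_def by (auto intro!: exI[of _ "[(1, 1)]"])
  have "closed_two_sided_ideal B (closure J)"
    unfolding closed_two_sided_ideal_def
  proof (intro conjI ballI allI)
    show "closure J \<subseteq> B"
      by (rule closure_minimal[OF J_B closed])
    have "0 * e * 0 \<in> J"
      by (rule J_mult[OF \<open>e \<in> J\<close>]) auto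
    then show "0 \<in> closure J"
      using closure_subset by auto
    show "x + y \<in> closure J" if xy: "x \<in> closure J" "y \<in> closure J" for x y
    proof -
      obtain f g where "\<forall>n. f n \<in> J" "f \<longlonglongrightarrow> x" "\<forall>n. g n \<in> J" "g \<longlonglongrightarrow> y"
        using xy unfolding closure_sequential by blast
      then show ?thesis
        unfolding closure_sequential by (intro exI[of _ "\<lambda>n. f n + g n"]) (auto intro: J_add tendsto_add)
    qed
    have ab: "a * x * b \<in> closure J" if x: "x \<in> closure J" "a \<in> B" "b \<in> B" for x a b
    proof -
      obtain f where "\<forall>n. f n \<in> J" "f \<longlonglongrightarrow> x"
        using x(1) unfolding closure_sequential by blast
      then show ?thesis
        unfolding closure_sequential using x
        by (intro exI[of _ "\<lambda>n. a * f n * b"]) (auto intro!: J_mult tendsto_intros)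
    qed
    show "c *\<^sub>C x \<in> closure J" if "x \<in> closure J" for c x
      using ab[OF that, of "c *\<^sub>C 1" 1] by (simp add: scaleC_in mult_scaleC_left)
    show "b * x \<in> closure J" "x * b \<in> closure J" if "b \<in> B" "x \<in> closure J" for b x
      using ab[of x b 1] ab[of x 1 b] that by auto
  qed simp
  moreover have "closure J \<noteq> {0}"
    using \<open>e \<in> J\<close> \<open>e \<noteq> 0\<close> closure_subset[of J] by auto
  ultimately have "closure J = B"
    using simple by (auto simp: simple_cstar_def)
  then have "1 \<in> closure J" by simp
  then obtain x where "x \<in> J" "dist x 1 < 1/4"
    unfolding closure_approachable by (meson zero_less_divide_1_iff zero_less_numeral)
  then obtain xs where xs: "set xs \<subseteq> B \<times> B" "x = (\<Sum>(x, y)\<leftarrow>xs. x * e * y)"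
    unfolding J_def by blast
  define m where "m = length xs"
  define a where "a l = fst (xs ! l)" for l
  define b where "b l = snd (xs ! l)" for l
  have ab: "a l \<in> B" "b l \<in> B" if "l < m" for l
  proof -
    have "xs ! l \<in> B \<times> B"
      using nth_mem[of l xs] xs(1) that by (auto simp only: m_def)
    then show "a l \<in> B" "b l \<in> B"
      by (auto simp: a_def b_def mem_Times_iff)
  qed
  have x: "x = (\<Sum>l<m. a l * e * b l)"
    unfolding xs by (simp add: sum_list_sum_nth m_def a_def b_def case_prod_unfold atLeast0LessThan)
  define c where "c = (\<Sum>l<m. star (b l) * e * b l)"
  \<comment> \<open>The product comes from the Cauchy-Schwarz inequality for m summands; the
    additional 1 keeps K positive.\<close>
  define K where "K = (\<Sum>l<m. (norm (a l))\<^sup>2) * real m + 1"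
  have K: "0 < K"
    unfolding K_def by (intro add_nonneg_pos mult_nonneg_nonneg sum_nonneg) auto
  have eb: "star (e * b l) * (e * b l) = star (b l) * e * b l" for l
    using assms by (simp add: star_mult) (metis mult.assoc)
  have cpos_eb: "cpos (star (b l) * e * b l)" for l
    using cpos_star_mult_self[of "e * b l"] by (simp add: eb)
  have "cpos (K *\<^sub>R c - star x * x)"
  proof -
    have 1: "cpos (real m *\<^sub>R (\<Sum>l<m. star (a l * (e * b l)) * (a l * (e * b l))) - star x * x)"
      using cpos_sum_square_le[of "{..<m}" "\<lambda>l. a l * (e * b l)"] by (simp add: x mult.assoc)
    have 2: "cpos (\<Sum>l<m. (norm (a l))\<^sup>2 *\<^sub>R (star (b l) * e * b l) - star (a l * (e * b l)) * (a l * (e * b l)))"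
      using cpos_conj_norm_le[of "a _" "e * b _"] by (intro cpos_sum) (simp add: eb)
    have 3: "cpos (\<Sum>l<m. (\<Sum>l<m. (norm (a l))\<^sup>2) *\<^sub>R (star (b l) * e * b l) - (norm (a l))\<^sup>2 *\<^sub>R (star (b l) * e * b l))"
      by (intro cpos_sum cpos_scaleR_diff cpos_eb member_le_sum) auto
    have 4: "cpos c"
      unfolding c_def by (intro cpos_sum cpos_eb)
    have "K *\<^sub>R c - star x * x = c + real m *\<^sub>R (\<Sum>l<m. (\<Sum>l<m. (norm (a l))\<^sup>2) *\<^sub>R (star (b l) * e * b l) - (norm (a l))\<^sup>2 *\<^sub>R (star (b l) * e * b l))
      + real m *\<^sub>R (\<Sum>l<m. (norm (a l))\<^sup>2 *\<^sub>R (star (b l) * e * b l) - star (a l * (e * b l)) * (a l * (e * b l)))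
      + (real m *\<^sub>R (\<Sum>l<m. star (a l * (e * b l)) * (a l * (e * b l))) - star x * x)"
      by (simp add: sum_subtractf scaleR_diff_right c_def K_def scaleR_add_left flip: scaleR_sum_right)
    also have "cpos \<dots>"
      by (intro cpos_add cpos_scaleR 1 2 3 4) auto
    finally show ?thesis .
  qed
  moreover have "cpos (star x * x - of_real (1/2))"
  proof -
    define d where "d = 1 - x"
    have "norm (d + star d) \<le> 1/2"
      using norm_triangle_ineq[of d "star d"] \<open>dist x 1 < 1/4\<close> by (simp add: d_def dist_norm norm_minus_commute)
    then have "cpos (of_real (1/2) - (d + star d))"
      by (intro cpos_norm_minus) (simp_all add: star_simps add.commute)
    then have "cpos (of_real (1/2) - (d + star d) + star d * d)"
      by (intro cpos_add cpos_star_mult_self)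
    moreover have "of_real (1/2) - (d + star d) + star d * d = star x * x - (1 - of_real (1/2))"
      by (simp add: d_def star_diff algebra_simps)
    moreover have "of_real (1 - 1/2) = (1 - of_real (1/2) :: 'a)"
      by (simp only: of_real_diff of_real_1)
    ultimately show ?thesis by simp
  qed
  ultimately have "cpos (K *\<^sub>R c - of_real (1/2))"
    using cpos_add by fastforce
  then have "cpos ((1/K) *\<^sub>R (K *\<^sub>R c - of_real (1/2)))"
    using K by (intro cpos_scaleR) auto
  then have "cpos (c - of_real (1/(2*K)))"
    using K by (simp add: scaleR_diff_right of_real_def mult.commute)
  moreover have "c \<in> B"
    unfolding c_def using ab assms by (auto intro!: closure_rules)
  ultimately obtain g where g: "g \<in> B" "star g = g" "g * c * g = 1"
    using cpos_inverse_sqrt[of c "1/(2*K)"] K by auto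
  show thesis
  proof (rule that[of m "\<lambda>l. b l * g"])
    show "b l * g \<in> B" if "l < m" for l
      using ab that g by (auto intro: mult_in)
    have "(\<Sum>l<m. star (b l * g) * e * (b l * g)) = g * c * g"
      using g by (simp add: c_def sum_distrib_left sum_distrib_right star_mult mult.assoc)
    then show "(\<Sum>l<m. star (b l * g) * e * (b l * g)) = 1"
      using g by simp
  qed
qed

text \<open>
  If \<open>v\<^sup>*v = p\<close> and \<open>vv\<^sup>* = q < p\<close>, then the elements \<open>v\<^sup>i(p - q)\<close> are partial isometries
  with the same source \<open>p - q\<close> and orthogonal ranges below \<open>p\<close>.
\<close>

lemma infinite_projection_isometries:
  assumes "infinite_projection B p"
  obtains T :: "nat \<Rightarrow> 'a" where "\<And>n. T n \<in> B" "\<And>n. p * T n = T n"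
    "\<And>m n. star (T m) * T n = (if m = n then 1 else 0)"
proof -
  obtain q v where p: "p \<in> B" "star p = p" "p * p = p" and q: "q \<in> B" "star q = q" "q * q = q"
    and pq: "p * q = q" "q \<noteq> p" and v: "v \<in> B" "star v * v = p" "v * star v = q"
    using assms by (auto simp: infinite_projection_def projection_in_def)
  have qp: "q * p = q"
    by (metis p(2) pq(1) q(2) star_mult)
  have "star (v - v * p) * (v - v * p) = 0"
    using v p by (simp add: star_diff star_mult algebra_simps) (metis mult.assoc v(2) p(3))
  then have vp: "v * p = v"
    by (simp add: star_mult_self_eq_0)
  have qv: "q * v = v"
    using v vp by (metis mult.assoc)
  have pv: "p * v = v"
    by (metis mult.assoc pq(1) qv)
  define e where "e = p - q"
  have e: "e \<in> B" "star e = e" "e * e = e" "e \<noteq> 0" "e * v = 0" "p * e = e" "e * p = e"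
    using p q pq qp pv qv by (auto simp: e_def star_diff algebra_simps intro: diff_in)
  obtain m :: nat and z where z: "\<And>l. l < m \<Longrightarrow> z l \<in> B" "(\<Sum>l<m. star (z l) * e * z l) = 1"
    using full_projection[OF e(1-4)] by blast
  define w where "w i = v ^ i * e" for i
  have pw: "p * w i = w i" for i
    using pv e by (cases i) (simp_all add: w_def mult.assoc[symmetric])
  have ww_Suc: "star (w (Suc i)) * w (Suc j) = star (w i) * w j" for i j
  proof -
    have "w (Suc i) = v * w i" for i
      by (simp add: w_def mult.assoc)
    then have "star (w (Suc i)) * w (Suc j) = star (w i) * ((star v * v) * w j)"
      by (simp add: star_mult mult.assoc)
    then show ?thesis
      using v pw by simp
  qed
  have ew: "e * w (Suc j) = 0" for j
    using e by (simp add: w_def mult.assoc[symmetric])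
  have w0: "w 0 = e"
    by (simp add: w_def)
  have ww: "star (w i) * w j = (if i = j then e else 0)" for i j
  proof (induction i arbitrary: j)
    case 0
    then show ?case
      using ew e by (cases j) (simp_all add: w0)
  next
    case (Suc i)
    show ?case
    proof (cases j)
      case 0
      have "star (star (w 0) * w (Suc i)) = 0"
        using ew e by (simp add: w0 star_zero)
      then show ?thesis
        using 0 by (simp add: star_mult star_star)
    next
      case j: (Suc k)
      then show ?thesis
        using Suc.IH[of k] ww_Suc[of i k] by simp
    qed
  qed
  \<comment> \<open>The \<open>w i\<close> have source e, not 1. Since \<Sum> z_l^* e z_l = 1,
    gluing m consecutive ones with the z_l gives an isometry; the n-th uses the indices from n m to
    n m + m - 1, so distinct ones have orthogonal ranges.\<close>
  define T where "T n = (\<Sum>l<m. w (n * m + l) * z l)" for n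
  show thesis
  proof (rule that[of T])
    show "T n \<in> B" for n
      unfolding T_def w_def using z v e by (auto intro!: closure_rules)
    show "p * T n = T n" for n
      unfolding T_def by (simp add: sum_distrib_left mult.assoc[symmetric] pw)
    show "star (T i) * T j = (if i = j then 1 else 0)" for i j
    proof -
      have "star (T i) * T j
        = (\<Sum>l<m. \<Sum>k<m. star (z l) * (star (w (i * m + l)) * w (j * m + k)) * z k)"
        by (simp add: T_def star_sum star_mult sum_product mult.assoc)
      also have "\<dots> = (\<Sum>l<m. \<Sum>k<m. if i * m + l = j * m + k then star (z l) * e * z k else 0)"
        by (intro sum.cong refl) (simp add: ww)
      also have "\<dots> = (\<Sum>l<m. \<Sum>k<m. if i = j \<and> l = k then star (z l) * e * z k else 0)"
      proof (intro sum.cong refl)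
        fix l k assume "l \<in> {..<m}" "k \<in> {..<m}"
        then have "i * m + l = j * m + k \<longleftrightarrow> i = j \<and> l = k"
          by (metis add_left_cancel div_mult_self3 div_less lessThan_iff add.right_neutral
              less_nat_zero_code mult.commute)
        then show "(if i * m + l = j * m + k then star (z l) * e * z k else 0)
          = (if i = j \<and> l = k then star (z l) * e * z k else 0)"
          by simp
      qed
      also have "\<dots> = (if i = j then 1 else 0)"
        using z by simp
      finally show ?thesis .
    qed
  qed
qed

text \<open>Such a sequence serves two purposes below: \<open>T i * b * star (T j)\<close> embeds
  matrices over \<open>B\<close> into \<open>B\<close>, and \<Sum> T_r y_r packs a column of
  elements into a single one.\<close>

lemma orthogonal_isometries:
  obtains T :: "nat \<Rightarrow> 'a" where "\<And>n. T n \<in> isometries"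
    "\<And>m n. star (T m) * T n = (if m = n then 1 else 0)"
proof -
  have "hereditary_subalgebra B B"
    unfolding hereditary_subalgebra_def using subalgebra
    by (auto simp: positive_in_def intro: mult_in star_in)
  moreover have "B \<noteq> {0}"
    using one_in by (metis singletonD zero_neq_one)
  ultimately obtain p where "infinite_projection B p"
    using purely_infinite by (auto simp: purely_infinite_def)
  then obtain T :: "nat \<Rightarrow> 'a" where "\<And>n. T n \<in> B"
    "\<And>m n. star (T m) * T n = (if m = n then 1 else 0)"
    using infinite_projection_isometries by metis
  then show thesis
    by (intro that[of T]) (auto simp: isometries_def)
qed

text \<open>The range of \<open>S\<close> lies in the spectral subspace of \<open>h\<close> near its norm.\<close>

lemma isometry_near_norm:
  assumes "h \<in> B" "cpos h" "h \<noteq> 0" "0 < \<tau>"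
  obtains S where "S \<in> isometries" "norm (h * S - norm h *\<^sub>R S) \<le> \<tau>" "\<And>x. x * h = 0 \<Longrightarrow> x * S = 0"
proof -
  define M where "M = norm h"
  \<comment> \<open>The cut-off level M - \<delta> has to be positive, and on the range of S the
    element h differs from M by p - \<delta>, whence 2 \<delta> \<le> \<tau>.\<close>
  define \<delta> where "\<delta> = min (\<tau>/2) (M/2)"
  have "0 < M"
    using assms by (simp add: M_def)
  then have M: "0 < M" "0 < \<delta>" "\<delta> < M" "2 * \<delta> \<le> \<tau>"
    using assms by (auto simp: \<delta>_def min_def)
  define y where "y = h - of_real (M - \<delta>)"
  have "y \<in> B" "star y = y"
    using assms by (auto simp: y_def star_diff cpos_selfadjoint intro!: diff_in)
  then obtain p n where pn: "p \<in> B" "n \<in> B" "cpos p" "cpos n" "y = p - n" "p * n = 0" "n * p = 0"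
    by (rule pos_neg_parts)
  have sn: "star n = n" "star p = p"
    using pn by (auto simp: cpos_selfadjoint)
  have "p \<noteq> 0"
  proof
    assume "p = 0"
    then have "of_real (M - \<delta>) - h = n"
      using pn(5) by (simp add: y_def algebra_simps)
    then have "norm h \<le> M - \<delta>"
      using pn(4) assms(2) by (intro cpos_norm_le) auto
    with M show False by (simp add: M_def)
  qed
  \<comment> \<open>From y \<le> \<delta> and p y p = p^3 follows p^3 \<le> \<delta> p^2. Passing to
    p^4 = p^3 p allows cancelling (norm p)^3.\<close>
  have np: "norm p \<le> \<delta>"
  proof -
    have "cpos (of_real M - h)"
      using assms by (intro cpos_norm_minus cpos_selfadjoint) (auto simp: M_def)
    then have "cpos (of_real \<delta> - y)"
      by (simp add: y_def)
    from cpos_conj[OF this, of p] have "cpos (\<delta> *\<^sub>R (p * p) - p * p * p)"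
      by (simp add: sn pn algebra_simps of_real_def)
    moreover have "cpos (p * p * p)"
      using cpos_conj[OF pn(3), of p] sn by simp
    ultimately have "norm (p * p * p) \<le> norm (\<delta> *\<^sub>R (p * p))"
      by (intro cpos_norm_mono)
    also have "\<dots> = \<delta> * (norm p)\<^sup>2"
      using M sn by (simp add: norm_selfadjoint_square)
    finally have "norm (p * p * p) * norm p \<le> \<delta> * (norm p)\<^sup>2 * norm p"
      by (intro mult_right_mono) auto
    moreover have "((norm p)\<^sup>2)\<^sup>2 = norm ((p * p) * (p * p))"
      using sn by (simp add: norm_selfadjoint_square star_mult)
    moreover have "norm ((p * p) * (p * p)) \<le> norm (p * p * p) * norm p"
      by (metis mult.assoc norm_mult_ineq)
    ultimately have "norm p * (norm p) ^ 3 \<le> \<delta> * (norm p) ^ 3"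
      by (simp add: power2_eq_square power3_eq_cube mult.assoc)
    then show ?thesis
      using \<open>p \<noteq> 0\<close> by simp
  qed
  \<comment> \<open>The annihilator of the negative part n consists of what lives where h \<ge> M -
    \<delta>. It is hereditary and contains p, hence it contains an infinite projection.\<close>
  define H where "H = {b \<in> B. n * b = 0 \<and> b * n = 0}"
  have "hereditary_subalgebra B H"
    unfolding hereditary_subalgebra_def cstar_subalgebra_def
  proof (intro conjI ballI allI impI)
    have "H = B \<inter> {b. n * b = 0} \<inter> {b. b * n = 0}"
      by (auto simp: H_def)
    moreover have "closed {b. n * b = 0}" "closed {b. b * n = 0}"
      by (intro closed_Collect_eq continuous_intros)+
    ultimately show "closed H"
      by (simp add: closed closed_Int)
    show "star x \<in> H" if "x \<in> H" for x
      using that sn by (auto simp: H_def intro: star_in) (metis star_mult star_zero)+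
    show "x * y \<in> H" if "x \<in> H" "y \<in> H" for x y
      using that by (auto simp: H_def intro: mult_in) (metis mult.assoc mult_zero_left mult_zero_right)+
    show "b \<in> H" if "h \<in> H" "b \<in> B" "positive_in B b \<and> positive_in B (h - b)" for h b
    proof -
      have hB: "h \<in> B" "n * h = 0" using that by (auto simp: H_def)
      have "cpos b" "cpos (h - b)"
        using that hB cpos_iff_star_mult_self diff_in by auto
      then have "cpos (n * b * n)" "cpos (- (n * b * n))"
        using cpos_conj[of b n] cpos_conj[of "h - b" n] sn hB by (auto simp: algebra_simps)
      then have "n * b * n = 0"
        by (intro cpos_antisym)
      obtain c where c: "c \<in> B" "cpos c" "c * c = b"
        using cpos_sqrt[OF \<open>b \<in> B\<close> \<open>cpos b\<close>] by metis
      then have "star (c * n) * (c * n) = n * b * n"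
        using sn by (simp add: star_mult cpos_selfadjoint) (metis mult.assoc)
      then have "c * n = 0"
        using \<open>n * b * n = 0\<close> star_mult_self_eq_0 by metis
      then have "b * n = 0"
        using c by (metis mult.assoc mult_zero_right)
      moreover have "n * b = 0"
        using \<open>b * n = 0\<close> \<open>cpos b\<close> sn by (metis cpos_selfadjoint star_mult star_zero)
      ultimately show ?thesis
        using that by (simp add: H_def)
    qed
  qed (auto simp: H_def algebra_simps scaleC_simps scaleC_zero_right intro: closure_rules)
  moreover have "H \<noteq> {0}"
    using pn \<open>p \<noteq> 0\<close> by (auto simp: H_def)
  ultimately obtain P where P: "P \<in> H" "infinite_projection B P"
    using purely_infinite unfolding purely_infinite_def by blast
  then obtain T :: "nat \<Rightarrow> 'a" where T: "\<And>n. T n \<in> B" "\<And>n. P * T n = T n"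
    "\<And>m n. star (T m) * T n = (if m = n then 1 else 0)"
    using infinite_projection_isometries by metis
  define S where "S = T 0"
  have S: "S \<in> isometries"
    using T by (simp add: S_def isometries_def)
  have "n * S = 0"
    using P(1) T(2)[of 0] unfolding S_def H_def by (metis (mono_tags, lifting) mem_Collect_eq mult.assoc mult_zero_left)
  have "h = p - n + of_real (M - \<delta>)"
    using pn(5) unfolding y_def by (metis diff_add_cancel)
  then have "h * S = (p - n + of_real (M - \<delta>)) * S"
    by simp
  also have "\<dots> = p * S + (M - \<delta>) *\<^sub>R S"
    using \<open>n * S = 0\<close> by (simp add: algebra_simps of_real_def)
  finally have hS: "h * S = p * S + (M - \<delta>) *\<^sub>R S" .
  show thesis
  proof (rule that[OF S])
    have "h * S - M *\<^sub>R S = p * S - \<delta> *\<^sub>R S"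
      by (simp add: hS algebra_simps)
    then have "norm (h * S - M *\<^sub>R S) \<le> norm p * norm S + \<bar>\<delta>\<bar> * norm S"
      using norm_triangle_ineq4[of "p * S" "\<delta> *\<^sub>R S"] norm_mult_ineq[of p S] by simp
    then show "norm (h * S - norm h *\<^sub>R S) \<le> \<tau>"
      using np M isometries_norm[OF S] by (simp add: M_def)
    \<comment> \<open>From x h = 0 follows x p p = -(M - \<delta>) x p. Since p \<ge> 0, this makes
      both (x p)(x p)^* and its negative positive, so x p = 0; on the range of S the element h is p
      + (M - \<delta>).\<close>
    show "x * S = 0" if "x * h = 0" for x
    proof -
      have "x * y = - (M - \<delta>) *\<^sub>R x"
        using that by (simp add: y_def algebra_simps of_real_def)
      then have "x * y * p = - (M - \<delta>) *\<^sub>R (x * p)"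
        by simp
      then have xp: "x * p * p = - ((M - \<delta>) *\<^sub>R (x * p))"
        using pn by (simp add: algebra_simps)
      have "cpos (star (star (x * p)) * p * star (x * p))"
        using pn(3) by (rule cpos_conj)
      then have "cpos (- ((M - \<delta>) *\<^sub>R ((x * p) * star (x * p))))"
        using xp by (simp add: star_star)
      then have "cpos ((1 / (M - \<delta>)) *\<^sub>R (- ((M - \<delta>) *\<^sub>R ((x * p) * star (x * p)))))"
        using M by (intro cpos_scaleR) auto
      then have "cpos (- ((x * p) * star (x * p)))"
        using M by simp
      then have "(x * p) * star (x * p) = 0"
        by (intro cpos_antisym cpos_mult_star_self)
      then have "x * p = 0"
        using cstar_identity'[of "x * p"] by simp
      then have "(M - \<delta>) *\<^sub>R (x * S) = x * h * S"
        using arg_cong[OF hS, of "\<lambda>t. x * t"] by (simp add: algebra_simps)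
          (metis add_0 mult.assoc mult_zero_left)
      then show ?thesis
        using that M by simp
    qed
  qed
qed

end

section \<open>Means of almost periodic functions\<close>

text \<open>Induction with the usual two cases. If every proper nonempty subset has a surplus of
  neighbours, any single pair may be removed; otherwise a tight subset is matched within its
  neighbours and the rest outside of them.\<close>

lemma hall_marriage:
  fixes N :: "'i \<Rightarrow> 'b set"
  assumes "finite A" "\<And>a. a \<in> A \<Longrightarrow> finite (N a)" "\<And>J. J \<subseteq> A \<Longrightarrow> card J \<le> card (\<Union>a\<in>J. N a)"
  shows "\<exists>\<sigma>. inj_on \<sigma> A \<and> (\<forall>a\<in>A. \<sigma> a \<in> N a)"
  using assms
proof (induction "card A" arbitrary: A N rule: less_induct)
  case less
  note fin = less.prems(1,2) and hall = less.prems(3)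
  show ?case
  proof (cases "A = {}")
    case False
    then obtain a where a: "a \<in> A" by blast
    show ?thesis
    proof (cases "\<forall>J. J \<subset> A \<and> J \<noteq> {} \<longrightarrow> card J < card (\<Union>a\<in>J. N a)")
      case True
      have "card {a} \<le> card (\<Union>a\<in>{a}. N a)"
        using a by (intro hall) auto
      then obtain x where x: "x \<in> N a"
        by fastforce
      have "\<exists>\<sigma>. inj_on \<sigma> (A - {a}) \<and> (\<forall>b\<in>A - {a}. \<sigma> b \<in> N b - {x})"
      proof (rule less.hyps)
        show "card (A - {a}) < card A"
          using a fin by (intro psubset_card_mono) auto
        show "card J \<le> card (\<Union>b\<in>J. N b - {x})" if "J \<subseteq> A - {a}" for J
        proof (cases "J = {}")
          case False
          then have "card J < card (\<Union>b\<in>J. N b)"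
            using True that a by blast
          moreover have "(\<Union>b\<in>J. N b - {x}) = (\<Union>b\<in>J. N b) - {x}"
            by auto
          ultimately show ?thesis
            by (auto simp: card_Diff_singleton_if)
        qed simp
      qed (use fin in auto)
      then obtain \<sigma> where \<sigma>: "inj_on \<sigma> (A - {a})" "\<forall>b\<in>A - {a}. \<sigma> b \<in> N b - {x}"
        by blast
      then have "inj_on (\<sigma>(a := x)) A \<and> (\<forall>b\<in>A. (\<sigma>(a := x)) b \<in> N b)"
        using x by (auto simp: inj_on_def)
      then show ?thesis by blast
    next
      case False
      then obtain J where J: "J \<subset> A" "J \<noteq> {}" "card (\<Union>a\<in>J. N a) \<le> card J"
        by (meson not_less)
      have finJ: "finite J" "finite (\<Union>a\<in>J. N a)"
        using J fin finite_subset[of J A] by auto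
      have "\<exists>\<sigma>. inj_on \<sigma> J \<and> (\<forall>a\<in>J. \<sigma> a \<in> N a)"
        using J fin finJ hall by (intro less.hyps psubset_card_mono) auto
      then obtain \<sigma> where \<sigma>: "inj_on \<sigma> J" "\<forall>a\<in>J. \<sigma> a \<in> N a"
        by blast
      have "\<exists>\<tau>. inj_on \<tau> (A - J) \<and> (\<forall>a\<in>A - J. \<tau> a \<in> N a - (\<Union>a\<in>J. N a))"
      proof (rule less.hyps)
        show "card (A - J) < card A"
          using J fin by (intro psubset_card_mono) auto
        show "card K \<le> card (\<Union>a\<in>K. N a - (\<Union>a\<in>J. N a))" if K: "K \<subseteq> A - J" for K
        proof -
          have finK: "finite K" "finite (\<Union>a\<in>K. N a)"
            using K fin finite_subset[of K A] by auto
          have "card K + card J = card (K \<union> J)"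
            using K finK finJ by (intro card_Un_disjoint[symmetric]) auto
          also have "\<dots> \<le> card (\<Union>a\<in>K \<union> J. N a)"
            using K J by (intro hall) auto
          also have "(\<Union>a\<in>K \<union> J. N a) = (\<Union>a\<in>K. N a - (\<Union>a\<in>J. N a)) \<union> (\<Union>a\<in>J. N a)"
            by auto
          also have "card \<dots> \<le> card (\<Union>a\<in>K. N a - (\<Union>a\<in>J. N a)) + card J"
            using J(3) by (intro order.trans[OF card_Un_le]) auto
          finally show ?thesis by simp
        qed
      qed (use fin in auto)
      then obtain \<tau> where \<tau>: "inj_on \<tau> (A - J)" "\<forall>a\<in>A - J. \<tau> a \<in> N a - (\<Union>a\<in>J. N a)"
        by blast
      have "inj_on (\<lambda>a. if a \<in> J then \<sigma> a else \<tau> a) A"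
      proof (rule inj_onI)
        fix a b assume ab: "a \<in> A" "b \<in> A" "(if a \<in> J then \<sigma> a else \<tau> a) = (if b \<in> J then \<sigma> b else \<tau> b)"
        have "\<sigma> c \<noteq> \<tau> d" if "c \<in> J" "d \<in> A - J" for c d
          using that \<sigma> \<tau> by fastforce
        with ab \<sigma>(1) \<tau>(1) show "a = b"
          by (auto split: if_splits dest: inj_onD) (metis DiffI inj_onD)+
      qed
      moreover have "\<forall>a\<in>A. (if a \<in> J then \<sigma> a else \<tau> a) \<in> N a"
        using \<sigma> \<tau> by auto
      ultimately show ?thesis by blast
    qed
  qed simp
qed

text \<open>Lists instead of sets, because products of averaging sets are counted with
  multiplicity.\<close>

definition avg :: "'g list \<Rightarrow> ('g \<Rightarrow> 'b::real_vector) \<Rightarrow> 'b"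
  where "avg N f = (\<Sum>n\<leftarrow>N. f n) /\<^sub>R real (length N)"

lemma avg_add: "avg N (\<lambda>n. f n + g n) = avg N f + avg N g"
  by (simp add: avg_def sum_list_addf scaleR_add_right)

lemma avg_diff: "avg N (\<lambda>n. f n - g n) = avg N f - avg N g"
  by (simp add: avg_def sum_list_subtractf scaleR_diff_right)

lemma avg_const: "N \<noteq> [] \<Longrightarrow> avg N (\<lambda>n. c) = c"
proof -
  assume "N \<noteq> []"
  moreover have "(\<Sum>n\<leftarrow>N. c) = real (length N) *\<^sub>R c"
    by (induction N) (auto simp: scaleR_add_left)
  ultimately show ?thesis
    by (simp add: avg_def)
qed

lemma avg_cong: "(\<And>n. n \<in> set N \<Longrightarrow> f n = g n) \<Longrightarrow> avg N f = avg N g"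
  unfolding avg_def by (simp cong: map_cong)

lemma avg_linear:
  assumes "linear T"
  shows "T (avg N f) = avg N (\<lambda>n. T (f n))"
proof -
  have "T (\<Sum>n\<leftarrow>N. f n) = (\<Sum>n\<leftarrow>N. T (f n))"
    using assms by (induction N) (auto simp: linear_0 linear_add)
  then show ?thesis
    using assms by (simp add: avg_def linear_scale)
qed

lemma norm_avg_le: "norm (avg N f) \<le> avg N (\<lambda>n. norm (f n :: 'b::real_normed_vector))"
proof -
  have "norm (\<Sum>n\<leftarrow>N. f n) \<le> (\<Sum>n\<leftarrow>N. norm (f n))"
    by (induction N) (auto intro: norm_triangle_le)
  then show ?thesis
    by (simp add: avg_def divide_right_mono divide_inverse_commute mult_left_mono)
qed

lemma avg_mono: "(\<And>n. n \<in> set N \<Longrightarrow> f n \<le> g n) \<Longrightarrow> avg N f \<le> (avg N g :: real)"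
  unfolding avg_def by (simp add: sum_list_mono mult_left_mono)

lemma norm_avg_bound:
  assumes "N \<noteq> []" "\<And>n. n \<in> set N \<Longrightarrow> norm (f n :: 'b::real_normed_vector) \<le> c"
  shows "norm (avg N f) \<le> c"
  using order.trans[OF norm_avg_le avg_mono[of N "\<lambda>n. norm (f n)" "\<lambda>_. c"]] assms avg_const[of N c]
  by simp

lemma norm_avg_diff_bound:
  assumes "N \<noteq> []" "\<And>n. n \<in> set N \<Longrightarrow> norm (f n - g n :: 'b::real_normed_vector) \<le> c"
  shows "norm (avg N f - avg N g) \<le> c"
  using norm_avg_bound[of N "\<lambda>n. f n - g n" c] assms by (simp add: avg_diff)

lemma avg_avg:
  "avg N (\<lambda>n. avg M (\<lambda>m. f n m)) = (\<Sum>n\<leftarrow>N. \<Sum>m\<leftarrow>M. f n m) /\<^sub>R (real (length N) * real (length M))"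
  using avg_linear[of "\<lambda>x. x /\<^sub>R real (length M)" N "\<lambda>n. \<Sum>m\<leftarrow>M. f n m", symmetric]
  by (simp add: avg_def linear_iff scaleR_add_right mult.commute)

lemma avg_swap: "avg N (\<lambda>n. avg M (\<lambda>m. f n m)) = avg M (\<lambda>m. avg N (\<lambda>n. f n m))"
proof -
  have "(\<Sum>n\<leftarrow>N. \<Sum>m\<leftarrow>M. f n m) = (\<Sum>m\<leftarrow>M. \<Sum>n\<leftarrow>N. f n m)"
    by (induction N) (simp_all add: sum_list_addf)
  then show ?thesis
    by (simp add: avg_avg mult.commute)
qed

lemma avg_in_convex:
  assumes "convex S" "N \<noteq> []" "\<And>n. n \<in> set N \<Longrightarrow> f n \<in> S"
  shows "avg N f \<in> S"
proof -
  have "avg N f = (\<Sum>i<length N. (1 / real (length N)) *\<^sub>R f (N ! i))"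
    by (simp add: avg_def sum_list_sum_nth atLeast0LessThan scaleR_sum_right inverse_eq_divide)
  also have "\<dots> \<in> S"
    using assms by (intro convex_sum) auto
  finally show ?thesis .
qed

section \<open>Almost periodic functions on a group\<close>

context group
begin

definition close_translates :: "('a \<Rightarrow> 'c::real_normed_vector) \<Rightarrow> real \<Rightarrow> 'a \<Rightarrow> 'a \<Rightarrow> bool"
  where "close_translates F \<epsilon> g h \<longleftrightarrow>
    (\<forall>a\<in>carrier G. \<forall>b\<in>carrier G. norm (F (a \<otimes> g \<otimes> b) - F (a \<otimes> h \<otimes> b)) \<le> \<epsilon>)"

text \<open>Total boundedness of the group in the pseudometric that compares all two-sided
  translates of F. The supremum over both sides makes this pseudometric invariant under left and
  right translation, which the matching of nets needs.\<close>

definition almost_periodic :: "('a \<Rightarrow> 'c::real_normed_vector) \<Rightarrow> bool"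
  where "almost_periodic F \<longleftrightarrow> (\<forall>\<epsilon>>0. \<exists>\<C>. finite \<C> \<and> carrier G \<subseteq> \<Union>\<C> \<and>
    (\<forall>C\<in>\<C>. \<forall>g\<in>C \<inter> carrier G. \<forall>h\<in>C \<inter> carrier G. close_translates F \<epsilon> g h))"

lemma close_translates_mult:
  assumes "close_translates F \<epsilon> g h" "g \<in> carrier G" "h \<in> carrier G" "x \<in> carrier G" "y \<in> carrier G"
  shows "close_translates F \<epsilon> (x \<otimes> g \<otimes> y) (x \<otimes> h \<otimes> y)"
  unfolding close_translates_def
proof (intro ballI)
  fix a b assume "a \<in> carrier G" "b \<in> carrier G"
  then have "norm (F ((a \<otimes> x) \<otimes> g \<otimes> (y \<otimes> b)) - F ((a \<otimes> x) \<otimes> h \<otimes> (y \<otimes> b))) \<le> \<epsilon>"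
    using assms unfolding close_translates_def by (meson m_closed)
  then show "norm (F (a \<otimes> (x \<otimes> g \<otimes> y) \<otimes> b) - F (a \<otimes> (x \<otimes> h \<otimes> y) \<otimes> b)) \<le> \<epsilon>"
    using assms \<open>a \<in> _\<close> \<open>b \<in> _\<close> by (simp add: m_assoc)
qed

lemma almost_periodic_Lipschitz2:
  assumes "almost_periodic F1" "almost_periodic F2" "0 \<le> K"
    and F: "\<And>g h. g \<in> carrier G \<Longrightarrow> h \<in> carrier G \<Longrightarrow>
      norm (F g - F h) \<le> K * (norm (F1 g - F1 h) + norm (F2 g - F2 h))"
  shows "almost_periodic F"
  unfolding almost_periodic_def
proof (intro allI impI)
  fix \<epsilon> :: real assume "0 < \<epsilon>"
  define \<delta> where "\<delta> = \<epsilon> / (2 * (K + 1))"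
  have "0 < \<delta>"
    using \<open>0 < \<epsilon>\<close> \<open>0 \<le> K\<close> by (simp add: \<delta>_def)
  have \<delta>: "K * (\<delta> + \<delta>) \<le> \<epsilon>"
  proof -
    have "2 * \<delta> * (K + 1) = \<epsilon>"
      using \<open>0 \<le> K\<close> by (simp add: \<delta>_def field_simps)
    then show ?thesis
      using \<open>0 < \<delta>\<close> by (simp add: algebra_simps)
  qed
  obtain \<C>1 where C1: "finite \<C>1" "carrier G \<subseteq> \<Union>\<C>1"
    "\<And>C g h. C \<in> \<C>1 \<Longrightarrow> g \<in> C \<inter> carrier G \<Longrightarrow> h \<in> C \<inter> carrier G \<Longrightarrow> close_translates F1 \<delta> g h"
    using assms(1) \<open>0 < \<delta>\<close> unfolding almost_periodic_def by meson
  obtain \<C>2 where C2: "finite \<C>2" "carrier G \<subseteq> \<Union>\<C>2"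
    "\<And>C g h. C \<in> \<C>2 \<Longrightarrow> g \<in> C \<inter> carrier G \<Longrightarrow> h \<in> C \<inter> carrier G \<Longrightarrow> close_translates F2 \<delta> g h"
    using assms(2) \<open>0 < \<delta>\<close> unfolding almost_periodic_def by meson
  show "\<exists>\<C>. finite \<C> \<and> carrier G \<subseteq> \<Union>\<C> \<and>
    (\<forall>C\<in>\<C>. \<forall>g\<in>C \<inter> carrier G. \<forall>h\<in>C \<inter> carrier G. close_translates F \<epsilon> g h)"
  proof (intro exI[of _ "(\<lambda>(C, D). C \<inter> D) ` (\<C>1 \<times> \<C>2)"] conjI ballI)
    show "carrier G \<subseteq> \<Union> ((\<lambda>(C, D). C \<inter> D) ` (\<C>1 \<times> \<C>2))"
      using C1(2) C2(2) by fastforce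
    fix C g h assume "C \<in> (\<lambda>(C, D). C \<inter> D) ` (\<C>1 \<times> \<C>2)" and gh: "g \<in> C \<inter> carrier G" "h \<in> C \<inter> carrier G"
    then have close: "close_translates F1 \<delta> g h" "close_translates F2 \<delta> g h"
      using C1(3) C2(3) by auto
    show "close_translates F \<epsilon> g h"
      unfolding close_translates_def
    proof (intro ballI)
      fix a b assume ab: "a \<in> carrier G" "b \<in> carrier G"
      have "norm (F (a \<otimes> g \<otimes> b) - F (a \<otimes> h \<otimes> b)) \<le> K * (norm (F1 (a \<otimes> g \<otimes> b) - F1 (a \<otimes> h \<otimes> b))
        + norm (F2 (a \<otimes> g \<otimes> b) - F2 (a \<otimes> h \<otimes> b)))"
        using ab gh by (intro F) auto
      also have "\<dots> \<le> K * (\<delta> + \<delta>)"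
        using close ab \<open>0 \<le> K\<close> unfolding close_translates_def by (intro mult_left_mono add_mono) auto
      finally show "norm (F (a \<otimes> g \<otimes> b) - F (a \<otimes> h \<otimes> b)) \<le> \<epsilon>"
        using \<delta> by simp
    qed
  qed (use C1 C2 in auto)
qed

lemma almost_periodic_Lipschitz:
  assumes "almost_periodic F1" "0 \<le> K"
    and "\<And>g h. g \<in> carrier G \<Longrightarrow> h \<in> carrier G \<Longrightarrow> norm (F g - F h) \<le> K * norm (F1 g - F1 h)"
  shows "almost_periodic F"
proof (rule almost_periodic_Lipschitz2[OF assms(1,1,2)])
  fix g h assume gh: "g \<in> carrier G" "h \<in> carrier G"
  have "0 \<le> K * norm (F1 g - F1 h)"
    using assms(2) by simp
  with assms(3)[OF gh] show "norm (F g - F h) \<le> K * (norm (F1 g - F1 h) + norm (F1 g - F1 h))"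
    by (simp add: distrib_left)
qed

lemma almost_periodic_bilinear:
  assumes "bounded_bilinear pr" "almost_periodic F1" "almost_periodic F2"
    and "\<And>g. g \<in> carrier G \<Longrightarrow> norm (F1 g) \<le> C" "\<And>g. g \<in> carrier G \<Longrightarrow> norm (F2 g) \<le> C"
  shows "almost_periodic (\<lambda>g. pr (F1 g) (F2 g))"
proof -
  interpret bounded_bilinear pr by fact
  obtain K where K: "0 \<le> K" "\<And>a b. norm (pr a b) \<le> norm a * norm b * K"
    using nonneg_bounded by blast
  have "0 \<le> C"
    using assms(4)[OF one_closed] norm_ge_zero[of "F1 \<one>"] by linarith
  show ?thesis
  proof (rule almost_periodic_Lipschitz2[OF assms(2,3)])
    show "0 \<le> K * C" using K \<open>0 \<le> C\<close> by simp
    fix g h assume gh: "g \<in> carrier G" "h \<in> carrier G"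
    have "pr (F1 g) (F2 g) - pr (F1 h) (F2 h) = pr (F1 g - F1 h) (F2 g) + pr (F1 h) (F2 g - F2 h)"
      by (simp add: diff_left diff_right)
    then have "norm (pr (F1 g) (F2 g) - pr (F1 h) (F2 h))
      \<le> norm (F1 g - F1 h) * norm (F2 g) * K + norm (F1 h) * norm (F2 g - F2 h) * K"
      using norm_triangle_le[OF add_mono[OF K(2) K(2)]] by simp
    also have "\<dots> \<le> norm (F1 g - F1 h) * C * K + C * norm (F2 g - F2 h) * K"
      using assms(4,5) gh K by (intro add_mono mult_right_mono mult_left_mono) auto
    finally show "norm (pr (F1 g) (F2 g) - pr (F1 h) (F2 h))
      \<le> K * C * (norm (F1 g - F1 h) + norm (F2 g - F2 h))"
      by (simp add: algebra_simps)
  qed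
qed

text \<open>
  Two \<open>\<epsilon>\<close>-nets of minimal cardinality are matched up to \<open>2\<epsilon>\<close> by Hall's theorem, so the average
  over such a net is almost invariant under translations.
\<close>

lemma almost_invariant_average:
  assumes F: "almost_periodic F" and "0 < \<epsilon>"
  obtains N where "N \<noteq> []" "set N \<subseteq> carrier G"
    "\<And>a b. a \<in> carrier G \<Longrightarrow> b \<in> carrier G \<Longrightarrow> norm (avg N (\<lambda>n. F (a \<otimes> n \<otimes> b)) - avg N F) \<le> \<epsilon>"
proof -
  define \<delta> where "\<delta> = \<epsilon> / 2"
  have \<delta>: "0 < \<delta>" "\<epsilon> = \<delta> + \<delta>" using \<open>0 < \<epsilon>\<close> by (auto simp: \<delta>_def)
  define net where "net M \<longleftrightarrow> finite M \<and> M \<subseteq> carrier G \<and>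
    (\<forall>g\<in>carrier G. \<exists>m\<in>M. close_translates F \<delta> g m)" for M
  obtain \<C> where C: "finite \<C>" "carrier G \<subseteq> \<Union>\<C>"
    "\<And>C g h. C \<in> \<C> \<Longrightarrow> g \<in> C \<inter> carrier G \<Longrightarrow> h \<in> C \<inter> carrier G \<Longrightarrow> close_translates F \<delta> g h"
    using F \<open>0 < \<delta>\<close> unfolding almost_periodic_def by meson
  define pick where "pick C = (SOME g. g \<in> C \<inter> carrier G)" for C
  have pick: "pick C \<in> C \<inter> carrier G" if "g \<in> C" "g \<in> carrier G" for g C
    unfolding pick_def by (rule someI[of _ g]) (use that in auto)
  have "net (pick ` {C \<in> \<C>. C \<inter> carrier G \<noteq> {}})"
    unfolding net_def
  proof (intro conjI ballI)
    show "pick ` {C \<in> \<C>. C \<inter> carrier G \<noteq> {}} \<subseteq> carrier G"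
      using pick by blast
    fix g assume g: "g \<in> carrier G"
    then obtain D where D: "D \<in> \<C>" "g \<in> D" using C by blast
    then have "close_translates F \<delta> g (pick D)"
      using pick[of g D] g by (intro C(3)[of D]) auto
    then show "\<exists>m\<in>pick ` {C \<in> \<C>. C \<inter> carrier G \<noteq> {}}. close_translates F \<delta> g m"
      using D g by blast
  qed (use C in auto)
  then have "\<exists>M. net M" by blast
  then obtain M where M: "net M" and min: "\<And>M'. net M' \<Longrightarrow> card M \<le> card M'"
    using ex_has_least_nat[of net _ card] by metis
  have finM: "finite M" "M \<subseteq> carrier G"
    using M by (auto simp: net_def)
  obtain N where N: "set N = M" "distinct N"
    using finite_distinct_list[OF finM(1)] by blast
  have "M \<noteq> {}"
    using M one_closed by (auto simp: net_def)
  have avg_N: "avg N f = (\<Sum>m\<in>M. f m) /\<^sub>R real (card M)" for f :: "'a \<Rightarrow> 'c"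
    using N distinct_card[OF N(2)] by (simp add: avg_def sum_list_distinct_conv_sum_set)
  show thesis
  proof (rule that[of N])
    show "N \<noteq> []" "set N \<subseteq> carrier G"
      using N \<open>M \<noteq> {}\<close> finM by auto
    fix a b assume ab: "a \<in> carrier G" "b \<in> carrier G"
    define t where "t m = a \<otimes> m \<otimes> b" for m
    have t_inj: "inj_on t (carrier G)"
      using ab by (auto simp: inj_on_def t_def)
    \<comment> \<open>A point of the translated net is a neighbour of m if some g is \<delta>-close
      to both. Matched points thus differ by at most 2 \<delta> = \<epsilon>.\<close>
    define nb where "nb m = {m' \<in> t ` M. \<exists>g\<in>carrier G. close_translates F \<delta> g m \<and> close_translates F \<delta> g m'}" for m
    have tM: "\<exists>m\<in>t ` M. close_translates F \<delta> g m" if "g \<in> carrier G" for g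
    proof -
      have "inv a \<otimes> g \<otimes> inv b \<in> carrier G"
        using ab that by simp
      then obtain m where m: "m \<in> M" "close_translates F \<delta> (inv a \<otimes> g \<otimes> inv b) m"
        using M unfolding net_def by blast
      have "close_translates F \<delta> (a \<otimes> (inv a \<otimes> g \<otimes> inv b) \<otimes> b) (a \<otimes> m \<otimes> b)"
        using m finM ab that by (intro close_translates_mult) auto
      moreover have "a \<otimes> (inv a \<otimes> g \<otimes> inv b) \<otimes> b = g"
        using ab that by (simp add: m_assoc) (simp flip: m_assoc)
      ultimately show ?thesis
        using m by (auto simp: t_def)
    qed
    have "card J \<le> card (\<Union>m\<in>J. nb m)" if J: "J \<subseteq> M" for J
    proof -
      have finJ: "finite J"
        using J finM(1) by (rule finite_subset)
      moreover have "finite (nb m)" for m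
        using finM by (auto simp: nb_def)
      ultimately have "finite (\<Union>m\<in>J. nb m)"
        by blast
      note finJ = finJ this
      \<comment> \<open>A g served by a point of J is also served by some point of the translated
        net, which is then a neighbour of it. So J may be exchanged for its neighbours, and
        minimality of M becomes Hall's condition.\<close>
      have "net ((M - J) \<union> (\<Union>m\<in>J. nb m))"
        unfolding net_def
      proof (intro conjI ballI)
        show "(M - J) \<union> (\<Union>m\<in>J. nb m) \<subseteq> carrier G"
          using finM ab by (auto simp: nb_def t_def)
        fix g assume g: "g \<in> carrier G"
        obtain m where m: "m \<in> M" "close_translates F \<delta> g m"
          using M g unfolding net_def by blast
        obtain m' where m': "m' \<in> t ` M" "close_translates F \<delta> g m'"
          using tM[OF g] by blast
        show "\<exists>m\<in>(M - J) \<union> (\<Union>m\<in>J. nb m). close_translates F \<delta> g m"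
        proof (cases "m \<in> J")
          case True
          then have "m' \<in> (\<Union>m\<in>J. nb m)"
            using m m' g by (auto simp: nb_def)
          then show ?thesis using m' by blast
        qed (use m in blast)
      qed (use finM finJ in auto)
      then have "card M \<le> card ((M - J) \<union> (\<Union>m\<in>J. nb m))"
        by (rule min)
      also have "\<dots> \<le> card (M - J) + card (\<Union>m\<in>J. nb m)"
        by (rule card_Un_le)
      also have "card (M - J) = card M - card J"
        using J finJ by (intro card_Diff_subset) auto
      finally show ?thesis
        using card_mono[OF finM(1) J] by linarith
    qed
    moreover have "finite (nb m)" for m
      using finM by (auto simp: nb_def)
    ultimately obtain \<sigma> where \<sigma>: "inj_on \<sigma> M" "\<And>m. m \<in> M \<Longrightarrow> \<sigma> m \<in> nb m"
      using hall_marriage[of M nb] finM(1) by metis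
    have "\<sigma> ` M \<subseteq> t ` M"
      using \<sigma> by (auto simp: nb_def)
    moreover have "card (\<sigma> ` M) = card (t ` M)"
      using \<sigma>(1) inj_on_subset[OF t_inj finM(2)] by (simp add: card_image)
    ultimately have "\<sigma> ` M = t ` M"
      using finM by (intro card_subset_eq) auto
    then have "(\<Sum>m\<in>M. F (t m)) = (\<Sum>m\<in>M. F (\<sigma> m))"
      using \<sigma>(1) inj_on_subset[OF t_inj finM(2)]
      by (metis sum.reindex_cong)
    moreover have "norm (F (\<sigma> m) - F m) \<le> \<epsilon>" if m: "m \<in> M" for m
    proof -
      obtain g where g: "g \<in> carrier G" "close_translates F \<delta> g m" "close_translates F \<delta> g (\<sigma> m)"
        using \<sigma>(2)[OF m] by (auto simp: nb_def)
      have "\<sigma> m \<in> t ` M"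
        using \<open>\<sigma> ` M = t ` M\<close> m by blast
      then have "\<sigma> m \<in> carrier G"
        using finM ab by (auto simp: t_def)
      then have "norm (F g - F m) \<le> \<delta>" "norm (F g - F (\<sigma> m)) \<le> \<delta>"
        using g m finM unfolding close_translates_def by (metis one_closed l_one r_one subsetD)+
      then have "norm ((F g - F m) - (F g - F (\<sigma> m))) \<le> \<delta> + \<delta>"
        by (intro norm_triangle_le_diff) auto
      then show ?thesis using \<delta> by simp
    qed
    then have "norm (avg N (\<lambda>m. F (\<sigma> m)) - avg N F) \<le> \<epsilon>"
      using N \<open>M \<noteq> {}\<close> by (intro norm_avg_diff_bound) auto
    ultimately show "norm (avg N (\<lambda>n. F (a \<otimes> n \<otimes> b)) - avg N F) \<le> \<epsilon>"
      by (simp add: avg_N t_def)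
  qed
qed

section \<open>Mean values and their calculus\<close>

definition averages :: "'a list \<Rightarrow> ('a \<Rightarrow> 'c::real_normed_vector) \<Rightarrow> 'c \<Rightarrow> real \<Rightarrow> bool"
  where "averages N F c \<epsilon> \<longleftrightarrow> N \<noteq> [] \<and> set N \<subseteq> carrier G \<and>
    (\<forall>a\<in>carrier G. \<forall>b\<in>carrier G. norm (avg N (\<lambda>n. F (a \<otimes> n \<otimes> b)) - c) \<le> \<epsilon>)"

definition is_mean :: "('a \<Rightarrow> 'c::real_normed_vector) \<Rightarrow> 'c \<Rightarrow> bool"
  where "is_mean F c \<longleftrightarrow> (\<forall>\<epsilon>>0. \<exists>N. averages N F c \<epsilon>)"

lemma is_meanD: "is_mean F c \<Longrightarrow> 0 < \<epsilon> \<Longrightarrow> \<exists>N. averages N F c \<epsilon>"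
  by (simp add: is_mean_def)

definition mult_lists :: "'a list \<Rightarrow> 'a list \<Rightarrow> 'a list"
  where "mult_lists M N = concat (map (\<lambda>m. map (\<lambda>n. m \<otimes> n) N) M)"

lemma avg_mult_lists: "avg (mult_lists M N) f = avg M (\<lambda>m. avg N (\<lambda>n. f (m \<otimes> n)))"
proof -
  have "(\<Sum>k\<leftarrow>mult_lists M N. f k) = (\<Sum>m\<leftarrow>M. \<Sum>n\<leftarrow>N. f (m \<otimes> n))"
    unfolding mult_lists_def by (induction M) (simp_all add: o_def)
  moreover have "length (mult_lists M N) = length M * length N"
    unfolding mult_lists_def by (induction M) simp_all
  moreover have "(\<Sum>m\<leftarrow>M. (\<Sum>n\<leftarrow>N. f (m \<otimes> n)) /\<^sub>R real (length N))
    = (\<Sum>m\<leftarrow>M. \<Sum>n\<leftarrow>N. f (m \<otimes> n)) /\<^sub>R real (length N)"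
    by (induction M) (simp_all add: scaleR_add_right)
  ultimately show ?thesis
    by (simp add: avg_def mult.commute)
qed

lemma averages_mult_lists:
  assumes "averages N F c \<epsilon>" "M \<noteq> []" "set M \<subseteq> carrier G"
  shows "averages (mult_lists M N) F c \<epsilon>" "averages (mult_lists N M) F c \<epsilon>"
proof -
  have N: "N \<noteq> []" "set N \<subseteq> carrier G"
    "\<And>a b. a \<in> carrier G \<Longrightarrow> b \<in> carrier G \<Longrightarrow> norm (avg N (\<lambda>n. F (a \<otimes> n \<otimes> b)) - c) \<le> \<epsilon>"
    using assms by (auto simp: averages_def)
  have ne: "mult_lists M N \<noteq> []" "mult_lists N M \<noteq> []"
    "set (mult_lists M N) \<subseteq> carrier G" "set (mult_lists N M) \<subseteq> carrier G"
    using N assms(2,3) by (auto simp: mult_lists_def neq_Nil_conv)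
  have "norm (avg (mult_lists M N) (\<lambda>n. F (a \<otimes> n \<otimes> b)) - c) \<le> \<epsilon>"
    if ab: "a \<in> carrier G" "b \<in> carrier G" for a b
  proof -
    have "avg (mult_lists M N) (\<lambda>n. F (a \<otimes> n \<otimes> b)) = avg M (\<lambda>m. avg N (\<lambda>n. F ((a \<otimes> m) \<otimes> n \<otimes> b)))"
      unfolding avg_mult_lists using ab assms(3) N(2)
      by (intro avg_cong arg_cong[of _ _ F]) (auto simp: m_assoc subset_iff)
    also have "norm (\<dots> - avg M (\<lambda>_. c)) \<le> \<epsilon>"
      using ab assms(2,3) by (intro norm_avg_diff_bound N(3)) auto
    finally show ?thesis
      using assms(2) by (simp add: avg_const)
  qed
  then show "averages (mult_lists M N) F c \<epsilon>"
    using ne by (simp add: averages_def)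
  have "norm (avg (mult_lists N M) (\<lambda>n. F (a \<otimes> n \<otimes> b)) - c) \<le> \<epsilon>"
    if ab: "a \<in> carrier G" "b \<in> carrier G" for a b
  proof -
    have "avg (mult_lists N M) (\<lambda>n. F (a \<otimes> n \<otimes> b)) = avg N (\<lambda>n. avg M (\<lambda>m. F (a \<otimes> n \<otimes> (m \<otimes> b))))"
      unfolding avg_mult_lists using ab assms(3) N(2)
      by (intro avg_cong arg_cong[of _ _ F]) (auto simp: m_assoc subset_iff)
    also have "\<dots> = avg M (\<lambda>m. avg N (\<lambda>n. F (a \<otimes> n \<otimes> (m \<otimes> b))))"
      by (rule avg_swap)
    also have "norm (\<dots> - avg M (\<lambda>_. c)) \<le> \<epsilon>"
      using ab assms(2,3) by (intro norm_avg_diff_bound N(3)) auto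
    finally show ?thesis
      using assms(2) by (simp add: avg_const)
  qed
  then show "averages (mult_lists N M) F c \<epsilon>"
    using ne by (simp add: averages_def)
qed

text \<open>Because \<open>averages\<close> bounds all two-sided translates, multiplying the list on
  either side by another list preserves the estimate. So one product list is good for both
  functions; uniqueness and additivity of means rest on this.\<close>

lemma averages_common2:
  assumes "averages N F c \<epsilon>" "averages M F' c' \<epsilon>'"
  shows "averages (mult_lists M N) F c \<epsilon>" "averages (mult_lists M N) F' c' \<epsilon>'"
proof -
  have "N \<noteq> []" "set N \<subseteq> carrier G" "M \<noteq> []" "set M \<subseteq> carrier G"
    using assms by (auto simp: averages_def)
  with assms averages_mult_lists
  show "averages (mult_lists M N) F c \<epsilon>" "averages (mult_lists M N) F' c' \<epsilon>'"
    by blast+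
qed

lemma is_mean_common2:
  assumes "is_mean F c" "is_mean F' c'" "0 < \<epsilon>"
  obtains N where "averages N F c \<epsilon>" "averages N F' c' \<epsilon>"
  using assms averages_common2 unfolding is_mean_def by meson

lemma averages_at:
  assumes "averages N F c \<epsilon>"
  shows "norm (avg N F - c) \<le> \<epsilon>"
proof -
  have "norm (avg N (\<lambda>n. F (\<one> \<otimes> n \<otimes> \<one>)) - c) \<le> \<epsilon>"
    using assms by (auto simp: averages_def)
  moreover have "avg N (\<lambda>n. F (\<one> \<otimes> n \<otimes> \<one>)) = avg N F"
    using assms by (intro avg_cong) (auto simp: averages_def subset_iff)
  ultimately show ?thesis by simp
qed

lemma is_mean_unique:
  assumes "is_mean F c" "is_mean F c'"
  shows "c = c'"
proof (rule ccontr)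
  assume "c \<noteq> c'"
  define \<epsilon> where "\<epsilon> = norm (c - c') / 3"
  have "0 < \<epsilon>" using \<open>c \<noteq> c'\<close> by (simp add: \<epsilon>_def)
  then obtain N where "averages N F c \<epsilon>" "averages N F c' \<epsilon>"
    using is_mean_common2[OF assms] by blast
  then have "norm ((avg N F - c') - (avg N F - c)) \<le> \<epsilon> + \<epsilon>"
    by (intro norm_triangle_le_diff add_mono averages_at)
  then show False
    using \<open>0 < \<epsilon>\<close> by (simp add: \<epsilon>_def)
qed

text \<open>The product of two averaging lists is close to both of their averages. Hence averages
  taken with accuracies tending to 0 form a Cauchy sequence.\<close>

lemma almost_periodic_imp_is_mean:
  fixes F :: "'a \<Rightarrow> 'c::banach"
  assumes "almost_periodic F"
  obtains c where "is_mean F c"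
proof -
  define e where "e n = 1 / real (Suc n)" for n
  have e: "0 < e n" for n by (simp add: e_def)
  have "\<exists>N. averages N F (avg N F) (e n)" for n
    using almost_invariant_average[OF assms e[of n]] unfolding averages_def by metis
  then obtain N where N: "\<And>n. averages (N n) F (avg (N n) F) (e n)"
    by metis
  define c where "c n = avg (N n) F" for n
  have cc: "norm (c m - c n) \<le> e m + e n" for m n
  proof -
    have "averages (mult_lists (N m) (N n)) F (c n) (e n)" "averages (mult_lists (N m) (N n)) F (c m) (e m)"
      using averages_common2[OF N[of n] N[of m]] by (auto simp: c_def)
    then have "norm ((avg (mult_lists (N m) (N n)) F - c n) - (avg (mult_lists (N m) (N n)) F - c m)) \<le> e n + e m"
      by (intro norm_triangle_le_diff add_mono averages_at)
    then show ?thesis by (simp add: add.commute)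
  qed
  have elim: "e \<longlonglongrightarrow> 0"
    unfolding e_def by (rule LIMSEQ_Suc[OF lim_1_over_n])
  have "Cauchy c"
  proof (rule metric_CauchyI)
    fix \<delta> :: real assume "0 < \<delta>"
    then have "\<forall>\<^sub>F n in sequentially. e n < \<delta>/2"
      using elim by (intro order_tendstoD) auto
    then obtain M where "\<And>n. M \<le> n \<Longrightarrow> e n < \<delta>/2"
      by (auto simp: eventually_sequentially)
    then show "\<exists>M. \<forall>m\<ge>M. \<forall>n\<ge>M. dist (c m) (c n) < \<delta>"
      unfolding dist_norm using cc by (intro exI[of _ M]) (smt (verit) field_sum_of_halves)
  qed
  then obtain l where l: "c \<longlonglongrightarrow> l"
    by (auto simp: Cauchy_convergent_iff convergent_def)
  have "is_mean F l"
    unfolding is_mean_def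
  proof (intro allI impI)
    fix \<epsilon> :: real assume "0 < \<epsilon>"
    then have "\<forall>\<^sub>F n in sequentially. e n < \<epsilon>/2" "\<forall>\<^sub>F n in sequentially. dist (c n) l < \<epsilon>/2"
      by (intro order_tendstoD(2)[OF elim] tendstoD[OF l], simp)+
    then have "\<forall>\<^sub>F n in sequentially. e n < \<epsilon>/2 \<and> dist (c n) l < \<epsilon>/2"
      by (rule eventually_conj)
    then obtain n where n: "e n < \<epsilon>/2" "dist (c n) l < \<epsilon>/2"
      by (auto simp: eventually_sequentially)
    have "norm (avg (N n) (\<lambda>k. F (a \<otimes> k \<otimes> b)) - l) \<le> \<epsilon>" if "a \<in> carrier G" "b \<in> carrier G" for a b
    proof -
      have "norm (avg (N n) (\<lambda>k. F (a \<otimes> k \<otimes> b)) - c n) \<le> e n"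
        using N[of n] that by (auto simp: averages_def c_def)
      then show ?thesis
        using n norm_triangle_ineq[of "avg (N n) (\<lambda>k. F (a \<otimes> k \<otimes> b)) - c n" "c n - l"]
        by (simp add: dist_norm)
    qed
    then show "\<exists>N. averages N F l \<epsilon>"
      using N[of n] by (auto simp: averages_def)
  qed
  then show thesis by (rule that)
qed

lemma is_mean_cong:
  assumes "is_mean F c" "\<And>g. g \<in> carrier G \<Longrightarrow> F g = F' g"
  shows "is_mean F' c"
proof -
  have "avg N (\<lambda>n. F (a \<otimes> n \<otimes> b)) = avg N (\<lambda>n. F' (a \<otimes> n \<otimes> b))"
    if "set N \<subseteq> carrier G" "a \<in> carrier G" "b \<in> carrier G" for N a b
    using that assms(2) by (intro avg_cong) auto
  then show ?thesis
    using assms(1) unfolding is_mean_def averages_def by metis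
qed

lemma is_mean_const: "is_mean (\<lambda>_. c) c"
  unfolding is_mean_def averages_def by (auto simp: avg_const intro!: exI[of _ "[\<one>]"])

lemma is_mean_linear:
  assumes "is_mean F c" "bounded_linear T"
  shows "is_mean (\<lambda>g. T (F g)) (T c)"
  unfolding is_mean_def
proof (intro allI impI)
  fix \<epsilon> :: real assume "0 < \<epsilon>"
  interpret T: bounded_linear T by fact
  obtain K where K: "0 < K" "\<And>x. norm (T x) \<le> norm x * K"
    using T.pos_bounded by blast
  obtain N where N: "averages N F c (\<epsilon> / K)"
    using is_meanD[OF assms(1), of "\<epsilon> / K"] \<open>0 < \<epsilon>\<close> K(1) by auto
  have "norm (avg N (\<lambda>n. T (F (a \<otimes> n \<otimes> b))) - T c) \<le> \<epsilon>" if "a \<in> carrier G" "b \<in> carrier G" for a b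
  proof -
    have "avg N (\<lambda>n. T (F (a \<otimes> n \<otimes> b))) - T c = T (avg N (\<lambda>n. F (a \<otimes> n \<otimes> b)) - c)"
      using avg_linear[OF T.linear_axioms, of N "\<lambda>n. F (a \<otimes> n \<otimes> b)"] by (simp add: T.diff)
    also have "norm \<dots> \<le> \<epsilon> / K * K"
      using N that K by (intro order.trans[OF K(2)] mult_right_mono) (auto simp: averages_def)
    finally show ?thesis using K by simp
  qed
  then show "\<exists>N. averages N (\<lambda>g. T (F g)) (T c) \<epsilon>"
    using N by (auto simp: averages_def)
qed

lemma is_mean_add:
  assumes "is_mean F c" "is_mean F' c'"
  shows "is_mean (\<lambda>g. F g + F' g) (c + c')"
  unfolding is_mean_def
proof (intro allI impI)
  fix \<epsilon> :: real assume "0 < \<epsilon>"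
  then obtain N where N: "averages N F c (\<epsilon>/2)" "averages N F' c' (\<epsilon>/2)"
    using is_mean_common2[OF assms, of "\<epsilon>/2"] by auto
  have "norm (avg N (\<lambda>n. F (a \<otimes> n \<otimes> b) + F' (a \<otimes> n \<otimes> b)) - (c + c')) \<le> \<epsilon>"
    if "a \<in> carrier G" "b \<in> carrier G" for a b
  proof -
    have "norm (avg N (\<lambda>n. F (a \<otimes> n \<otimes> b)) - c) \<le> \<epsilon>/2" "norm (avg N (\<lambda>n. F' (a \<otimes> n \<otimes> b)) - c') \<le> \<epsilon>/2"
      using N that by (auto simp: averages_def)
    then have "norm ((avg N (\<lambda>n. F (a \<otimes> n \<otimes> b)) - c) + (avg N (\<lambda>n. F' (a \<otimes> n \<otimes> b)) - c')) \<le> \<epsilon>/2 + \<epsilon>/2"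
      by (intro norm_triangle_le add_mono)
    then show ?thesis by (simp add: avg_add algebra_simps)
  qed
  then show "\<exists>N. averages N (\<lambda>g. F g + F' g) (c + c') \<epsilon>"
    using N by (auto simp: averages_def)
qed

lemma is_mean_sum:
  "(\<And>i. i \<in> I \<Longrightarrow> is_mean (F i) (c i)) \<Longrightarrow> is_mean (\<lambda>g. \<Sum>i\<in>I. F i g) (\<Sum>i\<in>I. c i)"
  by (induction I rule: infinite_finite_induct) (auto intro: is_mean_const is_mean_add)

lemma is_mean_diff:
  assumes "is_mean F c" "is_mean F' c'"
  shows "is_mean (\<lambda>g. F g - F' g) (c - c')"
  using is_mean_add[OF assms(1) is_mean_linear[OF assms(2) bounded_linear_minus[OF bounded_linear_ident]]]
  by simp

lemma is_mean_translate:
  assumes "is_mean F c" "x \<in> carrier G" "y \<in> carrier G"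
  shows "is_mean (\<lambda>g. F (x \<otimes> g \<otimes> y)) c"
proof -
  have "averages N (\<lambda>g. F (x \<otimes> g \<otimes> y)) c \<epsilon>" if "averages N F c \<epsilon>" for N \<epsilon>
    unfolding averages_def
  proof (intro conjI ballI)
    fix a b assume ab: "a \<in> carrier G" "b \<in> carrier G"
    then have "norm (avg N (\<lambda>n. F ((x \<otimes> a) \<otimes> n \<otimes> (b \<otimes> y))) - c) \<le> \<epsilon>"
      using that assms by (auto simp: averages_def)
    moreover have "avg N (\<lambda>n. F ((x \<otimes> a) \<otimes> n \<otimes> (b \<otimes> y))) = avg N (\<lambda>n. F (x \<otimes> (a \<otimes> n \<otimes> b) \<otimes> y))"
      using that assms ab by (intro avg_cong arg_cong[of _ _ F]) (auto simp: averages_def m_assoc subset_iff)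
    ultimately show "norm (avg N (\<lambda>n. F (x \<otimes> (a \<otimes> n \<otimes> b) \<otimes> y)) - c) \<le> \<epsilon>"
      by simp
  qed (use that in \<open>auto simp: averages_def\<close>)
  then show ?thesis
    using assms(1) unfolding is_mean_def by blast
qed

text \<open>Inversion exchanges left and right translates, and \<open>averages\<close> treats both
  alike.\<close>

lemma is_mean_inverse:
  assumes "is_mean F c"
  shows "is_mean (\<lambda>g. F (inv g)) c"
proof -
  have "averages (map (\<lambda>g. inv g) N) (\<lambda>g. F (inv g)) c \<epsilon>" if "averages N F c \<epsilon>" for N \<epsilon>
    unfolding averages_def
  proof (intro conjI ballI)
    fix a b assume ab: "a \<in> carrier G" "b \<in> carrier G"
    then have "norm (avg N (\<lambda>n. F (inv b \<otimes> n \<otimes> inv a)) - c) \<le> \<epsilon>"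
      using that by (auto simp: averages_def)
    moreover have "avg N (\<lambda>n. F (inv b \<otimes> n \<otimes> inv a)) = avg N (\<lambda>n. F (inv (a \<otimes> inv n \<otimes> b)))"
      using that ab by (intro avg_cong arg_cong[of _ _ F]) (auto simp: averages_def m_assoc subset_iff inv_mult_group)
    moreover have "avg (map (\<lambda>g. inv g) N) (\<lambda>n. F (inv (a \<otimes> n \<otimes> b))) = avg N (\<lambda>n. F (inv (a \<otimes> inv n \<otimes> b)))"
      by (simp add: avg_def o_def)
    ultimately show "norm (avg (map (\<lambda>g. inv g) N) (\<lambda>n. F (inv (a \<otimes> n \<otimes> b))) - c) \<le> \<epsilon>"
      by simp
  qed (use that in \<open>auto simp: averages_def\<close>)
  then show ?thesis
    using assms unfolding is_mean_def by blast
qed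

lemma is_mean_in_closed_convex:
  assumes "is_mean F c" "closed S" "convex S" "\<And>g. g \<in> carrier G \<Longrightarrow> F g \<in> S"
  shows "c \<in> S"
proof -
  have "c \<in> closure S"
    unfolding closure_approachable
  proof (intro allI impI)
    fix e :: real assume "0 < e"
    then obtain N where N: "averages N F c (e/2)"
      using is_meanD[OF assms(1), of "e/2"] by auto
    then have "avg N F \<in> S"
      using assms by (intro avg_in_convex) (auto simp: averages_def)
    moreover have "dist (avg N F) c < e"
      using averages_at[OF N] \<open>0 < e\<close> by (simp add: dist_norm)
    ultimately show "\<exists>y\<in>S. dist y c < e" by blast
  qed
  with assms show ?thesis by simp
qed

lemma is_mean_norm_le:
  assumes "is_mean F c" "is_mean \<phi> m" "\<And>g. g \<in> carrier G \<Longrightarrow> norm (F g) \<le> \<phi> g"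
  shows "norm c \<le> m"
proof (rule field_le_epsilon)
  fix e :: real assume "0 < e"
  then obtain N where N: "averages N F c (e/2)" "averages N \<phi> m (e/2)"
    using is_mean_common2[OF assms(1,2), of "e/2"] by auto
  have "norm c \<le> norm (avg N F) + e/2"
    using averages_at[OF N(1)] norm_triangle_ineq2[of c "avg N F"] by (simp add: norm_minus_commute)
  also have "norm (avg N F) \<le> avg N \<phi>"
    using N(1) assms(3) by (intro order.trans[OF norm_avg_le] avg_mono) (auto simp: averages_def)
  also have "avg N \<phi> \<le> m + e/2"
    using averages_at[OF N(2)] unfolding real_norm_def by linarith
  finally show "norm c \<le> m + e" by simp
qed

lemma is_mean_nonneg: "is_mean \<phi> (m::real) \<Longrightarrow> (\<And>g. g \<in> carrier G \<Longrightarrow> 0 \<le> \<phi> g) \<Longrightarrow> 0 \<le> m"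
  by (rule is_mean_in_closed_convex[of \<phi> m "{0..}", simplified])

lemma is_mean_mono:
  "is_mean \<phi> m \<Longrightarrow> is_mean \<psi> n \<Longrightarrow> (\<And>g. g \<in> carrier G \<Longrightarrow> \<phi> g \<le> \<psi> g) \<Longrightarrow> m \<le> (n::real)"
  using is_mean_nonneg[OF is_mean_diff[of \<psi> n \<phi> m]] by simp

lemma almost_periodic_net:
  assumes "almost_periodic F" "0 < \<delta>"
  obtains N where "finite N" "N \<subseteq> carrier G" "\<And>g. g \<in> carrier G \<Longrightarrow> \<exists>h\<in>N. norm (F g - F h) \<le> \<delta>"
proof -
  obtain \<C> where C: "finite \<C>" "carrier G \<subseteq> \<Union>\<C>"
    "\<And>C g h. C \<in> \<C> \<Longrightarrow> g \<in> C \<inter> carrier G \<Longrightarrow> h \<in> C \<inter> carrier G \<Longrightarrow> close_translates F \<delta> g h"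
    using assms unfolding almost_periodic_def by meson
  define pick where "pick C = (SOME g. g \<in> C \<inter> carrier G)" for C
  have pick: "pick C \<in> C \<inter> carrier G" if "C \<inter> carrier G \<noteq> {}" for C
    unfolding pick_def using that someI_ex[of "\<lambda>g. g \<in> C \<inter> carrier G"] by blast
  show thesis
  proof (rule that[of "pick ` {C \<in> \<C>. C \<inter> carrier G \<noteq> {}}"])
    show "pick ` {C \<in> \<C>. C \<inter> carrier G \<noteq> {}} \<subseteq> carrier G"
      using pick by blast
    fix g assume g: "g \<in> carrier G"
    then obtain D where D: "D \<in> \<C>" "g \<in> D" using C(2) by blast
    then have "close_translates F \<delta> g (pick D)"
      using g pick[of D] by (intro C(3)[of D]) auto
    then have "norm (F (\<one> \<otimes> g \<otimes> \<one>) - F (\<one> \<otimes> pick D \<otimes> \<one>)) \<le> \<delta>"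
      unfolding close_translates_def by blast
    then have "norm (F g - F (pick D)) \<le> \<delta>"
      using g pick[of D] D by (metis IntE IntI empty_iff l_one r_one)
    then show "\<exists>h\<in>pick ` {C \<in> \<C>. C \<inter> carrier G \<noteq> {}}. norm (F g - F h) \<le> \<delta>"
      using D g by blast
  qed (use C in auto)
qed

lemma almost_periodic_translate:
  assumes "almost_periodic F" "x \<in> carrier G"
  shows "almost_periodic (\<lambda>g. F (x \<otimes> g))"
  unfolding almost_periodic_def
proof (intro allI impI)
  fix \<epsilon> :: real assume "0 < \<epsilon>"
  have "close_translates (\<lambda>g. F (x \<otimes> g)) \<epsilon> g h" if "close_translates F \<epsilon> g h" "g \<in> carrier G" "h \<in> carrier G" for g h
    unfolding close_translates_def
  proof (intro ballI)
    fix a b assume ab: "a \<in> carrier G" "b \<in> carrier G"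
    then have "norm (F ((x \<otimes> a) \<otimes> g \<otimes> b) - F ((x \<otimes> a) \<otimes> h \<otimes> b)) \<le> \<epsilon>"
      using that assms(2) unfolding close_translates_def by (meson m_closed)
    then show "norm (F (x \<otimes> (a \<otimes> g \<otimes> b)) - F (x \<otimes> (a \<otimes> h \<otimes> b))) \<le> \<epsilon>"
      using that ab assms(2) by (simp add: m_assoc)
  qed
  then show "\<exists>\<C>. finite \<C> \<and> carrier G \<subseteq> \<Union>\<C> \<and>
    (\<forall>C\<in>\<C>. \<forall>g\<in>C \<inter> carrier G. \<forall>h\<in>C \<inter> carrier G. close_translates (\<lambda>g. F (x \<otimes> g)) \<epsilon> g h)"
    using assms(1) \<open>0 < \<epsilon>\<close> unfolding almost_periodic_def by (metis IntE)
qed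

text \<open>Finitely many translates of \<open>\<phi>\<close> have a sum bounded below.\<close>

lemma is_mean_pos:
  assumes \<phi>: "is_mean \<phi> (m::real)" "almost_periodic \<phi>" "\<And>g. g \<in> carrier G \<Longrightarrow> 0 \<le> \<phi> g" "0 < \<phi> \<one>"
  shows "0 < m"
proof -
  obtain \<C> where C: "finite \<C>" "carrier G \<subseteq> \<Union>\<C>"
    "\<And>C g h. C \<in> \<C> \<Longrightarrow> g \<in> C \<inter> carrier G \<Longrightarrow> h \<in> C \<inter> carrier G \<Longrightarrow> close_translates \<phi> (\<phi> \<one> / 2) g h"
    using \<phi>(2,4) unfolding almost_periodic_def by (meson half_gt_zero)
  define pick where "pick C = (SOME g. g \<in> C \<inter> carrier G)" for C
  have pick: "pick C \<in> C \<inter> carrier G" if "C \<inter> carrier G \<noteq> {}" for C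
    unfolding pick_def using that someI_ex[of "\<lambda>g. g \<in> C \<inter> carrier G"] by blast
  define \<D> where "\<D> = {C \<in> \<C>. C \<inter> carrier G \<noteq> {}}"
  have "finite \<D>" using C by (simp add: \<D>_def)
  have mean: "is_mean (\<lambda>g. \<Sum>C\<in>\<D>. \<phi> (inv (pick C) \<otimes> g)) (\<Sum>C\<in>\<D>. m)"
  proof (rule is_mean_sum)
    fix C assume "C \<in> \<D>"
    then have p: "inv (pick C) \<in> carrier G"
      using pick[of C] by (simp add: \<D>_def)
    then have "is_mean (\<lambda>g. \<phi> (inv (pick C) \<otimes> g \<otimes> \<one>)) m"
      by (intro is_mean_translate[OF \<phi>(1)]) auto
    then show "is_mean (\<lambda>g. \<phi> (inv (pick C) \<otimes> g)) m"
      by (rule is_mean_cong) (use p in simp)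
  qed
  have "\<phi> \<one> / 2 \<le> (\<Sum>C\<in>\<D>. \<phi> (inv (pick C) \<otimes> g))" if g: "g \<in> carrier G" for g
  proof -
    obtain C where C': "C \<in> \<C>" "g \<in> C" using C(2) g by blast
    then have p: "C \<in> \<D>" "pick C \<in> C \<inter> carrier G"
      using g pick[of C] by (auto simp: \<D>_def)
    then have "close_translates \<phi> (\<phi> \<one> / 2) g (pick C)"
      using C' g by (intro C(3)) auto
    then have "norm (\<phi> (inv (pick C) \<otimes> g \<otimes> \<one>) - \<phi> (inv (pick C) \<otimes> pick C \<otimes> \<one>)) \<le> \<phi> \<one> / 2"
      unfolding close_translates_def using p by (meson inv_closed one_closed IntE)
    then have "\<bar>\<phi> (inv (pick C) \<otimes> g) - \<phi> \<one>\<bar> \<le> \<phi> \<one> / 2"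
      using p g by simp
    then have "\<phi> \<one> / 2 \<le> \<phi> (inv (pick C) \<otimes> g)"
      unfolding abs_le_iff by linarith
    also have "\<dots> \<le> (\<Sum>C\<in>\<D>. \<phi> (inv (pick C) \<otimes> g))"
      using p \<open>finite \<D>\<close> g pick by (intro member_le_sum \<phi>(3)) (auto simp: \<D>_def)
    finally show ?thesis .
  qed
  then have "\<phi> \<one> / 2 \<le> (\<Sum>C\<in>\<D>. m)"
    by (rule is_mean_mono[OF is_mean_const mean])
  then show ?thesis
    using \<phi>(4) mult_nonneg_nonpos[of "real (card \<D>)" m] unfolding sum_constant by linarith
qed

end

section \<open>The conditional expectation of a compact group action\<close>

text \<open>The topology of the group is represented by norm compactness of the orbits, from which
  almost periodicity of the orbit maps follows.\<close>

locale cstar_action = group G for G :: "('g, 'm) monoid_scheme" (structure) +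
  fixes \<alpha> :: "'g \<Rightarrow> 'a::unital_cstar_algebra \<Rightarrow> 'a"
  assumes act_mult: "g \<in> carrier G \<Longrightarrow> h \<in> carrier G \<Longrightarrow> \<alpha> (g \<otimes> h) x = \<alpha> g (\<alpha> h x)"
    and act_one_group [simp]: "\<alpha> \<one> x = x"
    and act_add: "g \<in> carrier G \<Longrightarrow> \<alpha> g (x + y) = \<alpha> g x + \<alpha> g y"
    and act_scaleC: "g \<in> carrier G \<Longrightarrow> \<alpha> g (c *\<^sub>C x) = c *\<^sub>C \<alpha> g x"
    and act_times: "g \<in> carrier G \<Longrightarrow> \<alpha> g (x * y) = \<alpha> g x * \<alpha> g y"
    and act_star: "g \<in> carrier G \<Longrightarrow> \<alpha> g (star x) = star (\<alpha> g x)"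
    and compact_orbit: "compact ((\<lambda>g. \<alpha> g x) ` carrier G)"
begin

lemma act_inv: "g \<in> carrier G \<Longrightarrow> \<alpha> g (\<alpha> (inv g) x) = x" "g \<in> carrier G \<Longrightarrow> \<alpha> (inv g) (\<alpha> g x) = x"
  by (simp_all flip: act_mult)

lemma act_zero: "g \<in> carrier G \<Longrightarrow> \<alpha> g 0 = 0"
  using act_scaleC[of g 0 0] by simp

lemma act_scaleR: "g \<in> carrier G \<Longrightarrow> \<alpha> g (r *\<^sub>R x) = r *\<^sub>R \<alpha> g x"
  by (metis act_scaleC scaleC_of_real)

lemma act_minus: "g \<in> carrier G \<Longrightarrow> \<alpha> g (- x) = - \<alpha> g x"
  using act_scaleR[of g "-1" x] by simp

lemma act_diff: "g \<in> carrier G \<Longrightarrow> \<alpha> g (x - y) = \<alpha> g x - \<alpha> g y"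
  using act_add[of g x "- y"] by (simp add: act_minus)

lemma act_one: "g \<in> carrier G \<Longrightarrow> \<alpha> g 1 = 1"
  by (metis act_inv(1) act_times mult.left_neutral mult.right_neutral)

lemma act_of_real: "g \<in> carrier G \<Longrightarrow> \<alpha> g (of_real r) = of_real r"
  by (simp add: of_real_def act_scaleR act_one)

lemma act_sum: "g \<in> carrier G \<Longrightarrow> \<alpha> g (sum f I) = (\<Sum>i\<in>I. \<alpha> g (f i))"
  by (induction I rule: infinite_finite_induct) (simp_all add: act_zero act_add)

lemmas act_simps = act_zero act_scaleR act_minus act_diff act_one act_of_real act_sum
  act_add act_scaleC act_times act_star

text \<open>The argument is algebraic: (norm x)^2 - x^*x equals some y^*y, and this form is
  preserved by the action.\<close>

lemma norm_act_le: 
  assumes "g \<in> carrier G"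
  shows "norm (\<alpha> g x) \<le> norm x"
proof -
  have "cpos (of_real ((norm x)\<^sup>2) - star x * x)"
    by (intro cpos_norm_minus) (simp_all add: star_simps cstar_identity)
  then obtain y where "of_real ((norm x)\<^sup>2) - star x * x = star y * y"
    using unital_subalgebra.cpos_iff_star_mult_self[OF unital_subalgebra_UNIV] by (auto simp: positive_in_def)
  then have "\<alpha> g (of_real ((norm x)\<^sup>2) - star x * x) = \<alpha> g (star y * y)"
    by simp
  then have "of_real ((norm x)\<^sup>2) - star (\<alpha> g x) * \<alpha> g x = star (\<alpha> g y) * \<alpha> g y"
    using assms by (simp add: act_simps del: of_real_power)
  then have "cpos (of_real ((norm x)\<^sup>2) - star (\<alpha> g x) * \<alpha> g x)"
    by (simp only: cpos_star_mult_self)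
  then have "norm (star (\<alpha> g x) * \<alpha> g x) \<le> (norm x)\<^sup>2"
    by (intro cpos_norm_le cpos_star_mult_self)
  then show ?thesis
    by (simp add: cstar_identity)
qed

lemma norm_act [simp]: "g \<in> carrier G \<Longrightarrow> norm (\<alpha> g x) = norm x"
  using norm_act_le[of g x] norm_act_le[of "inv g" "\<alpha> g x"] by (simp add: act_inv)

lemma bounded_linear_act: "g \<in> carrier G \<Longrightarrow> bounded_linear (\<alpha> g)"
  by (rule bounded_linear_intro[of _ 1]) (simp_all add: act_simps)

lemma cpos_act: "g \<in> carrier G \<Longrightarrow> cpos x \<Longrightarrow> cpos (\<alpha> g x)"
  using unital_subalgebra.cpos_iff_star_mult_self[OF unital_subalgebra_UNIV, of x]
  by (auto simp: positive_in_def act_simps intro: cpos_star_mult_self)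

text \<open>The estimate must hold for all right translates b, that is, at all points of the orbit
  of x. A finite \<delta>-net of the orbit reduces this to finitely many vectors z, and g is sorted
  by the net point near \<alpha>_g(z) for each z. The errors are \<delta> + 2 \<delta> +
  \<delta>.\<close>

lemma almost_periodic_orbit: "almost_periodic (\<lambda>g. \<alpha> g x)"
  unfolding almost_periodic_def
proof (intro allI impI)
  fix \<epsilon> :: real assume "0 < \<epsilon>"
  define \<delta> where "\<delta> = \<epsilon> / 4"
  have \<delta>: "0 < \<delta>" "\<epsilon> = 4 * \<delta>" using \<open>0 < \<epsilon>\<close> by (auto simp: \<delta>_def)
  have tb: "\<exists>K. finite K \<and> (\<lambda>g. \<alpha> g z) ` carrier G \<subseteq> (\<Union>k\<in>K. ball k \<delta>)" for z
    using compact_orbit[of z] \<delta>(1) unfolding compact_eq_totally_bounded by blast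
  then obtain K where K: "\<And>z. finite (K z)" "\<And>z. (\<lambda>g. \<alpha> g z) ` carrier G \<subseteq> (\<Union>k\<in>K z. ball k \<delta>)"
    by metis
  define part where "part f = {g. \<forall>z\<in>K x. \<alpha> g z \<in> ball (f z) \<delta>}" for f
  show "\<exists>\<C>. finite \<C> \<and> carrier G \<subseteq> \<Union>\<C> \<and>
    (\<forall>C\<in>\<C>. \<forall>g\<in>C \<inter> carrier G. \<forall>h\<in>C \<inter> carrier G. close_translates (\<lambda>g. \<alpha> g x) \<epsilon> g h)"
  proof (intro exI[of _ "part ` (PiE (K x) K)"] conjI ballI subsetI)
    show "finite (part ` (PiE (K x) K))"
      using K(1) by (intro finite_imageI finite_PiE) auto
    fix g assume g: "g \<in> carrier G"
    then have "\<exists>k. k \<in> K z \<and> \<alpha> g z \<in> ball k \<delta>" for z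
      using K(2)[of z] by blast
    then obtain f where "\<And>z. f z \<in> K z \<and> \<alpha> g z \<in> ball (f z) \<delta>"
      by metis
    then show "g \<in> \<Union> (part ` (PiE (K x) K))"
      by (auto simp: part_def intro!: bexI[of _ "restrict f (K x)"])
  next
    fix C g h assume C: "C \<in> part ` (PiE (K x) K)" and gh: "g \<in> C \<inter> carrier G" "h \<in> C \<inter> carrier G"
    then obtain f where f: "C = part f" by blast
    have close: "norm (\<alpha> g z - \<alpha> h z) \<le> 2 * \<delta>" if "z \<in> K x" for z
    proof -
      have "dist (f z) (\<alpha> g z) < \<delta>" "dist (f z) (\<alpha> h z) < \<delta>"
        using gh that unfolding f part_def by auto
      then show ?thesis
        using dist_triangle2[of "\<alpha> g z" "\<alpha> h z" "f z"] by (simp add: dist_norm norm_minus_commute)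
    qed
    show "close_translates (\<lambda>g. \<alpha> g x) \<epsilon> g h"
      unfolding close_translates_def
    proof (intro ballI)
      fix a b assume ab: "a \<in> carrier G" "b \<in> carrier G"
      obtain z where z: "z \<in> K x" "dist z (\<alpha> b x) < \<delta>"
        using K(2)[of x] ab by force
      have gz: "norm (\<alpha> g (\<alpha> b x) - \<alpha> g z) \<le> \<delta>" "norm (\<alpha> h z - \<alpha> h (\<alpha> b x)) \<le> \<delta>"
        using z gh by (simp_all flip: act_diff add: dist_norm norm_minus_commute)
      have "\<alpha> (a \<otimes> g \<otimes> b) x - \<alpha> (a \<otimes> h \<otimes> b) x = \<alpha> a (\<alpha> g (\<alpha> b x) - \<alpha> h (\<alpha> b x))"
        using ab gh by (simp add: act_mult act_diff)
      also have "norm \<dots> = norm ((\<alpha> g (\<alpha> b x) - \<alpha> g z) + (\<alpha> g z - \<alpha> h z) + (\<alpha> h z - \<alpha> h (\<alpha> b x)))"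
        using ab by simp
      also have "\<dots> \<le> \<delta> + 2 * \<delta> + \<delta>"
        using gz close[OF z(1)] by (intro norm_triangle_le add_mono)
      finally show "norm (\<alpha> (a \<otimes> g \<otimes> b) x - \<alpha> (a \<otimes> h \<otimes> b) x) \<le> \<epsilon>"
        using \<delta> by simp
    qed
  qed
qed

lemma almost_periodic_norm_orbit: "almost_periodic (\<lambda>g. norm (\<alpha> g x - x))"
proof (rule almost_periodic_Lipschitz[OF almost_periodic_orbit[of x], of 1])
  fix g h
  show "norm (norm (\<alpha> g x - x) - norm (\<alpha> h x - x)) \<le> 1 * norm (\<alpha> g x - \<alpha> h x)"
    using norm_triangle_ineq3[of "\<alpha> g x - x" "\<alpha> h x - x"] by simp
qed simp

text \<open>A bump function on the elements that move x by less than \<eta>. It is Lipschitz in the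
  orbit of x, hence almost periodic, and it has positive mean since its value at the neutral element
  is 1.\<close>

definition near_one :: "'a \<Rightarrow> real \<Rightarrow> 'g \<Rightarrow> real"
  where "near_one x \<eta> g = max 0 (1 - norm (\<alpha> g x - x) / \<eta>)"

lemma near_one_bounds: "0 \<le> near_one x \<eta> g" "0 < \<eta> \<Longrightarrow> near_one x \<eta> g \<le> 1"
  by (auto simp: near_one_def)

lemma near_one_neutral: "near_one x \<eta> \<one> = 1"
  by (simp add: near_one_def)

lemma near_one_eq_0: "0 < \<eta> \<Longrightarrow> \<eta> \<le> norm (\<alpha> g x - x) \<Longrightarrow> near_one x \<eta> g = 0"
  by (simp add: near_one_def)

lemma almost_periodic_near_one:
  assumes "0 < \<eta>"
  shows "almost_periodic (near_one x \<eta>)"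
proof (rule almost_periodic_Lipschitz[OF almost_periodic_norm_orbit[of x], of "1/\<eta>"])
  fix g h
  have "\<bar>max 0 (1 - s) - max 0 (1 - t)\<bar> \<le> \<bar>s - t\<bar>" for s t :: real
    by linarith
  from this[of "norm (\<alpha> g x - x) / \<eta>" "norm (\<alpha> h x - x) / \<eta>"]
  show "norm (near_one x \<eta> g - near_one x \<eta> h) \<le> 1/\<eta> * norm (norm (\<alpha> g x - x) - norm (\<alpha> h x - x))"
    using assms by (simp add: near_one_def flip: diff_divide_distrib)
qed (use assms in simp)

lemma near_one_mean:
  assumes "0 < \<eta>"
  obtains \<mu> where "is_mean (near_one x \<eta>) \<mu>" "0 < \<mu>" "\<mu> \<le> 1"
proof -
  obtain \<mu> where \<mu>: "is_mean (near_one x \<eta>) \<mu>"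
    using almost_periodic_imp_is_mean[OF almost_periodic_near_one[OF assms]] .
  have "0 < \<mu>"
    by (rule is_mean_pos[OF \<mu> almost_periodic_near_one[OF assms]])
      (simp_all add: near_one_bounds near_one_neutral)
  moreover have "\<mu> \<le> 1"
    using is_mean_mono[OF \<mu> is_mean_const[of 1]] assms by (simp add: near_one_bounds)
  ultimately show thesis
    using \<mu> that by blast
qed

section \<open>The fixed point algebra and averaging over orbits\<close>

abbreviation B :: "'a set"
  where "B \<equiv> fixed_point_algebra G \<alpha>"

lemma B_iff: "x \<in> B \<longleftrightarrow> (\<forall>g\<in>carrier G. \<alpha> g x = x)"
  by (simp add: fixed_point_algebra_def)

lemma unital_subalgebra_B: "unital_subalgebra B"
proof (rule unital_subalgebraI)
  have "closed {x. \<alpha> g x = x}" if "g \<in> carrier G" for g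
    using bounded_linear.continuous_on[OF bounded_linear_act[OF that] continuous_on_id]
    by (intro closed_Collect_eq continuous_intros) auto
  moreover have "B = (\<Inter>g\<in>carrier G. {x. \<alpha> g x = x})"
    by (auto simp: B_iff)
  ultimately show "closed B" by auto
qed (auto simp: B_iff act_simps)

sublocale B: unital_subalgebra B
  by (rule unital_subalgebra_B)

definition E :: "'a \<Rightarrow> 'a"
  where "E x = (THE c. is_mean (\<lambda>g. \<alpha> g x) c)"

lemma is_mean_E: "is_mean (\<lambda>g. \<alpha> g x) (E x)"
proof -
  obtain c where c: "is_mean (\<lambda>g. \<alpha> g x) c"
    using almost_periodic_imp_is_mean[OF almost_periodic_orbit] by blast
  then have "E x = c"
    unfolding E_def using is_mean_unique by (intro the_equality)
  with c show ?thesis by simp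
qed

lemma E_eqI: "is_mean (\<lambda>g. \<alpha> g x) c \<Longrightarrow> E x = c"
  using is_mean_unique[OF is_mean_E] .

lemma E_in [simp]: "E x \<in> B"
  unfolding B_iff
proof
  fix h assume h: "h \<in> carrier G"
  have "is_mean (\<lambda>g. \<alpha> h (\<alpha> g x)) (\<alpha> h (E x))"
    by (rule is_mean_linear[OF is_mean_E bounded_linear_act[OF h]])
  moreover have "is_mean (\<lambda>g. \<alpha> (h \<otimes> g \<otimes> \<one>) x) (E x)"
    using h by (intro is_mean_translate[OF is_mean_E]) auto
  then have "is_mean (\<lambda>g. \<alpha> h (\<alpha> g x)) (E x)"
    by (rule is_mean_cong) (use h in \<open>simp add: act_mult\<close>)
  ultimately show "\<alpha> h (E x) = E x"
    by (rule is_mean_unique)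
qed

lemma act_E [simp]: "g \<in> carrier G \<Longrightarrow> \<alpha> g (E x) = E x"
  using E_in[of x] unfolding B_iff by blast

lemma E_act:
  assumes "h \<in> carrier G"
  shows "E (\<alpha> h x) = E x"
proof (rule E_eqI)
  have "is_mean (\<lambda>g. \<alpha> (\<one> \<otimes> g \<otimes> h) x) (E x)"
    using assms by (intro is_mean_translate[OF is_mean_E]) auto
  then show "is_mean (\<lambda>g. \<alpha> g (\<alpha> h x)) (E x)"
    by (rule is_mean_cong) (use assms in \<open>simp add: act_mult\<close>)
qed

lemma E_linear:
  assumes "bounded_linear T" "\<And>g y. g \<in> carrier G \<Longrightarrow> \<alpha> g (T y) = T (\<alpha> g y)"
  shows "E (T x) = T (E x)"
  by (rule E_eqI, rule is_mean_cong[OF is_mean_linear[OF is_mean_E assms(1)]]) (simp add: assms(2))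

lemma E_add: "E (x + y) = E x + E y"
  by (rule E_eqI, rule is_mean_cong[OF is_mean_add[OF is_mean_E is_mean_E]]) (simp add: act_add)

lemma E_scaleC: "E (c *\<^sub>C x) = c *\<^sub>C E x"
  by (rule E_linear) (simp_all add: bounded_linear_scaleC act_scaleC)

lemma E_scaleR: "E (r *\<^sub>R x) = r *\<^sub>R E x"
  by (metis E_scaleC scaleC_of_real)

lemma E_minus: "E (- x) = - E x"
  using E_scaleR[of "-1" x] by simp

lemma E_diff: "E (x - y) = E x - E y"
  using E_add[of x "- y"] by (simp add: E_minus)

lemma E_star: "E (star x) = star (E x)"
  by (rule E_linear) (simp_all add: bounded_linear_star act_star)

lemma E_fixed: "b \<in> B \<Longrightarrow> E b = b"
  by (rule E_eqI, rule is_mean_cong[OF is_mean_const]) (simp add: B_iff)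

lemma E_mult_left: "b \<in> B \<Longrightarrow> E (b * x) = b * E x"
  by (rule E_linear) (auto simp: bounded_linear_mult_right act_times B_iff)

lemma E_mult_right: "b \<in> B \<Longrightarrow> E (x * b) = E x * b"
  by (rule E_linear[of "\<lambda>x. x * b"]) (auto simp: bounded_linear_mult_left act_times B_iff)

lemma E_sum: "E (sum f I) = (\<Sum>i\<in>I. E (f i))"
  by (induction I rule: infinite_finite_induct) (simp_all add: E_add E_fixed)

lemma norm_E: "norm (E x) \<le> norm x"
  by (rule is_mean_norm_le[OF is_mean_E is_mean_const]) simp

lemma bounded_linear_E: "bounded_linear E"
  by (rule bounded_linear_intro[of _ 1]) (simp_all add: E_add E_scaleR norm_E)

lemma closed_cpos: "closed {x. cpos x}"
  unfolding closed_sequential_limits by (auto intro: cpos_LIMSEQ)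

lemma convex_cpos: "convex {x. cpos x}"
  by (auto simp: convex_def intro: cpos_add cpos_scaleR)

lemma is_mean_cpos: "is_mean F c \<Longrightarrow> (\<And>g. g \<in> carrier G \<Longrightarrow> cpos (F g)) \<Longrightarrow> cpos c"
  using is_mean_in_closed_convex[OF _ closed_cpos convex_cpos] by blast

lemma cpos_E: "cpos x \<Longrightarrow> cpos (E x)"
  by (rule is_mean_cpos[OF is_mean_E]) (rule cpos_act)

lemma E_mono: "cpos (y - x) \<Longrightarrow> cpos (E y - E x)"
  using cpos_E[of "y - x"] by (simp add: E_diff)

subsection \<open>The norm of the Hilbert module\<close>

text \<open>Measuring a by E(a^*a) instead of a^*a has the advantage that E(a^*a) lies in
  \<open>B\<close>, so that isometries of \<open>B\<close> can be placed where it almost attains its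
  norm.\<close>

definition enorm :: "'a \<Rightarrow> real"
  where "enorm a = sqrt (norm (E (star a * a)))"

lemma enorm_nonneg [simp]: "0 \<le> enorm a"
  by (simp add: enorm_def)

lemma enorm_square: "(enorm a)\<^sup>2 = norm (E (star a * a))"
  by (simp add: enorm_def)

lemma enorm_le_norm: "enorm a \<le> norm a"
  using norm_E[of "star a * a"] by (simp add: enorm_def cstar_identity real_le_lsqrt)

lemma enorm_mult_left: "enorm (x * a) \<le> norm x * enorm a"
proof (rule power2_le_imp_le)
  have "norm (E (star (x * a) * (x * a))) \<le> norm (E ((norm x)\<^sup>2 *\<^sub>R (star a * a)))"
    by (intro cpos_norm_mono cpos_E cpos_star_mult_self E_mono cpos_conj_norm_le)
  then show "(enorm (x * a))\<^sup>2 \<le> (norm x * enorm a)\<^sup>2"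
    by (simp add: enorm_square power_mult_distrib E_scaleR)
qed simp

lemma enorm_mult_right:
  assumes "b \<in> B"
  shows "enorm (a * b) \<le> enorm a * norm b"
proof (rule power2_le_imp_le)
  have "star (a * b) * (a * b) = star b * (star a * a) * b"
    by (simp add: star_mult mult.assoc)
  then have "E (star (a * b) * (a * b)) = star b * E (star a * a) * b"
    by (simp add: E_mult_right[OF assms] E_mult_left[OF B.star_in[OF assms]])
  then have "norm (E (star (a * b) * (a * b))) \<le> norm (star b) * norm (E (star a * a)) * norm b"
    by (simp only:) (intro order.trans[OF norm_mult_ineq] mult_right_mono norm_mult_ineq norm_ge_zero)
  then show "(enorm (a * b))\<^sup>2 \<le> (enorm a * norm b)\<^sup>2"
    by (simp add: enorm_square power_mult_distrib power2_eq_square[of "norm b"] mult_ac)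
qed simp

lemma enorm_scaleC: "enorm (c *\<^sub>C a) = cmod c * enorm a"
proof -
  have "star (c *\<^sub>C a) * (c *\<^sub>C a) = ((cmod c)\<^sup>2) *\<^sub>R (star a * a)"
    by (simp add: star_scaleC scaleC_simps complex_norm_square flip: scaleC_of_real)
      (metis complex_norm_square of_real_power)
  then show ?thesis
    by (simp add: enorm_def E_scaleR real_sqrt_mult)
qed

lemma enorm_minus: "enorm (- a) = enorm a"
  by (simp add: enorm_def star_minus)

text \<open>The mixed terms are bounded by t a^*a + (1/t) b^*b. The choice t = q/p turns the sum
  into (p + q)^2, and the added e/2 keeps p and q positive.\<close>

lemma enorm_triangle: "enorm (a + b) \<le> enorm a + enorm b"
proof (rule field_le_epsilon)
  fix e :: real assume "0 < e"
  define p where "p = enorm a + e/2"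
  define q where "q = enorm b + e/2"
  have pq: "0 < p" "0 < q" "enorm a \<le> p" "enorm b \<le> q"
    using \<open>0 < e\<close> by (auto simp: p_def q_def intro: add_nonneg_pos)
  define t where "t = q / p"
  have t: "0 < t" using pq by (simp add: t_def)
  have "star (sqrt t *\<^sub>R a - (1 / sqrt t) *\<^sub>R b) * (sqrt t *\<^sub>R a - (1 / sqrt t) *\<^sub>R b)
    = ((1 + t) *\<^sub>R (star a * a) + (1 + 1/t) *\<^sub>R (star b * b)) - star (a + b) * (a + b)"
    using t by (simp add: star_simps algebra_simps)
  then have "cpos (((1 + t) *\<^sub>R (star a * a) + (1 + 1/t) *\<^sub>R (star b * b)) - star (a + b) * (a + b))"
    by (metis cpos_star_mult_self)
  then have "norm (E (star (a + b) * (a + b))) \<le> norm (E ((1 + t) *\<^sub>R (star a * a) + (1 + 1/t) *\<^sub>R (star b * b)))"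
    by (intro cpos_norm_mono cpos_E cpos_star_mult_self E_mono)
  also have "\<dots> \<le> norm ((1 + t) *\<^sub>R E (star a * a)) + norm ((1 + 1/t) *\<^sub>R E (star b * b))"
    by (simp add: E_add E_scaleR del: norm_scaleR) (rule norm_triangle_ineq)
  also have "\<dots> = (1 + t) * (enorm a)\<^sup>2 + (1 + 1/t) * (enorm b)\<^sup>2"
    using t by (simp add: enorm_square)
  also have "\<dots> \<le> (1 + t) * p\<^sup>2 + (1 + 1/t) * q\<^sup>2"
    using t pq by (intro add_mono mult_left_mono power_mono) auto
  also have "\<dots> = (p + q)\<^sup>2"
    using pq by (simp add: t_def power2_eq_square field_simps)
  finally have "(enorm (a + b))\<^sup>2 \<le> (p + q)\<^sup>2"
    by (simp add: enorm_square)
  then have "enorm (a + b) \<le> p + q"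
    by (rule power2_le_imp_le) (use pq in simp)
  then show "enorm (a + b) \<le> enorm a + enorm b + e"
    by (simp add: p_def q_def)
qed

lemma enorm_triangle_diff: "enorm (a - b) \<le> enorm a + enorm b"
  using enorm_triangle[of a "- b"] by (simp add: enorm_minus)

subsection \<open>Weighted means\<close>

definition weight :: "('g \<Rightarrow> real) \<Rightarrow> real \<Rightarrow> bool"
  where "weight f \<mu> \<longleftrightarrow> almost_periodic f \<and> is_mean f \<mu> \<and> 0 < \<mu> \<and> (\<forall>g\<in>carrier G. 0 \<le> f g \<and> f g \<le> 1)"

definition wmean :: "('g \<Rightarrow> real) \<Rightarrow> 'a \<Rightarrow> 'a"
  where "wmean f x = (THE c. is_mean (\<lambda>g. f g *\<^sub>R \<alpha> g x) c)"

context
  fixes f \<mu> assumes f: "weight f \<mu>"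
begin

lemma is_mean_wmean: "is_mean (\<lambda>g. f g *\<^sub>R \<alpha> g x) (wmean f x)"
proof -
  have "almost_periodic (\<lambda>g. f g *\<^sub>R \<alpha> g x)"
    by (rule almost_periodic_bilinear[OF bounded_bilinear_scaleR, of _ _ "1 + norm x"])
      (use f almost_periodic_orbit in \<open>auto simp: weight_def add_increasing2\<close>)
  then obtain c where c: "is_mean (\<lambda>g. f g *\<^sub>R \<alpha> g x) c"
    using almost_periodic_imp_is_mean by blast
  then have "wmean f x = c"
    unfolding wmean_def using is_mean_unique by (intro the_equality)
  with c show ?thesis by simp
qed

lemma wmean_eqI: "is_mean (\<lambda>g. f g *\<^sub>R \<alpha> g x) c \<Longrightarrow> wmean f x = c"
  using is_mean_unique[OF is_mean_wmean] .

lemma wmean_add: "wmean f (x + y) = wmean f x + wmean f y"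
  by (rule wmean_eqI, rule is_mean_cong[OF is_mean_add[OF is_mean_wmean is_mean_wmean]])
    (simp add: act_add scaleR_add_right)

lemma wmean_linear:
  assumes "bounded_linear T" "\<And>g y. g \<in> carrier G \<Longrightarrow> \<alpha> g (T y) = T (\<alpha> g y)"
  shows "wmean f (T x) = T (wmean f x)"
proof (rule wmean_eqI)
  interpret T: bounded_linear T by fact
  show "is_mean (\<lambda>g. f g *\<^sub>R \<alpha> g (T x)) (T (wmean f x))"
    by (rule is_mean_cong[OF is_mean_linear[OF is_mean_wmean assms(1)]]) (simp add: assms(2) T.scaleR)
qed

lemma wmean_mult_left: "b \<in> B \<Longrightarrow> wmean f (b * x) = b * wmean f x"
  by (rule wmean_linear) (auto simp: bounded_linear_mult_right act_times B_iff)

lemma wmean_mult_right: "b \<in> B \<Longrightarrow> wmean f (x * b) = wmean f x * b"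
  by (rule wmean_linear[of "\<lambda>x. x * b"]) (auto simp: bounded_linear_mult_left act_times B_iff)

lemma wmean_minus: "wmean f (- x) = - wmean f x"
  by (rule wmean_linear) (auto simp: bounded_linear_minus[OF bounded_linear_ident] act_minus)

lemma wmean_diff: "wmean f (x - y) = wmean f x - wmean f y"
  using wmean_add[of x "- y"] by (simp add: wmean_minus)

lemma E_wmean: "E (wmean f x) = \<mu> *\<^sub>R E x"
proof (rule is_mean_unique)
  show "is_mean (\<lambda>g. E (f g *\<^sub>R \<alpha> g x)) (E (wmean f x))"
    by (rule is_mean_linear[OF is_mean_wmean bounded_linear_E])
  have "is_mean (\<lambda>g. f g *\<^sub>R E x) (\<mu> *\<^sub>R E x)"
    using f by (intro is_mean_linear[OF _ bounded_linear_scaleR_left]) (simp add: weight_def)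
  then show "is_mean (\<lambda>g. E (f g *\<^sub>R \<alpha> g x)) (\<mu> *\<^sub>R E x)"
    by (rule is_mean_cong) (simp add: E_scaleR E_act)
qed

lemma wmean_fixed: "b \<in> B \<Longrightarrow> wmean f b = \<mu> *\<^sub>R b"
  by (rule wmean_eqI, rule is_mean_cong[OF is_mean_linear[OF _ bounded_linear_scaleR_left]])
    (use f in \<open>auto simp: weight_def B_iff\<close>)

text \<open>Positivity of a variance: the weighted mean of |\<alpha>_g(x) - Q|^2 is positive, where
  Q is the normalised weighted mean of x.\<close>

lemma wmean_square_le: "cpos (\<mu> *\<^sub>R wmean f (star x * x) - star (wmean f x) * wmean f x)"
proof -
  define P where "P = wmean f x"
  define Q where "Q = (1/\<mu>) *\<^sub>R P"
  have \<mu>: "0 < \<mu>" using f by (simp add: weight_def)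
  have "is_mean (\<lambda>g. f g *\<^sub>R \<alpha> g (star x * x) - star Q * (f g *\<^sub>R \<alpha> g x) - star (f g *\<^sub>R \<alpha> g x) * Q + f g *\<^sub>R (star Q * Q))
    (wmean f (star x * x) - star Q * P - star P * Q + \<mu> *\<^sub>R (star Q * Q))"
    unfolding P_def using f
    by (intro is_mean_add is_mean_diff is_mean_wmean is_mean_linear[OF is_mean_wmean bounded_linear_mult_right]
        is_mean_linear[OF is_mean_linear[OF is_mean_wmean bounded_linear_star] bounded_linear_mult_left]
        is_mean_linear[OF _ bounded_linear_scaleR_left]) (auto simp: weight_def)
  moreover have "f g *\<^sub>R \<alpha> g (star x * x) - star Q * (f g *\<^sub>R \<alpha> g x) - star (f g *\<^sub>R \<alpha> g x) * Q + f g *\<^sub>R (star Q * Q)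
    = f g *\<^sub>R (star (\<alpha> g x - Q) * (\<alpha> g x - Q))" if "g \<in> carrier G" for g
    using that by (simp add: act_simps star_simps algebra_simps)
  ultimately have "cpos (wmean f (star x * x) - star Q * P - star P * Q + \<mu> *\<^sub>R (star Q * Q))"
    using f by (elim is_mean_cpos) (auto simp: weight_def intro!: cpos_scaleR cpos_star_mult_self)
  also have "wmean f (star x * x) - star Q * P - star P * Q + \<mu> *\<^sub>R (star Q * Q)
    = (1/\<mu>) *\<^sub>R (\<mu> *\<^sub>R wmean f (star x * x) - star P * P)"
    using \<mu> by (simp add: Q_def star_scaleR scaleR_diff_right)
  finally show ?thesis
    using \<mu> cpos_scaleR[of _ \<mu>] by (fastforce simp: P_def)
qed

lemma cpos_wmean: "cpos x \<Longrightarrow> cpos (wmean f x)"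
  using f by (intro is_mean_cpos[OF is_mean_wmean] cpos_scaleR cpos_act) (auto simp: weight_def)

lemma wmean_le_E:
  assumes "cpos x"
  shows "cpos (E x - wmean f x)"
proof -
  have "cpos (\<alpha> g x - f g *\<^sub>R \<alpha> g x)" if "g \<in> carrier G" for g
    using that f cpos_scaleR[of "\<alpha> g x" "1 - f g"] cpos_act[OF that assms]
    by (simp add: weight_def scaleR_diff_left)
  then show ?thesis
    by (rule is_mean_cpos[OF is_mean_diff[OF is_mean_E is_mean_wmean]])
qed

lemma weight_le_1: "\<mu> \<le> 1"
  using f is_mean_mono[OF _ is_mean_const[of 1], of f \<mu>] by (simp add: weight_def)

text \<open>Smoothing along the action turns estimates in the module norm into estimates in the norm
  of the algebra. This rests on P(x)^* P(x) \<le> \<mu> P(x^*x) \<le> E(x^*x) for the weighted mean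
  P.\<close>

lemma norm_wmean_le: "norm (wmean f x) \<le> enorm x"
proof (rule power2_le_imp_le)
  have \<mu>: "0 \<le> \<mu>" "\<mu> \<le> 1" using f weight_le_1 by (auto simp: weight_def)
  have "norm (star (wmean f x) * wmean f x) \<le> norm (\<mu> *\<^sub>R wmean f (star x * x))"
    by (intro cpos_norm_mono cpos_star_mult_self wmean_square_le)
  also have "\<dots> \<le> 1 * norm (wmean f (star x * x))"
    using \<mu> by (simp add: mult_right_mono mult_left_le_one_le)
  also have "\<dots> \<le> norm (E (star x * x))"
    by (simp, intro cpos_norm_mono cpos_wmean wmean_le_E cpos_star_mult_self)
  finally show "(norm (wmean f x))\<^sup>2 \<le> (enorm x)\<^sup>2"
    by (simp add: cstar_identity enorm_square)
qed simp

lemma enorm_wmean_le: "enorm (wmean f x) \<le> \<mu> * enorm x"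
proof (rule power2_le_imp_le)
  have \<mu>: "0 \<le> \<mu>" using f by (auto simp: weight_def)
  have "norm (E (star (wmean f x) * wmean f x)) \<le> norm (E (\<mu> *\<^sub>R wmean f (star x * x)))"
    by (intro cpos_norm_mono cpos_E cpos_star_mult_self E_mono wmean_square_le)
  also have "\<dots> = \<mu>\<^sup>2 * norm (E (star x * x))"
    using \<mu> by (simp add: E_scaleR E_wmean power2_eq_square)
  finally show "(enorm (wmean f x))\<^sup>2 \<le> (\<mu> * enorm x)\<^sup>2"
    by (simp add: enorm_square power_mult_distrib)
  show "0 \<le> \<mu> * enorm x" using \<mu> by simp
qed

end

lemma near_one_weight:
  assumes "0 < \<eta>"
  obtains \<mu> where "weight (near_one x \<eta>) \<mu>"
  using near_one_mean[OF assms, of x] almost_periodic_near_one[OF assms, of x] assms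
  by (auto simp: weight_def near_one_bounds)

text \<open>It is used with y = x: smoothing x with its own bump function yields \<mu> x up to \<mu>
  \<eta>, so x can be recovered after division by \<mu>.\<close>

lemma norm_wmean_near_one_diff_le:
  assumes "weight (near_one x \<eta>) \<mu>" "0 < \<eta>" "0 \<le> \<delta>"
    and "\<And>g. g \<in> carrier G \<Longrightarrow> norm (\<alpha> g x - x) < \<eta> \<Longrightarrow> norm (\<alpha> g y - y) \<le> \<delta>"
  shows "norm (wmean (near_one x \<eta>) y - \<mu> *\<^sub>R y) \<le> \<mu> * \<delta>"
proof (rule is_mean_norm_le)
  show "is_mean (\<lambda>g. near_one x \<eta> g *\<^sub>R \<alpha> g y - near_one x \<eta> g *\<^sub>R y) (wmean (near_one x \<eta>) y - \<mu> *\<^sub>R y)"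
    using assms(1) by (intro is_mean_diff is_mean_wmean is_mean_linear[OF _ bounded_linear_scaleR_left])
      (auto simp: weight_def)
  show "is_mean (\<lambda>g. near_one x \<eta> g * \<delta>) (\<mu> * \<delta>)"
    using assms(1) by (intro is_mean_linear[OF _ bounded_linear_mult_left]) (auto simp: weight_def)
  show "norm (near_one x \<eta> g *\<^sub>R \<alpha> g y - near_one x \<eta> g *\<^sub>R y) \<le> near_one x \<eta> g * \<delta>"
    if "g \<in> carrier G" for g
  proof (cases "norm (\<alpha> g x - x) < \<eta>")
    case True
    then show ?thesis
      using assms(4)[OF that True] near_one_bounds(1)[of x \<eta> g]
      by (simp flip: scaleR_diff_right add: mult_left_mono)
  qed (use assms in \<open>simp add: near_one_eq_0\<close>)
qed

end

section \<open>Compression to scalars by isometries in the fixed point algebra\<close>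

lemma norm_conj_isometry_le:
  assumes "star S * S = (1::'a::unital_cstar_algebra)"
  shows "norm (star S * x * S) \<le> norm x"
proof -
  have "norm (star S * x * S) \<le> norm (star S) * norm x * norm S"
    by (intro order.trans[OF norm_mult_ineq] mult_right_mono norm_mult_ineq norm_ge_zero)
  then show ?thesis
    using norm_isometry[OF assms] by simp
qed

lemma norm_conj_isometry_diff_le:
  assumes "star S * S = (1::'a::unital_cstar_algebra)"
  shows "norm (star S * x * S - c *\<^sub>C 1) \<le> norm (x - c *\<^sub>C 1)"
  using norm_conj_isometry_le[OF assms, of "x - c *\<^sub>C 1"] assms
  by (simp add: algebra_simps scaleC_simps)

lemma of_real_eq_scaleC: "of_real r = complex_of_real r *\<^sub>C (1::'a::unital_cstar_algebra)"
  by (metis of_real_def scaleC_of_real)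

lemma norm_conj_isometry_diff_le_real:
  assumes "star S * S = (1::'a::unital_cstar_algebra)"
  shows "norm (star S * x * S - of_real r) \<le> norm (x - of_real r)"
  using norm_conj_isometry_diff_le[OF assms, of x "complex_of_real r"]
  by (simp only: of_real_eq_scaleC[where 'a='a])

lemma norm_scaleC_one [simp]: "norm (c *\<^sub>C (1::'a::unital_cstar_algebra)) = cmod c"
  by (simp add: norm_scaleC)

lemma scaleC_one_cancel [simp]: "c *\<^sub>C (1::'a::unital_cstar_algebra) = d *\<^sub>C 1 \<longleftrightarrow> c = d"
  using norm_scaleC_one[of "c - d", where 'a='a] by (auto simp: scaleC_diff_left)

lemma cartesian_decomposition:
  fixes x :: "'a::unital_cstar_algebra"
  defines "a \<equiv> (1/2) *\<^sub>R (x + star x)" and "b \<equiv> (- \<i> / 2) *\<^sub>C (x - star x)"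
  shows "star a = a" "star b = b" "x = a + \<i> *\<^sub>C b"
  unfolding a_def b_def
  by (simp_all add: star_simps add.commute scaleC_simps scaleC_of_real[of "1/2", simplified]
      flip: scaleC_minus_right scaleC_minus_left scaleR_add_right)
    (simp add: scaleC_diff_right scaleC_minus_left)

locale kirchberg_action = cstar_action G \<alpha>
  for G :: "('g, 'm) monoid_scheme" (structure) and \<alpha> :: "'g \<Rightarrow> 'a::unital_cstar_algebra \<Rightarrow> 'a" +
  assumes simple_B: "simple_cstar B"
    and purely_infinite_B: "purely_infinite B"
    and nuclear_B: "nuclear_cstar B"
    and minimal: "relative_commutant B = range (\<lambda>c. c *\<^sub>C 1)"
    and separable: "\<exists>D :: 'a set. countable D \<and> closure D = UNIV"
begin

sublocale B: pi_subalgebra B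
  by unfold_locales (rule simple_B purely_infinite_B)+

abbreviation isom :: "'a set"
  where "isom \<equiv> B.isometries"

text \<open>
  Suppose that no compression of \<open>a\<close> has a much smaller norm than \<open>a\<close>. Choose \<open>S\<close> below \<open>p\<close> so
  that \<open>\<kappa> = \<parallel>(1 - p) a p\<parallel>\<^sup>2\<close> is almost attained on the range of \<open>S\<close>, and compress further such that
  \<open>S\<^sup>*aS\<close> almost attains its norm. Then \<open>SS\<^sup>* a\<close> and \<open>(1 - p) a\<close> together exceed the norm of
  \<open>a\<close>, unless \<open>\<kappa>\<close> is small.
\<close>

lemma off_diagonal_small:
  assumes p: "p \<in> B" "star p = p" "p * p = p"
    and "0 \<le> \<eta>" and near_min: "\<And>S. S \<in> isom \<Longrightarrow> (enorm a)\<^sup>2 \<le> (enorm (star S * a * S))\<^sup>2 + \<eta>"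
  shows "(enorm ((1 - p) * a * p))\<^sup>2 \<le> \<eta>"
proof (rule ccontr)
  define x where "x = (1 - p) * a * p"
  define D where "D = E (star x * x)"
  assume "\<not> (enorm ((1 - p) * a * p))\<^sup>2 \<le> \<eta>"
  then have \<kappa>: "\<eta> < norm D"
    by (simp add: D_def x_def enorm_square)
  \<comment> \<open>The final estimate will read norm D \<le> \<eta> + 2 \<tau>, which this value
    contradicts.\<close>
  define \<tau> where "\<tau> = (norm D - \<eta>) / 4"
  have \<tau>: "0 < \<tau>" using \<kappa> by (simp add: \<tau>_def)
  have D: "D \<in> B" "cpos D" "D \<noteq> 0"
    using \<kappa> \<open>0 \<le> \<eta>\<close> by (auto simp: D_def intro: cpos_E cpos_star_mult_self)
  obtain S where S: "S \<in> isom" "norm (D * S - norm D *\<^sub>R S) \<le> \<tau>" "\<And>x. x * D = 0 \<Longrightarrow> x * S = 0"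
    by (rule B.isometry_near_norm[OF D \<tau>]) (rule that)
  have pB: "1 - p \<in> B" using p by (intro B.diff_in) auto
  have xp: "x * p = x"
    using p by (simp add: x_def mult.assoc)
  then have px: "p * star x = star x"
    using p by (metis star_mult)
  have "(1 - p) * D = E ((1 - p) * (star x * x))"
    using pB by (simp add: D_def E_mult_left)
  also have "(1 - p) * (star x * x) = 0"
    using px by (simp add: algebra_simps flip: mult.assoc)
  finally have "(1 - p) * D = 0"
    by (simp add: E_fixed)
  then have "(1 - p) * S = 0"
    by (rule S(3))
  then have pS: "p * S = S"
    by (simp add: algebra_simps)
  define a' where "a' = star S * a * S"
  define D' where "D' = E (star a' * a')"
  have D': "D' \<in> B" "cpos D'" "norm D' = (enorm a')\<^sup>2"
    by (auto simp: D'_def enorm_square intro: cpos_E cpos_star_mult_self)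
  have D'_ge: "(enorm a)\<^sup>2 \<le> norm D' + \<eta>"
    using near_min[OF S(1)] D' by (simp add: a'_def)
  \<comment> \<open>As enorm x \<le> enorm a, vanishing of D' would give norm D \<le> \<eta> at
    once. Otherwise an isometry R near the norm of D' exists.\<close>
  have "D' \<noteq> 0"
  proof
    assume "D' = 0"
    have "norm (1 - p) \<le> 1"
    proof -
      have "star (1 - p) * (1 - p) = 1 - p"
        using p by (simp add: star_diff algebra_simps)
      then have "(norm (1 - p))\<^sup>2 = norm (1 - p)"
        using cstar_identity[of "1 - p"] by simp
      then have "norm (1 - p) = 0 \<or> norm (1 - p) = 1"
        by (simp add: power2_eq_square)
      then show ?thesis by auto
    qed
    moreover have "norm p \<le> 1"
    proof -
      have "(norm p)\<^sup>2 = norm p"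
        using p norm_selfadjoint_square[of p] by simp
      then have "norm p = 0 \<or> norm p = 1"
        by (simp add: power2_eq_square)
      then show ?thesis by auto
    qed
    moreover have "enorm x \<le> norm (1 - p) * enorm (a * p)"
      unfolding x_def by (metis enorm_mult_left mult.assoc)
    moreover have "enorm (a * p) \<le> enorm a * norm p"
      using p by (intro enorm_mult_right)
    ultimately have "enorm x \<le> enorm a"
      by (smt (verit) enorm_nonneg mult_left_le mult_left_le_one_le norm_ge_zero)
    then have "(enorm x)\<^sup>2 \<le> (enorm a)\<^sup>2"
      by (intro power_mono) auto
    then show False
      using D'_ge \<open>D' = 0\<close> \<kappa> by (simp add: D_def enorm_square)
  qed
  then obtain R where R: "R \<in> isom" "norm (D' * R - norm D' *\<^sub>R R) \<le> \<tau>"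
    using B.isometry_near_norm[OF D'(1,2) _ \<tau>] by blast
  have SS: "star S * S = 1" "S \<in> B" and RR: "star R * R = 1" "R \<in> B"
    using S R B.isometriesD by auto
  define U where "U = S * R"
  have U: "U \<in> isom"
    unfolding U_def using S(1) R(1) by (rule B.isometries_mult)
  then have UU: "star U * U = 1" "U \<in> B"
    using B.isometriesD by auto
  have pU: "p * U = U"
    using pS by (simp add: U_def flip: mult.assoc)
  define q where "q = S * star S"
  have q: "star q = q" "q * q = q" "p * q = q" "q * p = q"
  proof -
    show "star q = q" by (simp add: q_def star_simps)
    show "q * q = q" unfolding q_def by (metis SS(1) mult.assoc mult.right_neutral)
    show "p * q = q" using pS by (simp add: q_def flip: mult.assoc)
    then show "q * p = q" by (metis \<open>star q = q\<close> p(2) star_mult)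
  qed
  define A1 where "A1 = E (star (a * U) * (a * U))"
  define L where "L = E (star ((1 - p) * (a * U)) * ((1 - p) * (a * U)))"
  define M where "M = E (star ((p - q) * (a * U)) * ((p - q) * (a * U)))"
  define Q where "Q = E (star (star S * (a * U)) * (star S * (a * U)))"
  have split: "A1 = L + M + Q"
  proof -
    have "star (e * y) * (e * y) = star y * e * y" if "star e = e" "e * e = e" for e y :: 'a
      using that by (simp add: star_mult) (metis mult.assoc)
    note eq = this[of "1 - p"] this[of "p - q"]
    have "star (star S * y) * (star S * y) = star y * q * y" for y
      by (simp add: q_def star_simps mult.assoc)
    then have "star y * y = star ((1 - p) * y) * ((1 - p) * y) + star ((p - q) * y) * ((p - q) * y)
      + star (star S * y) * (star S * y)" for y
      using eq[of y] p q by (simp add: star_diff algebra_simps)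
    then show ?thesis
      unfolding A1_def L_def M_def Q_def by (metis E_add)
  qed
  have "norm A1 \<le> (enorm a)\<^sup>2"
  proof -
    have "enorm (a * U) \<le> enorm a"
      using enorm_mult_right[OF UU(2), of a] B.isometries_norm[OF U] by simp
    then show ?thesis
      unfolding A1_def enorm_square[symmetric] by (intro power_mono) auto
  qed
  then have A1: "cpos (of_real ((enorm a)\<^sup>2) - A1)"
    by (intro cpos_norm_minus cpos_selfadjoint) (auto simp: A1_def intro: cpos_E cpos_star_mult_self)
  have M: "cpos M"
    unfolding M_def by (intro cpos_E cpos_star_mult_self)
  have L: "L = star R * (star S * D * S) * R"
  proof -
    have "(1 - p) * (a * U) = x * U"
      using pU by (simp add: x_def mult.assoc)
    then have "star ((1 - p) * (a * U)) * ((1 - p) * (a * U)) = star U * (star x * x) * U"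
      by (simp add: star_mult mult.assoc)
    then have "L = star U * D * U"
      using UU by (simp add: L_def D_def E_mult_right E_mult_left B.star_in)
    then show ?thesis
      by (simp add: U_def star_mult mult.assoc)
  qed
  have "norm (star S * D * S - of_real (norm D)) \<le> \<tau>"
  proof -
    have "star S * D * S - of_real (norm D) = star S * (D * S - norm D *\<^sub>R S)"
      using SS by (simp add: algebra_simps of_real_def)
    also have "norm \<dots> \<le> norm (star S) * norm (D * S - norm D *\<^sub>R S)"
      by (rule norm_mult_ineq)
    finally show ?thesis
      using S(2) B.isometries_norm[OF S(1)] by simp
  qed
  then have nL: "norm (L - of_real (norm D)) \<le> \<tau>"
    unfolding L by (rule order.trans[OF norm_conj_isometry_diff_le_real[OF RR(1)]])
  have Q: "Q = star R * D' * R"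
  proof -
    have "star (star S * (a * U)) * (star S * (a * U)) = star R * (star a' * a') * R"
      by (simp add: star_simps a'_def U_def mult.assoc)
    then show ?thesis
      using RR by (simp add: Q_def D'_def E_mult_right E_mult_left B.star_in)
  qed
  have nQ: "norm (Q - of_real (norm D')) \<le> \<tau>"
  proof -
    have "Q - of_real (norm D') = star R * (D' * R - norm D' *\<^sub>R R)"
      using RR Q by (simp add: algebra_simps of_real_def)
    also have "norm \<dots> \<le> norm (star R) * norm (D' * R - norm D' *\<^sub>R R)"
      by (rule norm_mult_ineq)
    finally show ?thesis
      using R(2) B.isometries_norm[OF R(1)] by simp
  qed
  have "star L = L" "star Q = Q"
    unfolding L_def Q_def by (intro cpos_selfadjoint cpos_E cpos_star_mult_self)+
  then have "cpos (of_real \<tau> - (of_real (norm D) - L))" "cpos (of_real \<tau> - (of_real (norm D') - Q))"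
    using nL nQ by (auto intro!: cpos_norm_minus simp: star_diff norm_minus_commute)
  then have "cpos (of_real ((enorm a)\<^sup>2) - A1 + M + (of_real \<tau> - (of_real (norm D) - L))
      + (of_real \<tau> - (of_real (norm D') - Q)))"
    by (intro cpos_add A1 M)
  also have "of_real ((enorm a)\<^sup>2) - A1 + M + (of_real \<tau> - (of_real (norm D) - L))
      + (of_real \<tau> - (of_real (norm D') - Q)) = of_real ((enorm a)\<^sup>2 + (\<tau> + \<tau>) - norm D - norm D')"
    unfolding split of_real_add of_real_diff by (simp only: algebra_simps)
  finally have "norm D \<le> \<eta> + 2 * \<tau>"
    using D'_ge by (simp only: cpos_of_real)
  then show False
    using \<kappa> by (simp add: \<tau>_def field_simps)
qed

section \<open>Almost commutation of incompressible elements with isometries\<close>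

definition comm_norm :: "'a \<Rightarrow> 'a \<Rightarrow> real"
  where "comm_norm a x = enorm (a * x - x * a)"

lemma comm_norm_add: "comm_norm a (x + y) \<le> comm_norm a x + comm_norm a y"
  using enorm_triangle[of "a * x - x * a" "a * y - y * a"] by (simp add: comm_norm_def algebra_simps)

lemma comm_norm_scaleC: "comm_norm a (c *\<^sub>C x) = cmod c * comm_norm a x"
  unfolding comm_norm_def by (simp add: scaleC_simps enorm_scaleC flip: scaleC_diff_right)

lemma comm_norm_mult:
  assumes "y \<in> B" "norm x \<le> 1" "norm y \<le> 1"
  shows "comm_norm a (x * y) \<le> comm_norm a x + comm_norm a y"
proof -
  have "comm_norm a (x * y) = enorm ((a * x - x * a) * y + x * (a * y - y * a))"
    by (simp add: comm_norm_def algebra_simps)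
  also have "\<dots> \<le> enorm ((a * x - x * a) * y) + enorm (x * (a * y - y * a))"
    by (rule enorm_triangle)
  also have "\<dots> \<le> comm_norm a x * norm y + norm x * comm_norm a y"
    unfolding comm_norm_def using assms(1) by (intro add_mono enorm_mult_right enorm_mult_left)
  also have "\<dots> \<le> comm_norm a x * 1 + 1 * comm_norm a y"
    unfolding comm_norm_def using assms by (intro add_mono mult_left_mono mult_right_mono) auto
  finally show ?thesis by simp
qed

context
  fixes a \<eta>
  assumes eta: "0 \<le> \<eta>" and near_min: "\<And>S. S \<in> isom \<Longrightarrow> (enorm a)\<^sup>2 \<le> (enorm (star S * a * S))\<^sup>2 + \<eta>"
begin

text \<open>The commutator with p is the difference of the two off-diagonal corners, and the
  estimate for a corner applies to p and to 1 - p.\<close>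

lemma comm_norm_projection:
  assumes p: "p \<in> B" "star p = p" "p * p = p"
  shows "comm_norm a p \<le> 2 * sqrt \<eta>"
proof -
  have "(enorm ((1 - p) * a * p))\<^sup>2 \<le> \<eta>"
    using p eta near_min by (rule off_diagonal_small)
  moreover have "(enorm ((1 - (1 - p)) * a * (1 - p)))\<^sup>2 \<le> \<eta>"
    by (rule off_diagonal_small) (use p eta near_min in \<open>auto simp: star_diff algebra_simps intro: B.diff_in\<close>)
  ultimately have "enorm ((1 - p) * a * p) \<le> sqrt \<eta>" "enorm (p * a * (1 - p)) \<le> sqrt \<eta>"
    by (auto intro: real_le_rsqrt)
  moreover have "a * p - p * a = (1 - p) * a * p - p * a * (1 - p)"
    by (simp add: algebra_simps)
  ultimately show ?thesis
    using enorm_triangle_diff[of "(1 - p) * a * p" "p * a * (1 - p)"] by (simp add: comm_norm_def)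
qed

text \<open>A partial isometry of square zero is a combination of four projections.\<close>

lemma comm_norm_partial_isometry:
  assumes v: "v \<in> B" "v * v = 0" "v * star v * v = v"
  shows "comm_norm a v \<le> 8 * sqrt \<eta>"
proof -
  define u where "u = star v"
  have u: "u \<in> B" "u * u = 0" "u * v * u = u" "star u = v" "star v = u"
    using v by (auto simp: u_def star_star intro: B.star_in)
      (metis star_mult star_zero, metis mult.assoc star_mult star_star)
  have vuv: "v * u * v = v" using v by (simp add: u_def)
  define e1 where "e1 = u * v"
  define e2 where "e2 = v * u"
  define w where "w = v + u"
  define w' where "w' = \<i> *\<^sub>C (u - v)"
  define p where "p = (1/2) *\<^sub>R (e1 + e2 + w)"
  define p' where "p' = (1/2) *\<^sub>R (e1 + e2 + w')"
  have e: "e1 \<in> B" "e2 \<in> B" "star e1 = e1" "star e2 = e2" "e1 * e1 = e1" "e2 * e2 = e2"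
    "e1 * e2 = 0" "e2 * e1 = 0" "e1 * v = 0" "v * e1 = v" "e2 * v = v" "v * e2 = 0"
    "e1 * u = u" "u * e1 = 0" "e2 * u = 0" "u * e2 = u"
    unfolding e1_def e2_def using u v vuv
    by (auto simp: star_mult intro: B.mult_in) (metis mult.assoc mult_zero_left mult_zero_right)+
  have "w' * w' = (\<i> * \<i>) *\<^sub>C ((u - v) * (u - v))"
    by (simp add: w'_def scaleC_simps)
  then have "w * w = e1 + e2" "w' * w' = e1 + e2"
    using u v by (simp_all add: w_def e1_def e2_def algebra_simps scaleC_minus_left)
  moreover have "(e1 + e2) * w = w" "w * (e1 + e2) = w" "(e1 + e2) * w' = w'" "w' * (e1 + e2) = w'"
    using e by (simp_all add: w_def w'_def algebra_simps scaleC_simps scaleC_diff_right)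
  moreover have "(e1 + e2) * (e1 + e2) = e1 + e2"
    using e by (simp add: algebra_simps)
  moreover have "(x + y) * (x + y) = x * x + x * y + y * x + y * y" for x y :: 'a
    by (simp add: algebra_simps)
  ultimately have pp: "p * p = p" "p' * p' = p'"
    by (simp_all add: p_def p'_def flip: scaleR_2) (simp_all add: algebra_simps scaleR_2 flip: scaleR_add_left)
  have sp: "star p = p" "star p' = p'"
    using e u by (simp_all add: p_def p'_def w_def w'_def star_simps scaleC_minus_left scaleC_diff_right add.commute)
  have pB: "p \<in> B" "p' \<in> B"
    using e u v by (auto simp: p_def p'_def w_def w'_def intro!: B.closure_rules)
  \<comment> \<open>The projections p and p' average e1 + e2 with the symmetries v + v^* and i(v^* -
    v). In p + i p' the v^* cancel, and (1 + i)/2 times e1 + e2 is in excess. The four projections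
    count 2 each, which gives the constant 8.\<close>
  have v_eq: "v = p + \<i> *\<^sub>C p' + (- (1 + \<i>) / 2) *\<^sub>C (e1 + e2)"
  proof -
    have half: "(1/2) *\<^sub>R x = (1/2) *\<^sub>C x" for x :: 'a
      using scaleC_of_real[of "1/2" x] by simp
    have 1: "p = (1/2) *\<^sub>C (e1 + e2) + ((1/2) *\<^sub>C v + (1/2) *\<^sub>C u)"
      unfolding p_def w_def half by (simp add: scaleC_add_right)
    have 2: "\<i> *\<^sub>C p' = (\<i>/2) *\<^sub>C (e1 + e2) + ((1/2) *\<^sub>C v + (-1/2) *\<^sub>C u)"
      unfolding p'_def w'_def half
      by (simp add: scaleC_add_right scaleC_diff_right scaleC_scaleC scaleC_minus_left)
    have "p + \<i> *\<^sub>C p' + (- (1 + \<i>) / 2) *\<^sub>C (e1 + e2)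
      = (1/2 + \<i>/2 + - (1 + \<i>) / 2) *\<^sub>C (e1 + e2) + ((1/2 + 1/2) *\<^sub>C v + (1/2 + -1/2) *\<^sub>C u)"
      unfolding 1 2 by (simp only: scaleC_add_left) (simp only: ac_simps)
    also have "(1/2 + \<i>/2 + - (1 + \<i>) / 2) = 0"
      by (simp add: field_simps)
    finally show ?thesis by simp
  qed
  define s where "s = sqrt \<eta>"
  have c: "comm_norm a p \<le> 2 * s" "comm_norm a p' \<le> 2 * s" "comm_norm a e1 \<le> 2 * s" "comm_norm a e2 \<le> 2 * s"
    unfolding s_def by (intro comm_norm_projection pp sp pB e)+
  have "cmod (- (1 + \<i>) / 2) \<le> 1"
    using norm_triangle_ineq[of 1 \<i>] by (simp add: norm_divide norm_minus_commute del: minus_add_distrib)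
  then have "comm_norm a ((- (1 + \<i>) / 2) *\<^sub>C (e1 + e2)) \<le> 1 * comm_norm a (e1 + e2)"
    unfolding comm_norm_scaleC by (intro mult_right_mono) (auto simp: comm_norm_def)
  also have "\<dots> \<le> 2 * s + 2 * s"
    using comm_norm_add[of a e1 e2] c by simp
  finally have "comm_norm a ((- (1 + \<i>) / 2) *\<^sub>C (e1 + e2)) \<le> 2 * s + 2 * s" .
  moreover have "comm_norm a (\<i> *\<^sub>C p') \<le> 2 * s"
    using c by (simp add: comm_norm_scaleC)
  moreover have "comm_norm a v \<le> comm_norm a p + comm_norm a (\<i> *\<^sub>C p') + comm_norm a ((- (1 + \<i>) / 2) *\<^sub>C (e1 + e2))"
    by (subst v_eq) (intro order.trans[OF comm_norm_add] add_mono comm_norm_add order_refl)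
  ultimately show ?thesis
    using c by (simp add: s_def)
qed

lemma comm_norm_corner:
  assumes "T \<in> B" "T' \<in> B" "S \<in> isom" "star T * T = 1" "star T' * T' = 1" "star T' * T = 0"
  shows "comm_norm a (T * S * star T') \<le> 8 * sqrt \<eta>"
proof (rule comm_norm_partial_isometry)
  have S: "S \<in> B" "star S * S = 1"
    using assms B.isometriesD by auto
  then show "T * S * star T' \<in> B"
    using assms by (intro B.mult_in B.star_in)
  show "T * S * star T' * (T * S * star T') = 0"
    using assms by (metis mult.assoc mult_zero_left mult_zero_right)
  have "T * S * star T' * star (T * S * star T') * (T * S * star T')
      = T * S * (star T' * T') * (star S * (star T * T) * S) * star T'"
    by (simp add: star_simps mult.assoc)
  then show "T * S * star T' * star (T * S * star T') * (T * S * star T') = T * S * star T'"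
    using assms S by simp
qed

lemma comm_norm_isometry:
  assumes "S \<in> isom"
  shows "comm_norm a S \<le> 56 * sqrt \<eta>"
proof -
  define s where "s = sqrt \<eta>"
  have s: "0 \<le> s" using eta by (simp add: s_def)
  obtain T :: "nat \<Rightarrow> 'a" where T: "\<And>n. T n \<in> isom" "\<And>m n. star (T m) * T n = (if m = n then 1 else 0)"
    by (rule B.orthogonal_isometries) (rule that)
  have TB: "T n \<in> B" "norm (T n) = 1" for n
    using T(1) B.isometriesD B.isometries_norm by auto
  have iso: "comm_norm a (T m) \<le> 24 * s \<and> comm_norm a (star (T m)) \<le> 24 * s" if "m \<noteq> n" for m n
  proof -
    define t where "t = T m"
    define t' where "t' = T n"
    have t: "t \<in> B" "t' \<in> B" "star t * t = 1" "star t' * t' = 1" "star t' * t = 0" "star t * t' = 0"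
      "t \<in> isom" "norm t = 1" "norm t' = 1" "star t \<in> B" "star t' \<in> B"
      using T TB that by (auto simp: t_def t'_def intro: B.star_in)
    \<comment> \<open>Splitting off the range of t: t f and f t^* have square zero because f t = 0,
      and the remaining part factors through the second isometry t'.\<close>
    define f where "f = 1 - t * star t"
    have f: "f \<in> B" "star f = f" "f * f = f" "f * t = 0" "star t * f = 0"
      unfolding f_def using t by (auto simp: star_simps algebra_simps intro!: B.closure_rules)
        (metis mult.assoc mult.right_neutral mult.left_neutral)+
    have tt': "norm (t * t * star t') \<le> 1" "norm (t' * 1 * star t) \<le> 1" "norm (t * 1 * star t') \<le> 1"
      "norm (t' * star t * star t) \<le> 1"
      using t(8,9) by (auto intro!: order.trans[OF norm_mult_ineq] mult_le_one)
    have B: "t' * 1 * star t \<in> B" "t' * star t * star t \<in> B"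
      using t by (auto intro!: B.mult_in)
    have c1: "comm_norm a (t * f) \<le> 8 * s" "comm_norm a (f * star t) \<le> 8 * s"
      unfolding s_def using t f
      by (auto intro!: comm_norm_partial_isometry B.mult_in simp: star_simps)
        (metis mult.assoc mult_zero_left mult_zero_right mult.left_neutral mult.right_neutral)+
    have c2: "comm_norm a (t * t * star t') \<le> 8 * s" "comm_norm a (t' * 1 * star t) \<le> 8 * s"
      "comm_norm a (t * 1 * star t') \<le> 8 * s"
      unfolding s_def using comm_norm_corner[of t t' t] comm_norm_corner[of t' t 1] comm_norm_corner[of t t' 1] t
      by simp_all
    have c3: "comm_norm a (t' * star t * star t) \<le> 8 * s"
      unfolding s_def
    proof (rule comm_norm_partial_isometry)
      show "t' * star t * star t * (t' * star t * star t) = 0"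
        using t by (metis mult.assoc mult_zero_left mult_zero_right)
      have "t' * star t * star t * star (t' * star t * star t) * (t' * star t * star t)
        = t' * (star t * (star t * t) * t) * (star t' * t') * star t * star t"
        by (simp add: star_simps mult.assoc)
      then show "t' * star t * star t * star (t' * star t * star t) * (t' * star t * star t) = t' * star t * star t"
        using t by simp
    qed (use B in auto)
    have d1: "t = t * f + (t * t * star t') * (t' * 1 * star t)"
    proof -
      have "(t * t * star t') * (t' * 1 * star t) = t * t * (star t' * t') * star t"
        by (simp add: mult.assoc)
      then show ?thesis using t by (simp add: f_def algebra_simps)
    qed
    have d2: "star t = f * star t + (t * 1 * star t') * (t' * star t * star t)"
    proof -
      have "(t * 1 * star t') * (t' * star t * star t) = t * (star t' * t') * star t * star t"
        by (simp add: mult.assoc)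
      then show ?thesis using t by (simp add: f_def algebra_simps)
    qed
    have "comm_norm a t \<le> comm_norm a (t * f) + (comm_norm a (t * t * star t') + comm_norm a (t' * 1 * star t))"
      by (subst d1) (intro order.trans[OF comm_norm_add] add_mono order_refl comm_norm_mult B tt')
    moreover have "comm_norm a (star t) \<le> comm_norm a (f * star t)
        + (comm_norm a (t * 1 * star t') + comm_norm a (t' * star t * star t))"
      by (subst d2) (intro order.trans[OF comm_norm_add] add_mono order_refl comm_norm_mult B tt')
    ultimately show ?thesis
      using c1 c2 c3 by (auto simp: t_def)
  qed
  define w where "w = T 0 * S * star (T 1)"
  have S: "S \<in> B" "norm S = 1"
    using assms B.isometriesD B.isometries_norm by auto
  have w: "comm_norm a w \<le> 8 * s"
    unfolding w_def s_def using T TB assms by (intro comm_norm_corner) auto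
  have nw: "norm w \<le> 1" "w \<in> B"
    unfolding w_def using TB S by (auto intro!: order.trans[OF norm_mult_ineq] mult_le_one B.mult_in B.star_in)
  have "S = star (T 0) * (w * T 1)"
  proof -
    have "star (T 0) * (w * T 1) = (star (T 0) * T 0) * S * (star (T 1) * T 1)"
      by (simp add: w_def mult.assoc)
    then show ?thesis using T by simp
  qed
  moreover have "comm_norm a (star (T 0) * (w * T 1)) \<le> comm_norm a (star (T 0)) + (comm_norm a w + comm_norm a (T 1))"
    using nw TB
    by (intro order.trans[OF comm_norm_mult] add_mono order_refl comm_norm_mult B.mult_in)
      (auto intro!: order.trans[OF norm_mult_ineq] mult_le_one)
  moreover have "comm_norm a (star (T 0)) \<le> 24 * s" "comm_norm a (T 1) \<le> 24 * s"
    using iso[of 0 1] iso[of 1 0] by auto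
  ultimately show ?thesis
    using w by (simp add: s_def)
qed

end

text \<open>A self-adjoint x with norm below 1 is the mean of the unitaries x \<plusminus> i (1 -
  x^2)^(1/2), which are isometries of \<open>B\<close>. So y commutes with \<open>B\<close>, and
  minimality of the action applies.\<close>

lemma commutes_isometries_imp_scalar:
  assumes "\<And>S. S \<in> isom \<Longrightarrow> y * S = S * y"
  obtains c where "y = c *\<^sub>C 1"
proof -
  have sa: "y * x = x * y" if x: "x \<in> B" "star x = x" "norm x < 1" for x
  proof -
    have "norm (x * x) < 1"
      using x by (simp add: norm_selfadjoint_square abs_square_less_1)
    moreover interpret C: unital_subalgebra "B \<inter> relative_commutant {x}"
      using x by (intro unital_subalgebra_Int unital_subalgebra_B unital_subalgebra_relative_commutant_selfadjoint)
    have "x * x \<in> B \<inter> relative_commutant {x}"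
      using x by (auto simp: relative_commutant_def mult.assoc intro: B.mult_in)
    ultimately obtain s where s: "s \<in> B" "s * x = x * s" "s * s = 1 - x * x" "star s = s"
      using C.sqrt_one_minus[of "x * x"] x by (auto simp: star_mult relative_commutant_def)
    define u where "u = x + \<i> *\<^sub>C s"
    define u' where "u' = x - \<i> *\<^sub>C s"
    have st: "star u = u'" "star u' = u"
      using x s by (simp_all add: u_def u'_def star_simps scaleC_minus_left)
    have "u' * u = 1" "u * u' = 1"
      using s(2,3) by (simp_all add: u_def u'_def algebra_simps scaleC_simps scaleC_minus_left
          scaleC_add_right scaleC_diff_right)
    then have "u \<in> isom" "u' \<in> isom"
      using st x s by (auto simp: B.isometries_def u_def u'_def intro!: B.closure_rules)
    then have "y * (u + u') = (u + u') * y"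
      using assms by (simp add: distrib_left distrib_right)
    then have "y * (2 *\<^sub>R x) = (2 *\<^sub>R x) * y"
      by (simp add: u_def u'_def scaleR_2)
    then show ?thesis by simp
  qed
  have sa': "y * x = x * y" if x: "x \<in> B" "star x = x" for x
  proof -
    define r where "r = norm x + 1"
    have r: "0 < r" "norm x < r" by (auto simp: r_def add_nonneg_pos)
    have "y * ((1/r) *\<^sub>R x) = ((1/r) *\<^sub>R x) * y"
      using x r by (intro sa) (auto simp: star_scaleR intro: B.scaleR_in)
    then have "(1/r) *\<^sub>R (y * x) = (1/r) *\<^sub>R (x * y)"
      by simp
    then show ?thesis
      using r by (simp only: scaleR_cancel_left) simp
  qed
  have "y * x = x * y" if x: "x \<in> B" for x
  proof -
    define a where "a = (1/2) *\<^sub>R (x + star x)"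
    define b where "b = (- \<i> / 2) *\<^sub>C (x - star x)"
    have ab: "star a = a" "star b = b" "x = a + \<i> *\<^sub>C b"
      unfolding a_def b_def by (rule cartesian_decomposition)+
    have "a \<in> B" "b \<in> B"
      unfolding a_def b_def using x by (auto intro!: B.closure_rules)
    then have "y * a = a * y" "y * b = b * y"
      using sa' ab by auto
    then show ?thesis
      unfolding ab(3) by (simp add: algebra_simps scaleC_simps)
  qed
  then have "y \<in> relative_commutant B"
    by (simp add: relative_commutant_def)
  with minimal show thesis
    using that by auto
qed

text \<open>
  Repeated compression produces a sequence that is Cauchy in the module norm and asymptotically
  commutes with \<open>B\<close>. Its weighted means converge in norm to an element of the relative commutant.
\<close>

lemma compression_to_zero:
  assumes a: "E a = 0" and "0 < \<delta>"
  obtains S where "S \<in> isom" "enorm (star S * a * S) < \<delta>"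
proof (rule ccontr)
  assume "\<not> thesis"
  with that have ge: "\<delta> \<le> enorm (star S * a * S)" if "S \<in> isom" for S
    using \<open>S \<in> isom\<close> not_le by blast
  \<comment> \<open>Geometric decay makes the steps summable. The factor 1/1000 ensures that the
    total displacement 112 \<epsilon>_0 and the smoothing error \<delta>/8 stay together below
    \<delta>/2.\<close>
  define \<epsilon> where "\<epsilon> n = \<delta> / 1000 * (1/2) ^ n" for n :: nat
  have \<epsilon>: "0 < \<epsilon> n" for n using \<open>0 < \<delta>\<close> by (simp add: \<epsilon>_def)
  define good where "good n b \<longleftrightarrow> (\<exists>R\<in>isom. b = star R * a * R) \<and>
    (\<forall>S\<in>isom. (enorm b)\<^sup>2 \<le> (enorm (star S * b * S))\<^sup>2 + (\<epsilon> n)\<^sup>2)" for n b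
  have step: "\<exists>S\<in>isom. good n (star S * b * S)" if b: "\<exists>R\<in>isom. b = star R * a * R" for b n
  proof -
    obtain R where R: "R \<in> isom" "b = star R * a * R" using b by blast
    define X where "X = (\<lambda>S. (enorm (star S * b * S))\<^sup>2) ` isom"
    have X: "X \<noteq> {}" "bdd_below X"
      by (auto simp: X_def intro!: bdd_belowI[of _ 0] exI[of _ 1] B.isometries_one)
    have "Inf X < Inf X + (\<epsilon> n)\<^sup>2" using \<epsilon>[of n] by simp
    then obtain S where S: "S \<in> isom" "(enorm (star S * b * S))\<^sup>2 < Inf X + (\<epsilon> n)\<^sup>2"
      using cInf_lessD[OF X(1)] unfolding X_def by blast
    have "good n (star S * b * S)"
      unfolding good_def
    proof (intro conjI ballI)
      show "\<exists>R\<in>isom. star S * b * S = star R * a * R"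
        using B.isometries_mult[OF R(1) S(1)] R(2) by (intro bexI[of _ "R * S"]) (simp_all add: star_mult mult.assoc)
      fix U assume U: "U \<in> isom"
      have "Inf X \<le> (enorm (star (S * U) * b * (S * U)))\<^sup>2"
        using B.isometries_mult[OF S(1) U] X(2) unfolding X_def by (intro cINF_lower)
      then show "(enorm (star S * b * S))\<^sup>2 \<le> (enorm (star U * (star S * b * S) * U))\<^sup>2 + (\<epsilon> n)\<^sup>2"
        using S(2) by (simp add: star_mult mult.assoc)
    qed
    with S show ?thesis by blast
  qed
  have "\<exists>b. \<forall>n. good n (b n) \<and> (\<exists>S\<in>isom. b (Suc n) = star S * b n * S)"
  proof (rule dependent_nat_choice)
    have "\<exists>R\<in>isom. a = star R * a * R"
      by (intro bexI[of _ 1]) simp_all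
    from step[OF this, of 0] show "\<exists>x. good 0 x" by blast
    fix x n assume "good n x"
    then have "\<exists>R\<in>isom. x = star R * a * R" by (simp add: good_def)
    from step[OF this, of "Suc n"]
    show "\<exists>y. good (Suc n) y \<and> (\<exists>S\<in>isom. y = star S * x * S)" by blast
  qed
  then obtain b where b: "\<And>n. good n (b n)" "\<And>n. \<exists>S\<in>isom. b (Suc n) = star S * b n * S"
    by blast
  have comm: "comm_norm (b n) S \<le> 56 * \<epsilon> n" if "S \<in> isom" for n S
    using comm_norm_isometry[of "(\<epsilon> n)\<^sup>2" "b n" S] b(1)[of n] that \<epsilon>[of n] by (auto simp: good_def)
  have Eb: "E (b n) = 0" for n
  proof -
    obtain R where "R \<in> isom" "b n = star R * a * R"
      using b(1)[of n] by (auto simp: good_def)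
    then show ?thesis
      using a B.isometriesD by (simp add: E_mult_left E_mult_right B.star_in)
  qed
  have step_small: "enorm (b (Suc n) - b n) \<le> 56 * \<epsilon> n" for n
  proof -
    obtain S where S: "S \<in> isom" "b (Suc n) = star S * b n * S"
      using b(2) by blast
    have "b (Suc n) - b n = star S * (b n * S - S * b n)"
      unfolding S(2) using B.isometriesD[OF S(1)] by (simp add: algebra_simps flip: mult.assoc)
    also have "enorm \<dots> \<le> norm (star S) * enorm (b n * S - S * b n)"
      by (rule enorm_mult_left)
    finally show ?thesis
      using comm[OF S(1), of n] B.isometries_norm[OF S(1)] by (simp add: comm_norm_def)
  qed
  \<comment> \<open>As \<epsilon> halves in each step, 56 \<epsilon>_n = 112 \<epsilon>_n - 112
    \<epsilon>_(n+1), so the bound telescopes.\<close>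
  have dist_b: "enorm (b (n + k) - b n) \<le> 112 * \<epsilon> n - 112 * \<epsilon> (n + k)" for n k
  proof (induction k)
    case 0
    then show ?case by (simp add: enorm_def E_fixed star_zero)
  next
    case (Suc k)
    have "\<epsilon> (n + Suc k) = \<epsilon> (n + k) / 2" by (simp add: \<epsilon>_def)
    moreover have "enorm (b (n + Suc k) - b n) \<le> enorm (b (Suc (n + k)) - b (n + k)) + enorm (b (n + k) - b n)"
      using enorm_triangle[of "b (Suc (n + k)) - b (n + k)" "b (n + k) - b n"] by simp
    ultimately show ?case
      using step_small[of "n + k"] Suc by simp
  qed
  have dist_b': "enorm (b m - b n) \<le> 112 * \<epsilon> n" if "n \<le> m" for m n
    using dist_b[of n "m - n"] that \<epsilon>[of m] by simp
  define \<eta> where "\<eta> = \<delta> / 8"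
  have \<eta>: "0 < \<eta>" using \<open>0 < \<delta>\<close> by (simp add: \<eta>_def)
  obtain \<mu> where w: "weight (near_one (b 0) \<eta>) \<mu>"
    using near_one_weight[OF \<eta>] .
  have \<mu>: "0 < \<mu>" using w by (simp add: weight_def)
  define P where "P = wmean (near_one (b 0) \<eta>)"
  have "norm (P (b 0) - \<mu> *\<^sub>R b 0) \<le> \<mu> * \<eta>"
    unfolding P_def by (rule norm_wmean_near_one_diff_le[OF w \<eta>]) (use \<eta> in auto)
  then have P0: "enorm (P (b 0) - \<mu> *\<^sub>R b 0) \<le> \<mu> * \<eta>"
    using enorm_le_norm order.trans by blast
  have "\<epsilon> \<longlonglongrightarrow> \<delta> / 1000 * 0"
    unfolding \<epsilon>_def by (intro tendsto_intros LIMSEQ_power_zero) simp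
  then have \<epsilon>_lim: "\<epsilon> \<longlonglongrightarrow> 0" by simp
  have "Cauchy (\<lambda>n. P (b n))"
  proof (rule metric_CauchyI)
    fix e :: real assume "0 < e"
    then have "\<forall>\<^sub>F n in sequentially. \<epsilon> n < e / 224"
      using \<epsilon>_lim by (intro order_tendstoD) auto
    then obtain N where N: "\<epsilon> N < e / 224"
      by (auto simp: eventually_sequentially)
    have "dist (P (b m)) (P (b N)) < e / 2" if "N \<le> m" for m
    proof -
      have "norm (P (b m) - P (b N)) \<le> enorm (b m - b N)"
        unfolding P_def wmean_diff[OF w, symmetric] by (rule norm_wmean_le[OF w])
      then show ?thesis
        using dist_b'[OF that] N by (simp add: dist_norm)
    qed
    then show "\<exists>M. \<forall>m\<ge>M. \<forall>n\<ge>M. dist (P (b m)) (P (b n)) < e"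
      using dist_triangle_half_l by (metis dist_commute)
  qed
  then obtain y where y: "(\<lambda>n. P (b n)) \<longlonglongrightarrow> y"
    by (auto simp: Cauchy_convergent_iff convergent_def)
  have "y * S = S * y" if S: "S \<in> isom" for S
  proof -
    have SB: "S \<in> B" using S by (rule B.isometriesD)
    have "(\<lambda>n. P (b n) * S - S * P (b n)) \<longlonglongrightarrow> y * S - S * y"
      using y by (intro tendsto_intros)
    moreover have "(\<lambda>n. P (b n) * S - S * P (b n)) \<longlonglongrightarrow> 0"
    proof (rule Lim_null_comparison)
      have "norm (P (b n) * S - S * P (b n)) \<le> 56 * \<epsilon> n" for n
      proof -
        have "P (b n) * S - S * P (b n) = P (b n * S - S * b n)"
          unfolding P_def using SB by (simp add: wmean_diff[OF w] wmean_mult_left[OF w] wmean_mult_right[OF w])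
        also have "norm \<dots> \<le> enorm (b n * S - S * b n)"
          unfolding P_def by (rule norm_wmean_le[OF w])
        finally show ?thesis
          using comm[OF S, of n] by (simp add: comm_norm_def)
      qed
      then show "\<forall>\<^sub>F n in sequentially. norm (P (b n) * S - S * P (b n)) \<le> 56 * \<epsilon> n"
        by simp
      show "(\<lambda>n. 56 * \<epsilon> n) \<longlonglongrightarrow> 0"
        using tendsto_mult_right_zero[OF \<epsilon>_lim] by simp
    qed
    ultimately have "y * S - S * y = 0"
      by (rule LIMSEQ_unique)
    then show ?thesis by simp
  qed
  then obtain c where c: "y = c *\<^sub>C 1"
    using commutes_isometries_imp_scalar by blast
  have "(\<lambda>n. E (P (b n))) \<longlonglongrightarrow> E y"
    by (rule bounded_linear.tendsto[OF bounded_linear_E y])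
  moreover have "E (P (b n)) = 0" for n
    unfolding P_def using Eb by (simp add: E_wmean[OF w])
  ultimately have "E y = 0"
    by (simp add: LIMSEQ_const_iff)
  moreover have "E y = y"
    unfolding c by (intro E_fixed B.scaleC_in) auto
  ultimately have "y = 0" by simp
  with y have "(\<lambda>n. norm (P (b n))) \<longlonglongrightarrow> 0"
    by (simp add: tendsto_norm_zero)
  then have "\<forall>\<^sub>F n in sequentially. norm (P (b n)) < \<mu> * (\<delta> / 2)"
    using \<mu> \<open>0 < \<delta>\<close> by (intro order_tendstoD) auto
  then obtain n where n: "norm (P (b n)) < \<mu> * (\<delta> / 2)"
    by (auto simp: eventually_sequentially)
  \<comment> \<open>All P(b_n) have expectation 0, so their scalar limit is 0. Since \<mu> b_0 is
    close to P(b_0), which is close to P(b_n), its module norm falls below \<mu> \<delta>, although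
    every compression of a has module norm at least \<delta>.\<close>
  have "\<mu> *\<^sub>R b 0 = P (b n) - P (b n - b 0) - (P (b 0) - \<mu> *\<^sub>R b 0)"
    unfolding P_def by (simp add: wmean_diff[OF w])
  then have "enorm (\<mu> *\<^sub>R b 0) \<le> enorm (P (b n)) + enorm (P (b n - b 0)) + enorm (P (b 0) - \<mu> *\<^sub>R b 0)"
    by (metis (no_types) add_mono_thms_linordered_semiring(3) enorm_triangle_diff order.trans)
  moreover have "enorm (\<mu> *\<^sub>R b 0) = \<mu> * enorm (b 0)"
    using enorm_scaleC[of "complex_of_real \<mu>" "b 0"] \<mu> by (simp add: scaleC_of_real)
  moreover have "\<delta> \<le> enorm (b 0)"
    using b(1)[of 0] ge by (auto simp: good_def)
  moreover have "enorm (P (b n - b 0)) \<le> \<mu> * (112 * \<epsilon> 0)"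
    unfolding P_def using \<mu> dist_b'[of 0 n] by (intro order.trans[OF enorm_wmean_le[OF w]] mult_left_mono) auto
  ultimately have "\<mu> * \<delta> < \<mu> * (\<delta> / 2) + \<mu> * (112 * \<epsilon> 0) + \<mu> * \<eta>"
    using n P0 enorm_le_norm[of "P (b n)"] mult_left_mono[of \<delta> "enorm (b 0)" \<mu>] \<mu> by linarith
  then have "\<mu> * \<delta> < \<mu> * (\<delta> / 2 + 112 * \<epsilon> 0 + \<eta>)"
    by (simp add: distrib_left)
  then show False
    using \<mu> \<open>0 < \<delta>\<close> by (simp add: \<epsilon>_def \<eta>_def)
qed

section \<open>Simultaneous compression to scalars\<close>

definition scalars :: "'a set"
  where "scalars = range (\<lambda>c. c *\<^sub>C 1)"

lemma closed_scalars: "closed scalars"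
proof -
  interpret C: unital_subalgebra "relative_commutant B"
    by (rule unital_subalgebra_relative_commutant) (rule B.star_in)
  show ?thesis
    using C.closed minimal by (simp add: scalars_def)
qed

text \<open>Adding norm b makes b positive, and near the norm of a positive element some isometry of
  \<open>B\<close> sees a scalar. The excluded case is that b is a scalar already.\<close>

lemma scalar_compression_selfadjoint:
  assumes "b \<in> B" "star b = b" "0 < \<epsilon>"
  obtains S r where "S \<in> isom" "norm (star S * b * S - of_real r) \<le> \<epsilon>"
proof (cases "b + of_real (norm b) = 0")
  case True
  then have "star 1 * b * 1 - of_real (- norm b) = 0"
    by simp
  then have "norm (star 1 * b * 1 - of_real (- norm b)) \<le> \<epsilon>"
    using assms(3) by (metis less_imp_le norm_zero)
  then show thesis
    by (rule that[rotated]) (rule B.isometries_one)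
next
  case False
  define h where "h = b + of_real (norm b)"
  have "cpos h"
    using cpos_norm_minus[of "- b" "norm b"] assms by (simp add: h_def star_minus add.commute)
  moreover have "h \<in> B"
    unfolding h_def using assms by (intro B.add_in) auto
  ultimately obtain S where S: "S \<in> isom" "norm (h * S - norm h *\<^sub>R S) \<le> \<epsilon>"
    using B.isometry_near_norm[of h \<epsilon>] False assms(3) by (metis h_def)
  have SS: "star S * S = 1"
    using S(1) by (rule B.isometriesD)
  have "star S * b * S - of_real (norm h - norm b) = star S * (h * S - norm h *\<^sub>R S)"
    using SS by (simp add: h_def algebra_simps of_real_def)
  also have "norm \<dots> \<le> norm (star S) * norm (h * S - norm h *\<^sub>R S)"
    by (rule norm_mult_ineq)
  finally have "norm (star S * b * S - of_real (norm h - norm b)) \<le> \<epsilon>"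
    using S B.isometries_norm[OF S(1)] by simp
  with S(1) show thesis by (rule that)
qed

lemma scalar_compression_fixed:
  assumes "b \<in> B" "0 < \<epsilon>"
  obtains S c where "S \<in> isom" "norm (star S * b * S - c *\<^sub>C 1) \<le> \<epsilon>"
proof -
  define x where "x = (1/2) *\<^sub>R (b + star b)"
  define y where "y = (- \<i> / 2) *\<^sub>C (b - star b)"
  have xy: "star x = x" "star y = y" "b = x + \<i> *\<^sub>C y"
    unfolding x_def y_def by (rule cartesian_decomposition)+
  have B: "x \<in> B" "y \<in> B"
    unfolding x_def y_def using assms(1) by (auto intro!: B.closure_rules)
  obtain S r where S: "S \<in> isom" "norm (star S * x * S - of_real r) \<le> \<epsilon>/2"
    using scalar_compression_selfadjoint[OF B(1) xy(1), of "\<epsilon>/2"] assms(2) by auto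
  have SB: "S \<in> B" "star S * S = 1" using S(1) by (rule B.isometriesD)+
  have "star S * y * S \<in> B" "star (star S * y * S) = star S * y * S" "0 < \<epsilon>/2"
    using SB B xy(2) assms(2) by (auto simp: star_simps mult.assoc intro: B.mult_in B.star_in)
  then obtain R q where R: "R \<in> isom" "norm (star R * (star S * y * S) * R - of_real q) \<le> \<epsilon>/2"
    by (rule scalar_compression_selfadjoint) (rule that)
  have RB: "star R * R = 1" using R(1) by (rule B.isometriesD)
  show thesis
  proof (rule that[of "S * R" "complex_of_real r + \<i> * complex_of_real q"])
    show "S * R \<in> isom" using S R by (intro B.isometries_mult)
    have "star (S * R) * b * (S * R) - (complex_of_real r + \<i> * complex_of_real q) *\<^sub>C 1
      = (star R * (star S * x * S) * R - of_real r) + \<i> *\<^sub>C (star R * (star S * y * S) * R - of_real q)"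
      unfolding xy(3) of_real_eq_scaleC[where 'a='a]
      by (simp add: star_mult algebra_simps scaleC_simps scaleC_add_left scaleC_diff_right)
    also have "norm \<dots> \<le> \<epsilon>/2 + \<epsilon>/2"
      using S(2) R(2) norm_conj_isometry_diff_le_real[OF RB, of "star S * x * S" r]
      by (intro norm_triangle_le add_mono) (auto simp: norm_scaleC)
    finally show "norm (star (S * R) * b * (S * R) - (complex_of_real r + \<i> * complex_of_real q) *\<^sub>C 1) \<le> \<epsilon>"
      by simp
  qed
qed

text \<open>E(y) is compressed to a scalar within \<open>B\<close>, and y - E(y) to something small,
  but only in the module norm. Smoothing converts this to the norm and commutes with compression by
  \<open>B\<close>. Since smoothing multiplies y by about \<mu>, the second compression is made
  \<mu> \<eta>-small.\<close>

lemma scalar_compression: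
  assumes "0 < \<epsilon>"
  obtains S c where "S \<in> isom" "norm (star S * y * S - c *\<^sub>C 1) \<le> \<epsilon>"
proof -
  define \<eta> where "\<eta> = \<epsilon> / 4"
  have \<eta>: "0 < \<eta>" using assms by (simp add: \<eta>_def)
  obtain \<mu> where w: "weight (near_one y \<eta>) \<mu>"
    using near_one_weight[OF \<eta>] .
  have \<mu>: "0 < \<mu>" using w by (simp add: weight_def)
  define P where "P = wmean (near_one y \<eta>)"
  have Py: "norm (P y - \<mu> *\<^sub>R y) \<le> \<mu> * \<eta>"
    unfolding P_def by (rule norm_wmean_near_one_diff_le[OF w \<eta>]) (use \<eta> in auto)
  obtain S c where S: "S \<in> isom" "norm (star S * E y * S - c *\<^sub>C 1) \<le> \<eta>"
    by (rule scalar_compression_fixed[OF E_in \<eta>]) (rule that)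
  have SB: "S \<in> B" "star S * S = 1" using S(1) by (rule B.isometriesD)+
  define a where "a = star S * (y - E y) * S"
  have "E a = 0"
    unfolding a_def using SB by (simp add: E_mult_left E_mult_right B.star_in E_diff E_fixed)
  then obtain R where R: "R \<in> isom" "enorm (star R * a * R) < \<mu> * \<eta>"
    using compression_to_zero[of a "\<mu> * \<eta>"] \<mu> \<eta> by auto
  have RB: "R \<in> B" "star R * R = 1" using R(1) by (rule B.isometriesD)+
  define U where "U = S * R"
  have U: "U \<in> isom" unfolding U_def using S R by (intro B.isometries_mult)
  then have UB: "U \<in> B" "star U * U = 1" by (rule B.isometriesD)+
  have "P (star R * a * R) = star U * P (y - E y) * U"
    unfolding P_def a_def U_def using SB RB
    by (simp add: wmean_mult_left[OF w] wmean_mult_right[OF w] B.star_in star_mult mult.assoc)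
      (simp add: wmean_mult_left[OF w] wmean_mult_right[OF w] B.star_in star_mult B.mult_in flip: mult.assoc)
  then have 1: "norm (star U * P (y - E y) * U) \<le> \<mu> * \<eta>"
    using norm_wmean_le[OF w, of "star R * a * R"] R(2) by (simp add: P_def)
  have 2: "norm (star U * E y * U - c *\<^sub>C 1) \<le> \<eta>"
    using norm_conj_isometry_diff_le[OF RB(2), of "star S * E y * S" c] S(2)
    by (simp add: U_def star_mult mult.assoc)
  have 3: "norm (star U * (P y - \<mu> *\<^sub>R y) * U) \<le> \<mu> * \<eta>"
    by (rule order.trans[OF norm_conj_isometry_le[OF UB(2)] Py])
  have Py_eq: "P y = P (y - E y) + \<mu> *\<^sub>R E y"
    unfolding P_def using E_in by (simp add: wmean_diff[OF w] wmean_fixed[OF w])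
  have "\<mu> *\<^sub>R (star U * y * U - c *\<^sub>C 1)
    = star U * P (y - E y) * U + \<mu> *\<^sub>R (star U * E y * U - c *\<^sub>C 1) - star U * (P y - \<mu> *\<^sub>R y) * U"
    by (subst Py_eq) (simp add: algebra_simps)
  also have "norm \<dots> \<le> \<mu> * \<eta> + \<mu> * \<eta> + \<mu> * \<eta>"
    using 1 2 3 \<mu> by (intro norm_triangle_le_diff norm_triangle_le add_mono) auto
  finally have "\<mu> * norm (star U * y * U - c *\<^sub>C 1) \<le> \<mu> * (3 * \<eta>)"
    using \<mu> by simp
  then have "norm (star U * y * U - c *\<^sub>C 1) \<le> \<epsilon>"
    using \<mu> \<eta> by (simp add: \<eta>_def)
  with U show thesis by (rule that)
qed

lemma scalar_compression_finite:
  assumes "finite Y" "0 < \<epsilon>"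
  shows "\<exists>S\<in>isom. \<forall>y\<in>Y. \<exists>c. norm (star S * y * S - c *\<^sub>C 1) \<le> \<epsilon>"
  using assms(1)
proof induction
  case empty
  then show ?case using B.isometries_one by blast
next
  case (insert y Y)
  then obtain S where S: "S \<in> isom" "\<And>y. y \<in> Y \<Longrightarrow> \<exists>c. norm (star S * y * S - c *\<^sub>C 1) \<le> \<epsilon>"
    by blast
  obtain R c where R: "R \<in> isom" "norm (star R * (star S * y * S) * R - c *\<^sub>C 1) \<le> \<epsilon>"
    by (rule scalar_compression[OF assms(2)]) (rule that)
  have RB: "star R * R = 1" using R(1) by (rule B.isometriesD)
  have SR: "S * R \<in> isom" using S R by (intro B.isometries_mult)
  have eq: "star (S * R) * x * (S * R) = star R * (star S * x * S) * R" for x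
    by (simp add: star_mult mult.assoc)
  have "\<exists>c. norm (star (S * R) * x * (S * R) - c *\<^sub>C 1) \<le> \<epsilon>" if "x \<in> insert y Y" for x
  proof (cases "x = y")
    case True
    then show ?thesis using R by (auto simp: eq)
  next
    case False
    with that S obtain d where "norm (star S * x * S - d *\<^sub>C 1) \<le> \<epsilon>" by blast
    then have "norm (star R * (star S * x * S) * R - d *\<^sub>C 1) \<le> \<epsilon>"
      using norm_conj_isometry_diff_le[OF RB] order.trans by blast
    then show ?thesis by (auto simp: eq)
  qed
  with SR show ?case by blast
qed

text \<open>A diagonal argument along a dense sequence. Each isometry is the preceding one times
  another isometry on the right, and compressing further cannot increase the distance to a
  scalar.\<close>

lemma scalar_compression_sequence:
  obtains S :: "nat \<Rightarrow> 'a" and \<omega> where "\<And>n. S n \<in> isom"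
    "\<And>y. (\<lambda>n. star (S n) * y * S n) \<longlonglongrightarrow> \<omega> y *\<^sub>C 1"
proof -
  obtain D :: "'a set" where D: "countable D" "closure D = UNIV"
    using separable by blast
  then have "D \<noteq> {}" by auto
  define d where "d = from_nat_into D"
  have d: "range d = D"
    unfolding d_def using D \<open>D \<noteq> {}\<close> by (intro range_from_nat_into)
  define good where "good n S \<longleftrightarrow> S \<in> isom \<and> (\<forall>j\<le>n. \<exists>c. norm (star S * d j * S - c *\<^sub>C 1) \<le> 1 / real (Suc n))" for n S
  have step: "\<exists>R\<in>isom. good n (S * R)" if "S \<in> isom" for S n
  proof -
    have "\<exists>R\<in>isom. \<forall>y\<in>(\<lambda>j. star S * d j * S) ` {..n}. \<exists>c. norm (star R * y * R - c *\<^sub>C 1) \<le> 1 / real (Suc n)"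
      by (rule scalar_compression_finite) auto
    then obtain R where "R \<in> isom" "\<And>j. j \<le> n \<Longrightarrow> \<exists>c. norm (star R * (star S * d j * S) * R - c *\<^sub>C 1) \<le> 1 / real (Suc n)"
      by auto
    then show ?thesis
      using that by (intro bexI[of _ R]) (auto simp: good_def star_mult mult.assoc intro: B.isometries_mult)
  qed
  have "\<exists>S. \<forall>n. good n (S n) \<and> (\<exists>R\<in>isom. S (Suc n) = S n * R)"
  proof (rule dependent_nat_choice)
    show "\<exists>x. good 0 x"
      using step[OF B.isometries_one] by auto
    fix S n assume "good n S"
    then show "\<exists>y. good (Suc n) y \<and> (\<exists>R\<in>isom. y = S * R)"
      using step[of S "Suc n"] by (auto simp: good_def)
  qed
  then obtain S where S: "\<And>n. good n (S n)" "\<And>n. \<exists>R\<in>isom. S (Suc n) = S n * R"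
    by blast
  have later: "\<exists>R\<in>isom. S (n + k) = S n * R" for n k
  proof (induction k)
    case 0
    then show ?case by (intro bexI[of _ 1]) simp_all
  next
    case (Suc k)
    then obtain R where R: "R \<in> isom" "S (n + k) = S n * R" by blast
    obtain R' where R': "R' \<in> isom" "S (Suc (n + k)) = S (n + k) * R'" using S(2) by blast
    show ?case
      using R R' by (intro bexI[of _ "R * R'"]) (auto simp: mult.assoc intro: B.isometries_mult)
  qed
  have near: "\<exists>N c. \<forall>n\<ge>N. norm (star (S n) * y * S n - c *\<^sub>C 1) \<le> \<epsilon>" if "0 < \<epsilon>" for y \<epsilon>
  proof -
    have "y \<in> closure D" using D by simp
    then obtain j where j: "dist (d j) y < \<epsilon>/2"
      using d \<open>0 < \<epsilon>\<close> by (metis closure_approachable half_gt_zero rangeE)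
    obtain N where N: "1 / real (Suc N) < \<epsilon>/2"
      using \<open>0 < \<epsilon>\<close> nat_approx_posE[of "\<epsilon>/2"] by auto
    define M where "M = max N j"
    have "1 / real (Suc M) \<le> 1 / real (Suc N)" by (simp add: M_def frac_le)
    moreover obtain c where c: "norm (star (S M) * d j * S M - c *\<^sub>C 1) \<le> 1 / real (Suc M)"
      using S(1)[of M] unfolding good_def M_def by (meson max.cobounded2)
    ultimately have c': "norm (star (S M) * d j * S M - c *\<^sub>C 1) \<le> \<epsilon>/2"
      using N by linarith
    have "norm (star (S n) * y * S n - c *\<^sub>C 1) \<le> \<epsilon>" if "M \<le> n" for n
    proof -
      obtain R where R: "R \<in> isom" "S n = S M * R"
        using later[of M "n - M"] \<open>M \<le> n\<close> by (metis le_add_diff_inverse)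
      have "star R * R = 1" using R(1) by (rule B.isometriesD)
      then have "norm (star R * (star (S M) * d j * S M) * R - c *\<^sub>C 1) \<le> \<epsilon>/2"
        using norm_conj_isometry_diff_le c' order.trans by blast
      then have 1: "norm (star (S n) * d j * S n - c *\<^sub>C 1) \<le> \<epsilon>/2"
        by (simp add: R(2) star_mult mult.assoc)
      have "star (S n) * S n = 1" using S(1)[of n] by (auto simp: good_def intro: B.isometriesD)
      then have "norm (star (S n) * (y - d j) * S n) \<le> \<epsilon>/2"
        using norm_conj_isometry_le[of "S n" "y - d j"] j by (simp add: dist_norm norm_minus_commute)
      then have "norm (star (S n) * (y - d j) * S n + (star (S n) * d j * S n - c *\<^sub>C 1)) \<le> \<epsilon>/2 + \<epsilon>/2"
        using 1 by (intro norm_triangle_le add_mono)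
      then show ?thesis by (simp add: algebra_simps)
    qed
    then show ?thesis by blast
  qed
  have "\<exists>c. (\<lambda>n. star (S n) * y * S n) \<longlonglongrightarrow> c *\<^sub>C 1" for y
  proof -
    have "Cauchy (\<lambda>n. star (S n) * y * S n)"
    proof (rule metric_CauchyI)
      fix e :: real assume "0 < e"
      then obtain N c where N: "\<And>n. N \<le> n \<Longrightarrow> norm (star (S n) * y * S n - c *\<^sub>C 1) \<le> e/4"
        using near[of "e/4" y] by auto
      have "dist (star (S m) * y * S m) (star (S n) * y * S n) < e" if "N \<le> m" "N \<le> n" for m n
      proof -
        have "dist (star (S m) * y * S m) (c *\<^sub>C 1) \<le> e/4" "dist (star (S n) * y * S n) (c *\<^sub>C 1) \<le> e/4"
          using N that by (auto simp: dist_norm)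
        then show ?thesis
          using dist_triangle2[of "star (S m) * y * S m" "star (S n) * y * S n" "c *\<^sub>C 1"] \<open>0 < e\<close> by linarith
      qed
      then show "\<exists>M. \<forall>m\<ge>M. \<forall>n\<ge>M. dist (star (S m) * y * S m) (star (S n) * y * S n) < e"
        by blast
    qed
    then obtain l where l: "(\<lambda>n. star (S n) * y * S n) \<longlonglongrightarrow> l"
      by (auto simp: Cauchy_convergent_iff convergent_def)
    have "l \<in> closure scalars"
      unfolding closure_approachable
    proof (intro allI impI)
      fix e :: real assume "0 < e"
      then obtain N c where N: "\<And>n. N \<le> n \<Longrightarrow> norm (star (S n) * y * S n - c *\<^sub>C 1) \<le> e/2"
        using near[of "e/2" y] by auto
      have "(\<lambda>n. norm (star (S n) * y * S n - c *\<^sub>C 1)) \<longlonglongrightarrow> norm (l - c *\<^sub>C 1)"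
        using l by (intro tendsto_intros)
      then have "norm (l - c *\<^sub>C 1) \<le> e/2"
        by (rule LIMSEQ_le_const2) (use N in blast)
      then have "dist (c *\<^sub>C 1) l < e"
        using \<open>0 < e\<close> by (simp add: dist_norm norm_minus_commute)
      then show "\<exists>y\<in>scalars. dist y l < e"
        by (auto simp: scalars_def)
    qed
    then have "l \<in> scalars"
      using closed_scalars by simp
    with l show ?thesis by (auto simp: scalars_def)
  qed
  then obtain \<omega> where "\<And>y. (\<lambda>n. star (S n) * y * S n) \<longlonglongrightarrow> \<omega> y *\<^sub>C 1"
    by metis
  moreover have "S n \<in> isom" for n
    using S(1)[of n] by (simp add: good_def)
  ultimately show thesis by (rule that[rotated])
qed

end

section \<open>Approximation of positive functionals\<close>

text \<open>A closest point argument in a cone of functions on a finite set.\<close>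

lemma cone_near_separation:
  fixes C :: "('y \<Rightarrow> complex) set" and v :: "'y \<Rightarrow> complex"
  assumes "finite Y" and C0: "(\<lambda>_. 0) \<in> C"
    and C_add: "\<And>c c'. c \<in> C \<Longrightarrow> c' \<in> C \<Longrightarrow> (\<lambda>y. c y + c' y) \<in> C"
    and C_scale: "\<And>c t. c \<in> C \<Longrightarrow> 0 \<le> t \<Longrightarrow> (\<lambda>y. complex_of_real t * c y) \<in> C"
    and "0 < \<epsilon>" and far: "\<And>c. c \<in> C \<Longrightarrow> \<exists>y\<in>Y. \<epsilon> \<le> cmod (v y - c y)"
  obtains \<delta> where "0 < \<delta>" "\<And>\<eta>. 0 < \<eta> \<Longrightarrow> \<exists>r. \<delta> \<le> (\<Sum>y\<in>Y. Re (cnj (r y) * v y)) \<and>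
    (\<forall>c\<in>C. (\<Sum>y\<in>Y. Re (cnj (r y) * c y)) \<le> \<eta> * (\<Sum>y\<in>Y. cmod (c y)))"
proof -
  define N where "N c = (\<Sum>y\<in>Y. (cmod (c y))\<^sup>2)" for c :: "'y \<Rightarrow> complex"
  define ip where "ip r c = (\<Sum>y\<in>Y. Re (cnj (r y) * c y))" for r c :: "'y \<Rightarrow> complex"
  have N_nonneg: "0 \<le> N c" for c by (simp add: N_def sum_nonneg)
  have expand: "N (\<lambda>y. r y - complex_of_real t * c y) = N r - 2 * t * ip r c + t\<^sup>2 * N c" for r t c
    unfolding N_def ip_def sum_distrib_left sum.distrib[symmetric] sum_subtractf[symmetric]
    by (intro sum.cong refl) (simp add: cmod_power2, simp add: power2_eq_square algebra_simps)
  define X where "X = (\<lambda>c. N (\<lambda>y. v y - c y)) ` C"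
  define d where "d = Inf X"
  have X: "X \<noteq> {}" "bdd_below X"
    using C0 N_nonneg by (auto simp: X_def intro!: bdd_belowI[of _ 0])
  have d_le: "d \<le> N (\<lambda>y. v y - c y)" if "c \<in> C" for c
    unfolding d_def using that X(2) by (intro cInf_lower) (auto simp: X_def)
  have "\<epsilon>\<^sup>2 \<le> d"
    unfolding d_def
  proof (rule cInf_greatest[OF X(1)])
    fix x assume "x \<in> X"
    then obtain c where c: "c \<in> C" "x = N (\<lambda>y. v y - c y)" by (auto simp: X_def)
    obtain y where y: "y \<in> Y" "\<epsilon> \<le> cmod (v y - c y)" using far[OF c(1)] by blast
    have "\<epsilon>\<^sup>2 \<le> (cmod (v y - c y))\<^sup>2"
      using y \<open>0 < \<epsilon>\<close> by (intro power_mono) auto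
    also have "\<dots> \<le> x"
      unfolding c(2) N_def using y \<open>finite Y\<close> by (intro member_le_sum) auto
    finally show "\<epsilon>\<^sup>2 \<le> x" .
  qed
  then have d: "0 < d" using \<open>0 < \<epsilon>\<close> by (smt (verit) zero_less_power)
  \<comment> \<open>A bound for the squared length of c = v - r, valid whenever that of r is below d
    + 1.\<close>
  define K where "K = 2 * N v + 2 * (d + 1)"
  have K: "0 \<le> K" using N_nonneg[of v] d by (simp add: K_def)
  have main: "\<exists>r. d - \<eta> * (1 + K) \<le> ip r v \<and> (\<forall>c\<in>C. ip r c \<le> \<eta> * (\<Sum>y\<in>Y. cmod (c y)))"
    if \<eta>: "0 < \<eta>" "\<eta> \<le> 1" for \<eta>
  proof -
    have "Inf X < d + \<eta>\<^sup>2" using \<eta> by (simp add: d_def)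
    then obtain c where c: "c \<in> C" "N (\<lambda>y. v y - c y) < d + \<eta>\<^sup>2"
      using cInf_lessD[OF X(1)] unfolding X_def by blast
    \<comment> \<open>The infimum need not be attained, so the residual of a near-minimiser serves
      as separating vector. The slack \<eta>^2 costs only order \<eta> in the inequalities
      below.\<close>
    define r where "r = (\<lambda>y. v y - c y)"
    have Nr: "N r < d + \<eta>\<^sup>2" using c(2) by (simp add: r_def)
    have cone: "ip r c' \<le> \<eta> * (\<Sum>y\<in>Y. cmod (c' y))" if c': "c' \<in> C" for c'
    proof (cases "N c' = 0")
      case True
      then have "c' y = 0" if "y \<in> Y" for y
        using that \<open>finite Y\<close> by (simp add: N_def sum_nonneg_eq_0_iff)
      then show ?thesis by (simp add: ip_def)
    next
      case False
      define s where "s = sqrt (N c')"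
      have s: "0 < s" "s\<^sup>2 = N c'" using False N_nonneg[of c'] by (auto simp: s_def)
      \<comment> \<open>A step of length \<eta> in the direction c': the quadratic term equals the
        slack \<eta>^2.\<close>
      define t where "t = \<eta> / s"
      have t: "0 < t" using s \<eta> by (simp add: t_def)
      have "d \<le> N (\<lambda>y. v y - (c y + complex_of_real t * c' y))"
        using t by (intro d_le C_add c C_scale c') auto
      also have "\<dots> = N (\<lambda>y. r y - complex_of_real t * c' y)"
        by (simp add: r_def algebra_simps)
      also have "\<dots> = N r - 2 * t * ip r c' + \<eta>\<^sup>2"
        using s False by (simp only: expand) (simp add: t_def power_divide)
      finally have "2 * (t * ip r c') \<le> 2 * \<eta>\<^sup>2" using Nr by simp
      then have "\<eta> * ip r c' \<le> \<eta> * (\<eta> * s)"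
        using s by (simp add: t_def field_simps power2_eq_square)
      then have "ip r c' \<le> \<eta> * s" using \<eta> by simp
      moreover have "s \<le> (\<Sum>y\<in>Y. cmod (c' y))"
        using L2_set_le_sum[of Y "\<lambda>y. cmod (c' y)"] by (simp add: s_def N_def L2_set_def)
      ultimately show ?thesis
        using \<eta> by (meson less_imp_le mult_left_mono order.trans)
    qed
    \<comment> \<open>Shrinking c within the cone shows that r is nearly nonnegative on c, so that
      its pairing with v = r + c is nearly as large as d.\<close>
    have "d \<le> N (\<lambda>y. v y - complex_of_real (1 - \<eta>) * c y)"
      using \<eta> by (intro d_le C_scale c) auto
    also have "\<dots> = N (\<lambda>y. r y - complex_of_real (- \<eta>) * c y)"
      by (simp add: r_def algebra_simps)
    also have "\<dots> = N r + 2 * \<eta> * ip r c + \<eta>\<^sup>2 * N c"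
      unfolding expand by simp
    finally have "0 \<le> \<eta> * (\<eta> + 2 * ip r c + \<eta> * N c)"
      using Nr by (simp add: power2_eq_square algebra_simps)
    then have "0 \<le> \<eta> + 2 * ip r c + \<eta> * N c"
      using \<eta> by (simp add: zero_le_mult_iff)
    moreover have "N c \<le> K"
    proof -
      have "(cmod (c y))\<^sup>2 \<le> 2 * (cmod (v y))\<^sup>2 + 2 * (cmod (r y))\<^sup>2" for y
      proof -
        have "(cmod (v y - r y))\<^sup>2 \<le> (cmod (v y) + cmod (r y))\<^sup>2"
          by (intro power_mono norm_triangle_ineq4) auto
        also have "\<dots> \<le> 2 * (cmod (v y))\<^sup>2 + 2 * (cmod (r y))\<^sup>2"
          using sum_squares_bound[of "cmod (v y)" "cmod (r y)"] by (simp add: power2_sum)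
        finally show ?thesis by (simp add: r_def)
      qed
      then have "N c \<le> 2 * N v + 2 * N r"
        unfolding N_def sum_distrib_left sum.distrib[symmetric] by (intro sum_mono)
      moreover have "\<eta>\<^sup>2 \<le> 1" using \<eta> by (simp add: power_le_one)
      ultimately show ?thesis using Nr by (simp add: K_def)
    qed
    then have "\<eta> * N c \<le> \<eta> * K" using \<eta> by simp
    ultimately have ipc: "- (\<eta> * (1 + K)) / 2 \<le> ip r c" by (simp add: algebra_simps)
    have "ip r v = N r + ip r c"
      unfolding ip_def N_def sum.distrib[symmetric]
      by (intro sum.cong refl) (simp add: r_def cmod_power2, simp add: power2_eq_square algebra_simps)
    moreover have "d \<le> N r" using d_le[OF c(1)] by (simp add: r_def)
    moreover have "0 \<le> \<eta> * (1 + K)" using \<eta> K by simp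
    ultimately have "d - \<eta> * (1 + K) \<le> ip r v" using ipc by linarith
    with cone show ?thesis by blast
  qed
  show thesis
  proof (rule that[of "d/2"])
    show "0 < d/2" using d by simp
    fix \<eta> :: real assume \<eta>: "0 < \<eta>"
    define \<eta>' where "\<eta>' = min (min \<eta> 1) (d / (2 * (1 + K)))"
    have \<eta>': "0 < \<eta>'" "\<eta>' \<le> 1" "\<eta>' \<le> \<eta>" "\<eta>' \<le> d / (2 * (1 + K))"
      using \<eta> d K by (auto simp: \<eta>'_def)
    then have "\<eta>' * (1 + K) \<le> d / 2"
      using K by (simp add: pos_le_divide_eq algebra_simps)
    moreover obtain r where r: "d - \<eta>' * (1 + K) \<le> ip r v"
      "\<And>c. c \<in> C \<Longrightarrow> ip r c \<le> \<eta>' * (\<Sum>y\<in>Y. cmod (c y))"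
      using main[OF \<eta>'(1,2)] by blast
    moreover have "\<eta>' * (\<Sum>y\<in>Y. cmod (c y)) \<le> \<eta> * (\<Sum>y\<in>Y. cmod (c y))" for c
      using \<eta>' by (intro mult_right_mono sum_nonneg) auto
    ultimately show "\<exists>r. d/2 \<le> (\<Sum>y\<in>Y. Re (cnj (r y) * v y)) \<and>
      (\<forall>c\<in>C. (\<Sum>y\<in>Y. Re (cnj (r y) * c y)) \<le> \<eta> * (\<Sum>y\<in>Y. cmod (c y)))"
      unfolding ip_def[symmetric] by (intro exI[of _ r]) (fastforce intro: order.trans)
  qed
qed

section \<open>The state given by a compressing sequence\<close>

locale kirchberg_state = kirchberg_action G \<alpha>
  for G :: "('g, 'm) monoid_scheme" (structure) and \<alpha> :: "'g \<Rightarrow> 'a::unital_cstar_algebra \<Rightarrow> 'a" +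
  fixes S :: "nat \<Rightarrow> 'a" and \<omega> :: "'a \<Rightarrow> complex"
  assumes S_isom: "S n \<in> isom"
    and S_lim: "(\<lambda>n. star (S n) * y * S n) \<longlonglongrightarrow> \<omega> y *\<^sub>C 1"
begin

lemma \<omega>_eqI: "(\<lambda>n. star (S n) * y * S n) \<longlonglongrightarrow> c *\<^sub>C 1 \<Longrightarrow> \<omega> y = c"
  using LIMSEQ_unique[OF S_lim[of y]] by (metis scaleC_one_cancel)

lemma \<omega>_add: "\<omega> (x + y) = \<omega> x + \<omega> y"
  using tendsto_add[OF S_lim[of x] S_lim[of y]]
  by (intro \<omega>_eqI) (simp add: algebra_simps scaleC_add_left)

lemma \<omega>_scaleC: "\<omega> (c *\<^sub>C x) = c * \<omega> x"
  using bounded_linear.tendsto[OF bounded_linear_scaleC S_lim[of x], of c]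
  by (intro \<omega>_eqI) (simp add: scaleC_simps)

lemma \<omega>_zero: "\<omega> 0 = 0"
  using \<omega>_scaleC[of 0 0] by simp

lemma \<omega>_diff: "\<omega> (x - y) = \<omega> x - \<omega> y"
  using \<omega>_add[of x "- y"] \<omega>_scaleC[of "-1" y] by (simp add: scaleC_minus_left)

lemma \<omega>_scaleR: "\<omega> (r *\<^sub>R x) = complex_of_real r * \<omega> x"
  by (metis \<omega>_scaleC scaleC_of_real)

lemma \<omega>_sum: "\<omega> (sum f I) = (\<Sum>i\<in>I. \<omega> (f i))"
  by (induction I rule: infinite_finite_induct) (simp_all add: \<omega>_add \<omega>_zero)

lemma \<omega>_star: "\<omega> (star x) = cnj (\<omega> x)"
  using bounded_linear.tendsto[OF bounded_linear_star S_lim[of x]]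
  by (intro \<omega>_eqI) (simp add: star_simps mult.assoc)

lemma \<omega>_fixed:
  assumes "\<And>n. star (S n) * x * S n = c *\<^sub>C 1"
  shows "\<omega> x = c"
  by (rule \<omega>_eqI) (simp add: assms)

lemma \<omega>_one: "\<omega> 1 = 1"
  by (rule \<omega>_fixed) (simp add: B.isometriesD(2)[OF S_isom])

lemma \<omega>_E: "\<omega> (E x) = \<omega> x"
proof (rule \<omega>_eqI)
  have "(\<lambda>n. E (star (S n) * x * S n)) \<longlonglongrightarrow> E (\<omega> x *\<^sub>C 1)"
    by (rule bounded_linear.tendsto[OF bounded_linear_E S_lim])
  then show "(\<lambda>n. star (S n) * E x * S n) \<longlonglongrightarrow> \<omega> x *\<^sub>C 1"
    using B.isometriesD(1)[OF S_isom]
    by (simp add: E_mult_left E_mult_right B.star_in E_fixed B.scaleC_in)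
qed

lemma cmod_\<omega>_le: "cmod (\<omega> x) \<le> norm x"
proof (rule LIMSEQ_le_const2)
  show "(\<lambda>n. norm (star (S n) * x * S n)) \<longlonglongrightarrow> cmod (\<omega> x)"
    using tendsto_norm[OF S_lim[of x]] by simp
  show "\<exists>N. \<forall>n\<ge>N. norm (star (S n) * x * S n) \<le> norm x"
    using norm_conj_isometry_le B.isometriesD(2)[OF S_isom] by blast
qed

lemma \<omega>_cpos:
  assumes "cpos x"
  shows "0 \<le> Re (\<omega> x)" "Im (\<omega> x) = 0"
proof -
  have "\<omega> x = cnj (\<omega> x)"
    using \<omega>_star[of x] cpos_selfadjoint[OF assms] by simp
  then show "Im (\<omega> x) = 0"
    by (simp add: complex_eq_iff)
  then have "\<omega> x = complex_of_real (Re (\<omega> x))"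
    by (simp add: complex_eq_iff)
  moreover have "cpos (\<omega> x *\<^sub>C (1::'a))"
    using cpos_LIMSEQ[of "\<lambda>n. star (S n) * x * S n", OF cpos_conj[OF assms] S_lim] .
  ultimately have "cpos (of_real (Re (\<omega> x)) :: 'a)"
    by (metis of_real_eq_scaleC)
  then show "0 \<le> Re (\<omega> x)"
    by (simp add: cpos_of_real)
qed

text \<open>\<open>|\<omega>(D\<^sup>*yD)| \<le> \<parallel>y\<parallel> \<omega>(D\<^sup>*D)\<close>, by rotating \<open>y\<close> such that \<open>\<omega>(D\<^sup>*yD) \<ge> 0\<close>.\<close>

lemma cmod_\<omega>_conj_le: "cmod (\<omega> (star D * y * D)) \<le> norm y * Re (\<omega> (star D * D))"
proof (cases "\<omega> (star D * y * D) = 0")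
  case True
  then show ?thesis using \<omega>_cpos(1)[OF cpos_star_mult_self[of D]] by simp
next
  case False
  define c where "c = cnj (\<omega> (star D * y * D)) / complex_of_real (cmod (\<omega> (star D * y * D)))"
  define z where "z = c *\<^sub>C y"
  have "cmod c = 1"
    using False by (simp add: c_def norm_divide)
  then have nz: "norm z = norm y" by (simp add: z_def norm_scaleC)
  have "\<omega> (star D * z * D) = c * \<omega> (star D * y * D)"
    by (simp add: z_def scaleC_simps \<omega>_scaleC)
  also have "\<dots> = complex_of_real (cmod (\<omega> (star D * y * D)))"
    using False by (simp add: c_def power2_eq_square complex_norm_square[symmetric] mult.commute)
  finally have eq: "\<omega> (star D * z * D) = complex_of_real (cmod (\<omega> (star D * y * D)))" .
  have "norm (z + star z) \<le> 2 * norm y"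
    using norm_triangle_ineq[of z "star z"] nz by simp
  then have "cpos (of_real (2 * norm y) - (z + star z))"
    by (intro cpos_norm_minus) (simp_all add: star_simps add.commute)
  from \<omega>_cpos(1)[OF cpos_conj[OF this, of D]]
  have "0 \<le> Re (\<omega> (of_real (2 * norm y) * (star D * D)) - (\<omega> (star D * z * D) + \<omega> (star (star D * z * D))))"
    by (simp add: algebra_simps \<omega>_diff \<omega>_add star_simps scaleR_conv_of_real[symmetric] of_real_def)
  then have "0 \<le> 2 * norm y * Re (\<omega> (star D * D)) - 2 * cmod (\<omega> (star D * y * D))"
    using \<omega>_scaleR[of "2 * norm y" "star D * D"] by (simp add: \<omega>_star eq scaleR_conv_of_real)
  then show ?thesis by simp
qed

text \<open>If norm y - y had norm larger than norm y, an isometry D of \<open>B\<close> near that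
  norm would make \<omega>(D^*yD) negative. So the functionals \<omega>(D^* . D) detect positivity
  in \<open>B\<close>.\<close>

lemma cpos_of_\<omega>_conj:
  assumes "y \<in> B" "star y = y" "\<And>D. D \<in> B \<Longrightarrow> 0 \<le> Re (\<omega> (star D * y * D))"
  shows "cpos y"
proof -
  define h where "h = of_real (norm y) - y"
  have h: "h \<in> B" "cpos h"
    unfolding h_def using assms by (auto intro: B.diff_in cpos_norm_minus)
  have "norm h \<le> norm y"
  proof (rule ccontr)
    assume "\<not> norm h \<le> norm y"
    then have lt: "norm y < norm h" by simp
    then have "h \<noteq> 0" using norm_ge_zero[of y] by auto
    define \<tau> where "\<tau> = (norm h - norm y) / 2"
    have "0 < \<tau>" using lt by (simp add: \<tau>_def)
    then obtain D where D: "D \<in> isom" "norm (h * D - norm h *\<^sub>R D) \<le> \<tau>"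
      using B.isometry_near_norm[OF h \<open>h \<noteq> 0\<close>] by blast
    have DB: "D \<in> B" "star D * D = 1" using D(1) by (rule B.isometriesD)+
    have "star D * h * D - of_real (norm h) = star D * (h * D - norm h *\<^sub>R D)"
      using DB by (simp add: algebra_simps of_real_def)
    also have "norm \<dots> \<le> norm (star D) * norm (h * D - norm h *\<^sub>R D)"
      by (rule norm_mult_ineq)
    finally have "norm (star D * h * D - of_real (norm h)) \<le> \<tau>"
      using D B.isometries_norm[OF D(1)] by simp
    moreover have "star D * h * D - of_real (norm h) = of_real (norm y - norm h) - star D * y * D"
      using DB by (simp add: h_def algebra_simps of_real_def)
    ultimately have "cmod (\<omega> (of_real (norm y - norm h) - star D * y * D)) \<le> \<tau>"
      using cmod_\<omega>_le order.trans by metis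
    moreover have "\<omega> (of_real (norm y - norm h)) = complex_of_real (norm y - norm h)"
      using \<omega>_scaleR[of "norm y - norm h" 1] by (simp add: of_real_def \<omega>_one)
    ultimately have "\<bar>norm y - norm h - Re (\<omega> (star D * y * D))\<bar> \<le> \<tau>"
      using abs_Re_le_cmod[of "\<omega> (of_real (norm y - norm h) - star D * y * D)"] by (simp add: \<omega>_diff)
    then show False
      using assms(3)[OF DB(1)] \<open>0 < \<tau>\<close> by (simp add: \<tau>_def abs_le_iff field_simps)
  qed
  then show ?thesis
    using assms(2) unfolding cpos_def h_def by (intro conjI exI[of _ "norm y"]) auto
qed

lemma positive_functional_hermitian:
  fixes \<phi> :: "'a \<Rightarrow> complex"
  assumes add: "\<And>x y. x \<in> B \<Longrightarrow> y \<in> B \<Longrightarrow> \<phi> (x + y) = \<phi> x + \<phi> y"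
    and scale: "\<And>c x. x \<in> B \<Longrightarrow> \<phi> (c *\<^sub>C x) = c * \<phi> x"
    and pos: "\<And>x. x \<in> B \<Longrightarrow> cpos x \<Longrightarrow> 0 \<le> Re (\<phi> x) \<and> Im (\<phi> x) = 0"
    and "b \<in> B"
  shows "\<phi> (star b) = cnj (\<phi> b)"
proof -
  have real: "Im (\<phi> x) = 0" if x: "x \<in> B" "star x = x" for x
  proof -
    have "Im (\<phi> (of_real (norm x))) = 0"
      using pos[of "of_real (norm x)"] by (simp add: cpos_of_real)
    moreover have "cpos (of_real (norm x) - x)" "of_real (norm x) - x \<in> B"
      using x by (auto intro: cpos_norm_minus B.diff_in)
    then have "Im (\<phi> (of_real (norm x) - x)) = 0"
      using pos by blast
    moreover have "\<phi> (of_real (norm x) - x + x) = \<phi> (of_real (norm x) - x) + \<phi> x"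
      using x by (intro add B.diff_in) auto
    ultimately show ?thesis by simp
  qed
  define x where "x = (1/2) *\<^sub>R (b + star b)"
  define y where "y = (- \<i> / 2) *\<^sub>C (b - star b)"
  have xy: "star x = x" "star y = y" "b = x + \<i> *\<^sub>C y"
    unfolding x_def y_def by (rule cartesian_decomposition)+
  have B: "x \<in> B" "y \<in> B"
    unfolding x_def y_def using assms(4) by (auto intro!: B.closure_rules)
  have "\<phi> b = \<phi> x + \<i> * \<phi> y"
    unfolding xy(3) using B by (simp add: add scale B.scaleC_in)
  moreover have "star b = x + (- \<i>) *\<^sub>C y"
    unfolding xy(3) using xy(1,2) by (simp add: star_simps)
  then have "\<phi> (star b) = \<phi> x + (- \<i>) * \<phi> y"
    using B by (simp only: add scale B.scaleC_in)
  ultimately show ?thesis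
    using real[OF B(1) xy(1)] real[OF B(2) xy(2)] by (simp add: complex_eq_iff)
qed

text \<open>A positive functional far from the cone of sums of \<omega>(D^* . D) would yield a
  self-adjoint h in \<open>B\<close> with \<omega>(D^*hD) \<le> \<eta> K \<omega>(D^*D) for all D,
  yet Re \<phi>(h) \<ge> \<delta>. By the preceding criterion h \<le> \<eta> K, and positivity of
  \<phi> bounds Re \<phi>(h) by \<eta> K \<phi>(1), which is below \<delta>.\<close>

lemma positive_functional_approx:
  fixes \<phi> :: "'a \<Rightarrow> complex"
  assumes add: "\<And>x y. x \<in> B \<Longrightarrow> y \<in> B \<Longrightarrow> \<phi> (x + y) = \<phi> x + \<phi> y"
    and scale: "\<And>c x. x \<in> B \<Longrightarrow> \<phi> (c *\<^sub>C x) = c * \<phi> x"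
    and pos: "\<And>x. x \<in> B \<Longrightarrow> cpos x \<Longrightarrow> 0 \<le> Re (\<phi> x) \<and> Im (\<phi> x) = 0"
    and "finite Y" "Y \<subseteq> B" "0 < \<epsilon>"
  shows "\<exists>(m::nat) D. (\<forall>i<m. D i \<in> B) \<and>
    (\<forall>y\<in>Y. cmod (\<phi> y - (\<Sum>i<m. \<omega> (star (D i) * y * D i))) < \<epsilon>)"
proof (rule ccontr)
  assume contra: "\<not> (\<exists>(m::nat) D. (\<forall>i<m. D i \<in> B) \<and>
    (\<forall>y\<in>Y. cmod (\<phi> y - (\<Sum>i<m. \<omega> (star (D i) * y * D i))) < \<epsilon>))"
  define C where "C = {c. \<exists>(m::nat) D. (\<forall>i<m. D i \<in> B) \<and> c = (\<lambda>y. \<Sum>i<m. \<omega> (star (D i) * y * D i))}"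
  have CE: "\<exists>(m::nat) D. (\<forall>i<m. D i \<in> B) \<and> c = (\<lambda>y. \<Sum>i<m. \<omega> (star (D i) * y * D i))" if "c \<in> C" for c
    using that by (simp only: C_def mem_Collect_eq)
  have CI: "(\<lambda>y. \<Sum>i<m. \<omega> (star (D i) * y * D i)) \<in> C" if "\<forall>i<m. D i \<in> B" for m :: nat and D
    unfolding C_def by (intro CollectI exI[of _ m] exI[of _ D] conjI refl that)
  have far: "\<exists>y\<in>Y. \<epsilon> \<le> cmod (\<phi> y - c y)" if "c \<in> C" for c
  proof -
    obtain m :: nat and D where "\<forall>i<m. D i \<in> B" "c = (\<lambda>y. \<Sum>i<m. \<omega> (star (D i) * y * D i))"
      using CE[OF \<open>c \<in> C\<close>] by (elim exE conjE)
    then show ?thesis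
      using contra not_le by blast
  qed
  have C0: "(\<lambda>_. 0) \<in> C"
    using CI[of 0] by simp
  have C_add: "(\<lambda>y. c y + c' y) \<in> C" if "c \<in> C" "c' \<in> C" for c c'
  proof -
    obtain m :: nat and D where D: "\<forall>i<m. D i \<in> B" "c = (\<lambda>y. \<Sum>i<m. \<omega> (star (D i) * y * D i))"
      using CE[OF \<open>c \<in> C\<close>] by (elim exE conjE)
    obtain m' :: nat and D' where D': "\<forall>i<m'. D' i \<in> B" "c' = (\<lambda>y. \<Sum>i<m'. \<omega> (star (D' i) * y * D' i))"
      using CE[OF \<open>c' \<in> C\<close>] by (elim exE conjE)
    define D'' where "D'' i = (if i < m then D i else D' (i - m))" for i
    have "(\<Sum>i<m + k. \<omega> (star (D'' i) * y * D'' i))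
      = (\<Sum>i<m. \<omega> (star (D i) * y * D i)) + (\<Sum>i<k. \<omega> (star (D' i) * y * D' i))" for y k
      by (induction k) (simp_all add: D''_def)
    then have "(\<Sum>i<m + m'. \<omega> (star (D'' i) * y * D'' i)) = c y + c' y" for y
      unfolding D(2) D'(2) .
    moreover have "\<forall>i<m + m'. D'' i \<in> B"
      using D(1) D'(1) by (auto simp: D''_def)
    ultimately show ?thesis
      using CI[of "m + m'" D''] by simp
  qed
  have C_scale: "(\<lambda>y. complex_of_real t * c y) \<in> C" if "c \<in> C" "0 \<le> t" for c t
  proof -
    obtain m :: nat and D where D: "\<forall>i<m. D i \<in> B" "c = (\<lambda>y. \<Sum>i<m. \<omega> (star (D i) * y * D i))"
      using CE[OF \<open>c \<in> C\<close>] by (elim exE conjE)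
    have "(\<Sum>i<m. \<omega> (star (sqrt t *\<^sub>R D i) * y * (sqrt t *\<^sub>R D i))) = complex_of_real t * c y" for y
      unfolding D(2) using \<open>0 \<le> t\<close> by (simp add: star_scaleR \<omega>_scaleR sum_distrib_left)
    then show ?thesis
      using CI[of m "\<lambda>i. sqrt t *\<^sub>R D i"] D(1) by (simp add: B.scaleR_in)
  qed
  obtain \<delta> where \<delta>: "0 < \<delta>" "\<And>\<eta>. 0 < \<eta> \<Longrightarrow> \<exists>r. \<delta> \<le> (\<Sum>y\<in>Y. Re (cnj (r y) * \<phi> y)) \<and>
    (\<forall>c\<in>C. (\<Sum>y\<in>Y. Re (cnj (r y) * c y)) \<le> \<eta> * (\<Sum>y\<in>Y. cmod (c y)))"
    using cone_near_separation[OF \<open>finite Y\<close> C0 C_add C_scale \<open>0 < \<epsilon>\<close> far] by blast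
  define K where "K = (\<Sum>y\<in>Y. norm y)"
  define p where "p = Re (\<phi> 1)"
  have Kp: "0 \<le> K" "0 \<le> p"
    using pos[of 1] by (auto simp: K_def p_def sum_nonneg)
  \<comment> \<open>Chosen after p = \<phi>(1), so that \<eta> K p < \<delta>. The separation
    provides the same \<delta> for every \<eta>.\<close>
  define \<eta> where "\<eta> = \<delta> / (2 * (K * p + 1))"
  have \<eta>: "0 < \<eta>" using \<delta> Kp by (simp add: \<eta>_def add_nonneg_pos)
  obtain r where r: "\<delta> \<le> (\<Sum>y\<in>Y. Re (cnj (r y) * \<phi> y))"
    "\<And>c. c \<in> C \<Longrightarrow> (\<Sum>y\<in>Y. Re (cnj (r y) * c y)) \<le> \<eta> * (\<Sum>y\<in>Y. cmod (c y))"
    using \<delta>(2)[OF \<eta>] by blast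
  define y0 where "y0 = (\<Sum>y\<in>Y. cnj (r y) *\<^sub>C y)"
  have y0: "y0 \<in> B"
    unfolding y0_def using \<open>Y \<subseteq> B\<close> by (intro B.sum_in B.scaleC_in) auto
  have \<omega>_y0: "Re (\<omega> (star D * y0 * D)) \<le> \<eta> * K * Re (\<omega> (star D * D))" if D: "D \<in> B" for D
  proof -
    have "(\<lambda>y. \<omega> (star D * y * D)) \<in> C"
      using CI[of 1 "\<lambda>_. D"] D by simp
    from r(2)[OF this] have "(\<Sum>y\<in>Y. Re (cnj (r y) * \<omega> (star D * y * D))) \<le> \<eta> * (\<Sum>y\<in>Y. cmod (\<omega> (star D * y * D)))" .
    also have "\<dots> \<le> \<eta> * (\<Sum>y\<in>Y. norm y * Re (\<omega> (star D * D)))"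
      using \<eta> by (intro mult_left_mono sum_mono cmod_\<omega>_conj_le) auto
    also have "(\<Sum>y\<in>Y. Re (cnj (r y) * \<omega> (star D * y * D))) = Re (\<omega> (star D * y0 * D))"
      by (simp add: y0_def sum_distrib_left sum_distrib_right \<omega>_sum scaleC_simps \<omega>_scaleC)
    finally show ?thesis
      by (simp add: K_def sum_distrib_right mult.assoc)
  qed
  define h where "h = (1/2) *\<^sub>R (y0 + star y0)"
  have h: "h \<in> B" "star h = h"
    unfolding h_def using y0 by (auto simp: star_simps add.commute intro!: B.closure_rules)
  have \<omega>_h: "Re (\<omega> (star D * h * D)) = Re (\<omega> (star D * y0 * D))" for D
  proof -
    have "star D * star y0 * D = star (star D * y0 * D)"
      by (simp add: star_simps mult.assoc)
    then have "star D * h * D = (1/2) *\<^sub>R (star D * y0 * D + star (star D * y0 * D))"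
      by (simp add: h_def algebra_simps)
    then show ?thesis
      by (simp add: \<omega>_scaleR \<omega>_add \<omega>_star)
  qed
  define z where "z = of_real (\<eta> * K) - h"
  have zB: "z \<in> B" unfolding z_def using h(1) by (intro B.diff_in B.of_real_in)
  have "cpos z"
  proof (rule cpos_of_\<omega>_conj[OF zB])
    show "star z = z" using h by (simp add: z_def star_diff del: of_real_mult)
    fix D assume "D \<in> B"
    have "star D * z * D = (\<eta> * K) *\<^sub>R (star D * D) - star D * h * D"
      by (simp add: z_def algebra_simps of_real_def)
    then show "0 \<le> Re (\<omega> (star D * z * D))"
      using \<omega>_y0[OF \<open>D \<in> B\<close>] \<omega>_h by (simp add: \<omega>_diff \<omega>_scaleR)
  qed
  then have \<phi>z: "0 \<le> Re (\<phi> z)" using pos zB by blast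
  have "\<phi> (z + h) = \<phi> z + \<phi> h" using zB h by (intro add)
  moreover have "z + h = complex_of_real (\<eta> * K) *\<^sub>C 1"
    unfolding of_real_eq_scaleC[where 'a='a, symmetric] by (simp add: z_def)
  then have "\<phi> (z + h) = complex_of_real (\<eta> * K) * \<phi> 1"
    by (metis scale B.one_in)
  ultimately have "\<phi> z + \<phi> h = complex_of_real (\<eta> * K) * \<phi> 1"
    by (simp only:)
  from arg_cong[OF this, of Re] have "Re (\<phi> z) + Re (\<phi> h) = \<eta> * K * p"
    by (simp add: p_def)
  then have "Re (\<phi> h) \<le> \<eta> * K * p"
    using \<phi>z by linarith
  moreover have "Re (\<phi> h) = Re (\<phi> y0)"
  proof -
    have "h = complex_of_real (1/2) *\<^sub>C (y0 + star y0)"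
      unfolding h_def by (rule scaleC_of_real[symmetric])
    then have "\<phi> h = complex_of_real (1/2) * (\<phi> y0 + \<phi> (star y0))"
      using y0 by (simp only: scale add B.add_in B.star_in)
    also have "\<phi> (star y0) = cnj (\<phi> y0)"
      by (rule positive_functional_hermitian[OF add scale pos y0])
    finally have "Re (\<phi> h) = Re (complex_of_real (1/2) * (\<phi> y0 + cnj (\<phi> y0)))"
      by (rule arg_cong)
    then show ?thesis by simp
  qed
  moreover have "(\<Sum>y\<in>Y. Re (cnj (r y) * \<phi> y)) = Re (\<phi> y0)"
  proof -
    have "\<phi> (\<Sum>y\<in>Y'. cnj (r y) *\<^sub>C y) = (\<Sum>y\<in>Y'. cnj (r y) * \<phi> y)" if "Y' \<subseteq> Y" for Y'
      using finite_subset[OF that \<open>finite Y\<close>] that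
    proof (induction Y')
      case empty
      then show ?case using scale[of 0 0] by simp
    next
      case (insert y Y')
      then have "(\<Sum>y\<in>Y'. cnj (r y) *\<^sub>C y) \<in> B" "y \<in> B"
        using \<open>Y \<subseteq> B\<close> by (auto intro!: B.sum_in B.scaleC_in)
      with insert show ?case by (simp add: add scale B.scaleC_in)
    qed
    from this[of Y] show ?thesis by (simp add: y0_def)
  qed
  ultimately have "\<delta> \<le> \<eta> * K * p" using r(1) by simp
  moreover have "\<eta> * K * p < \<delta>"
  proof -
    have "\<eta> * (K * p + 1) = \<delta> / 2"
      using Kp add_nonneg_pos[of "K * p" 1] by (simp add: \<eta>_def field_simps)
    then show ?thesis using \<eta> \<delta> by (simp add: algebra_simps)
  qed
  ultimately show False by simp
qed

text \<open>After expansion the isometry occurs only in the form R^* (u_p^* z u_q) R. There are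
  finitely many such middle terms, and a late member of the compressing sequence makes all of them
  nearly scalar at once.\<close>

lemma isometry_sandwich_approx:
  assumes "finite P" "finite Z" "0 < \<epsilon>"
  obtains R where "R \<in> isom" "\<And>z. z \<in> Z \<Longrightarrow>
    norm (star (\<Sum>p\<in>P. u p * R * v p) * z * (\<Sum>p\<in>P. u p * R * v p)
      - (\<Sum>p\<in>P. \<Sum>q\<in>P. \<omega> (star (u p) * z * u q) *\<^sub>C (star (v p) * v q))) \<le> \<epsilon>"
proof -
  define K where "K = (\<Sum>p\<in>P. \<Sum>q\<in>P. norm (v p) * norm (v q))"
  have K: "0 \<le> K" by (simp add: K_def sum_nonneg)
  define \<delta> where "\<delta> = \<epsilon> / (K + 1)"
  have \<delta>: "0 < \<delta>" using assms K by (simp add: \<delta>_def)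
  have "\<delta> * (K + 1) = \<epsilon>" using K by (simp add: \<delta>_def)
  then have \<delta>K: "\<delta> * K \<le> \<epsilon>" using \<delta> by (simp add: algebra_simps)
  define Y where "Y = (\<lambda>(z, p, q). star (u p) * z * u q) ` (Z \<times> P \<times> P)"
  have "finite Y" using assms by (simp add: Y_def)
  have "\<forall>y\<in>Y. \<forall>\<^sub>F n in sequentially. dist (star (S n) * y * S n) (\<omega> y *\<^sub>C 1) < \<delta>"
    using tendstoD[OF S_lim \<delta>] by blast
  then have "\<forall>\<^sub>F n in sequentially. \<forall>y\<in>Y. dist (star (S n) * y * S n) (\<omega> y *\<^sub>C 1) < \<delta>"
    using \<open>finite Y\<close> by (simp add: eventually_ball_finite)
  then obtain n where n: "\<And>y. y \<in> Y \<Longrightarrow> dist (star (S n) * y * S n) (\<omega> y *\<^sub>C 1) < \<delta>"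
    by (auto simp: eventually_sequentially)
  show thesis
  proof (rule that[OF S_isom[of n]])
    fix z assume z: "z \<in> Z"
    have "star (\<Sum>p\<in>P. u p * S n * v p) * z * (\<Sum>p\<in>P. u p * S n * v p)
      = (\<Sum>p\<in>P. \<Sum>q\<in>P. star (u p * S n * v p) * z * (u q * S n * v q))"
      by (simp only: star_sum sum_distrib_right) (simp only: sum_distrib_left)
    then have "star (\<Sum>p\<in>P. u p * S n * v p) * z * (\<Sum>p\<in>P. u p * S n * v p)
      - (\<Sum>p\<in>P. \<Sum>q\<in>P. \<omega> (star (u p) * z * u q) *\<^sub>C (star (v p) * v q))
      = (\<Sum>p\<in>P. \<Sum>q\<in>P. star (v p) * (star (S n) * (star (u p) * z * u q) * S n - \<omega> (star (u p) * z * u q) *\<^sub>C 1) * v q)"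
      by (simp only: sum_subtractf[symmetric], intro sum.cong refl)
        (simp add: star_mult algebra_simps scaleC_simps)
    also have "norm \<dots> \<le> (\<Sum>p\<in>P. \<Sum>q\<in>P. norm (v p) * \<delta> * norm (v q))"
    proof (intro sum_norm_le)
      fix p q assume "p \<in> P" "q \<in> P"
      then have "star (u p) * z * u q \<in> Y"
        unfolding Y_def using z by (intro image_eqI[of _ _ "(z, p, q)"]) auto
      then have "norm (star (S n) * (star (u p) * z * u q) * S n - \<omega> (star (u p) * z * u q) *\<^sub>C 1) \<le> \<delta>"
        using n by (fastforce simp: dist_norm)
      then show "norm (star (v p) * (star (S n) * (star (u p) * z * u q) * S n - \<omega> (star (u p) * z * u q) *\<^sub>C 1) * v q)
        \<le> norm (v p) * \<delta> * norm (v q)"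
        by (intro order.trans[OF norm_mult_ineq] mult_right_mono order.trans[OF norm_mult_ineq])
          (auto intro: mult_left_mono)
    qed
    also have "\<dots> = \<delta> * K"
      by (simp add: K_def sum_distrib_left mult_ac)
    finally show "norm (star (\<Sum>p\<in>P. u p * S n * v p) * z * (\<Sum>p\<in>P. u p * S n * v p)
      - (\<Sum>p\<in>P. \<Sum>q\<in>P. \<omega> (star (u p) * z * u q) *\<^sub>C (star (v p) * v q))) \<le> \<epsilon>"
      using \<delta>K by linarith
  qed
qed

end

section \<open>Completely positive maps through matrix algebras\<close>

definition mk_fmat :: "nat \<Rightarrow> (nat \<Rightarrow> nat \<Rightarrow> 'a::zero) \<Rightarrow> 'a fmat"
  where "mk_fmat n f = Abs_fmat (\<lambda>i j. if i < n \<and> j < n then f i j else 0)"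

lemma entry_mk_fmat: "entry (mk_fmat n f) i j = (if i < n \<and> j < n then f i j else 0)"
  unfolding mk_fmat_def by (subst Abs_fmat_inverse) (auto intro: exI[of _ n])

lemma mk_fmat_in: "(\<And>i j. i < n \<Longrightarrow> j < n \<Longrightarrow> f i j \<in> C) \<Longrightarrow> mk_fmat n f \<in> matrices_over n C"
  by (auto simp: matrices_over_def entry_mk_fmat)

lemma entry_outside: "X \<in> matrices_over n C \<Longrightarrow> n \<le> i \<or> n \<le> j \<Longrightarrow> entry X i j = 0"
  by (auto simp: matrices_over_def)

lemma entry_star_times:
  assumes "X \<in> matrices_over n (C :: 'a::complex_star_algebra set)"
  shows "entry (star X * X) i j = (\<Sum>r<n. star (entry X r i) * entry X r j)"
  using entry_times'[of n X "star X" i j] entry_outside[OF assms] by (simp add: star_fmat.rep_eq)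

lemma positive_in_matrices_rows:
  assumes "positive_in (matrices_over n C) X"
  obtains y where "\<And>r i. r < n \<Longrightarrow> i < n \<Longrightarrow> y r i \<in> C"
    "\<And>i j. entry X i j = (\<Sum>r<n. star (y r i) * y r j)"
proof -
  obtain Y where "Y \<in> matrices_over n C" "X = star Y * Y"
    using assms by (auto simp: positive_in_def)
  then show thesis
    by (intro that[of "entry Y"]) (auto simp: entry_star_times matrices_over_def)
qed

text \<open>The witness has w as its row with index 0 and zeros elsewhere.\<close>

lemma positive_in_matrices_row:
  assumes "\<And>i. i < n \<Longrightarrow> w i \<in> C" "0 \<in> C"
  shows "positive_in (matrices_over n C) (mk_fmat n (\<lambda>i j. star (w i) * w j))"
proof -
  define Z where "Z = mk_fmat n (\<lambda>r j. if r = 0 then w j else 0)"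
  have Z: "Z \<in> matrices_over n C"
    unfolding Z_def using assms by (intro mk_fmat_in) auto
  have "mk_fmat n (\<lambda>i j. star (w i) * w j) = star Z * Z"
  proof (rule fmat_eqI)
    fix i j
    have "star (entry Z r i) * entry Z r j = (if r = 0 then if i < n \<and> j < n then star (w i) * w j else 0 else 0)"
      if "r < n" for r
      using that by (auto simp: Z_def entry_mk_fmat star_zero)
    then show "entry (mk_fmat n (\<lambda>i j. star (w i) * w j)) i j = entry (star Z * Z) i j"
      unfolding entry_star_times[OF Z] by (auto simp: entry_mk_fmat)
  qed
  with Z show ?thesis by (auto simp: positive_in_def)
qed

text \<open>The positivity condition of completely positive maps enters the sequel in this form: the
  image of a Gram matrix of n elements is again a Gram matrix.\<close>

lemma completely_positive_row:
  fixes n :: nat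
  assumes "completely_positive C D \<phi>" "\<And>i. i < n \<Longrightarrow> w i \<in> C" "0 \<in> C"
    and "\<And>x y. x \<in> C \<Longrightarrow> y \<in> C \<Longrightarrow> star x * y \<in> C"
  obtains y where "\<And>r i. r < n \<Longrightarrow> i < n \<Longrightarrow> y r i \<in> D"
    "\<And>i j. i < n \<Longrightarrow> j < n \<Longrightarrow> \<phi> (star (w i) * w j) = (\<Sum>r<n. star (y r i) * y r j)"
proof -
  have "positive_in (matrices_over n C) (mk_fmat n (\<lambda>i j. star (w i) * w j))"
    using assms(2,3) by (rule positive_in_matrices_row)
  moreover have "mk_fmat n (\<lambda>i j. star (w i) * w j) \<in> matrices_over n C"
    using assms(2,4) by (intro mk_fmat_in) auto
  ultimately have "positive_in (matrices_over n D) (amplification n \<phi> (mk_fmat n (\<lambda>i j. star (w i) * w j)))"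
    using assms(1) unfolding completely_positive_def by blast
  then obtain y where y: "\<And>r i. r < n \<Longrightarrow> i < n \<Longrightarrow> y r i \<in> D"
    "\<And>i j. entry (amplification n \<phi> (mk_fmat n (\<lambda>i j. star (w i) * w j))) i j = (\<Sum>r<n. star (y r i) * y r j)"
    by (rule positive_in_matrices_rows) (rule that)
  show thesis
  proof (rule that[of y])
    show "y r i \<in> D" if "r < n" "i < n" for r i
      using that by (rule y)
    show "\<phi> (star (w i) * w j) = (\<Sum>r<n. star (y r i) * y r j)" if "i < n" "j < n" for i j
      using y(2)[of i j] that by (simp add: entry_amplification entry_mk_fmat)
  qed
qed

lemma complex_linear_on_sum:
  assumes "complex_linear_on C \<phi>" "0 \<in> C" "\<And>x y. x \<in> C \<Longrightarrow> y \<in> C \<Longrightarrow> x + y \<in> C"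
    and "\<And>i. i \<in> I \<Longrightarrow> f i \<in> C"
  shows "\<phi> (sum f I) = (\<Sum>i\<in>I. \<phi> (f i))"
proof -
  have "\<phi> (0 *\<^sub>C 0) = 0 *\<^sub>C \<phi> 0"
    using assms(1,2) unfolding complex_linear_on_def by blast
  then have "\<phi> 0 = 0" by simp
  have "sum f I \<in> C \<and> \<phi> (sum f I) = (\<Sum>i\<in>I. \<phi> (f i))"
    using assms(4)
    by (induction I rule: infinite_finite_induct)
      (use assms(1-3) \<open>\<phi> 0 = 0\<close> in \<open>auto simp: complex_linear_on_def\<close>)
  then show ?thesis ..
qed

context kirchberg_state
begin

text \<open>
  The factorisation of the identity of \<open>B\<close> through \<open>M\<^sub>k\<close> is written as
  \<open>b \<mapsto> \<Sum> \<omega>(d\<^sub>i\<^sup>* b d\<^sub>j) c\<^sub>i\<^sup>* c\<^sub>j\<close>, and \<open>\<omega>\<close> is implemented by an isometry.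
\<close>

lemma nuclear_implementation:
  fixes \<theta> :: "'a \<Rightarrow> 'a"
  assumes \<theta>_add: "\<And>x y. \<theta> (x + y) = \<theta> x + \<theta> y"
    and \<theta>_scaleC: "\<And>c x. \<theta> (c *\<^sub>C x) = c *\<^sub>C \<theta> x"
    and \<theta>_B: "\<And>x. \<theta> x \<in> B"
    and \<theta>_bound: "\<And>x. norm (\<theta> x) \<le> K * norm x"
    and \<theta>_cp: "\<And>(k::nat) w t. (\<And>i. i < k \<Longrightarrow> w i \<in> B) \<Longrightarrow> (\<And>i. i < k \<Longrightarrow> t i \<in> B) \<Longrightarrow>
      cpos (\<Sum>i<k. \<Sum>j<k. t i * \<theta> (star (w i) * w j) * star (t j))"
    and "finite Z" "0 < \<epsilon>"
  shows "\<exists>W\<in>B. \<forall>z\<in>Z. norm (star W * z * W - \<theta> (E z)) \<le> \<epsilon>"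
proof -
  have "norm (\<theta> 1) \<le> K" using \<theta>_bound[of 1] by simp
  then have K: "0 \<le> K" using norm_ge_zero order.trans by blast
  have \<theta>_minus: "\<theta> (x - y) = \<theta> x - \<theta> y" for x y
    using \<theta>_add[of x "(-1) *\<^sub>C y"] \<theta>_scaleC[of "-1" y] by (simp add: scaleC_minus_left)
  have "\<theta> 0 = 0" using \<theta>_scaleC[of 0 0] by simp
  then have \<theta>_sum: "\<theta> (sum f I) = (\<Sum>i\<in>I. \<theta> (f i))" for f and I :: "'i set"
    by (induction I rule: infinite_finite_induct) (simp_all add: \<theta>_add)
  obtain T :: "nat \<Rightarrow> 'a" where T: "\<And>n. T n \<in> isom" "\<And>m n. star (T m) * T n = (if m = n then 1 else 0)"
    by (rule B.orthogonal_isometries) (rule that)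
  have TB [simp]: "T n \<in> B" "star (T n) \<in> B" for n
    using T(1) B.isometriesD by (auto intro: B.star_in)
  \<comment> \<open>The three thirds of \<epsilon> go to the isometry that implements \<omega>, to
    the approximation of a functional, and to the factorisation through matrices.\<close>
  define \<delta> where "\<delta> = \<epsilon> / (3 * (K + 1))"
  have \<delta>: "0 < \<delta>" using K \<open>0 < \<epsilon>\<close> by (simp add: \<delta>_def)
  have \<delta>K: "K * \<delta> \<le> \<epsilon> / 3"
  proof -
    have "(K + 1) * \<delta> = \<epsilon> / 3" using K by (simp add: \<delta>_def field_simps)
    then show ?thesis using \<delta> by (simp add: algebra_simps)
  qed
  have "finite (E ` Z) \<and> E ` Z \<subseteq> B \<and> 0 < \<delta>"
    using \<open>finite Z\<close> \<delta> by auto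
  then obtain k and \<phi> :: "'a \<Rightarrow> complex fmat" and \<psi> :: "complex fmat \<Rightarrow> 'a" where
    \<phi>: "completely_positive B (matrices_over k UNIV) \<phi>" and
    \<psi>: "completely_positive (matrices_over k UNIV) B \<psi>" and
    \<psi>\<phi>: "\<And>x. x \<in> E ` Z \<Longrightarrow> norm (\<psi> (\<phi> x) - x) < \<delta>"
    using nuclear_B unfolding nuclear_cstar_def by meson
  let ?Mk = "matrices_over k (UNIV :: complex set)"
  define e where "e i j = mk_fmat k (\<lambda>a b. if a = i \<and> b = j then (1::complex) else 0)" for i j
  have Mk: "0 \<in> ?Mk" "\<And>X Y. X \<in> ?Mk \<Longrightarrow> Y \<in> ?Mk \<Longrightarrow> X + Y \<in> ?Mk"
    "\<And>c X. X \<in> ?Mk \<Longrightarrow> c *\<^sub>C X \<in> ?Mk" "e i j \<in> ?Mk"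
    "\<And>X Y. X \<in> ?Mk \<Longrightarrow> Y \<in> ?Mk \<Longrightarrow> star X * Y \<in> ?Mk" for i j
    by (auto simp: matrices_over_def plus_fmat.rep_eq zero_fmat.rep_eq scaleC_fmat.rep_eq e_def entry_mk_fmat
        scaleC_zero_right star_fmat.rep_eq star_zero times_fmat.rep_eq)
  have ee: "star (e 0 i) * e 0 j = e i j" if "i < k" "j < k" for i j
  proof (rule fmat_eqI)
    fix a b
    have "0 < k" using that by simp
    have "entry (star (e 0 i) * e 0 j) a b = (\<Sum>r<k. star (entry (e 0 i) r a) * entry (e 0 j) r b)"
      by (subst entry_times'[of k]) (auto simp: star_fmat.rep_eq e_def entry_mk_fmat)
    also have "\<dots> = (\<Sum>r<k. if r = 0 then (if a = i \<and> b = j then 1 else 0) else 0)"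
      using that by (intro sum.cong refl) (auto simp: e_def entry_mk_fmat star_complex_def)
    finally show "entry (star (e 0 i) * e 0 j) a b = entry (e i j) a b"
      using that \<open>0 < k\<close> by (auto simp: e_def entry_mk_fmat)
  qed
  \<comment> \<open>The matrix units are the Gram matrix of those in row 0, so the matrix of all
    \<psi>(e_ij) is a Gram matrix. This is the positivity of the Choi matrix of \<psi>.\<close>
  obtain y where y: "\<And>r i. r < k \<Longrightarrow> i < k \<Longrightarrow> y r i \<in> B"
    and \<psi>_ee: "\<And>i j. i < k \<Longrightarrow> j < k \<Longrightarrow> \<psi> (star (e 0 i) * e 0 j) = (\<Sum>r<k. star (y r i) * y r j)"
    by (rule completely_positive_row[where w = "e 0" and n = k, OF \<psi> Mk(4) Mk(1) Mk(5)], assumption+) (rule that)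
  \<comment> \<open>Orthogonal isometries pack each column of y into one element, and a sum of
    products becomes a single product.\<close>
  define w where "w i = (\<Sum>r<k. T r * y r i)" for i
  have wB: "w i \<in> B" if "i < k" for i
    unfolding w_def using y that by (intro B.sum_in B.mult_in) auto
  have \<psi>e: "\<psi> (e i j) = star (w i) * w j" if "i < k" "j < k" for i j
  proof -
    have "star (w i) * w j = (\<Sum>r<k. \<Sum>s<k. star (y r i) * (star (T r) * T s) * y s j)"
      unfolding w_def star_sum sum_product by (simp add: star_mult mult.assoc)
    also have "\<dots> = (\<Sum>r<k. \<Sum>s<k. if r = s then star (y r i) * y s j else 0)"
      by (intro sum.cong refl) (simp add: T)
    finally show ?thesis
      using \<psi>_ee[OF that] that by (simp add: ee)
  qed
  have \<psi>X: "\<psi> X = (\<Sum>i<k. \<Sum>j<k. entry X i j *\<^sub>C \<psi> (e i j))" if X: "X \<in> ?Mk" for X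
  proof -
    have entry_sum: "entry (sum F I) a b = (\<Sum>i\<in>I. entry (F i) a b)" for F :: "'i \<Rightarrow> complex fmat" and I a b
      by (induction I rule: infinite_finite_induct) (simp_all add: plus_fmat.rep_eq zero_fmat.rep_eq)
    have "X = (\<Sum>p\<in>{..<k} \<times> {..<k}. entry X (fst p) (snd p) *\<^sub>C e (fst p) (snd p))"
    proof (rule fmat_eqI)
      fix a b
      have "entry (\<Sum>p\<in>{..<k} \<times> {..<k}. entry X (fst p) (snd p) *\<^sub>C e (fst p) (snd p)) a b
        = (\<Sum>p\<in>{..<k} \<times> {..<k}. if p = (a, b) then entry X a b else 0)"
        unfolding entry_sum
        by (intro sum.cong refl) (auto simp: scaleC_fmat.rep_eq e_def entry_mk_fmat scaleC_complex_def)
      then show "entry X a b = entry (\<Sum>p\<in>{..<k} \<times> {..<k}. entry X (fst p) (snd p) *\<^sub>C e (fst p) (snd p)) a b"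
        using entry_outside[OF X, of a b] by (auto simp: not_less)
    qed
    also have "\<psi> \<dots> = (\<Sum>p\<in>{..<k} \<times> {..<k}. \<psi> (entry X (fst p) (snd p) *\<^sub>C e (fst p) (snd p)))"
      using \<psi> Mk by (intro complex_linear_on_sum[of ?Mk]) (auto simp: completely_positive_def)
    also have "\<dots> = (\<Sum>p\<in>{..<k} \<times> {..<k}. entry X (fst p) (snd p) *\<^sub>C \<psi> (e (fst p) (snd p)))"
      using \<psi> Mk(4) by (auto simp: completely_positive_def complex_linear_on_def)
    finally show ?thesis
      by (simp add: sum.cartesian_product case_prod_unfold)
  qed
  \<comment> \<open>The matrix of all \<theta>(\<psi>(e_ij)), transported into \<open>B\<close> by
    the isometries T. Its positive root c supplies elements c T_i whose inner products are exactly
    these entries.\<close>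
  define H where "H = (\<Sum>i<k. \<Sum>j<k. T i * \<theta> (\<psi> (e i j)) * star (T j))"
  have "H = (\<Sum>i<k. \<Sum>j<k. T i * \<theta> (star (w i) * w j) * star (T j))"
    unfolding H_def by (intro sum.cong refl) (simp add: \<psi>e)
  moreover have "cpos (\<Sum>i<k. \<Sum>j<k. T i * \<theta> (star (w i) * w j) * star (T j))"
    using wB by (intro \<theta>_cp) auto
  ultimately have "cpos H" by simp
  moreover have "H \<in> B"
    unfolding H_def using \<theta>_B by (intro B.sum_in B.mult_in) auto
  ultimately obtain c where c: "c \<in> B" "cpos c" "c * c = H"
    using B.cpos_sqrt by metis
  have cc: "star (c * T i) * (c * T j) = \<theta> (\<psi> (e i j))" if "i < k" "j < k" for i j
  proof -
    have "star (c * T i) * (c * T j) = star (T i) * H * T j"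
      unfolding c(3)[symmetric] using cpos_selfadjoint[OF c(2)] by (simp add: star_mult mult.assoc)
    also have "\<dots> = (\<Sum>a<k. \<Sum>b<k. (star (T i) * T a) * \<theta> (\<psi> (e a b)) * (star (T b) * T j))"
      unfolding H_def by (simp add: sum_distrib_left sum_distrib_right mult.assoc)
    also have "\<dots> = (\<Sum>a<k. \<Sum>b<k. if a = i then if b = j then \<theta> (\<psi> (e a b)) else 0 else 0)"
      by (intro sum.cong refl) (auto simp: T)
    also have "\<dots> = \<theta> (\<psi> (e i j))"
      using that by (subst sum.swap) simp
    finally show ?thesis .
  qed
  \<comment> \<open>Completely positive maps from \<open>B\<close> to k by k matrices correspond to
    positive functionals on k by k matrices over \<open>B\<close>. With the matrices embedded into
    \<open>B\<close> by T, \<Phi> is the functional that belongs to \<phi>, and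
    \<open>\<Phi>_T\<close> reads the entries of \<phi> off from it.\<close>
  define \<Phi> where "\<Phi> b = (\<Sum>i<k. \<Sum>j<k. entry (\<phi> (star (T i) * b * T j)) i j)" for b
  have \<phi>_lin: "complex_linear_on B \<phi>" "\<And>b. b \<in> B \<Longrightarrow> \<phi> b \<in> ?Mk"
    using \<phi> by (auto simp: completely_positive_def)
  have \<Phi>_add: "\<Phi> (x + x') = \<Phi> x + \<Phi> x'" if "x \<in> B" "x' \<in> B" for x x'
  proof -
    have "\<phi> (star (T i) * (x + x') * T j) = \<phi> (star (T i) * x * T j) + \<phi> (star (T i) * x' * T j)" for i j
      using \<phi>_lin(1) that unfolding complex_linear_on_def distrib_left distrib_right
      by (simp add: B.mult_in)
    then show ?thesis
      by (simp add: \<Phi>_def plus_fmat.rep_eq sum.distrib)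
  qed
  have \<Phi>_scale: "\<Phi> (a *\<^sub>C x) = a * \<Phi> x" if "x \<in> B" for a x
  proof -
    have "\<phi> (star (T i) * (a *\<^sub>C x) * T j) = a *\<^sub>C \<phi> (star (T i) * x * T j)" for i j
      using \<phi>_lin(1) that unfolding complex_linear_on_def mult_scaleC_left mult_scaleC_right
      by (simp add: B.mult_in)
    then show ?thesis
      by (simp add: \<Phi>_def scaleC_fmat.rep_eq scaleC_complex_def sum_distrib_left)
  qed
  have \<Phi>_pos: "0 \<le> Re (\<Phi> x) \<and> Im (\<Phi> x) = 0" if x: "x \<in> B" "cpos x" for x
  proof -
    obtain s where s: "s \<in> B" "x = star s * s"
      using x B.cpos_iff_star_mult_self by (auto simp: positive_in_def)
    have sT: "s * T i \<in> B" for i using s by (intro B.mult_in) auto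
    obtain Y where Y: "\<And>r i. r < k \<Longrightarrow> i < k \<Longrightarrow> Y r i \<in> ?Mk"
      "\<And>i j. i < k \<Longrightarrow> j < k \<Longrightarrow> \<phi> (star (s * T i) * (s * T j)) = (\<Sum>r<k. star (Y r i) * Y r j)"
      by (rule completely_positive_row[where w = "\<lambda>i. s * T i" and n = k, OF \<phi> sT B.zero_in])
        (auto intro: B.mult_in B.star_in that)
    have entry_sum: "entry (sum F I) a b = (\<Sum>i\<in>I. entry (F i) a b)" for F :: "'i \<Rightarrow> complex fmat" and I a b
      by (induction I rule: infinite_finite_induct) (simp_all add: plus_fmat.rep_eq zero_fmat.rep_eq)
    define v where "v r m = (\<Sum>j<k. entry (Y r j) m j)" for r m
    have "\<Phi> x = (\<Sum>i<k. \<Sum>j<k. \<Sum>r<k. \<Sum>m<k. cnj (entry (Y r i) m i) * entry (Y r j) m j)"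
      unfolding \<Phi>_def
    proof (intro sum.cong refl)
      fix i j assume ij: "i \<in> {..<k}" "j \<in> {..<k}"
      have "star (T i) * x * T j = star (s * T i) * (s * T j)"
        by (simp add: s star_mult mult.assoc)
      then have "entry (\<phi> (star (T i) * x * T j)) i j = (\<Sum>r<k. entry (star (Y r i) * Y r j) i j)"
        using Y(2) ij by (simp add: entry_sum)
      also have "\<dots> = (\<Sum>r<k. \<Sum>m<k. cnj (entry (Y r i) m i) * entry (Y r j) m j)"
      proof (intro sum.cong refl)
        fix r assume "r \<in> {..<k}"
        then have "Y r j \<in> ?Mk" using Y(1) ij by simp
        note outside = entry_outside[OF this]
        show "entry (star (Y r i) * Y r j) i j = (\<Sum>m<k. cnj (entry (Y r i) m i) * entry (Y r j) m j)"
          by (subst entry_times'[OF outside]) (simp_all add: star_fmat.rep_eq star_complex_def)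
      qed
      finally show "entry (\<phi> (star (T i) * x * T j)) i j = (\<Sum>r<k. \<Sum>m<k. cnj (entry (Y r i) m i) * entry (Y r j) m j)" .
    qed
    also have "\<dots> = (\<Sum>i<k. \<Sum>r<k. \<Sum>j<k. \<Sum>m<k. cnj (entry (Y r i) m i) * entry (Y r j) m j)"
      by (intro sum.cong refl sum.swap)
    also have "\<dots> = (\<Sum>r<k. \<Sum>i<k. \<Sum>j<k. \<Sum>m<k. cnj (entry (Y r i) m i) * entry (Y r j) m j)"
      by (rule sum.swap)
    also have "\<dots> = (\<Sum>r<k. \<Sum>i<k. \<Sum>m<k. \<Sum>j<k. cnj (entry (Y r i) m i) * entry (Y r j) m j)"
      by (intro sum.cong refl sum.swap)
    also have "\<dots> = (\<Sum>r<k. \<Sum>m<k. \<Sum>i<k. \<Sum>j<k. cnj (entry (Y r i) m i) * entry (Y r j) m j)"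
      by (intro sum.cong refl sum.swap)
    also have "\<dots> = (\<Sum>r<k. \<Sum>m<k. cnj (v r m) * v r m)"
      by (simp add: v_def sum_product)
    also have "\<dots> = complex_of_real (\<Sum>r<k. \<Sum>m<k. (cmod (v r m))\<^sup>2)"
      by (simp add: mult.commute[of "cnj _"] flip: complex_norm_square)
    finally show ?thesis
      by (simp add: sum_nonneg)
  qed
  have \<Phi>_T: "\<Phi> (T i * b * star (T j)) = entry (\<phi> b) i j" if "b \<in> B" "i < k" "j < k" for b i j
  proof -
    have "\<phi> (0 *\<^sub>C 0) = 0 *\<^sub>C \<phi> 0"
      using \<phi>_lin(1) B.zero_in unfolding complex_linear_on_def by blast
    then have "\<phi> 0 = 0" by simp
    have "\<Phi> (T i * b * star (T j)) = (\<Sum>p<k. \<Sum>q<k. entry (\<phi> ((star (T p) * T i) * b * (star (T j) * T q))) p q)"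
      by (simp add: \<Phi>_def mult.assoc)
    also have "\<dots> = (\<Sum>p<k. \<Sum>q<k. if p = i then if q = j then entry (\<phi> b) p q else 0 else 0)"
      by (intro sum.cong refl) (auto simp: T \<open>\<phi> 0 = 0\<close> zero_fmat.rep_eq)
    also have "\<dots> = entry (\<phi> b) i j"
      using that by (subst sum.swap) simp
    finally show ?thesis .
  qed
  define L where "L = (\<Sum>i<k. \<Sum>j<k. norm (\<theta> (\<psi> (e i j))))"
  have L: "0 \<le> L" by (simp add: L_def sum_nonneg)
  define \<delta>' where "\<delta>' = \<epsilon> / (3 * (L + 1))"
  have \<delta>': "0 < \<delta>'" using L \<open>0 < \<epsilon>\<close> by (simp add: \<delta>'_def)
  have \<delta>'L: "\<delta>' * L \<le> \<epsilon> / 3"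
  proof -
    have "\<delta>' * (L + 1) = \<epsilon> / 3" using L by (simp add: \<delta>'_def field_simps)
    then show ?thesis using \<delta>' by (simp add: algebra_simps)
  qed
  define Y where "Y = (\<lambda>(z, i, j). T i * E z * star (T j)) ` (Z \<times> {..<k} \<times> {..<k})"
  have Y: "finite Y" "Y \<subseteq> B"
    using \<open>finite Z\<close> by (auto simp: Y_def intro!: B.mult_in)
  obtain M :: nat and D where D: "\<And>m. m < M \<Longrightarrow> D m \<in> B"
    "\<And>y. y \<in> Y \<Longrightarrow> cmod (\<Phi> y - (\<Sum>m<M. \<omega> (star (D m) * y * D m))) < \<delta>'"
    using positive_functional_approx[OF \<Phi>_add \<Phi>_scale \<Phi>_pos Y \<delta>'] by metis
  define P where "P = {..<M} \<times> {..<k}"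
  \<comment> \<open>An index p = (m, i) combines a summand m of the approximating functional with a
    matrix index i. The leftmost factor T_m of v removes cross terms between different summands, and
    T_i in u creates the argument T_i E(z) T_j^* of \<Phi>.\<close>
  define u where "u p = star (T (snd p)) * D (fst p)" for p
  define v where "v p = T (fst p) * c * T (snd p)" for p :: "nat \<times> nat"
  have vv: "star (v p) * v q = (if fst p = fst q then \<theta> (\<psi> (e (snd p) (snd q))) else 0)"
    if "p \<in> P" "q \<in> P" for p q
  proof -
    have "star (v p) * v q = star (T (snd p)) * star c * (star (T (fst p)) * T (fst q)) * c * T (snd q)"
      by (simp add: v_def star_mult mult.assoc)
    then show ?thesis
      using cc[of "snd p" "snd q"] that by (auto simp: T P_def star_mult mult.assoc)
  qed
  obtain R where R: "R \<in> isom" "\<And>z. z \<in> Z \<Longrightarrow>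
    norm (star (\<Sum>p\<in>P. u p * R * v p) * z * (\<Sum>p\<in>P. u p * R * v p)
      - (\<Sum>p\<in>P. \<Sum>q\<in>P. \<omega> (star (u p) * z * u q) *\<^sub>C (star (v p) * v q))) \<le> \<epsilon>/3"
    using isometry_sandwich_approx[of P Z "\<epsilon>/3"] \<open>finite Z\<close> \<open>0 < \<epsilon>\<close>
    by (auto simp: P_def)
  define W where "W = (\<Sum>p\<in>P. u p * R * v p)"
  show ?thesis
  proof (intro bexI[of _ W] ballI)
    show "W \<in> B"
      unfolding W_def u_def v_def using D(1) c(1) B.isometriesD(1)[OF R(1)]
      by (intro B.sum_in B.mult_in) (auto simp: P_def)
    fix z assume z: "z \<in> Z"
    have "(\<Sum>p\<in>P. \<Sum>q\<in>P. \<omega> (star (u p) * z * u q) *\<^sub>C (star (v p) * v q))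
      = (\<Sum>p\<in>P. \<Sum>q\<in>P. if fst p = fst q then \<omega> (star (u p) * z * u q) *\<^sub>C \<theta> (\<psi> (e (snd p) (snd q))) else 0)"
      by (intro sum.cong refl) (simp add: vv scaleC_zero_right)
    also have "\<dots> = (\<Sum>m<M. \<Sum>i<k. \<Sum>m'<M. \<Sum>j<k. if m = m'
        then \<omega> (star (u (m, i)) * z * u (m', j)) *\<^sub>C \<theta> (\<psi> (e i j)) else 0)"
      unfolding P_def by (simp only: sum.cartesian_product' fst_conv snd_conv)
    also have "\<dots> = (\<Sum>m<M. \<Sum>i<k. \<Sum>j<k. \<Sum>m'<M. if m = m'
        then \<omega> (star (u (m, i)) * z * u (m', j)) *\<^sub>C \<theta> (\<psi> (e i j)) else 0)"
      by (intro sum.cong refl sum.swap)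
    also have "\<dots> = (\<Sum>m<M. \<Sum>i<k. \<Sum>j<k. \<omega> (star (D m) * (T i * E z * star (T j)) * D m) *\<^sub>C \<theta> (\<psi> (e i j)))"
    proof (intro sum.cong refl)
      fix m i j assume "m \<in> {..<M}" "i \<in> {..<k}" "j \<in> {..<k}"
      then have DB: "D m \<in> B" using D(1) by simp
      have "E (star (u (m, i)) * z * u (m, j)) = star (u (m, i)) * E z * u (m, j)"
        unfolding u_def using DB by (simp add: E_mult_left E_mult_right B.mult_in B.star_in)
      then have "\<omega> (star (u (m, i)) * z * u (m, j)) = \<omega> (star (u (m, i)) * E z * u (m, j))"
        by (metis \<omega>_E)
      also have "star (u (m, i)) * E z * u (m, j) = star (D m) * (T i * E z * star (T j)) * D m"
        by (simp add: u_def star_simps mult.assoc)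
      finally show "(\<Sum>m'<M. if m = m' then \<omega> (star (u (m, i)) * z * u (m', j)) *\<^sub>C \<theta> (\<psi> (e i j)) else 0)
        = \<omega> (star (D m) * (T i * E z * star (T j)) * D m) *\<^sub>C \<theta> (\<psi> (e i j))"
        using \<open>m \<in> _\<close> by simp
    qed
    also have "\<dots> = (\<Sum>i<k. \<Sum>j<k. (\<Sum>m<M. \<omega> (star (D m) * (T i * E z * star (T j)) * D m)) *\<^sub>C \<theta> (\<psi> (e i j)))"
    proof -
      show ?thesis
        unfolding scaleC_sum_left by (subst sum.swap) (intro sum.cong refl sum.swap)
    qed
    finally have 1: "norm (star W * z * W - (\<Sum>i<k. \<Sum>j<k. (\<Sum>m<M. \<omega> (star (D m) * (T i * E z * star (T j)) * D m)) *\<^sub>C \<theta> (\<psi> (e i j)))) \<le> \<epsilon>/3"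
      using R(2)[OF z] by (simp only: W_def)
    have \<theta>\<psi>: "\<theta> (\<psi> (\<phi> (E z))) = (\<Sum>i<k. \<Sum>j<k. entry (\<phi> (E z)) i j *\<^sub>C \<theta> (\<psi> (e i j)))"
      using \<psi>X[OF \<phi>_lin(2)[OF E_in]] by (simp add: \<theta>_sum \<theta>_scaleC)
    have 2: "norm ((\<Sum>i<k. \<Sum>j<k. (\<Sum>m<M. \<omega> (star (D m) * (T i * E z * star (T j)) * D m)) *\<^sub>C \<theta> (\<psi> (e i j)))
      - \<theta> (\<psi> (\<phi> (E z)))) \<le> \<epsilon>/3"
    proof -
      have "norm ((\<Sum>i<k. \<Sum>j<k. (\<Sum>m<M. \<omega> (star (D m) * (T i * E z * star (T j)) * D m)) *\<^sub>C \<theta> (\<psi> (e i j)))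
        - \<theta> (\<psi> (\<phi> (E z)))) \<le> (\<Sum>i<k. \<Sum>j<k. \<delta>' * norm (\<theta> (\<psi> (e i j))))"
        unfolding \<theta>\<psi> sum_subtractf[symmetric] scaleC_diff_left[symmetric]
      proof (intro sum_norm_le)
        fix i j assume ij: "i \<in> {..<k}" "j \<in> {..<k}"
        then have "T i * E z * star (T j) \<in> Y"
          unfolding Y_def using z by (intro image_eqI[of _ _ "(z, i, j)"]) auto
        from D(2)[OF this] have "cmod ((\<Sum>m<M. \<omega> (star (D m) * (T i * E z * star (T j)) * D m)) - entry (\<phi> (E z)) i j) \<le> \<delta>'"
          using \<Phi>_T[of "E z" i j] ij by (simp add: norm_minus_commute)
        then show "norm (((\<Sum>m<M. \<omega> (star (D m) * (T i * E z * star (T j)) * D m)) - entry (\<phi> (E z)) i j) *\<^sub>C \<theta> (\<psi> (e i j)))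
          \<le> \<delta>' * norm (\<theta> (\<psi> (e i j)))"
          by (simp add: norm_scaleC mult_right_mono)
      qed
      also have "\<dots> = \<delta>' * L" by (simp add: L_def sum_distrib_left)
      finally show ?thesis using \<delta>'L by linarith
    qed
    have 3: "norm (\<theta> (\<psi> (\<phi> (E z))) - \<theta> (E z)) \<le> \<epsilon>/3"
    proof -
      have "norm (\<theta> (\<psi> (\<phi> (E z)) - E z)) \<le> K * \<delta>"
        using \<psi>\<phi>[of "E z"] z K by (intro order.trans[OF \<theta>_bound] mult_left_mono) auto
      then show ?thesis using \<delta>K by (simp add: \<theta>_minus)
    qed
    have "norm ((star W * z * W - (\<Sum>i<k. \<Sum>j<k. (\<Sum>m<M. \<omega> (star (D m) * (T i * E z * star (T j)) * D m)) *\<^sub>C \<theta> (\<psi> (e i j))))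
      + ((\<Sum>i<k. \<Sum>j<k. (\<Sum>m<M. \<omega> (star (D m) * (T i * E z * star (T j)) * D m)) *\<^sub>C \<theta> (\<psi> (e i j))) - \<theta> (\<psi> (\<phi> (E z))))
      + (\<theta> (\<psi> (\<phi> (E z))) - \<theta> (E z))) \<le> \<epsilon>/3 + \<epsilon>/3 + \<epsilon>/3"
      by (intro norm_triangle_le add_mono 1 2 3)
    then show "norm (star W * z * W - \<theta> (E z)) \<le> \<epsilon>"
      by simp
  qed
qed

section \<open>Kernels implemented by elements of the algebra\<close>

lemma bounded_linear_\<omega>: "bounded_linear \<omega>"
  by (rule bounded_linear_intro[of _ 1])
    (simp_all add: \<omega>_add \<omega>_scaleR scaleR_conv_of_real[where 'a=complex] cmod_\<omega>_le)

definition implements :: "'a \<Rightarrow> ('g \<Rightarrow> complex) \<Rightarrow> real \<Rightarrow> bool"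
  where "implements s k \<tau> \<longleftrightarrow>
    (\<forall>g\<in>carrier G. \<forall>h\<in>carrier G. norm (star (\<alpha> g s) * \<alpha> h s - k (inv g \<otimes> h) *\<^sub>C 1) \<le> \<tau>)"

text \<open>The function is fixed while the implementing element may change with the accuracy; its
  norm remains controlled, since s^*s is close to k(1).\<close>

definition kernel :: "('g \<Rightarrow> complex) \<Rightarrow> bool"
  where "kernel k \<longleftrightarrow> (\<forall>\<tau>>0. \<exists>s. implements s k \<tau>)"

lemma implementsD:
  "implements s k \<tau> \<Longrightarrow> g \<in> carrier G \<Longrightarrow> h \<in> carrier G \<Longrightarrow>
    norm (star (\<alpha> g s) * \<alpha> h s - k (inv g \<otimes> h) *\<^sub>C 1) \<le> \<tau>"
  by (auto simp: implements_def)

lemma kernelE: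
  assumes "kernel k" "0 < \<tau>"
  obtains s where "implements s k \<tau>"
  using assms by (auto simp: kernel_def)

lemma implements_bound:
  assumes "implements s k \<tau>" "g \<in> carrier G"
  shows "cmod (k g) \<le> (norm s)\<^sup>2 + \<tau>"
proof -
  have "norm (star (\<alpha> \<one> s) * \<alpha> g s - k (inv \<one> \<otimes> g) *\<^sub>C 1) \<le> \<tau>"
    using assms by (intro implementsD) auto
  then have "norm (k g *\<^sub>C (1::'a) - star s * \<alpha> g s) \<le> \<tau>"
    using assms(2) by (simp add: norm_minus_commute)
  moreover have "norm (star s * \<alpha> g s) \<le> norm s * norm s"
    using norm_mult_ineq[of "star s" "\<alpha> g s"] assms(2) by simp
  moreover have "norm (k g *\<^sub>C (1::'a)) \<le> norm (star s * \<alpha> g s) + norm (k g *\<^sub>C (1::'a) - star s * \<alpha> g s)"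
    by (rule norm_triangle_sub)
  ultimately show ?thesis
    by (simp add: power2_eq_square)
qed

lemma kernel_bounded:
  assumes "kernel k"
  obtains C where "0 \<le> C" "\<And>g. g \<in> carrier G \<Longrightarrow> cmod (k g) \<le> C"
  using kernelE[OF assms zero_less_one] implements_bound
  by (metis add_nonneg_nonneg zero_le_one zero_le_power2)

lemma kernel_hermitian:
  assumes "kernel k" "g \<in> carrier G"
  shows "k (inv g) = cnj (k g)"
proof (rule ccontr)
  assume ne: "k (inv g) \<noteq> cnj (k g)"
  define \<tau> where "\<tau> = cmod (k (inv g) - cnj (k g)) / 3"
  have "0 < \<tau>" using ne by (simp add: \<tau>_def)
  then obtain s where s: "implements s k \<tau>" using assms(1) kernelE by blast
  have 1: "norm (star (\<alpha> \<one> s) * \<alpha> g s - k (inv \<one> \<otimes> g) *\<^sub>C 1) \<le> \<tau>"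
    "norm (star (\<alpha> g s) * \<alpha> \<one> s - k (inv g \<otimes> \<one>) *\<^sub>C 1) \<le> \<tau>"
    using assms(2) by (intro implementsD[OF s]; simp)+
  have "norm (star (star s * \<alpha> g s - k g *\<^sub>C 1)) \<le> \<tau>"
    unfolding norm_star using 1(1) assms(2) by simp
  then have 2: "norm (star (\<alpha> g s) * s - cnj (k g) *\<^sub>C 1) \<le> \<tau>"
    by (simp add: star_simps)
  have "norm ((star (\<alpha> g s) * s - cnj (k g) *\<^sub>C 1) - (star (\<alpha> g s) * s - k (inv g) *\<^sub>C 1)) \<le> \<tau> + \<tau>"
    using 1(2) 2 assms(2) by (intro order.trans[OF norm_triangle_ineq4 add_mono]) auto
  then have "norm ((k (inv g) - cnj (k g)) *\<^sub>C (1::'a)) \<le> \<tau> + \<tau>"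
    by (simp add: scaleC_diff_left)
  then show False
    using \<open>0 < \<tau>\<close> by (simp add: \<tau>_def)
qed

section \<open>Closure properties of kernels\<close>

lemma kernel_one: "kernel (\<lambda>_. 1)"
  unfolding kernel_def implements_def by (auto intro!: exI[of _ 1] simp: act_one)

lemma kernel_approx:
  assumes "\<And>\<tau>. 0 < \<tau> \<Longrightarrow> \<exists>k'. kernel k' \<and> (\<forall>g\<in>carrier G. cmod (k' g - k g) \<le> \<tau>)"
  shows "kernel k"
  unfolding kernel_def
proof (intro allI impI)
  fix \<tau> :: real assume "0 < \<tau>"
  then obtain k' where k': "kernel k'" "\<And>g. g \<in> carrier G \<Longrightarrow> cmod (k' g - k g) \<le> \<tau>/2"
    using assms[of "\<tau>/2"] by auto
  obtain s where s: "implements s k' (\<tau>/2)"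
    using kernelE[OF k'(1), of "\<tau>/2"] \<open>0 < \<tau>\<close> by auto
  have "implements s k \<tau>"
    unfolding implements_def
  proof (intro ballI)
    fix g h assume gh: "g \<in> carrier G" "h \<in> carrier G"
    have "norm ((star (\<alpha> g s) * \<alpha> h s - k' (inv g \<otimes> h) *\<^sub>C 1) + (k' (inv g \<otimes> h) - k (inv g \<otimes> h)) *\<^sub>C 1) \<le> \<tau>/2 + \<tau>/2"
      using implementsD[OF s gh] k'(2)[of "inv g \<otimes> h"] gh by (intro norm_triangle_le add_mono) auto
    then show "norm (star (\<alpha> g s) * \<alpha> h s - k (inv g \<otimes> h) *\<^sub>C 1) \<le> \<tau>"
      by (simp add: scaleC_diff_left)
  qed
  then show "\<exists>s. implements s k \<tau>" by blast
qed

text \<open>Isometries of \<open>B\<close> with orthogonal ranges are fixed by the action, so they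
  place the two implementing elements side by side without mixed terms.\<close>

lemma kernel_add:
  assumes "kernel k" "kernel k'"
  shows "kernel (\<lambda>g. k g + k' g)"
  unfolding kernel_def
proof (intro allI impI)
  fix \<tau> :: real assume "0 < \<tau>"
  obtain s where s: "implements s k (\<tau>/2)"
    using kernelE[OF assms(1), of "\<tau>/2"] \<open>0 < \<tau>\<close> by auto
  obtain s' where s': "implements s' k' (\<tau>/2)"
    using kernelE[OF assms(2), of "\<tau>/2"] \<open>0 < \<tau>\<close> by auto
  obtain T :: "nat \<Rightarrow> 'a" where T: "\<And>n. T n \<in> isom" "\<And>m n. star (T m) * T n = (if m = n then 1 else 0)"
    by (rule B.orthogonal_isometries) (rule that)
  have aT: "\<alpha> g (T n) = T n" if "g \<in> carrier G" for g n
    using B.isometriesD(1)[OF T(1), of n] that by (simp add: B_iff)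
  have "implements (T 0 * s + T 1 * s') (\<lambda>g. k g + k' g) \<tau>"
    unfolding implements_def
  proof (intro ballI)
    fix g h assume gh: "g \<in> carrier G" "h \<in> carrier G"
    have "star (T m * x) * (T n * y) = (if m = n then star x * y else 0)" for m n x y
    proof -
      have "star (T m * x) * (T n * y) = star x * (star (T m) * T n) * y"
        by (simp add: star_mult mult.assoc)
      then show ?thesis by (simp add: T)
    qed
    then have "star (\<alpha> g (T 0 * s + T 1 * s')) * \<alpha> h (T 0 * s + T 1 * s')
      = star (\<alpha> g s) * \<alpha> h s + star (\<alpha> g s') * \<alpha> h s'"
      using gh by (simp add: act_add act_times aT star_add distrib_left distrib_right)
    then have "star (\<alpha> g (T 0 * s + T 1 * s')) * \<alpha> h (T 0 * s + T 1 * s') - (k (inv g \<otimes> h) + k' (inv g \<otimes> h)) *\<^sub>C 1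
      = (star (\<alpha> g s) * \<alpha> h s - k (inv g \<otimes> h) *\<^sub>C 1) + (star (\<alpha> g s') * \<alpha> h s' - k' (inv g \<otimes> h) *\<^sub>C 1)"
      by (simp add: scaleC_add_left)
    also have "norm \<dots> \<le> \<tau>/2 + \<tau>/2"
      using implementsD[OF s gh] implementsD[OF s' gh] by (intro norm_triangle_le add_mono)
    finally show "norm (star (\<alpha> g (T 0 * s + T 1 * s')) * \<alpha> h (T 0 * s + T 1 * s') - (k (inv g \<otimes> h) + k' (inv g \<otimes> h)) *\<^sub>C 1) \<le> \<tau>"
      by simp
  qed
  then show "\<exists>s. implements s (\<lambda>g. k g + k' g) \<tau>" by blast
qed

lemma kernel_scale:
  assumes "kernel k" "0 \<le> r"
  shows "kernel (\<lambda>g. complex_of_real r * k g)"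
  unfolding kernel_def
proof (intro allI impI)
  fix \<tau> :: real assume "0 < \<tau>"
  then have "0 < \<tau> / (r + 1)" using assms by simp
  then obtain s where s: "implements s k (\<tau> / (r + 1))"
    using kernelE[OF assms(1)] by blast
  have "implements (sqrt r *\<^sub>R s) (\<lambda>g. complex_of_real r * k g) \<tau>"
    unfolding implements_def
  proof (intro ballI)
    fix g h assume gh: "g \<in> carrier G" "h \<in> carrier G"
    have "star (\<alpha> g (sqrt r *\<^sub>R s)) * \<alpha> h (sqrt r *\<^sub>R s) - (complex_of_real r * k (inv g \<otimes> h)) *\<^sub>C 1
      = r *\<^sub>R (star (\<alpha> g s) * \<alpha> h s - k (inv g \<otimes> h) *\<^sub>C 1)"
    proof -
      have "(complex_of_real r * k (inv g \<otimes> h)) *\<^sub>C (1::'a) = r *\<^sub>R (k (inv g \<otimes> h) *\<^sub>C 1)"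
        by (metis scaleC_of_real scaleC_scaleC)
      then show ?thesis
        using gh assms(2) by (simp add: act_scaleR star_scaleR scaleR_diff_right)
    qed
    then have "norm (star (\<alpha> g (sqrt r *\<^sub>R s)) * \<alpha> h (sqrt r *\<^sub>R s) - (complex_of_real r * k (inv g \<otimes> h)) *\<^sub>C 1)
      \<le> r * (\<tau> / (r + 1))"
      using implementsD[OF s gh] assms(2) by (simp add: mult_left_mono del: times_divide_eq_right)
    also have "\<dots> \<le> \<tau>"
      using assms(2) \<open>0 < \<tau>\<close> by (simp add: field_simps)
    finally show "norm (star (\<alpha> g (sqrt r *\<^sub>R s)) * \<alpha> h (sqrt r *\<^sub>R s) - (complex_of_real r * k (inv g \<otimes> h)) *\<^sub>C 1) \<le> \<tau>" .
  qed
  then show "\<exists>s. implements s (\<lambda>g. complex_of_real r * k g) \<tau>" by blast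
qed

lemma kernel_sum:
  "(\<And>i. i \<in> I \<Longrightarrow> kernel (k i)) \<Longrightarrow> kernel (\<lambda>g. \<Sum>i\<in>I. k i g)"
  using kernel_scale[OF kernel_one, of 0]
  by (induction I rule: infinite_finite_induct) (auto intro: kernel_add)

text \<open>In s'^* (s^* s) s' the inner product is nearly scalar and moves out. Its error is
  multiplied by (norm s')^2, which is why s' is chosen before s.\<close>

lemma kernel_mult:
  assumes "kernel k" "kernel k'"
  shows "kernel (\<lambda>g. k g * k' g)"
  unfolding kernel_def
proof (intro allI impI)
  fix \<tau> :: real assume \<tau>: "0 < \<tau>"
  obtain C where C: "0 \<le> C" "\<And>g. g \<in> carrier G \<Longrightarrow> cmod (k g) \<le> C"
    using kernel_bounded[OF assms(1)] by blast
  have "0 < \<tau> / (2 * (C + 1))" using \<tau> C by simp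
  then obtain s' where s': "implements s' k' (\<tau> / (2 * (C + 1)))"
    using kernelE[OF assms(2)] by blast
  define L where "L = (norm s')\<^sup>2 + 1"
  have L: "0 < L" by (simp add: L_def add_nonneg_pos)
  then obtain s where s: "implements s k (\<tau> / (2 * L))"
    using kernelE[OF assms(1), of "\<tau> / (2 * L)"] \<tau> by auto
  have "implements (s * s') (\<lambda>g. k g * k' g) \<tau>"
    unfolding implements_def
  proof (intro ballI)
    fix g h assume gh: "g \<in> carrier G" "h \<in> carrier G"
    define c where "c = k (inv g \<otimes> h)"
    have "star (\<alpha> g (s * s')) * \<alpha> h (s * s') - (c * k' (inv g \<otimes> h)) *\<^sub>C 1
      = star (\<alpha> g s') * (star (\<alpha> g s) * \<alpha> h s - c *\<^sub>C 1) * \<alpha> h s'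
        + c *\<^sub>C (star (\<alpha> g s') * \<alpha> h s' - k' (inv g \<otimes> h) *\<^sub>C 1)"
      using gh by (simp add: act_times star_mult algebra_simps scaleC_simps scaleC_diff_right)
    also have "norm \<dots> \<le> norm s' * (\<tau> / (2 * L)) * norm s' + C * (\<tau> / (2 * (C + 1)))"
    proof (intro norm_triangle_le add_mono)
      show "norm (star (\<alpha> g s') * (star (\<alpha> g s) * \<alpha> h s - c *\<^sub>C 1) * \<alpha> h s') \<le> norm s' * (\<tau> / (2 * L)) * norm s'"
        using implementsD[OF s gh] gh \<tau> L unfolding c_def
        by (intro order.trans[OF norm_mult_ineq] mult_mono order.trans[OF norm_mult_ineq])
          (auto intro: mult_nonneg_nonneg order.trans[OF norm_ge_zero])
      have "cmod c \<le> C" unfolding c_def using gh by (intro C) auto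
      then show "norm (c *\<^sub>C (star (\<alpha> g s') * \<alpha> h s' - k' (inv g \<otimes> h) *\<^sub>C 1)) \<le> C * (\<tau> / (2 * (C + 1)))"
        unfolding norm_scaleC using implementsD[OF s' gh] C by (intro mult_mono) auto
    qed
    also have "\<dots> \<le> \<tau>/2 + \<tau>/2"
    proof (intro add_mono)
      have "norm s' * (\<tau> / (2 * L)) * norm s' = (norm s')\<^sup>2 / L * (\<tau>/2)"
        by (simp add: power2_eq_square mult_ac)
      also have "\<dots> \<le> 1 * (\<tau>/2)"
        using \<tau> L by (intro mult_right_mono) (auto simp: L_def)
      finally show "norm s' * (\<tau> / (2 * L)) * norm s' \<le> \<tau>/2" by simp
      show "C * (\<tau> / (2 * (C + 1))) \<le> \<tau>/2"
        using \<tau> C by (simp add: field_simps)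
    qed
    finally show "norm (star (\<alpha> g (s * s')) * \<alpha> h (s * s') - (k (inv g \<otimes> h) * k' (inv g \<otimes> h)) *\<^sub>C 1) \<le> \<tau>"
      by (simp add: c_def)
  qed
  then show "\<exists>s. implements s (\<lambda>g. k g * k' g) \<tau>" by blast
qed

lemma kernel_power: "kernel k \<Longrightarrow> kernel (\<lambda>g. k g ^ n)"
  by (induction n) (auto intro: kernel_one kernel_mult)

text \<open>
  Kernels of this form are implemented by \<open>s = \<Sum> y\<^sup>* D\<^sub>m R T\<^sub>m\<close>, where \<open>R\<close> implements \<open>\<omega>\<close> and
  the elements \<open>D\<^sub>m\<close> of \<open>B\<close> approximate the functional \<open>\<omega>(w\<^sup>* \<cdot> w)\<close> on \<open>B\<close>.
\<close>

lemma kernel_functional: "kernel (\<lambda>g. \<omega> (star w * E (y * star (\<alpha> g y)) * w))"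
  unfolding kernel_def
proof (intro allI impI)
  fix \<tau> :: real assume \<tau>: "0 < \<tau>"
  define \<phi> where "\<phi> x = \<omega> (star w * x * w)" for x
  have \<phi>_add: "\<phi> (x + x') = \<phi> x + \<phi> x'" for x x'
    by (simp add: \<phi>_def algebra_simps \<omega>_add)
  have \<phi>_scale: "\<phi> (c *\<^sub>C x) = c * \<phi> x" for c x
    by (simp add: \<phi>_def scaleC_simps \<omega>_scaleC)
  have \<phi>_pos: "0 \<le> Re (\<phi> x) \<and> Im (\<phi> x) = 0" if "cpos x" for x
    unfolding \<phi>_def using \<omega>_cpos[OF cpos_conj[OF that]] by simp
  have \<phi>_bound: "cmod (\<phi> x) \<le> (norm w)\<^sup>2 * norm x" for x
  proof -
    have "Re (\<omega> (star w * w)) \<le> (norm w)\<^sup>2"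
      using cmod_\<omega>_le[of "star w * w"] complex_Re_le_cmod[of "\<omega> (star w * w)"] by (simp add: cstar_identity)
    then have "norm x * Re (\<omega> (star w * w)) \<le> norm x * (norm w)\<^sup>2"
      by (intro mult_left_mono) auto
    then show ?thesis
      using cmod_\<omega>_conj_le[of w x] by (simp add: \<phi>_def mult.commute)
  qed
  define C where "C = (norm w)\<^sup>2 + 2"
  have C: "0 < C" by (simp add: C_def add_nonneg_pos)
  define z where "z h = y * star (\<alpha> h y)" for h
  define \<rho> where "\<rho> = \<tau> / (4 * (C * (norm y + 1)))"
  have \<rho>: "0 < \<rho>" using \<tau> C by (simp add: \<rho>_def add_nonneg_pos)
  have \<rho>C: "C * (norm y * \<rho>) \<le> \<tau> / 4"
  proof -
    define d where "d = norm y + 1"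
    have "0 < d" by (simp add: d_def add_nonneg_pos)
    then have "C * (d * \<rho>) = \<tau> / 4"
      using C by (simp add: \<rho>_def flip: d_def)
    then have "C * ((norm y + 1) * \<rho>) = \<tau> / 4"
      by (simp only: d_def)
    moreover have "C * (norm y * \<rho>) \<le> C * ((norm y + 1) * \<rho>)"
      using C \<rho> by (intro mult_left_mono mult_right_mono) auto
    ultimately show ?thesis by simp
  qed
  obtain N where N: "finite N" "N \<subseteq> carrier G" "\<And>g. g \<in> carrier G \<Longrightarrow> \<exists>h\<in>N. norm (\<alpha> g y - \<alpha> h y) \<le> \<rho>"
    using almost_periodic_net[OF almost_periodic_orbit[of y] \<rho>] by blast
  \<comment> \<open>The bound 1/2 serves the norm of W: the approximation is also required at the
    unit, so that (norm W)^2 is at most |\<phi>(1)| + 1 and hence below \<open>C\<close>.\<close>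
  define \<delta> where "\<delta> = min (\<tau> / 4) (1/2)"
  have \<delta>: "0 < \<delta>" "\<delta> \<le> \<tau> / 4" "\<delta> \<le> 1/2" using \<tau> by (auto simp: \<delta>_def)
  have "finite (insert 1 ((\<lambda>h. E (z h)) ` N))" "insert 1 ((\<lambda>h. E (z h)) ` N) \<subseteq> B"
    using N by auto
  then obtain M :: nat and D where D: "\<And>m. m < M \<Longrightarrow> D m \<in> B"
    "\<And>x. x \<in> insert 1 ((\<lambda>h. E (z h)) ` N) \<Longrightarrow> cmod (\<phi> x - (\<Sum>m<M. \<omega> (star (D m) * x * D m))) < \<delta>"
    using positive_functional_approx[OF \<phi>_add \<phi>_scale \<phi>_pos _ _ \<delta>(1)] by metis
  obtain T :: "nat \<Rightarrow> 'a" where T: "\<And>n. T n \<in> isom" "\<And>m n. star (T m) * T n = (if m = n then 1 else 0)"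
    by (rule B.orthogonal_isometries) (rule that)
  obtain R where R: "R \<in> isom" "\<And>x. x \<in> insert 1 (z ` N) \<Longrightarrow>
    norm (star (\<Sum>p<M. D p * R * T p) * x * (\<Sum>p<M. D p * R * T p)
      - (\<Sum>p<M. \<Sum>q<M. \<omega> (star (D p) * x * D q) *\<^sub>C (star (T p) * T q))) \<le> \<delta>"
    using isometry_sandwich_approx[of "{..<M}" "insert 1 (z ` N)" \<delta> D T] N(1) \<delta>(1) by auto
  define W where "W = (\<Sum>p<M. D p * R * T p)"
  have WB: "W \<in> B"
    unfolding W_def using D(1) B.isometriesD(1)[OF R(1)] B.isometriesD(1)[OF T(1)]
    by (intro B.sum_in B.mult_in) auto
  have sum_T: "(\<Sum>p<M. \<Sum>q<M. \<omega> (star (D p) * x * D q) *\<^sub>C (star (T p) * T q))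
    = (\<Sum>m<M. \<omega> (star (D m) * E x * D m)) *\<^sub>C 1" for x
  proof -
    have "(\<Sum>p<M. \<Sum>q<M. \<omega> (star (D p) * x * D q) *\<^sub>C (star (T p) * T q))
      = (\<Sum>p<M. \<Sum>q<M. if p = q then \<omega> (star (D p) * x * D q) *\<^sub>C 1 else 0)"
      by (intro sum.cong refl) (simp add: T scaleC_zero_right)
    also have "\<dots> = (\<Sum>p<M. \<omega> (star (D p) * x * D p) *\<^sub>C 1)"
      by simp
    also have "\<dots> = (\<Sum>p<M. \<omega> (star (D p) * E x * D p) *\<^sub>C 1)"
    proof (intro sum.cong refl)
      fix p assume "p \<in> {..<M}"
      then have "E (star (D p) * x * D p) = star (D p) * E x * D p"
        using D(1) by (simp add: E_mult_left E_mult_right B.star_in)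
      then show "\<omega> (star (D p) * x * D p) *\<^sub>C (1::'a) = \<omega> (star (D p) * E x * D p) *\<^sub>C 1"
        by (metis \<omega>_E)
    qed
    finally show ?thesis by (simp add: scaleC_sum_left)
  qed
  have W: "norm (star W * x * W - \<phi> (E x) *\<^sub>C 1) \<le> 2 * \<delta>" if x: "x \<in> insert 1 (z ` N)" for x
  proof -
    have Ex: "E x \<in> insert 1 ((\<lambda>h. E (z h)) ` N)"
      using x E_fixed[of 1] by auto
    have "norm ((star W * x * W - (\<Sum>m<M. \<omega> (star (D m) * E x * D m)) *\<^sub>C 1)
      + ((\<Sum>m<M. \<omega> (star (D m) * E x * D m)) - \<phi> (E x)) *\<^sub>C 1) \<le> \<delta> + \<delta>"
      using R(2)[OF x] D(2)[OF Ex] unfolding W_def[symmetric] sum_T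
      by (intro norm_triangle_le add_mono) (auto simp: norm_minus_commute)
    then show ?thesis by (simp add: scaleC_diff_left)
  qed
  have W_bound: "(norm W)\<^sup>2 \<le> C"
  proof -
    have "norm (star W * 1 * W - \<phi> (E 1) *\<^sub>C 1) \<le> 2 * \<delta>" by (rule W) simp
    then have "norm (star W * W) \<le> cmod (\<phi> 1) + 2 * \<delta>"
      using norm_triangle_sub[of "star W * W" "\<phi> 1 *\<^sub>C 1"] by (simp add: E_fixed)
    then show ?thesis
      using \<phi>_bound[of 1] \<delta> by (simp add: cstar_identity C_def)
  qed
  define s where "s = star y * W"
  have "implements s (\<lambda>g. \<phi> (E (z g))) \<tau>"
    unfolding implements_def
  proof (intro ballI)
    fix g h assume gh: "g \<in> carrier G" "h \<in> carrier G"
    define l where "l = inv g \<otimes> h"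
    have l: "l \<in> carrier G" "h = g \<otimes> l" using gh by (auto simp: l_def simp flip: m_assoc)
    obtain l' where l': "l' \<in> N" "norm (\<alpha> l y - \<alpha> l' y) \<le> \<rho>" using N(3)[OF l(1)] by blast
    have l'G: "l' \<in> carrier G" using l' N by blast
    have aW: "\<alpha> g W = W" using WB gh by (simp add: B_iff)
    have "star (\<alpha> g s) * \<alpha> h s = \<alpha> g (star s * \<alpha> l s)"
      using gh l by (simp add: act_times act_star act_mult)
    also have "star s * \<alpha> l s = star W * z l * W"
      using l WB by (simp add: s_def star_simps act_times act_star z_def B_iff mult.assoc)
    finally have eq: "star (\<alpha> g s) * \<alpha> h s - \<phi> (E (z l)) *\<^sub>C 1 = \<alpha> g (star W * z l * W - \<phi> (E (z l)) *\<^sub>C 1)"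
      using gh by (simp add: act_diff act_scaleC act_one)
    have zz: "norm (z l - z l') \<le> norm y * \<rho>"
    proof -
      have "z l - z l' = y * star (\<alpha> l y - \<alpha> l' y)"
        by (simp add: z_def star_diff right_diff_distrib)
      then have "norm (z l - z l') \<le> norm y * norm (star (\<alpha> l y - \<alpha> l' y))"
        by (simp only: norm_mult_ineq)
      also have "\<dots> \<le> norm y * \<rho>" using l' by (intro mult_left_mono) auto
      finally show ?thesis .
    qed
    have 1: "norm (star W * (z l - z l') * W) \<le> \<tau> / 4"
    proof -
      have "norm (star W * (z l - z l') * W) \<le> (norm W)\<^sup>2 * norm (z l - z l')"
        by (rule norm_star_conj_le)
      also have "\<dots> \<le> C * (norm y * \<rho>)"
        using W_bound zz C by (intro mult_mono) auto
      finally show ?thesis using \<rho>C by linarith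
    qed
    have 2: "norm (star W * z l' * W - \<phi> (E (z l')) *\<^sub>C 1) \<le> 2 * \<delta>"
      using l' by (intro W) auto
    have 3: "norm (\<phi> (E (z l' - z l)) *\<^sub>C (1::'a)) \<le> \<tau> / 4"
    proof -
      have "cmod (\<phi> (E (z l' - z l))) \<le> (norm w)\<^sup>2 * norm (z l' - z l)"
        by (intro order.trans[OF \<phi>_bound] mult_left_mono norm_E) auto
      also have "\<dots> \<le> C * (norm y * \<rho>)"
        using zz by (intro mult_mono) (auto simp: C_def norm_minus_commute)
      finally show ?thesis using \<rho>C by simp
    qed
    have \<phi>_diff: "\<phi> (x - x') = \<phi> x - \<phi> x'" for x x'
      using \<phi>_add[of x "(-1) *\<^sub>C x'"] \<phi>_scale[of "-1" x'] by (simp add: scaleC_minus_left)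
    have "star W * z l * W - \<phi> (E (z l)) *\<^sub>C 1
      = star W * (z l - z l') * W + (star W * z l' * W - \<phi> (E (z l')) *\<^sub>C 1) + \<phi> (E (z l' - z l)) *\<^sub>C 1"
      by (simp add: algebra_simps E_diff \<phi>_diff scaleC_diff_left)
    also have "norm \<dots> \<le> \<tau>/4 + 2 * \<delta> + \<tau>/4"
      by (intro norm_triangle_le add_mono 1 2 3)
    finally have "norm (star W * z l * W - \<phi> (E (z l)) *\<^sub>C 1) \<le> \<tau>"
      using \<delta> by linarith
    then show "norm (star (\<alpha> g s) * \<alpha> h s - \<phi> (E (z (inv g \<otimes> h))) *\<^sub>C 1) \<le> \<tau>"
      using eq gh by (simp add: l_def)
  qed
  then show "\<exists>s. implements s (\<lambda>g. \<omega> (star w * E (y * star (\<alpha> g y)) * w)) \<tau>"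
    unfolding \<phi>_def z_def by blast
qed

text \<open>
  The convolution square of a kernel is implemented by \<open>E(ss\<^sup>*)\<^sup>1\<^sup>/\<^sup>2 s\<close>, and its complex conjugate
  comes from the functional \<open>\<omega>(s\<^sup>* \<cdot> s)\<close>.
\<close>

lemma kernel_convolution:
  assumes k: "kernel k" and K: "\<And>g. g \<in> carrier G \<Longrightarrow> is_mean (\<lambda>a. k a * cnj (k (inv g \<otimes> a))) (K g)"
  shows "kernel K" "kernel (\<lambda>g. cnj (K g))"
proof -
  obtain C where C: "0 \<le> C" "\<And>g. g \<in> carrier G \<Longrightarrow> cmod (k g) \<le> C"
    using kernel_bounded[OF k] by blast
  have approx: "\<exists>s. \<forall>g\<in>carrier G. \<forall>a\<in>carrier G. \<forall>b\<in>carrier G. \<forall>h\<in>carrier G.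
      norm (star (\<alpha> g s) * \<alpha> a s * (star (\<alpha> b s) * \<alpha> h s) - (k (inv g \<otimes> a) * k (inv b \<otimes> h)) *\<^sub>C 1) \<le> \<tau>"
    if \<tau>: "0 < \<tau>" for \<tau>
  proof -
    define \<tau>' where \<tau>': "\<tau>' = min 1 (\<tau> / (2 * (C + 1)))"
    have "0 < \<tau>'" using \<tau> C by (simp add: \<tau>')
    then obtain s where s: "implements s k \<tau>'" using kernelE[OF k] by blast
    have "norm (star (\<alpha> g s) * \<alpha> a s * (star (\<alpha> b s) * \<alpha> h s) - (k (inv g \<otimes> a) * k (inv b \<otimes> h)) *\<^sub>C 1) \<le> \<tau>"
      if gah: "g \<in> carrier G" "a \<in> carrier G" "b \<in> carrier G" "h \<in> carrier G" for g a b h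
    proof -
      have kb: "cmod (k (inv g \<otimes> a)) \<le> C" "cmod (k (inv b \<otimes> h)) \<le> C"
        using gah by (auto intro: C)
      have i: "norm (star (\<alpha> g s) * \<alpha> a s - k (inv g \<otimes> a) *\<^sub>C 1) \<le> \<tau>'"
        "norm (star (\<alpha> b s) * \<alpha> h s - k (inv b \<otimes> h) *\<^sub>C 1) \<le> \<tau>'"
        using gah by (auto intro: implementsD[OF s])
      have "norm (star (\<alpha> b s) * \<alpha> h s) \<le> C + 1"
        using i(2) kb(2) norm_triangle_sub[of "star (\<alpha> b s) * \<alpha> h s" "k (inv b \<otimes> h) *\<^sub>C 1"] by (simp add: \<tau>')
      then have "norm (star (\<alpha> g s) * \<alpha> a s * (star (\<alpha> b s) * \<alpha> h s) - (k (inv g \<otimes> a) *\<^sub>C 1) * (k (inv b \<otimes> h) *\<^sub>C 1))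
        \<le> 2 * (C + 1) * \<tau>'"
        using i kb by (intro norm_mult_diff_le) auto
      also have "\<dots> \<le> \<tau>"
      proof -
        have "2 * (C + 1) * \<tau>' \<le> 2 * (C + 1) * (\<tau> / (2 * (C + 1)))"
          using C by (intro mult_left_mono) (auto simp: \<tau>')
        then show ?thesis using C by simp
      qed
      finally show ?thesis by (simp add: scaleC_simps mult.commute)
    qed
    then show ?thesis by blast
  qed
  show "kernel K"
    unfolding kernel_def
  proof (intro allI impI)
    fix \<tau> :: real assume \<tau>: "0 < \<tau>"
    obtain s where s: "\<And>g a h. g \<in> carrier G \<Longrightarrow> a \<in> carrier G \<Longrightarrow> h \<in> carrier G \<Longrightarrow>
      norm (star (\<alpha> g s) * \<alpha> a s * (star (\<alpha> a s) * \<alpha> h s) - (k (inv g \<otimes> a) * k (inv a \<otimes> h)) *\<^sub>C 1) \<le> \<tau>"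
      using approx[OF \<tau>] by blast
    define r where "r = E (s * star s)"
    have "r \<in> B" "cpos r"
      unfolding r_def by (auto intro: cpos_E cpos_mult_star_self)
    then obtain c where c: "c \<in> B" "cpos c" "c * c = r"
      using B.cpos_sqrt by metis
    have "implements (c * s) K \<tau>"
      unfolding implements_def
    proof (intro ballI)
      fix g h assume gh: "g \<in> carrier G" "h \<in> carrier G"
      have "star (\<alpha> g (c * s)) * \<alpha> h (c * s) = star (\<alpha> g s) * (c * c) * \<alpha> h s"
        using gh c(1) cpos_selfadjoint[OF c(2)] by (simp add: act_times B_iff star_mult mult.assoc)
      also have "\<dots> = star (\<alpha> g s) * r * \<alpha> h s" by (simp add: c)
      finally have eq: "star (\<alpha> g (c * s)) * \<alpha> h (c * s) = star (\<alpha> g s) * r * \<alpha> h s" .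
      have "is_mean (\<lambda>a. star (\<alpha> g s) * \<alpha> a (s * star s) * \<alpha> h s) (star (\<alpha> g s) * r * \<alpha> h s)"
        unfolding r_def by (intro is_mean_linear[OF is_mean_linear[OF is_mean_E bounded_linear_mult_right] bounded_linear_mult_left])
      moreover have "is_mean (\<lambda>a. (k (inv g \<otimes> a) * k (inv a \<otimes> h)) *\<^sub>C (1::'a)) (K (inv g \<otimes> h) *\<^sub>C 1)"
      proof -
        have "is_mean (\<lambda>a. k (inv g \<otimes> a \<otimes> \<one>) * cnj (k (inv (inv g \<otimes> h) \<otimes> (inv g \<otimes> a \<otimes> \<one>)))) (K (inv g \<otimes> h))"
          using gh by (intro is_mean_translate[OF K]) auto
        moreover have "k (inv g \<otimes> a \<otimes> \<one>) * cnj (k (inv (inv g \<otimes> h) \<otimes> (inv g \<otimes> a \<otimes> \<one>))) = k (inv g \<otimes> a) * k (inv a \<otimes> h)"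
          if a: "a \<in> carrier G" for a
        proof -
          have "inv (inv g \<otimes> h) \<otimes> (inv g \<otimes> a \<otimes> \<one>) = inv (inv a \<otimes> h)"
            using gh a by (simp add: inv_mult_group m_assoc) (simp flip: m_assoc)
          then show ?thesis
            using kernel_hermitian[OF k, of "inv a \<otimes> h"] gh a by simp
        qed
        ultimately have "is_mean (\<lambda>a. k (inv g \<otimes> a) * k (inv a \<otimes> h)) (K (inv g \<otimes> h))"
          by (rule is_mean_cong)
        moreover have "bounded_linear (\<lambda>c. c *\<^sub>C (1::'a))"
          by (rule bounded_linear_intro[of _ 1])
            (auto simp: scaleC_add_left scaleR_conv_of_real scaleC_scaleC[symmetric] scaleC_of_real)
        ultimately show ?thesis by (rule is_mean_linear)
      qed
      ultimately have "norm (star (\<alpha> g s) * r * \<alpha> h s - K (inv g \<otimes> h) *\<^sub>C 1) \<le> \<tau>"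
      proof (rule is_mean_norm_le[OF is_mean_diff is_mean_const])
        fix a assume a: "a \<in> carrier G"
        have "star (\<alpha> g s) * \<alpha> a (s * star s) * \<alpha> h s = star (\<alpha> g s) * \<alpha> a s * (star (\<alpha> a s) * \<alpha> h s)"
          using a by (simp add: act_times act_star mult.assoc)
        then show "norm (star (\<alpha> g s) * \<alpha> a (s * star s) * \<alpha> h s - (k (inv g \<otimes> a) * k (inv a \<otimes> h)) *\<^sub>C 1) \<le> \<tau>"
          using s[OF gh(1) a gh(2)] by simp
      qed
      then show "norm (star (\<alpha> g (c * s)) * \<alpha> h (c * s) - K (inv g \<otimes> h) *\<^sub>C 1) \<le> \<tau>"
        by (simp only: eq)
    qed
    then show "\<exists>s. implements s K \<tau>" by blast
  qed
  show "kernel (\<lambda>g. cnj (K g))"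
  proof (rule kernel_approx)
    fix \<tau> :: real assume \<tau>: "0 < \<tau>"
    obtain s where s: "\<And>g a b h. g \<in> carrier G \<Longrightarrow> a \<in> carrier G \<Longrightarrow> b \<in> carrier G \<Longrightarrow> h \<in> carrier G \<Longrightarrow>
      norm (star (\<alpha> g s) * \<alpha> a s * (star (\<alpha> b s) * \<alpha> h s) - (k (inv g \<otimes> a) * k (inv b \<otimes> h)) *\<^sub>C 1) \<le> \<tau>"
      using approx[OF \<tau>] by blast
    have "cmod (\<omega> (star s * E (s * star (\<alpha> g s)) * s) - cnj (K g)) \<le> \<tau>" if g: "g \<in> carrier G" for g
    proof -
      have "is_mean (\<lambda>a. star s * \<alpha> a (s * star (\<alpha> g s)) * s) (star s * E (s * star (\<alpha> g s)) * s)"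
        by (intro is_mean_linear[OF is_mean_linear[OF is_mean_E bounded_linear_mult_right] bounded_linear_mult_left])
      from is_mean_linear[OF this bounded_linear_\<omega>]
      have "is_mean (\<lambda>a. \<omega> (star s * \<alpha> a (s * star (\<alpha> g s)) * s)) (\<omega> (star s * E (s * star (\<alpha> g s)) * s))" .
      moreover have "is_mean (\<lambda>a. k a * k (inv (a \<otimes> g))) (cnj (K g))"
      proof -
        have "is_mean (\<lambda>a. cnj (k (inv a) * cnj (k (inv g \<otimes> inv a)))) (cnj (K g))"
          by (rule is_mean_linear[OF is_mean_inverse[OF K[OF g]] bounded_linear_cnj])
        then show ?thesis
          by (rule is_mean_cong) (use g in \<open>simp add: kernel_hermitian[OF k] inv_mult_group\<close>)
      qed
      ultimately show ?thesis
      proof (rule is_mean_norm_le[OF is_mean_diff is_mean_const])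
        fix a assume a: "a \<in> carrier G"
        have "norm (star (\<alpha> \<one> s) * \<alpha> a s * (star (\<alpha> (a \<otimes> g) s) * \<alpha> \<one> s) - (k (inv \<one> \<otimes> a) * k (inv (a \<otimes> g) \<otimes> \<one>)) *\<^sub>C 1) \<le> \<tau>"
          using a g by (intro s) auto
        then have "norm (star s * \<alpha> a s * (star (\<alpha> (a \<otimes> g) s) * s) - (k a * k (inv (a \<otimes> g))) *\<^sub>C 1) \<le> \<tau>"
          using a g by simp
        moreover have "star s * \<alpha> a (s * star (\<alpha> g s)) * s = star s * \<alpha> a s * (star (\<alpha> (a \<otimes> g) s) * s)"
          using a g by (simp add: act_times act_star act_mult mult.assoc)
        ultimately have *: "norm (star s * \<alpha> a (s * star (\<alpha> g s)) * s - (k a * k (inv (a \<otimes> g))) *\<^sub>C 1) \<le> \<tau>"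
          by simp
        have "\<omega> (star s * \<alpha> a (s * star (\<alpha> g s)) * s) - k a * k (inv (a \<otimes> g))
          = \<omega> (star s * \<alpha> a (s * star (\<alpha> g s)) * s - (k a * k (inv (a \<otimes> g))) *\<^sub>C 1)"
          by (simp add: \<omega>_diff \<omega>_scaleC \<omega>_one)
        then show "norm (\<omega> (star s * \<alpha> a (s * star (\<alpha> g s)) * s) - k a * k (inv (a \<otimes> g))) \<le> \<tau>"
          using order.trans[OF cmod_\<omega>_le *] by simp
      qed
    qed
    then show "\<exists>k'. kernel k' \<and> (\<forall>g\<in>carrier G. cmod (k' g - cnj (K g)) \<le> \<tau>)"
      using kernel_functional by blast
  qed
qed

section \<open>Kernels that are peaked at the neutral element\<close>

text \<open>Faithfulness of E. The smoothed z has norm at most enorm z = 0, but it is also within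
  \<mu> \<eta> of \<mu> z.\<close>

lemma enorm_eq_0:
  assumes "enorm z = 0"
  shows "z = 0"
proof -
  have "norm z \<le> 0 + \<eta>" if \<eta>: "0 < \<eta>" for \<eta>
  proof -
    obtain \<mu> where \<mu>: "weight (near_one z \<eta>) \<mu>" by (rule near_one_weight[OF \<eta>])
    then have "0 < \<mu>" by (simp add: weight_def)
    have "norm (wmean (near_one z \<eta>) z - \<mu> *\<^sub>R z) \<le> \<mu> * \<eta>"
      using \<eta> by (intro norm_wmean_near_one_diff_le[OF \<mu>]) auto
    moreover have "wmean (near_one z \<eta>) z = 0"
      using norm_wmean_le[OF \<mu>, of z] assms by simp
    ultimately show ?thesis
      using \<open>0 < \<mu>\<close> by simp
  qed
  then have "norm z \<le> 0" by (rule field_le_epsilon)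
  then show ?thesis by simp
qed

text \<open>The orbit points at distance at least \<epsilon> from y form a compact set, and by
  faithfulness of E the minimum there is positive.\<close>

lemma displacement_bounded_below:
  assumes "0 < \<epsilon>"
  obtains \<delta> where "0 < \<delta>" "\<And>g. g \<in> carrier G \<Longrightarrow> \<epsilon> \<le> norm (\<alpha> g y - y) \<Longrightarrow>
    \<delta> \<le> norm (E ((\<alpha> g y - y) * star (\<alpha> g y - y)))"
proof (cases "\<exists>g\<in>carrier G. \<epsilon> \<le> norm (\<alpha> g y - y)")
  case False
  then show ?thesis using that[of 1] by fastforce
next
  case True
  define X where "X = (\<lambda>g. \<alpha> g y) ` carrier G \<inter> {x. \<epsilon> \<le> norm (x - y)}"
  have "compact X"
    unfolding X_def by (intro compact_Int_closed compact_orbit closed_Collect_le continuous_intros)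
  moreover have "X \<noteq> {}" using True by (auto simp: X_def)
  moreover have "continuous_on X (\<lambda>x. norm (E ((x - y) * star (x - y))))"
    by (intro continuous_on_norm bounded_linear.continuous_on[OF bounded_linear_E]
        bounded_linear.continuous_on[OF bounded_linear_star] continuous_intros)
  ultimately have "\<exists>x\<in>X. \<forall>x'\<in>X. norm (E ((x - y) * star (x - y))) \<le> norm (E ((x' - y) * star (x' - y)))"
    by (rule continuous_attains_inf)
  then obtain x where x: "x \<in> X" "\<And>x'. x' \<in> X \<Longrightarrow>
    norm (E ((x - y) * star (x - y))) \<le> norm (E ((x' - y) * star (x' - y)))"
    by (auto elim: bexE)
  show ?thesis
  proof (rule that)
    show "0 < norm (E ((x - y) * star (x - y)))"
    proof (rule ccontr)
      assume "\<not> 0 < norm (E ((x - y) * star (x - y)))"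
      then have "enorm (star (x - y)) = 0"
        by (simp add: enorm_def star_star)
      then have "star (x - y) = 0" by (rule enorm_eq_0)
      then have "norm (x - y) = 0" by (metis norm_star norm_zero)
      then show False using x(1) assms by (simp add: X_def)
    qed
    fix g assume "g \<in> carrier G" "\<epsilon> \<le> norm (\<alpha> g y - y)"
    then show "norm (E ((x - y) * star (x - y))) \<le> norm (E ((\<alpha> g y - y) * star (\<alpha> g y - y)))"
      by (intro x(2)) (auto simp: X_def)
  qed
qed

lemma Re_\<omega>_displacement:
  assumes g: "g \<in> carrier G"
  shows "Re (\<omega> (star D * E ((\<alpha> g y - y) * star (\<alpha> g y - y)) * D))
    = 2 * Re (\<omega> (star D * E (y * star y) * D) - \<omega> (star D * E (y * star (\<alpha> g y)) * D))"
proof -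
  have "E ((\<alpha> g y - y) * star (\<alpha> g y - y))
    = E (\<alpha> g (y * star y)) - E (y * star (\<alpha> g y)) - star (E (y * star (\<alpha> g y))) + E (y * star y)"
    using g by (simp add: algebra_simps act_times act_star star_diff E_add E_diff star_mult star_star flip: E_star)
  then have eq: "E ((\<alpha> g y - y) * star (\<alpha> g y - y))
    = E (y * star y) - E (y * star (\<alpha> g y)) - star (E (y * star (\<alpha> g y))) + E (y * star y)"
    using g by (simp only: E_act)
  have "star D * E ((\<alpha> g y - y) * star (\<alpha> g y - y)) * D
    = star D * E (y * star y) * D - star D * E (y * star (\<alpha> g y)) * D
      - star (star D * E (y * star (\<alpha> g y)) * D) + star D * E (y * star y) * D"
    unfolding eq by (simp add: left_diff_distrib right_diff_distrib distrib_left distrib_right star_mult star_star mult.assoc)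
  then show ?thesis
    by (simp add: \<omega>_add \<omega>_diff \<omega>_star)
qed

text \<open>An isometry of \<open>B\<close> near the norm of the averaged displacement detects that
  g moves y, and it also works for nearby g. A finite net yields finitely many kernels. They can be
  added without loss, since each of them has nonnegative drop everywhere.\<close>

lemma separating_kernel:
  assumes "0 < \<epsilon>"
  obtains k \<gamma> L where "kernel k" "0 < \<gamma>" "0 \<le> L"
    "\<And>g h. norm (k g - k h) \<le> L * norm (\<alpha> g y - \<alpha> h y)"
    "\<And>g. g \<in> carrier G \<Longrightarrow> \<epsilon> \<le> norm (\<alpha> g y - y) \<Longrightarrow> \<gamma> \<le> Re (k \<one> - k g)"
proof -
  obtain \<delta> where \<delta>: "0 < \<delta>" "\<And>g. g \<in> carrier G \<Longrightarrow> \<epsilon> \<le> norm (\<alpha> g y - y) \<Longrightarrow>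
    \<delta> \<le> norm (E ((\<alpha> g y - y) * star (\<alpha> g y - y)))"
    by (rule displacement_bounded_below[OF assms]) (rule that)
  define c where "c g = E ((\<alpha> g y - y) * star (\<alpha> g y - y))" for g
  have c: "c g \<in> B" "cpos (c g)" for g
    unfolding c_def by (auto intro: cpos_E cpos_mult_star_self)
  define C where "C = 2 * norm y + 1"
  have C: "0 < C" by (simp add: C_def add_nonneg_pos)
  \<comment> \<open>Passing to a net point changes the displacement by at most \<delta>/8, which
    leaves 7 \<delta>/8. The compression loses at most \<delta>/4 more, so at least \<delta>/2
    remains, and half of this is the drop.\<close>
  define \<rho> where "\<rho> = \<delta> / (16 * C)"
  have \<rho>: "0 < \<rho>" using \<delta> C by (simp add: \<rho>_def)
  have \<rho>C: "2 * C * \<rho> = \<delta> / 8" using C by (simp add: \<rho>_def)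
  obtain N where N: "finite N" "N \<subseteq> carrier G" "\<And>g. g \<in> carrier G \<Longrightarrow> \<exists>h\<in>N. norm (\<alpha> g y - \<alpha> h y) \<le> \<rho>"
    by (rule almost_periodic_net[OF almost_periodic_orbit[of y] \<rho>]) (rule that)
  have c_close: "norm (c g - c h) \<le> \<delta> / 8"
    if "g \<in> carrier G" "h \<in> carrier G" "norm (\<alpha> g y - \<alpha> h y) \<le> \<rho>" for g h
  proof -
    have "norm (\<alpha> g y - y) \<le> C" "norm (\<alpha> h y - y) \<le> C"
      using norm_triangle_ineq4[of "\<alpha> g y" y] norm_triangle_ineq4[of "\<alpha> h y" y] that by (auto simp: C_def)
    then have "norm ((\<alpha> g y - y) * star (\<alpha> g y - y) - (\<alpha> h y - y) * star (\<alpha> h y - y)) \<le> 2 * C * \<rho>"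
      using that(3) by (intro norm_mult_diff_le) (auto simp flip: star_diff)
    then show ?thesis
      unfolding c_def E_diff[symmetric] \<rho>C by (rule order.trans[OF norm_E])
  qed
  define N' where "N' = {h \<in> N. \<delta> / 2 \<le> norm (c h)}"
  have "\<exists>D. D \<in> isom \<and> norm (c h * D - norm (c h) *\<^sub>R D) \<le> \<delta> / 8" if "h \<in> N'" for h
  proof -
    have "c h \<noteq> 0" using that \<delta>(1) by (auto simp: N'_def)
    then obtain D where "D \<in> isom" "norm (c h * D - norm (c h) *\<^sub>R D) \<le> \<delta> / 8"
      using B.isometry_near_norm[OF c, of h "\<delta> / 8"] \<delta>(1) by auto
    then show ?thesis by blast
  qed
  then obtain D where D: "\<And>h. h \<in> N' \<Longrightarrow> D h \<in> isom"
    "\<And>h. h \<in> N' \<Longrightarrow> norm (c h * D h - norm (c h) *\<^sub>R D h) \<le> \<delta> / 8"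
    by metis
  have finN: "finite N'" using N by (simp add: N'_def)
  define q where "q h g = \<omega> (star (D h) * E (y * star (\<alpha> g y)) * D h)" for h g
  have q_sep: "Re (\<omega> (star (D h) * c g * D h)) = 2 * Re (q h \<one> - q h g)" if "g \<in> carrier G" for g h
    using Re_\<omega>_displacement[OF that, of "D h" y] by (simp add: q_def c_def)
  define k where "k g = (\<Sum>h\<in>N'. q h g)" for g
  define L where "L = real (card N') * norm y"
  show thesis
  proof (rule that)
    show "kernel k"
      unfolding k_def q_def by (intro kernel_sum kernel_functional)
    show "0 < \<delta> / 4" using \<delta> by simp
    show "0 \<le> L" by (simp add: L_def)
    show "norm (k g - k h) \<le> L * norm (\<alpha> g y - \<alpha> h y)" for g h
    proof -
      have "norm (k g - k h) \<le> (\<Sum>i\<in>N'. norm y * norm (\<alpha> g y - \<alpha> h y))"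
        unfolding k_def sum_subtractf[symmetric]
      proof (intro sum_norm_le)
        fix i assume i: "i \<in> N'"
        have "q i g - q i h = \<omega> (star (D i) * E (y * star (\<alpha> g y - \<alpha> h y)) * D i)"
          by (simp add: q_def algebra_simps star_diff E_diff \<omega>_diff)
        also have "cmod \<dots> \<le> norm (star (D i) * E (y * star (\<alpha> g y - \<alpha> h y)) * D i)"
          by (rule cmod_\<omega>_le)
        also have "\<dots> \<le> norm (E (y * star (\<alpha> g y - \<alpha> h y)))"
          using B.isometriesD(2)[OF D(1)[OF i]] by (rule norm_conj_isometry_le)
        also have "\<dots> \<le> norm y * norm (star (\<alpha> g y - \<alpha> h y))"
          by (rule order.trans[OF norm_E norm_mult_ineq])
        finally show "norm (q i g - q i h) \<le> norm y * norm (\<alpha> g y - \<alpha> h y)"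
          by (simp only: norm_star)
      qed
      then show ?thesis by (simp add: L_def)
    qed
    fix g assume g: "g \<in> carrier G" "\<epsilon> \<le> norm (\<alpha> g y - y)"
    obtain h where h: "h \<in> N" "norm (\<alpha> g y - \<alpha> h y) \<le> \<rho>" using N(3) g by blast
    have ch: "norm (c g - c h) \<le> \<delta> / 8" using c_close g h N by blast
    have "\<delta> \<le> norm (c g)" using \<delta>(2)[OF g] by (simp add: c_def)
    then have nch: "\<delta> * (7/8) \<le> norm (c h)"
      using norm_triangle_sub[of "c g" "c h"] ch by simp
    then have h': "h \<in> N'" using h \<delta>(1) by (simp add: N'_def)
    have Dh: "D h \<in> B" "star (D h) * D h = 1" "norm (D h) = 1"
      using D(1)[OF h'] B.isometriesD B.isometries_norm by blast+
    have "star (D h) * c g * D h - of_real (norm (c h))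
      = star (D h) * (c g - c h) * D h + star (D h) * (c h * D h - norm (c h) *\<^sub>R D h)"
      using Dh(2) by (simp add: algebra_simps of_real_def)
    also have "norm \<dots> \<le> \<delta> / 8 + \<delta> / 8"
    proof (intro norm_triangle_le add_mono)
      show "norm (star (D h) * (c g - c h) * D h) \<le> \<delta> / 8"
        using norm_conj_isometry_le[OF Dh(2)] ch by (rule order.trans)
      show "norm (star (D h) * (c h * D h - norm (c h) *\<^sub>R D h)) \<le> \<delta> / 8"
        using norm_mult_ineq[of "star (D h)" "c h * D h - norm (c h) *\<^sub>R D h"] D(2)[OF h'] Dh(3) by simp
    qed
    finally have "norm (star (D h) * c g * D h - of_real (norm (c h))) \<le> \<delta> / 4" by simp
    then have "cmod (\<omega> (star (D h) * c g * D h - of_real (norm (c h)))) \<le> \<delta> / 4"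
      using cmod_\<omega>_le order.trans by blast
    moreover have "\<omega> (of_real (norm (c h))) = of_real (norm (c h))"
      by (simp add: of_real_def[where 'a='a] \<omega>_scaleR \<omega>_one)
    ultimately have "\<bar>Re (\<omega> (star (D h) * c g * D h)) - norm (c h)\<bar> \<le> \<delta> / 4"
      using abs_Re_le_cmod[of "\<omega> (star (D h) * c g * D h) - of_real (norm (c h))"] by (simp add: \<omega>_diff)
    then have "\<delta> / 2 \<le> Re (\<omega> (star (D h) * c g * D h))"
      using nch \<delta>(1) by linarith
    also have "\<dots> = 2 * Re (q h \<one> - q h g)" by (rule q_sep[OF g(1)])
    finally have "\<delta> / 4 \<le> Re (q h \<one> - q h g)" by simp
    also have "\<dots> \<le> (\<Sum>i\<in>N'. Re (q i \<one> - q i g))"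
    proof (rule member_le_sum[OF h' _ finN])
      fix i
      have "0 \<le> Re (\<omega> (star (D i) * c g * D i))"
        by (intro \<omega>_cpos cpos_conj c)
      then show "0 \<le> Re (q i \<one> - q i g)"
        using q_sep[OF g(1)] by simp
    qed
    also have "\<dots> = Re (k \<one> - k g)"
      by (simp add: k_def sum_subtractf)
    finally show "\<delta> / 4 \<le> Re (k \<one> - k g)" .
  qed
qed

text \<open>
  For the convolution square \<open>K\<close> of the kernel above, \<open>K(1) - Re K(g)\<close> is half the mean of
  \<open>|k(a) - k(g\<^sup>-\<^sup>1a)|\<^sup>2\<close> over \<open>a\<close>.
\<close>

lemma peaked_kernel_single:
  assumes "0 < \<epsilon>"
  obtains \<kappa> :: "'g \<Rightarrow> real" and \<delta> where "kernel (\<lambda>g. complex_of_real (\<kappa> g))" "0 < \<delta>" "\<kappa> \<one> = 1"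
    "\<And>g. g \<in> carrier G \<Longrightarrow> 0 \<le> \<kappa> g \<and> \<kappa> g \<le> 1"
    "\<And>g. g \<in> carrier G \<Longrightarrow> \<epsilon> \<le> norm (\<alpha> g y - y) \<Longrightarrow> \<kappa> g \<le> 1 - \<delta>"
proof -
  obtain k \<gamma> L where k: "kernel k" "0 < \<gamma>" "0 \<le> L"
    "\<And>g h. norm (k g - k h) \<le> L * norm (\<alpha> g y - \<alpha> h y)"
    "\<And>g. g \<in> carrier G \<Longrightarrow> \<epsilon> \<le> norm (\<alpha> g y - y) \<Longrightarrow> \<gamma> \<le> Re (k \<one> - k g)"
    by (rule separating_kernel[OF assms]) (rule that)
  obtain C where C: "0 \<le> C" "\<And>g. g \<in> carrier G \<Longrightarrow> cmod (k g) \<le> C"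
    using kernel_bounded[OF k(1)] by blast
  have ap: "almost_periodic k"
    by (rule almost_periodic_Lipschitz[OF almost_periodic_orbit[of y] k(3) k(4)])
  have "\<exists>c. is_mean (\<lambda>a. k a * cnj (k (inv g \<otimes> a))) c" if g: "g \<in> carrier G" for g
  proof -
    have "almost_periodic (\<lambda>a. cnj (k (inv g \<otimes> a)))"
      by (rule almost_periodic_Lipschitz[OF almost_periodic_translate[OF ap, of "inv g"], of 1])
        (use g in \<open>auto simp flip: complex_cnj_diff\<close>)
    then have "almost_periodic (\<lambda>a. k a * cnj (k (inv g \<otimes> a)))"
      by (rule almost_periodic_bilinear[OF bounded_bilinear_mult ap, of _ C]) (use C g in auto)
    then show ?thesis
      using almost_periodic_imp_is_mean by blast
  qed
  then obtain K where K: "\<And>g. g \<in> carrier G \<Longrightarrow> is_mean (\<lambda>a. k a * cnj (k (inv g \<otimes> a))) (K g)"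
    by metis
  define M where "M = Re (K \<one>)"
  have M: "is_mean (\<lambda>a. (cmod (k a))\<^sup>2) M"
    unfolding M_def
    by (rule is_mean_cong[OF is_mean_linear[OF K[OF one_closed] bounded_linear_Re]])
      (simp add: complex_mult_cnj cmod_power2)
  have M': "is_mean (\<lambda>a. (cmod (k (inv g \<otimes> a)))\<^sup>2) M" if g: "g \<in> carrier G" for g
    by (rule is_mean_cong[OF is_mean_translate[OF M, of "inv g" \<one>]]) (use g in auto)
  have RK: "is_mean (\<lambda>a. Re (k a * cnj (k (inv g \<otimes> a)))) (Re (K g))" if g: "g \<in> carrier G" for g
    by (rule is_mean_linear[OF K[OF g] bounded_linear_Re])
  have diff: "is_mean (\<lambda>a. (cmod (k a - k (inv g \<otimes> a)))\<^sup>2) (M + M - (Re (K g) + Re (K g)))"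
    if g: "g \<in> carrier G" for g
    by (rule is_mean_cong[OF is_mean_diff[OF is_mean_add[OF M M'[OF g]] is_mean_add[OF RK[OF g] RK[OF g]]]])
      (simp only: cmod_power2, simp add: power2_eq_square algebra_simps)
  have plus: "is_mean (\<lambda>a. (cmod (k a + k (inv g \<otimes> a)))\<^sup>2) (M + M + (Re (K g) + Re (K g)))"
    if g: "g \<in> carrier G" for g
    by (rule is_mean_cong[OF is_mean_add[OF is_mean_add[OF M M'[OF g]] is_mean_add[OF RK[OF g] RK[OF g]]]])
      (simp only: cmod_power2, simp add: power2_eq_square algebra_simps)
  have KM: "Re (K g) \<le> M" "- M \<le> Re (K g)" if g: "g \<in> carrier G" for g
    using is_mean_nonneg[OF diff[OF g]] is_mean_nonneg[OF plus[OF g]] by auto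
  have M0: "0 \<le> M" by (rule is_mean_nonneg[OF M]) simp
  \<comment> \<open>If a moves y by less than \<eta>, then k(a) and k(g^-1 a) are within \<gamma>/4
    of k(1) and k(g^-1), so the gap \<gamma> shrinks to no less than \<gamma>/2. The bump function
    at y bounds the measure of such a from below.\<close>
  define \<eta> where "\<eta> = \<gamma> / (4 * (L + 1))"
  have \<eta>: "0 < \<eta>" using k by (simp add: \<eta>_def)
  have "L * \<eta> \<le> \<gamma> / 4" using k(2,3) by (simp add: \<eta>_def field_simps)
  obtain \<mu> where \<mu>: "weight (near_one y \<eta>) \<mu>" by (rule near_one_weight[OF \<eta>])
  have \<mu>0: "0 < \<mu>" using \<mu> by (simp add: weight_def)
  have sep: "\<mu> * (\<gamma>/2)\<^sup>2 \<le> 2 * (M - Re (K g))"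
    if g: "g \<in> carrier G" "\<epsilon> \<le> norm (\<alpha> g y - y)" for g
  proof -
    have "\<alpha> (inv g) y - y = \<alpha> (inv g) (y - \<alpha> g y)"
      using g by (simp add: act_diff act_inv)
    then have "\<epsilon> \<le> norm (\<alpha> (inv g) y - y)"
      using g by (simp add: norm_minus_commute)
    then have k1: "\<gamma> \<le> Re (k \<one> - k (inv g))" using g by (intro k(5)) auto
    have "is_mean (\<lambda>a. near_one y \<eta> a * (\<gamma>/2)\<^sup>2) (\<mu> * (\<gamma>/2)\<^sup>2)"
      using \<mu> by (intro is_mean_linear[OF _ bounded_linear_mult_left]) (auto simp: weight_def)
    from is_mean_mono[OF this diff[OF g(1)]]
    have "\<mu> * (\<gamma>/2)\<^sup>2 \<le> M + M - (Re (K g) + Re (K g))"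
    proof -
      have "near_one y \<eta> a * (\<gamma>/2)\<^sup>2 \<le> (cmod (k a - k (inv g \<otimes> a)))\<^sup>2" if a: "a \<in> carrier G" for a
      proof (cases "norm (\<alpha> a y - y) < \<eta>")
        case True
        have 1: "cmod (k a - k \<one>) \<le> L * \<eta>"
          using k(4)[of a \<one>] True mult_left_mono[of "norm (\<alpha> a y - y)" \<eta> L] k(3) by auto
        have "\<alpha> (inv g \<otimes> a) y - \<alpha> (inv g) y = \<alpha> (inv g) (\<alpha> a y - y)"
          using g a by (simp add: act_mult act_diff)
        then have "norm (\<alpha> (inv g \<otimes> a) y - \<alpha> (inv g) y) \<le> \<eta>"
          using True g by simp
        then have 2: "cmod (k (inv g \<otimes> a) - k (inv g)) \<le> L * \<eta>"
          using k(4)[of "inv g \<otimes> a" "inv g"] mult_left_mono[of "norm (\<alpha> (inv g \<otimes> a) y - \<alpha> (inv g) y)" \<eta> L] k(3)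
          by auto
        have "\<gamma>/2 \<le> Re (k a - k (inv g \<otimes> a))"
          using 1 2 k1 abs_Re_le_cmod[of "k a - k \<one>"] abs_Re_le_cmod[of "k (inv g \<otimes> a) - k (inv g)"] \<open>L * \<eta> \<le> \<gamma> / 4\<close>
          by simp
        then have "\<gamma>/2 \<le> cmod (k a - k (inv g \<otimes> a))"
          using complex_Re_le_cmod order.trans by blast
        then have "(\<gamma>/2)\<^sup>2 \<le> (cmod (k a - k (inv g \<otimes> a)))\<^sup>2"
          using k(2) by (intro power_mono) auto
        moreover have "near_one y \<eta> a * (\<gamma>/2)\<^sup>2 \<le> 1 * (\<gamma>/2)\<^sup>2"
          using \<eta> by (intro mult_right_mono near_one_bounds) auto
        ultimately show ?thesis by simp
      qed (use \<eta> in \<open>simp add: near_one_eq_0\<close>)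
      then show ?thesis by (rule is_mean_mono[OF \<open>is_mean (\<lambda>a. near_one y \<eta> a * (\<gamma>/2)\<^sup>2) (\<mu> * (\<gamma>/2)\<^sup>2)\<close> diff[OF g(1)]])
    qed
    then show ?thesis by simp
  qed
  \<comment> \<open>As |Re K| \<le> M = K(1), adding M + 2 gives nonnegative values and 2 (M + 1) at
    the neutral element. Adding 2 more than M keeps this positive when M = 0.\<close>
  define \<kappa> where "\<kappa> g = (M + 2 + Re (K g)) / (2 * (M + 1))" for g
  show thesis
  proof (rule that)
    have "kernel (\<lambda>g. complex_of_real (1 / (2 * (M + 1))) * (complex_of_real (M + 2) * 1 + complex_of_real (1/2) * (K g + cnj (K g))))"
      using M0 by (intro kernel_scale kernel_add kernel_one kernel_convolution[OF k(1) K]) auto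
    moreover have "complex_of_real (1 / (2 * (M + 1))) * (complex_of_real (M + 2) * 1 + complex_of_real (1/2) * (K g + cnj (K g))) = complex_of_real (\<kappa> g)" for g
      by (simp add: complex_add_cnj \<kappa>_def)
    ultimately show "kernel (\<lambda>g. complex_of_real (\<kappa> g))" by simp
    show "0 < \<mu> * (\<gamma>/2)\<^sup>2 / (4 * (M + 1))" using \<mu>0 k(2) M0 by simp
    show "\<kappa> \<one> = 1" using M0 by (simp add: \<kappa>_def M_def[symmetric])
    show "0 \<le> \<kappa> g \<and> \<kappa> g \<le> 1" if "g \<in> carrier G" for g
      using KM[OF that] M0 by (simp add: \<kappa>_def)
    show "\<kappa> g \<le> 1 - \<mu> * (\<gamma>/2)\<^sup>2 / (4 * (M + 1))" if "g \<in> carrier G" "\<epsilon> \<le> norm (\<alpha> g y - y)" for g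
    proof -
      have "1 - \<kappa> g = (2 * (M - Re (K g))) / (4 * (M + 1))"
        using M0 by (simp add: \<kappa>_def field_simps)
      also have "\<dots> \<ge> \<mu> * (\<gamma>/2)\<^sup>2 / (4 * (M + 1))"
        using sep[OF that] M0 by (intro divide_right_mono) auto
      finally show ?thesis by simp
    qed
  qed
qed

text \<open>Kernels for the single elements are multiplied. All values lie in [0, 1], so one small
  factor makes the product small.\<close>

lemma peaked_kernel:
  assumes "finite Y" "0 < \<epsilon>"
  obtains \<kappa> :: "'g \<Rightarrow> real" and \<delta> where "kernel (\<lambda>g. complex_of_real (\<kappa> g))" "0 < \<delta>" "\<kappa> \<one> = 1"
    "\<And>g. g \<in> carrier G \<Longrightarrow> 0 \<le> \<kappa> g \<and> \<kappa> g \<le> 1"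
    "\<And>g y. g \<in> carrier G \<Longrightarrow> y \<in> Y \<Longrightarrow> \<epsilon> \<le> norm (\<alpha> g y - y) \<Longrightarrow> \<kappa> g \<le> 1 - \<delta>"
proof -
  have "\<exists>(\<kappa> :: 'g \<Rightarrow> real) \<delta>. kernel (\<lambda>g. complex_of_real (\<kappa> g)) \<and> 0 < \<delta> \<and> \<kappa> \<one> = 1 \<and>
    (\<forall>g\<in>carrier G. 0 \<le> \<kappa> g \<and> \<kappa> g \<le> 1 \<and> (\<forall>y\<in>Y. \<epsilon> \<le> norm (\<alpha> g y - y) \<longrightarrow> \<kappa> g \<le> 1 - \<delta>))"
    using assms(1)
  proof (induction Y)
    case empty
    show ?case
      using kernel_one by (intro exI[of _ "\<lambda>_. 1"] exI[of _ 1]) auto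
  next
    case (insert y Y)
    then obtain \<kappa> :: "'g \<Rightarrow> real" and \<delta> where 1: "kernel (\<lambda>g. complex_of_real (\<kappa> g))" "0 < \<delta>" "\<kappa> \<one> = 1"
      "\<And>g. g \<in> carrier G \<Longrightarrow> 0 \<le> \<kappa> g \<and> \<kappa> g \<le> 1"
      "\<And>g y. g \<in> carrier G \<Longrightarrow> y \<in> Y \<Longrightarrow> \<epsilon> \<le> norm (\<alpha> g y - y) \<Longrightarrow> \<kappa> g \<le> 1 - \<delta>"
      by blast
    obtain \<kappa>' :: "'g \<Rightarrow> real" and \<delta>' where 2: "kernel (\<lambda>g. complex_of_real (\<kappa>' g))" "0 < \<delta>'" "\<kappa>' \<one> = 1"
      "\<And>g. g \<in> carrier G \<Longrightarrow> 0 \<le> \<kappa>' g \<and> \<kappa>' g \<le> 1"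
      "\<And>g. g \<in> carrier G \<Longrightarrow> \<epsilon> \<le> norm (\<alpha> g y - y) \<Longrightarrow> \<kappa>' g \<le> 1 - \<delta>'"
      by (rule peaked_kernel_single[OF assms(2), of y]) (rule that)
    show ?case
    proof (intro exI[of _ "\<lambda>g. \<kappa> g * \<kappa>' g"] exI[of _ "min \<delta> \<delta>'"] conjI ballI impI)
      show "kernel (\<lambda>g. complex_of_real (\<kappa> g * \<kappa>' g))"
        using kernel_mult[OF 1(1) 2(1)] by simp
      fix g assume g: "g \<in> carrier G"
      note b = 1(4)[OF g] 2(4)[OF g]
      show "0 \<le> \<kappa> g * \<kappa>' g" using b by simp
      have le: "\<kappa> g * \<kappa>' g \<le> \<kappa> g" "\<kappa> g * \<kappa>' g \<le> \<kappa>' g"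
        using b by (auto simp: mult_left_le mult_left_le_one_le)
      then show "\<kappa> g * \<kappa>' g \<le> 1" using b by linarith
      fix z assume z: "z \<in> insert y Y" "\<epsilon> \<le> norm (\<alpha> g z - z)"
      then have "\<kappa> g \<le> 1 - \<delta> \<or> \<kappa>' g \<le> 1 - \<delta>'"
        using 1(5) 2(5) g by blast
      then show "\<kappa> g * \<kappa>' g \<le> 1 - min \<delta> \<delta>'"
        using le by linarith
    qed (use 1 2 in auto)
  qed
  then show thesis using that by blast
qed

end

section \<open>Approximation of equivariant completely positive maps\<close>

lemma norm_sandwich_diff_le:
  fixes u u' z :: "'a::real_normed_algebra_1"
  assumes "0 \<le> k" "k \<le> 1" "norm (u - k *\<^sub>R 1) \<le> \<tau>" "0 \<le> k'" "k' \<le> 1" "norm (u' - k' *\<^sub>R 1) \<le> \<tau>" "\<tau> \<le> 1"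
  shows "norm (u * z * u' - (k * k') *\<^sub>R z) \<le> 3 * \<tau> * norm z"
proof -
  have \<tau>: "0 \<le> \<tau>" using assms(3) norm_ge_zero order.trans by blast
  have "norm u' \<le> 2"
    using norm_triangle_sub[of u' "k' *\<^sub>R 1"] assms by simp
  have "u * z * u' - (k * k') *\<^sub>R z = (u - k *\<^sub>R 1) * z * u' + k *\<^sub>R (z * (u' - k' *\<^sub>R 1))"
    by (simp add: algebra_simps)
  also have "norm \<dots> \<le> \<tau> * norm z * 2 + 1 * (norm z * \<tau>)"
  proof (intro norm_triangle_le add_mono)
    show "norm ((u - k *\<^sub>R 1) * z * u') \<le> \<tau> * norm z * 2"
      using assms(3) \<open>norm u' \<le> 2\<close> \<tau>
      by (intro order.trans[OF norm_mult_ineq] mult_mono order.trans[OF norm_mult_ineq]) auto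
    show "norm (k *\<^sub>R (z * (u' - k' *\<^sub>R 1))) \<le> 1 * (norm z * \<tau>)"
      unfolding norm_scaleR using assms
      by (intro mult_mono order.trans[OF norm_mult_ineq]) auto
  qed
  finally show ?thesis by simp
qed

section \<open>Norm bounds for the equivariant map\<close>

locale equivariant_map = kirchberg_state G \<alpha> S \<omega>
  for G :: "('g, 'm) monoid_scheme" (structure) and \<alpha> :: "'g \<Rightarrow> 'a::unital_cstar_algebra \<Rightarrow> 'a" and S \<omega> +
  fixes \<nu> :: "'a \<Rightarrow> 'a"
  assumes cp_\<nu>: "completely_positive UNIV UNIV \<nu>"
    and \<nu>_one: "\<nu> 1 = 1"
    and \<nu>_act: "g \<in> carrier G \<Longrightarrow> \<nu> (\<alpha> g x) = \<alpha> g (\<nu> x)"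
begin

lemma \<nu>_add: "\<nu> (x + y) = \<nu> x + \<nu> y" and \<nu>_scaleC: "\<nu> (c *\<^sub>C x) = c *\<^sub>C \<nu> x"
  using cp_\<nu> unfolding completely_positive_def complex_linear_on_def by auto

lemma \<nu>_scaleR: "\<nu> (r *\<^sub>R x) = r *\<^sub>R \<nu> x"
  by (metis \<nu>_scaleC scaleC_of_real)

lemma \<nu>_diff: "\<nu> (x - y) = \<nu> x - \<nu> y"
  using \<nu>_add[of x "- y"] \<nu>_scaleR[of "-1" y] by simp

lemma cpos_\<nu>:
  assumes "cpos x"
  shows "cpos (\<nu> x)"
proof -
  obtain y where x: "x = star y * y"
    using unital_subalgebra.cpos_iff_star_mult_self[OF unital_subalgebra_UNIV] assms
    by (auto simp: positive_in_def)
  obtain v :: "nat \<Rightarrow> nat \<Rightarrow> 'a" where "\<And>r i. r < 1 \<Longrightarrow> i < 1 \<Longrightarrow> v r i \<in> UNIV"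
    and v: "\<And>i j. i < 1 \<Longrightarrow> j < 1 \<Longrightarrow> \<nu> (star y * y) = (\<Sum>r<1. star (v r i) * v r j)"
    by (rule completely_positive_row[OF cp_\<nu>, of 1 "\<lambda>_. y"], simp, simp, simp) (rule that)
  from v[of 0 0] show ?thesis
    by (simp add: x cpos_star_mult_self)
qed

text \<open>The constant is crude but sufficient. A self-adjoint x is shifted by its norm to a
  positive element of norm at most 2 norm x, which gives 3 after removing the shift; real and
  imaginary part double this.\<close>

lemma norm_\<nu>_le: "norm (\<nu> x) \<le> 6 * norm x"
proof -
  have pos: "norm (\<nu> x) \<le> t" if "cpos x" "norm x \<le> t" for x t
  proof (rule cpos_norm_le[OF cpos_\<nu>[OF that(1)]])
    have "cpos (\<nu> (of_real t - x))"
      using that by (intro cpos_\<nu> cpos_norm_minus cpos_selfadjoint)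
    then show "cpos (of_real t - \<nu> x)"
      by (simp add: \<nu>_diff of_real_def \<nu>_scaleR \<nu>_one)
  qed
  have selfadjoint: "norm (\<nu> x) \<le> 3 * norm x" if "star x = x" for x
  proof -
    have "cpos (of_real (norm x) - (- x))"
      using that by (intro cpos_norm_minus) (auto simp: star_minus)
    moreover have "norm (of_real (norm x) - (- x)) \<le> 2 * norm x"
      using norm_triangle_ineq[of "of_real (norm x)" x] by simp
    ultimately have "norm (\<nu> (of_real (norm x) - (- x))) \<le> 2 * norm x"
      by (rule pos)
    moreover have "\<nu> x = \<nu> (of_real (norm x) - (- x)) - norm x *\<^sub>R 1"
      by (simp add: \<nu>_add of_real_def \<nu>_scaleR \<nu>_one)
    ultimately show ?thesis
      using norm_triangle_ineq4[of "\<nu> (of_real (norm x) - (- x))" "norm x *\<^sub>R 1"] by simp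
  qed
  define a where "a = (1/2) *\<^sub>R (x + star x)"
  define b where "b = (- \<i> / 2) *\<^sub>C (x - star x)"
  have ab: "star a = a" "star b = b" "x = a + \<i> *\<^sub>C b"
    unfolding a_def b_def using cartesian_decomposition[of x] by auto
  have nab: "norm a \<le> norm x" "norm b \<le> norm x"
    using norm_triangle_ineq[of x "star x"] norm_triangle_ineq4[of x "star x"]
    by (auto simp: a_def b_def norm_scaleC norm_divide)
  have "norm (\<nu> x) \<le> norm (\<nu> a) + norm (\<i> *\<^sub>C \<nu> b)"
    unfolding ab(3) \<nu>_add \<nu>_scaleC by (rule norm_triangle_ineq)
  also have "\<dots> \<le> 3 * norm x + 3 * norm x"
    using selfadjoint[OF ab(1)] selfadjoint[OF ab(2)] nab by (intro add_mono) (auto simp: norm_scaleC)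
  finally show ?thesis by simp
qed

lemma bounded_linear_\<nu>: "bounded_linear \<nu>"
  by (rule bounded_linear_intro[of _ 6]) (simp_all add: \<nu>_add \<nu>_scaleR norm_\<nu>_le mult.commute[of _ 6])

text \<open>All four factors are within \<tau> of scalars in [0, 1] and thus have norm at most 2.
  The inner pair contributes 6 * 3 = 18. The outer pair contributes 3 times the bound 24 = 6 * 4 of
  the middle term, which is 72.\<close>

lemma norm_\<nu>_sandwich_le:
  assumes k: "\<And>i. i < (4::nat) \<Longrightarrow> 0 \<le> k i \<and> k i \<le> 1 \<and> norm (u i - k i *\<^sub>R 1) \<le> \<tau>" and "\<tau> \<le> 1"
  shows "norm (u 0 * \<nu> (u 1 * z * u 2) * u 3 - (k 0 * k 1 * k 2 * k 3) *\<^sub>R \<nu> z) \<le> 90 * \<tau> * norm z"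
proof -
  note k' = k[of 0, simplified] k[of 1, simplified] k[of 2, simplified] k[of 3, simplified]
  have \<tau>: "0 \<le> \<tau>" using k' norm_ge_zero order.trans by blast
  define v where "v = \<nu> (u 1 * z * u 2)"
  have u2: "norm (u i) \<le> 2" if "i < 4" for i
    using norm_triangle_sub[of "u i" "k i *\<^sub>R 1"] k[OF that] \<open>\<tau> \<le> 1\<close> by simp
  have "norm (u 1 * z * u 2) \<le> 2 * norm z * 2"
    using u2[of 1] u2[of 2]
    by (intro order.trans[OF norm_mult_ineq] mult_mono order.trans[OF norm_mult_ineq]) auto
  then have v: "norm v \<le> 24 * norm z"
    using norm_\<nu>_le[of "u 1 * z * u 2"] unfolding v_def by linarith
  have "norm (u 1 * z * u 2 - (k 1 * k 2) *\<^sub>R z) \<le> 3 * \<tau> * norm z"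
    using k' \<open>\<tau> \<le> 1\<close> by (intro norm_sandwich_diff_le) auto
  then have 1: "norm (v - (k 1 * k 2) *\<^sub>R \<nu> z) \<le> 18 * \<tau> * norm z"
    using norm_\<nu>_le[of "u 1 * z * u 2 - (k 1 * k 2) *\<^sub>R z"] by (simp add: v_def \<nu>_diff \<nu>_scaleR)
  have "norm (u 0 * v * u 3 - (k 0 * k 3) *\<^sub>R v) \<le> 3 * \<tau> * norm v"
    using k' \<open>\<tau> \<le> 1\<close> by (intro norm_sandwich_diff_le) auto
  also have "\<dots> \<le> 3 * \<tau> * (24 * norm z)"
    using v \<tau> by (intro mult_left_mono) auto
  finally have 2: "norm (u 0 * v * u 3 - (k 0 * k 3) *\<^sub>R v) \<le> 72 * \<tau> * norm z" by simp
  have kk: "\<bar>k 0 * k 3\<bar> \<le> 1" using k' by (simp add: mult_le_one)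
  have 3: "norm ((k 0 * k 3) *\<^sub>R (v - (k 1 * k 2) *\<^sub>R \<nu> z)) \<le> 1 * (18 * \<tau> * norm z)"
    unfolding norm_scaleR using 1 kk by (intro mult_mono) auto
  have "u 0 * v * u 3 - (k 0 * k 1 * k 2 * k 3) *\<^sub>R \<nu> z
    = (u 0 * v * u 3 - (k 0 * k 3) *\<^sub>R v) + (k 0 * k 3) *\<^sub>R (v - (k 1 * k 2) *\<^sub>R \<nu> z)"
    by (simp add: scaleR_diff_right mult_ac)
  also have "norm \<dots> \<le> 72 * \<tau> * norm z + 1 * (18 * \<tau> * norm z)"
    by (intro norm_triangle_le add_mono 2 3)
  finally show ?thesis by (simp add: v_def)
qed

section \<open>Maps into the fixed point algebra and their implementation\<close>

definition \<theta> :: "'a \<Rightarrow> 'a \<Rightarrow> 'a"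
  where "\<theta> s b = E (s * \<nu> (star s * b * s) * star s)"

lemma \<theta>_add: "\<theta> s (x + y) = \<theta> s x + \<theta> s y"
  by (simp add: \<theta>_def distrib_left distrib_right \<nu>_add E_add)

lemma \<theta>_scaleC: "\<theta> s (c *\<^sub>C x) = c *\<^sub>C \<theta> s x"
  by (simp add: \<theta>_def mult_scaleC_left mult_scaleC_right \<nu>_scaleC E_scaleC)

lemma \<theta>_diff: "\<theta> s (x - y) = \<theta> s x - \<theta> s y"
  by (simp add: \<theta>_def left_diff_distrib right_diff_distrib \<nu>_diff E_diff)

lemma norm_\<theta>_le: "norm (\<theta> s x) \<le> 6 * (norm s)^4 * norm x"
proof -
  have "norm (\<theta> s x) \<le> (norm (star s))\<^sup>2 * norm (\<nu> (star s * x * s))"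
    unfolding \<theta>_def using order.trans[OF norm_E norm_star_conj_le[of "star s"]] by (simp only: star_star)
  also have "\<dots> \<le> (norm s)\<^sup>2 * (6 * ((norm s)\<^sup>2 * norm x))"
    unfolding norm_star using norm_star_conj_le[of s x]
    by (intro mult_left_mono order.trans[OF norm_\<nu>_le]) auto
  also have "\<dots> = 6 * (norm s)^4 * norm x"
    by (simp add: power2_eq_square power4_eq_xxxx)
  finally show ?thesis .
qed

text \<open>The t_i belong to \<open>B\<close> and move inside E. Since \<nu> maps the Gram matrix
  of the w_i s to a Gram matrix, the sum becomes E of a sum of elements a_r a_r^*.\<close>

lemma \<theta>_completely_positive:
  fixes k :: nat
  assumes "\<And>i. i < k \<Longrightarrow> t i \<in> B"
  shows "cpos (\<Sum>i<k. \<Sum>j<k. t i * \<theta> s (star (w i) * w j) * star (t j))"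
proof -
  obtain y where y: "\<And>i j. i < k \<Longrightarrow> j < k \<Longrightarrow>
    \<nu> (star (w i * s) * (w j * s)) = (\<Sum>r<k. star (y r i) * y r j)"
    by (rule completely_positive_row[OF cp_\<nu>, of k "\<lambda>i. w i * s"]) (auto intro: that)
  define a where "a r = (\<Sum>i<k. t i * s * star (y r i))" for r
  have "(\<Sum>i<k. \<Sum>j<k. t i * \<theta> s (star (w i) * w j) * star (t j))
    = (\<Sum>i<k. \<Sum>j<k. E (\<Sum>r<k. t i * s * star (y r i) * star (t j * s * star (y r j))))"
  proof (intro sum.cong refl)
    fix i j assume ij: "i \<in> {..<k}" "j \<in> {..<k}"
    then have "t i * \<theta> s (star (w i) * w j) * star (t j)
      = E (t i * (s * \<nu> (star s * (star (w i) * w j) * s) * star s) * star (t j))"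
      using assms by (simp add: \<theta>_def E_mult_left E_mult_right B.star_in)
    also have "star s * (star (w i) * w j) * s = star (w i * s) * (w j * s)"
      by (simp add: star_mult mult.assoc)
    also have "t i * (s * \<nu> (star (w i * s) * (w j * s)) * star s) * star (t j)
      = (\<Sum>r<k. t i * s * star (y r i) * star (t j * s * star (y r j)))"
      using y[of i j] ij by (simp add: sum_distrib_left sum_distrib_right star_simps mult.assoc)
    finally show "t i * \<theta> s (star (w i) * w j) * star (t j)
      = E (\<Sum>r<k. t i * s * star (y r i) * star (t j * s * star (y r j)))" .
  qed
  also have "\<dots> = E (\<Sum>i<k. \<Sum>j<k. \<Sum>r<k. t i * s * star (y r i) * star (t j * s * star (y r j)))"
    by (simp only: E_sum)
  also have "(\<Sum>i<k. \<Sum>j<k. \<Sum>r<k. t i * s * star (y r i) * star (t j * s * star (y r j)))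
    = (\<Sum>i<k. \<Sum>r<k. \<Sum>j<k. t i * s * star (y r i) * star (t j * s * star (y r j)))"
    by (intro sum.cong refl sum.swap)
  also have "\<dots> = (\<Sum>r<k. \<Sum>i<k. \<Sum>j<k. t i * s * star (y r i) * star (t j * s * star (y r j)))"
    by (rule sum.swap)
  also have "\<dots> = (\<Sum>r<k. a r * star (a r))"
    by (simp only: a_def star_sum sum_product)
  finally show ?thesis
    by (simp only:) (intro cpos_E cpos_sum cpos_mult_star_self)
qed

text \<open>One W serves all g and h: a finite net of the orbit of s leaves finitely many arguments.
  Including the unit among them bounds (norm W)^2 by K + 1, so that replacing an argument by one at
  distance d costs at most (2K + 1) d.\<close>

lemma implementing_element:
  assumes "finite F" "0 < \<tau>"
  obtains W where "W \<in> B" "\<And>g h x. g \<in> carrier G \<Longrightarrow> h \<in> carrier G \<Longrightarrow> x \<in> F \<Longrightarrow>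
    norm (star W * (\<alpha> g s * x * star (\<alpha> h s)) * W - \<theta> s (E (\<alpha> g s * x * star (\<alpha> h s)))) \<le> \<tau>"
proof -
  define K where "K = 6 * (norm s)^4"
  have K: "0 \<le> K" by (simp add: K_def)
  define X where "X = (\<Sum>x\<in>F. norm x)"
  have X: "0 \<le> X" "\<And>x. x \<in> F \<Longrightarrow> norm x \<le> X"
    using assms(1) by (auto simp: X_def sum_nonneg intro: member_le_sum)
  define \<rho> where "\<rho> = \<tau> / (4 * ((2 * K + 1) * (X + 1) * (norm s + 1)))"
  have pos: "0 < (2 * K + 1) * (X + 1) * (norm s + 1)"
    using K X by (intro mult_pos_pos) (auto intro: add_nonneg_pos)
  have \<rho>: "0 < \<rho>" using pos assms(2) by (simp add: \<rho>_def)
  have "(2 * K + 1) * (2 * X * norm s * \<rho>) \<le> 2 * (((2 * K + 1) * (X + 1) * (norm s + 1)) * \<rho>)"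
  proof -
    have "X * norm s \<le> (X + 1) * (norm s + 1)" using X by (intro mult_mono) auto
    then have "(2 * K + 1) * (X * norm s) * \<rho> \<le> (2 * K + 1) * ((X + 1) * (norm s + 1)) * \<rho>"
      using K \<rho> by (intro mult_right_mono mult_left_mono) auto
    moreover have "(2 * K + 1) * (2 * X * norm s * \<rho>) = 2 * ((2 * K + 1) * (X * norm s) * \<rho>)"
      by simp
    ultimately show ?thesis by (simp only: mult.assoc)
  qed
  also have "\<dots> = \<tau> / 2"
  proof -
    have "2 * (M * (\<tau> / (4 * M))) = \<tau> / 2" if "0 < M" for M :: real
      using that by simp
    from this[OF pos] show ?thesis by (simp only: \<rho>_def)
  qed
  finally have \<rho>K: "(2 * K + 1) * (2 * X * norm s * \<rho>) \<le> \<tau> / 2" .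
  obtain N where N: "finite N" "N \<subseteq> carrier G" "\<And>g. g \<in> carrier G \<Longrightarrow> \<exists>h\<in>N. norm (\<alpha> g s - \<alpha> h s) \<le> \<rho>"
    by (rule almost_periodic_net[OF almost_periodic_orbit[of s] \<rho>]) (rule that)
  define z where "z g h x = \<alpha> g s * x * star (\<alpha> h s)" for g h x
  define Z where "Z = insert 1 ((\<lambda>(g, h, x). z g h x) ` (N \<times> N \<times> F))"
  have "finite Z" using N assms(1) by (simp add: Z_def)
  then obtain W where W: "W \<in> B" "\<And>z. z \<in> Z \<Longrightarrow> norm (star W * z * W - \<theta> s (E z)) \<le> min 1 (\<tau>/2)"
    using nuclear_implementation[of "\<theta> s" K Z "min 1 (\<tau>/2)"] assms(2)
      \<theta>_add[of s] \<theta>_scaleC[of s] norm_\<theta>_le[of s] \<theta>_completely_positive[of _ _ s]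
    by (auto simp: K_def \<theta>_def)
  have "norm (star W * W - \<theta> s 1) \<le> 1"
    using W(2)[of 1] by (auto simp: Z_def E_fixed)
  then have W_bound: "(norm W)\<^sup>2 \<le> K + 1"
    using norm_triangle_sub[of "star W * W" "\<theta> s 1"] norm_\<theta>_le[of s 1]
    unfolding cstar_identity[symmetric] by (simp add: K_def)
  show thesis
  proof (rule that[OF W(1)])
    fix g h x assume gh: "g \<in> carrier G" "h \<in> carrier G" and x: "x \<in> F"
    obtain g' h' where gh': "g' \<in> N" "h' \<in> N" "norm (\<alpha> g s - \<alpha> g' s) \<le> \<rho>" "norm (\<alpha> h s - \<alpha> h' s) \<le> \<rho>"
      using N(3) gh by meson
    then have G: "g' \<in> carrier G" "h' \<in> carrier G" using N by auto
    define d where "d = z g h x - z g' h' x"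
    have "d = (\<alpha> g s - \<alpha> g' s) * x * star (\<alpha> h s) + \<alpha> g' s * x * star (\<alpha> h s - \<alpha> h' s)"
      by (simp add: d_def z_def algebra_simps star_diff)
    also have "norm \<dots> \<le> \<rho> * X * norm s + norm s * X * \<rho>"
      using gh G gh'(3,4) X(2)[OF x] \<rho> X(1)
      by (intro norm_triangle_le add_mono order.trans[OF norm_mult_ineq] mult_mono order.trans[OF norm_mult_ineq])
        (simp_all del: star_diff)
    finally have d: "norm d \<le> 2 * X * norm s * \<rho>" by (simp add: mult_ac)
    have "norm (star W * d * W) \<le> (K + 1) * norm d"
      using W_bound by (intro order.trans[OF norm_star_conj_le] mult_right_mono) auto
    moreover have "norm (\<theta> s (E d)) \<le> K * norm d"
      using norm_\<theta>_le[of s "E d"] mult_left_mono[OF norm_E[of d] K] by (simp add: K_def)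
    moreover have "(2 * K + 1) * norm d \<le> \<tau> / 2"
      by (rule order.trans[OF mult_left_mono[OF d] \<rho>K]) (use K in simp)
    ultimately have 1: "norm (star W * d * W) + norm (\<theta> s (E d)) \<le> \<tau> / 2"
      by (simp add: algebra_simps)
    have 2: "norm (star W * z g' h' x * W - \<theta> s (E (z g' h' x))) \<le> \<tau> / 2"
      using W(2)[of "z g' h' x"] gh' x by (force simp: Z_def)
    have "star W * z g h x * W - \<theta> s (E (z g h x))
      = (star W * d * W - \<theta> s (E d)) + (star W * z g' h' x * W - \<theta> s (E (z g' h' x)))"
      by (simp add: d_def E_diff \<theta>_diff algebra_simps)
    also have "norm \<dots> \<le> \<tau> / 2 + \<tau> / 2"
      using 1 2 norm_triangle_ineq4[of "star W * d * W" "\<theta> s (E d)"]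
      by (intro norm_triangle_le add_mono) auto
    finally show "norm (star W * (\<alpha> g s * x * star (\<alpha> h s)) * W - \<theta> s (E (\<alpha> g s * x * star (\<alpha> h s)))) \<le> \<tau>"
      by (simp add: z_def)
  qed
qed

text \<open>
  The relation by which the iterated means \<open>p = V\<^sup>*xV\<close> and \<open>q = V\<^sup>*V\<close> are compared through
  their integrands.
\<close>

definition controlled :: "'a \<Rightarrow> real \<Rightarrow> real \<Rightarrow> real \<Rightarrow> 'a \<Rightarrow> 'a \<Rightarrow> bool"
  where "controlled y \<eta> e l p q \<longleftrightarrow>
    norm (p - \<omega> q *\<^sub>C y) \<le> \<eta> * Re (\<omega> q) + e \<and> l \<le> Re (\<omega> q)"

text \<open>The relation bounds the norm of a linear expression in p and q by an affine one in q,
  and its second condition is linear. So it is stable under taking means of all three data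
  simultaneously.\<close>

lemma controlled_mean:
  assumes "is_mean p P" "is_mean q Q" "is_mean l m"
    and c: "\<And>g. g \<in> carrier G \<Longrightarrow> controlled y \<eta> e (l g) (p g) (q g)"
  shows "controlled y \<eta> e m P Q"
proof -
  have bl: "bounded_linear (\<lambda>c. c *\<^sub>C y)"
    by (rule bounded_linear_intro[of _ "norm y"])
      (simp_all add: scaleC_add_left norm_scaleC scaleR_conv_of_real[where 'a=complex] scaleC_of_real
        flip: scaleC_scaleC)
  have "is_mean (\<lambda>g. p g - \<omega> (q g) *\<^sub>C y) (P - \<omega> Q *\<^sub>C y)"
    by (rule is_mean_diff[OF assms(1) is_mean_linear[OF is_mean_linear[OF assms(2) bounded_linear_\<omega>] bl]])
  moreover have re: "is_mean (\<lambda>g. Re (\<omega> (q g))) (Re (\<omega> Q))"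
    by (rule is_mean_linear[OF is_mean_linear[OF assms(2) bounded_linear_\<omega>] bounded_linear_Re])
  then have "is_mean (\<lambda>g. \<eta> * Re (\<omega> (q g)) + e) (\<eta> * Re (\<omega> Q) + e)"
    by (intro is_mean_add is_mean_const is_mean_linear[OF _ bounded_linear_mult_right])
  ultimately have "norm (P - \<omega> Q *\<^sub>C y) \<le> \<eta> * Re (\<omega> Q) + e"
    by (rule is_mean_norm_le) (use c in \<open>simp add: controlled_def\<close>)
  moreover have "m \<le> Re (\<omega> Q)"
    by (rule is_mean_mono[OF assms(3) re]) (use c in \<open>simp add: controlled_def\<close>)
  ultimately show ?thesis by (simp add: controlled_def)
qed

lemma controlled_perturb:
  assumes "controlled y \<eta> e l p q" "norm (p' - p) \<le> \<sigma>" "norm (q' - q) \<le> \<sigma>" "0 \<le> \<eta>"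
  shows "controlled y \<eta> (e + \<sigma> * (1 + norm y + \<eta>)) (l - \<sigma>) p' q'"
proof -
  have \<omega>: "cmod (\<omega> q' - \<omega> q) \<le> \<sigma>"
    using order.trans[OF cmod_\<omega>_le assms(3)] by (simp add: \<omega>_diff)
  then have re: "Re (\<omega> q) \<le> Re (\<omega> q') + \<sigma>"
    using abs_Re_le_cmod[of "\<omega> q' - \<omega> q"] by simp
  have "p' - \<omega> q' *\<^sub>C y = (p' - p) + (p - \<omega> q *\<^sub>C y) + (\<omega> q - \<omega> q') *\<^sub>C y"
    by (simp add: scaleC_diff_left)
  also have "norm \<dots> \<le> \<sigma> + (\<eta> * Re (\<omega> q) + e) + \<sigma> * norm y"
    using assms(1,2) \<omega>
    by (intro norm_triangle_le add_mono) (auto simp: controlled_def norm_scaleC norm_minus_commute mult_right_mono)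
  also have "\<dots> \<le> \<eta> * Re (\<omega> q') + (e + \<sigma> * (1 + norm y + \<eta>))"
    using mult_left_mono[OF re assms(4)] by (simp add: algebra_simps)
  finally show ?thesis
    using assms(1) re by (simp add: controlled_def)
qed

text \<open>The four means are taken from the inside out: over a for the E inside the argument of
  \<theta>, over c for the E that defines \<theta>, over h and g for the two factors V. Each of them
  turns one factor \<beta> into \<mu>. The error \<sigma> occurs twice, for the kernel values at the
  start and for exchanging \<theta> with conjugation by W between c and h.\<close>

lemma controlled_iterated_mean:
  fixes k \<beta> :: "'g \<Rightarrow> real"
  defines "kk \<equiv> \<lambda>g h c a. k (inv g \<otimes> c) * k (inv c \<otimes> (a \<otimes> g)) * k (inv (a \<otimes> h) \<otimes> c) * k (inv c \<otimes> h)"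
  assumes k: "\<And>g. g \<in> carrier G \<Longrightarrow> 0 \<le> k g \<and> k g \<le> 1"
    and s: "implements s (\<lambda>g. complex_of_real (k g)) \<tau>" and "\<tau> \<le> 1"
    and \<beta>: "is_mean \<beta> \<mu>"
    and low: "\<And>g h c a. g \<in> carrier G \<Longrightarrow> h \<in> carrier G \<Longrightarrow> c \<in> carrier G \<Longrightarrow> a \<in> carrier G \<Longrightarrow>
      L * \<beta> g * \<beta> h * \<beta> c * \<beta> a \<le> kk g h c a"
    and up: "\<And>g h c a. g \<in> carrier G \<Longrightarrow> h \<in> carrier G \<Longrightarrow> c \<in> carrier G \<Longrightarrow> a \<in> carrier G \<Longrightarrow>
      kk g h c a * norm (\<alpha> a (\<nu> x) - \<nu> x) \<le> \<eta> * kk g h c a + \<rho>"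
    and W: "W \<in> B" "\<And>g h z. g \<in> carrier G \<Longrightarrow> h \<in> carrier G \<Longrightarrow> z \<in> {1, x} \<Longrightarrow>
      norm (star W * (\<alpha> g s * z * star (\<alpha> h s)) * W - \<theta> s (E (\<alpha> g s * z * star (\<alpha> h s)))) \<le> \<tau>'"
    and \<eta>: "0 \<le> \<eta>"
    and \<sigma>: "90 * \<tau> * (norm x + 1) \<le> \<sigma>" "(norm s)\<^sup>2 * \<tau>' \<le> \<sigma>"
  shows "controlled (\<nu> x) \<eta> (\<rho> + 2 * \<sigma> * (1 + norm (\<nu> x) + \<eta>)) (L * \<mu>^4 - 2 * \<sigma>)
    (star (E (star s * W * s)) * x * E (star s * W * s)) (star (E (star s * W * s)) * E (star s * W * s))"
proof -
  define y where "y = \<nu> x"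
  define e where "e = \<rho> + \<sigma> * (1 + norm y + \<eta>)"
  have \<tau>0: "0 \<le> \<tau>" using implementsD[OF s one_closed one_closed] norm_ge_zero order.trans by blast
  have imp: "norm (star (\<alpha> g s) * \<alpha> h s - k (inv g \<otimes> h) *\<^sub>R 1) \<le> \<tau>" if "g \<in> carrier G" "h \<in> carrier G" for g h
    using implementsD[OF s that] by (simp add: scaleC_of_real)
  define Z where "Z g h z = \<alpha> g s * z * star (\<alpha> h s)" for g h z
  define T where "T g h c z = star (\<alpha> g s) * \<alpha> c s * \<nu> (star (\<alpha> c s) * z * \<alpha> c s) * (star (\<alpha> c s) * \<alpha> h s)" for g h c z
  have bl_T: "bounded_linear (T g h c)" for g h c
    unfolding T_def
    by (intro bounded_linear_compose[OF bounded_linear_mult_left] bounded_linear_compose[OF bounded_linear_mult_right]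
        bounded_linear_compose[OF bounded_linear_\<nu>] bounded_linear_mult_left bounded_linear_mult_right bounded_linear_ident)
  have bottom: "norm (T g h c (\<alpha> a (Z g h z)) - kk g h c a *\<^sub>R \<alpha> a (\<nu> z)) \<le> 90 * \<tau> * norm z"
    if G: "g \<in> carrier G" "h \<in> carrier G" "c \<in> carrier G" "a \<in> carrier G" for g h c a z
  proof -
    define u where "u = (!) [star (\<alpha> g s) * \<alpha> c s, star (\<alpha> c s) * \<alpha> (a \<otimes> g) s, star (\<alpha> (a \<otimes> h) s) * \<alpha> c s, star (\<alpha> c s) * \<alpha> h s]"
    define r where "r = (!) [k (inv g \<otimes> c), k (inv c \<otimes> (a \<otimes> g)), k (inv (a \<otimes> h) \<otimes> c), k (inv c \<otimes> h)]"
    have "0 \<le> r i \<and> r i \<le> 1 \<and> norm (u i - r i *\<^sub>R 1) \<le> \<tau>" if "i < 4" for i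
    proof -
      from that consider "i = 0" | "i = 1" | "i = 2" | "i = 3" by linarith
      then show ?thesis
        using G by cases (simp_all add: u_def r_def k imp)
    qed
    then have "norm (u 0 * \<nu> (u 1 * \<alpha> a z * u 2) * u 3 - (r 0 * r 1 * r 2 * r 3) *\<^sub>R \<nu> (\<alpha> a z)) \<le> 90 * \<tau> * norm (\<alpha> a z)"
      using \<open>\<tau> \<le> 1\<close> by (rule norm_\<nu>_sandwich_le)
    moreover have "u 0 * \<nu> (u 1 * \<alpha> a z * u 2) * u 3 = T g h c (\<alpha> a (Z g h z))"
      using G by (simp add: u_def T_def Z_def act_times act_star act_mult mult.assoc)
    moreover have "r 0 * r 1 * r 2 * r 3 = kk g h c a"
      by (simp add: r_def kk_def)
    ultimately show ?thesis
      using G by (simp add: \<nu>_act)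
  qed
  have 1: "controlled y \<eta> e (L * \<beta> g * \<beta> h * \<beta> c * \<beta> a - \<sigma>) (T g h c (\<alpha> a (Z g h x))) (T g h c (\<alpha> a (Z g h 1)))"
    if G: "g \<in> carrier G" "h \<in> carrier G" "c \<in> carrier G" "a \<in> carrier G" for g h c a
    unfolding e_def
  proof (rule controlled_perturb)
    have "0 \<le> kk g h c a" using G by (auto simp: kk_def intro!: mult_nonneg_nonneg k[THEN conjunct1])
    moreover have "kk g h c a *\<^sub>R \<alpha> a y - complex_of_real (kk g h c a) *\<^sub>C y = kk g h c a *\<^sub>R (\<alpha> a y - y)"
      by (simp add: scaleC_of_real scaleR_diff_right)
    ultimately show "controlled y \<eta> \<rho> (L * \<beta> g * \<beta> h * \<beta> c * \<beta> a) (kk g h c a *\<^sub>R \<alpha> a y) (kk g h c a *\<^sub>R 1)"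
      using up[OF G] low[OF G] by (simp add: controlled_def \<omega>_scaleR \<omega>_one y_def)
    have \<tau>x: "90 * \<tau> * norm x \<le> \<sigma>" "90 * \<tau> \<le> \<sigma>"
    proof -
      have "90 * \<tau> * (norm x + 1) = 90 * \<tau> * norm x + 90 * \<tau>" "0 \<le> 90 * \<tau> * norm x" "0 \<le> 90 * \<tau>"
        using \<tau>0 by (simp_all add: distrib_left)
      then show "90 * \<tau> * norm x \<le> \<sigma>" "90 * \<tau> \<le> \<sigma>"
        using \<sigma>(1) by linarith+
    qed
    then show "norm (T g h c (\<alpha> a (Z g h x)) - kk g h c a *\<^sub>R \<alpha> a y) \<le> \<sigma>"
      using bottom[OF G, of x] by (simp add: y_def)
    show "norm (T g h c (\<alpha> a (Z g h 1)) - kk g h c a *\<^sub>R 1) \<le> \<sigma>"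
      using bottom[OF G, of 1] \<tau>x G by (simp add: \<nu>_one act_one)
  qed (rule \<eta>)
  have lin: "is_mean (\<lambda>a. r * \<beta> a - \<sigma>') (r * \<mu> - \<sigma>')" for r \<sigma>'
    by (intro is_mean_diff is_mean_const is_mean_linear[OF \<beta> bounded_linear_mult_right])
  have 2: "controlled y \<eta> e (L * \<mu> * \<beta> g * \<beta> h * \<beta> c - \<sigma>) (T g h c (E (Z g h x))) (T g h c (E (Z g h 1)))"
    if G: "g \<in> carrier G" "h \<in> carrier G" "c \<in> carrier G" for g h c
  proof (rule controlled_mean[OF is_mean_linear[OF is_mean_E bl_T] is_mean_linear[OF is_mean_E bl_T]])
    show "is_mean (\<lambda>a. L * \<beta> g * \<beta> h * \<beta> c * \<beta> a - \<sigma>) (L * \<mu> * \<beta> g * \<beta> h * \<beta> c - \<sigma>)"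
      using lin[of "L * \<beta> g * \<beta> h * \<beta> c" \<sigma>] by (simp add: mult_ac)
  qed (use 1 G in blast)
  \<comment> \<open>Equivariance carries \<alpha>_c past \<nu>, where it meets b, which is fixed. So
    averaging T over c restores \<theta>.\<close>
  have mean_T: "is_mean (\<lambda>c. T g h c b) (star (\<alpha> g s) * \<theta> s b * \<alpha> h s)" if b: "b \<in> B" for g h b
  proof (rule is_mean_cong)
    show "is_mean (\<lambda>c. star (\<alpha> g s) * \<alpha> c (s * \<nu> (star s * b * s) * star s) * \<alpha> h s) (star (\<alpha> g s) * \<theta> s b * \<alpha> h s)"
      unfolding \<theta>_def
      by (intro is_mean_linear[OF is_mean_linear[OF is_mean_E bounded_linear_mult_right] bounded_linear_mult_left])
    show "star (\<alpha> g s) * \<alpha> c (s * \<nu> (star s * b * s) * star s) * \<alpha> h s = T g h c b" if "c \<in> carrier G" for c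
      using that b by (simp add: T_def act_times act_star B_iff mult.assoc flip: \<nu>_act)
  qed
  have 3: "controlled y \<eta> e (L * \<mu> * \<mu> * \<beta> g * \<beta> h - \<sigma>)
      (star (\<alpha> g s) * \<theta> s (E (Z g h x)) * \<alpha> h s) (star (\<alpha> g s) * \<theta> s (E (Z g h 1)) * \<alpha> h s)"
    if G: "g \<in> carrier G" "h \<in> carrier G" for g h
  proof (rule controlled_mean[OF mean_T mean_T])
    show "is_mean (\<lambda>c. L * \<mu> * \<beta> g * \<beta> h * \<beta> c - \<sigma>) (L * \<mu> * \<mu> * \<beta> g * \<beta> h - \<sigma>)"
      using lin[of "L * \<mu> * \<beta> g * \<beta> h" \<sigma>] by (simp add: mult_ac)
  qed (use 2 G in auto)
  define Y where "Y = star s * W * s"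
  have 4: "controlled y \<eta> (e + \<sigma> * (1 + norm y + \<eta>)) (L * \<mu> * \<mu> * \<beta> g * \<beta> h - \<sigma> - \<sigma>)
      (star (\<alpha> g Y) * x * \<alpha> h Y) (star (\<alpha> g Y) * 1 * \<alpha> h Y)"
    if G: "g \<in> carrier G" "h \<in> carrier G" for g h
  proof (rule controlled_perturb[OF 3[OF G]])
    have "norm (star (\<alpha> g Y) * z * \<alpha> h Y - star (\<alpha> g s) * \<theta> s (E (Z g h z)) * \<alpha> h s) \<le> \<sigma>" if z: "z \<in> {1, x}" for z
    proof -
      have "star (\<alpha> g Y) * z * \<alpha> h Y - star (\<alpha> g s) * \<theta> s (E (Z g h z)) * \<alpha> h s
        = star (\<alpha> g s) * (star W * Z g h z * W - \<theta> s (E (Z g h z))) * \<alpha> h s"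
        using G W(1) by (simp add: Y_def Z_def act_times act_star star_mult star_star B_iff algebra_simps)
      also have "norm \<dots> \<le> norm s * \<tau>' * norm s"
      proof -
        have t: "norm (star W * Z g h z * W - \<theta> s (E (Z g h z))) \<le> \<tau>'"
          unfolding Z_def by (rule W(2)[OF G z])
        then have "0 \<le> \<tau>'" using norm_ge_zero order.trans by blast
        with t show ?thesis
          using G by (intro order.trans[OF norm_mult_ineq] mult_mono order.trans[OF norm_mult_ineq]) auto
      qed
      finally show ?thesis using \<sigma>(2) by (simp add: power2_eq_square mult_ac)
    qed
    then show "norm (star (\<alpha> g Y) * x * \<alpha> h Y - star (\<alpha> g s) * \<theta> s (E (Z g h x)) * \<alpha> h s) \<le> \<sigma>"
      "norm (star (\<alpha> g Y) * 1 * \<alpha> h Y - star (\<alpha> g s) * \<theta> s (E (Z g h 1)) * \<alpha> h s) \<le> \<sigma>"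
      by blast+
  qed (rule \<eta>)
  have 5: "controlled y \<eta> (e + \<sigma> * (1 + norm y + \<eta>)) (L * \<mu> * \<mu> * \<mu> * \<beta> g - \<sigma> - \<sigma>)
      (star (\<alpha> g Y) * x * E Y) (star (\<alpha> g Y) * 1 * E Y)" if G: "g \<in> carrier G" for g
  proof (rule controlled_mean[OF is_mean_linear[OF is_mean_E bounded_linear_mult_right] is_mean_linear[OF is_mean_E bounded_linear_mult_right]])
    show "is_mean (\<lambda>h. L * \<mu> * \<mu> * \<beta> g * \<beta> h - \<sigma> - \<sigma>) (L * \<mu> * \<mu> * \<mu> * \<beta> g - \<sigma> - \<sigma>)"
      using lin[of "L * \<mu> * \<mu> * \<beta> g" "\<sigma> + \<sigma>"] by (simp add: mult_ac)
  qed (use 4 G in blast)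
  have mean_star: "is_mean (\<lambda>g. star (\<alpha> g Y) * z * E Y) (star (E Y) * z * E Y)" for z
    by (intro is_mean_linear[OF is_mean_linear[OF is_mean_linear[OF is_mean_E bounded_linear_star] bounded_linear_mult_left] bounded_linear_mult_left])
  have "controlled y \<eta> (e + \<sigma> * (1 + norm y + \<eta>)) (L * \<mu>^4 - 2 * \<sigma>)
      (star (E Y) * x * E Y) (star (E Y) * 1 * E Y)"
  proof (rule controlled_mean[OF mean_star mean_star])
    show "is_mean (\<lambda>g. L * \<mu> * \<mu> * \<mu> * \<beta> g - \<sigma> - \<sigma>) (L * \<mu>^4 - 2 * \<sigma>)"
      using lin[of "L * \<mu> * \<mu> * \<mu>" "\<sigma> + \<sigma>"] by (simp add: mult_ac power4_eq_xxxx)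
  qed (use 5 in blast)
  then show ?thesis
    by (simp add: e_def y_def Y_def algebra_simps)
qed

text \<open>The number w = \<omega>(V^*V) is at least l > 0. Dividing by it turns the multiple of y
  into y, and the additive error is divided by at least l.\<close>

lemma controlled_normalise:
  assumes c: "controlled y \<eta> e l (star V * x * V) (star V * V)" and "0 < l" "0 \<le> e"
  defines "w \<equiv> Re (\<omega> (star V * V))"
  shows "norm (star ((1 / sqrt w) *\<^sub>R V) * x * ((1 / sqrt w) *\<^sub>R V) - y) \<le> \<eta> + e / l"
proof -
  have w: "0 < w" "l \<le> w" "\<omega> (star V * V) = complex_of_real w"
    using c assms(2) \<omega>_cpos[OF cpos_star_mult_self[of V]]
    by (auto simp: controlled_def w_def complex_eq_iff)
  have "star ((1 / sqrt w) *\<^sub>R V) * x * ((1 / sqrt w) *\<^sub>R V) - y = (1 / w) *\<^sub>R (star V * x * V - w *\<^sub>R y)"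
    using w(1) by (simp add: star_scaleR scaleR_diff_right)
  also have "norm \<dots> \<le> (1 / w) * (\<eta> * w + e)"
    using c w by (simp add: controlled_def scaleC_of_real divide_right_mono)
  also have "\<dots> = \<eta> + e / w"
    using w(1) by (simp add: field_simps)
  also have "e / w \<le> e / l"
    using assms w by (intro divide_left_mono) auto
  finally show ?thesis by simp
qed

text \<open>If u and v hardly move s, then \<alpha>_u(s)^* \<alpha>_v(s) is close to s^*s, hence to
  \<kappa>(1) = 1. The implementing element thus provides a region in which \<kappa> is close to
  1.\<close>

lemma implements_lower_bound:
  assumes s: "implements s (\<lambda>g. complex_of_real (\<kappa> g)) \<tau>" "\<kappa> \<one> = 1"
    and u: "u \<in> carrier G" "norm (\<alpha> u s - s) \<le> a" and v: "v \<in> carrier G" "norm (\<alpha> v s - s) \<le> b"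
  shows "1 - 2 * \<tau> - norm s * (a + b) \<le> \<kappa> (inv u \<otimes> v)"
proof -
  have 1: "norm (star (\<alpha> u s) * \<alpha> v s - \<kappa> (inv u \<otimes> v) *\<^sub>R 1) \<le> \<tau>"
    using implementsD[OF s(1) u(1) v(1)] by (simp add: scaleC_of_real)
  have 2: "norm (star s * s - 1) \<le> \<tau>"
    using implementsD[OF s(1) one_closed one_closed] s(2) by (simp add: scaleC_of_real[of 1, simplified])
  have "(1 - \<kappa> (inv u \<otimes> v)) *\<^sub>R 1 = (star (\<alpha> u s) * \<alpha> v s - \<kappa> (inv u \<otimes> v) *\<^sub>R 1)
    - star (\<alpha> u s - s) * \<alpha> v s - star s * (\<alpha> v s - s) - (star s * s - 1)"
    by (simp add: algebra_simps star_diff)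
  also have "norm \<dots> \<le> \<tau> + a * norm s + norm s * b + \<tau>"
  proof (intro order.trans[OF norm_triangle_ineq4 add_mono] 1 2)
    show "norm (star (\<alpha> u s - s) * \<alpha> v s) \<le> a * norm s"
      using norm_mult_ineq[of "star (\<alpha> u s - s)" "\<alpha> v s"] mult_right_mono[OF u(2), of "norm s"] v(1) by simp
    show "norm (star s * (\<alpha> v s - s)) \<le> norm s * b"
      using norm_mult_ineq[of "star s" "\<alpha> v s - s"] mult_left_mono[OF v(2), of "norm s"] by simp
  qed
  finally have "\<bar>1 - \<kappa> (inv u \<otimes> v)\<bar> \<le> \<tau> + a * norm s + norm s * b + \<tau>"
    by (simp only: norm_scaleR norm_one mult_1_right)
  then show ?thesis by (simp add: algebra_simps)
qed

text \<open>
  If \<open>\<kappa>\<close> is close to \<open>1\<close> at both arguments, then so is their product \<open>c\<^sup>-\<^sup>1ac\<close> to the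
  neutral element, and it moves \<open>\<alpha>\<^sub>c\<^sup>-\<^sup>1(y)\<close> as much as \<open>a\<close> moves \<open>y\<close>.
\<close>

lemma peaked_kernel_orbit:
  assumes "finite Y" "0 < \<epsilon>"
  obtains \<kappa> :: "'g \<Rightarrow> real" and \<delta> where "kernel (\<lambda>g. complex_of_real (\<kappa> g))" "0 < \<delta>" "\<delta> \<le> 1" "\<kappa> \<one> = 1"
    "\<And>g. g \<in> carrier G \<Longrightarrow> 0 \<le> \<kappa> g \<and> \<kappa> g \<le> 1"
    "\<And>g c a y. g \<in> carrier G \<Longrightarrow> c \<in> carrier G \<Longrightarrow> a \<in> carrier G \<Longrightarrow> y \<in> Y \<Longrightarrow> \<epsilon> \<le> norm (\<alpha> a y - y) \<Longrightarrow>
      \<kappa> (inv g \<otimes> c) \<le> 1 - \<delta> \<or> \<kappa> (inv c \<otimes> (a \<otimes> g)) \<le> 1 - \<delta>"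
proof -
  have "\<exists>N. finite N \<and> N \<subseteq> carrier G \<and> (\<forall>g\<in>carrier G. \<exists>h\<in>N. norm (\<alpha> g y - \<alpha> h y) \<le> \<epsilon>/8)" for y
    using almost_periodic_net[OF almost_periodic_orbit[of y], of "\<epsilon>/8"] assms(2)
    by (metis zero_less_divide_iff zero_less_numeral)
  then obtain N where N: "\<And>y. finite (N y)" "\<And>y. N y \<subseteq> carrier G"
    "\<And>y g. g \<in> carrier G \<Longrightarrow> \<exists>h\<in>N y. norm (\<alpha> g y - \<alpha> h y) \<le> \<epsilon>/8"
    by metis
  \<comment> \<open>The argument moves translates of y, so \<kappa> has to be peaked for whole
    orbits; an \<epsilon>/8-net of each is enough. Two approximations and the displacement of a net
    point add up to 3 \<epsilon>/8, below the \<epsilon>/2 allotted to each of the two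
    factors.\<close>
  have fin: "finite (\<Union>y\<in>Y. (\<lambda>h. \<alpha> h y) ` N y)" "0 < \<epsilon>/8"
    using assms N(1) by auto
  obtain \<kappa> :: "'g \<Rightarrow> real" and \<delta> where \<kappa>: "kernel (\<lambda>g. complex_of_real (\<kappa> g))" "0 < \<delta>" "\<kappa> \<one> = 1"
    "\<And>g. g \<in> carrier G \<Longrightarrow> 0 \<le> \<kappa> g \<and> \<kappa> g \<le> 1"
    "\<And>g y. g \<in> carrier G \<Longrightarrow> y \<in> (\<Union>y\<in>Y. (\<lambda>h. \<alpha> h y) ` N y) \<Longrightarrow> \<epsilon>/8 \<le> norm (\<alpha> g y - y) \<Longrightarrow> \<kappa> g \<le> 1 - \<delta>"
    by (rule peaked_kernel[OF fin]) (rule that)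
  show thesis
  proof (rule that[OF \<kappa>(1) _ _ \<kappa>(3,4)])
    \<comment> \<open>The cap at 1 keeps 1 - \<delta> nonnegative, so that its powers can be
      compared later.\<close>
    show "0 < min \<delta> 1" "min \<delta> 1 \<le> 1" using \<kappa>(2) by auto
    fix g c a y assume G: "g \<in> carrier G" "c \<in> carrier G" "a \<in> carrier G" and y: "y \<in> Y" "\<epsilon> \<le> norm (\<alpha> a y - y)"
    have moved: "norm (\<alpha> u z - z) < \<epsilon>/2"
      if u: "u \<in> carrier G" "\<not> \<kappa> u \<le> 1 - min \<delta> 1" and z: "d \<in> carrier G" "z = \<alpha> d y" for u z d
    proof -
      obtain h where h: "h \<in> N y" "norm (z - \<alpha> h y) \<le> \<epsilon>/8" using N(3) z by blast
      then have "norm (\<alpha> u (\<alpha> h y) - \<alpha> h y) < \<epsilon>/8"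
        using \<kappa>(5)[OF u(1), of "\<alpha> h y"] u(2) y(1) by fastforce
      moreover have eq: "\<alpha> u z - z = \<alpha> u (z - \<alpha> h y) + (\<alpha> u (\<alpha> h y) - \<alpha> h y) - (z - \<alpha> h y)"
        using u(1) by (simp add: act_diff)
      moreover have "norm (\<alpha> u (z - \<alpha> h y) + (\<alpha> u (\<alpha> h y) - \<alpha> h y) - (z - \<alpha> h y))
        \<le> norm (z - \<alpha> h y) + norm (\<alpha> u (\<alpha> h y) - \<alpha> h y) + norm (z - \<alpha> h y)"
        using u(1) by (intro order.trans[OF norm_triangle_ineq4 add_mono] order.trans[OF norm_triangle_ineq add_mono]) auto
      ultimately show ?thesis unfolding eq using h(2) assms(2) by linarith
    qed
    show "\<kappa> (inv g \<otimes> c) \<le> 1 - min \<delta> 1 \<or> \<kappa> (inv c \<otimes> (a \<otimes> g)) \<le> 1 - min \<delta> 1"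
    proof (rule ccontr)
      define z where "z = \<alpha> (inv c) y"
      define u where "u = inv g \<otimes> c"
      define v where "v = inv c \<otimes> (a \<otimes> g)"
      assume "\<not> (\<kappa> (inv g \<otimes> c) \<le> 1 - min \<delta> 1 \<or> \<kappa> (inv c \<otimes> (a \<otimes> g)) \<le> 1 - min \<delta> 1)"
      then have uv: "norm (\<alpha> u z - z) < \<epsilon>/2" "norm (\<alpha> v z - z) < \<epsilon>/2"
        using G by (intro moved[OF _ _ _ z_def]; simp add: u_def v_def)+
      have uvG: "u \<in> carrier G" "v \<in> carrier G" using G by (auto simp: u_def v_def)
      have "\<alpha> v (\<alpha> u z) = \<alpha> (inv c) (\<alpha> a y)"
        using G by (simp add: u_def v_def z_def act_mult act_inv)
      then have "\<alpha> (inv c) (\<alpha> a y - y) = \<alpha> v (\<alpha> u z - z) + (\<alpha> v z - z)"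
        using G uvG by (simp add: act_diff z_def)
      then have "norm (\<alpha> a y - y) \<le> norm (\<alpha> u z - z) + norm (\<alpha> v z - z)"
        using norm_triangle_ineq[of "\<alpha> v (\<alpha> u z - z)" "\<alpha> v z - z"] G uvG by (metis inv_closed norm_act)
      then show False using uv y(2) by linarith
    qed
  qed
qed

text \<open>The order of the choices is the point. The kernel \<kappa>, an s0 that implements it,
  and the resulting \<mu> precede the exponent n. Far from the relevant a the n-th power of the
  fourfold product is at most (1 - \<delta>)^n, while its mean is at least (1 - \<delta>/2)^n
  \<mu>^4. Hence some n makes the far part negligible, and the accuracies of s and W come
  last.\<close>

lemma approximation_by_conjugation:
  assumes F: "finite F" and \<epsilon>: "0 < \<epsilon>"
  shows "\<exists>V\<in>B. \<forall>x\<in>F. norm (\<nu> x - star V * x * V) < \<epsilon>"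
proof -
  define X where "X = (\<Sum>x\<in>F. norm x)"
  have X: "0 \<le> X" "\<And>x. x \<in> F \<Longrightarrow> norm x \<le> X"
    using F by (auto simp: X_def sum_nonneg intro: member_le_sum)
  define Y where "Y = 6 * X"
  have Y: "0 \<le> Y" "\<And>x. x \<in> F \<Longrightarrow> norm (\<nu> x) \<le> Y"
    using X order.trans[OF norm_\<nu>_le] by (auto simp: Y_def)
  have fin: "finite (\<nu> ` F)" "0 < \<epsilon>/2" using F \<epsilon> by auto
  obtain \<kappa> :: "'g \<Rightarrow> real" and \<delta> where
    \<kappa>: "kernel (\<lambda>g. complex_of_real (\<kappa> g))" and \<delta>: "0 < \<delta>" "\<delta> \<le> 1" and \<kappa>_one: "\<kappa> \<one> = 1"
    and \<kappa>_01: "\<And>g. g \<in> carrier G \<Longrightarrow> 0 \<le> \<kappa> g \<and> \<kappa> g \<le> 1"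
    and \<kappa>_far: "\<And>g c a y. g \<in> carrier G \<Longrightarrow> c \<in> carrier G \<Longrightarrow> a \<in> carrier G \<Longrightarrow> y \<in> \<nu> ` F \<Longrightarrow>
      \<epsilon>/2 \<le> norm (\<alpha> a y - y) \<Longrightarrow> \<kappa> (inv g \<otimes> c) \<le> 1 - \<delta> \<or> \<kappa> (inv c \<otimes> (a \<otimes> g)) \<le> 1 - \<delta>"
    by (rule peaked_kernel_orbit[OF fin]) (rule that)
  \<comment> \<open>Twice this accuracy is \<delta>/16, and displacements of s0 by at most 3 \<eta>
    in total cost another \<delta>/16. Together they give the bound 1 - \<delta>/8 below.\<close>
  obtain s0 where s0: "implements s0 (\<lambda>g. complex_of_real (\<kappa> g)) (\<delta>/32)"
    using kernelE[OF \<kappa>, of "\<delta>/32"] \<delta> by auto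
  define \<eta> where "\<eta> = \<delta> / (48 * (norm s0 + 1))"
  have \<eta>: "0 < \<eta>" using \<delta> by (simp add: \<eta>_def add_nonneg_pos)
  have s0\<eta>: "norm s0 * (3 * \<eta>) \<le> \<delta>/16"
  proof -
    have "norm s0 * (3 * \<eta>) \<le> (norm s0 + 1) * (3 * \<eta>)" using \<eta> by (intro mult_right_mono) auto
    also have "\<dots> = \<delta>/16"
    proof -
      have "M * (3 * (\<delta> / (48 * M))) = \<delta>/16" if "0 < M" for M :: real
        using that by simp
      from this[of "norm s0 + 1"] show ?thesis by (simp only: \<eta>_def add_nonneg_pos norm_ge_zero zero_less_one)
    qed
    finally show ?thesis .
  qed
  define \<beta> where "\<beta> = near_one s0 \<eta>"
  obtain \<mu> where \<mu>: "is_mean (near_one s0 \<eta>) \<mu>" "0 < \<mu>" "\<mu> \<le> 1"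
    by (rule near_one_mean[OF \<eta>, of s0]) (rule that)
  have \<beta>: "0 \<le> \<beta> g" "\<beta> g \<le> 1" for g using near_one_bounds \<eta> by (auto simp: \<beta>_def)
  have \<kappa>_near: "1 - \<delta>/8 \<le> \<kappa> (inv u \<otimes> v)"
    if "u \<in> carrier G" "v \<in> carrier G" "norm (\<alpha> u s0 - s0) \<le> i * \<eta>" "norm (\<alpha> v s0 - s0) \<le> j * \<eta>" "i + j \<le> 3"
    for u v i j
  proof -
    have "norm s0 * (i * \<eta> + j * \<eta>) \<le> norm s0 * (3 * \<eta>)"
      using that(5) \<eta> by (intro mult_left_mono) (auto simp flip: distrib_right)
    then show ?thesis
      using implements_lower_bound[OF s0 \<kappa>_one that(1,3,2,4)] s0\<eta> by linarith
  qed
  \<comment> \<open>The ratio of the upper bound off the peak to the lower bound near it, per power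
    of \<kappa>.\<close>
  define q where "q = (1 - \<delta>) / (1 - \<delta>/2)"
  have q: "0 \<le> q" "q < 1" "1 - \<delta> = q * (1 - \<delta>/2)" using \<delta> by (auto simp: q_def field_simps)
  have "0 < \<epsilon> * \<mu>^4 / (16 * (2 * Y + 1))"
    using \<epsilon> \<mu>(2) Y(1) by (intro divide_pos_pos mult_pos_pos) auto
  then obtain n where n: "q ^ n < \<epsilon> * \<mu>^4 / (16 * (2 * Y + 1))"
    using real_arch_pow_inv[OF _ q(2)] by blast
  define L where "L = (1 - \<delta>/2) ^ n"
  have L: "0 < L" using \<delta> by (simp add: L_def)
  define l where "l = L * \<mu>^4"
  have l: "0 < l" using L \<mu> by (simp add: l_def)
  define \<rho> where "\<rho> = 2 * Y * (1 - \<delta>) ^ n"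
  have \<rho>: "0 \<le> \<rho>" using Y \<delta> by (simp add: \<rho>_def)
  have \<rho>_le: "\<rho> \<le> \<epsilon> * l / 16"
  proof -
    have "2 * Y * q ^ n \<le> (2 * Y + 1) * q ^ n" using q by (intro mult_right_mono) auto
    also have "\<dots> \<le> (2 * Y + 1) * (\<epsilon> * \<mu>^4 / (16 * (2 * Y + 1)))"
      using n Y by (intro mult_left_mono) auto
    also have "\<dots> = \<epsilon> * \<mu>^4 / 16" using Y by (simp add: field_simps)
    finally have "2 * Y * q ^ n * L \<le> \<epsilon> * \<mu>^4 / 16 * L" using L by (intro mult_right_mono) auto
    then show ?thesis by (simp add: \<rho>_def l_def L_def q(3) power_mult_distrib mult_ac)
  qed
  \<comment> \<open>The first bound retains half of the mass l after subtracting 2 \<sigma>; the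
    second makes the additive error at most a sixteenth of \<epsilon> l.\<close>
  define \<sigma> where "\<sigma> = min (l / 4) (\<epsilon> * l / (32 * (1 + Y + \<epsilon>/2)))"
  have d0: "0 < 1 + Y + \<epsilon>/2" using Y \<epsilon> by (intro add_nonneg_pos) auto
  have \<sigma>: "0 < \<sigma>" "2 * \<sigma> \<le> l / 2" using l \<epsilon> d0 by (auto simp: \<sigma>_def)
  have \<sigma>d: "2 * \<sigma> * (1 + Y + \<epsilon>/2) \<le> \<epsilon> * l / 16"
  proof -
    have "\<sigma> * (1 + Y + \<epsilon>/2) \<le> \<epsilon> * l / (32 * (1 + Y + \<epsilon>/2)) * (1 + Y + \<epsilon>/2)"
      using d0 by (intro mult_right_mono) (auto simp: \<sigma>_def)
    also have "\<dots> = \<epsilon> * l / 32"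
    proof -
      have "\<epsilon> * l / (32 * M) * M = \<epsilon> * l / 32" if "0 < M" for M :: real
        using that by simp
      from this[OF d0] show ?thesis .
    qed
    finally show ?thesis by simp
  qed
  define \<tau> where "\<tau> = min 1 (\<sigma> / (90 * (X + 1)))"
  have \<tau>: "0 < \<tau>" "\<tau> \<le> 1" using \<sigma> X by (auto simp: \<tau>_def)
  have \<tau>X: "90 * \<tau> * (norm x + 1) \<le> \<sigma>" if "x \<in> F" for x
  proof -
    have "90 * \<tau> * (norm x + 1) \<le> 90 * (\<sigma> / (90 * (X + 1))) * (X + 1)"
      using X(2)[OF that] \<tau> X(1) \<sigma> by (intro mult_mono) (auto simp: \<tau>_def)
    also have "\<dots> = \<sigma>"
    proof -
      have "90 * (\<sigma> / (90 * M)) * M = \<sigma>" if "0 < M" for M :: real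
        using that by simp
      from this[of "X + 1"] show ?thesis using X(1) by linarith
    qed
    finally show ?thesis .
  qed
  have "kernel (\<lambda>g. complex_of_real (\<kappa> g) ^ n)" by (rule kernel_power[OF \<kappa>])
  then obtain s where s: "implements s (\<lambda>g. complex_of_real (\<kappa> g ^ n)) \<tau>"
    using kernelE[OF _ \<tau>(1)] by (auto simp: of_real_power)
  define \<tau>' where "\<tau>' = \<sigma> / ((norm s)\<^sup>2 + 1)"
  have \<tau>': "0 < \<tau>'" using \<sigma> by (simp add: \<tau>'_def add_nonneg_pos)
  have s\<tau>': "(norm s)\<^sup>2 * \<tau>' \<le> \<sigma>"
  proof -
    have "(norm s)\<^sup>2 * \<tau>' \<le> ((norm s)\<^sup>2 + 1) * \<tau>'" using \<tau>' by (intro mult_right_mono) auto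
    also have "\<dots> = \<sigma>" using add_nonneg_pos[of "(norm s)\<^sup>2" 1] by (simp add: \<tau>'_def)
    finally show ?thesis .
  qed
  obtain W where W: "W \<in> B" "\<And>g h x. g \<in> carrier G \<Longrightarrow> h \<in> carrier G \<Longrightarrow> x \<in> insert 1 F \<Longrightarrow>
    norm (star W * (\<alpha> g s * x * star (\<alpha> h s)) * W - \<theta> s (E (\<alpha> g s * x * star (\<alpha> h s)))) \<le> \<tau>'"
    by (rule implementing_element[of "insert 1 F" \<tau>' s]) (use F \<tau>' in auto)
  define V where "V = E (star s * W * s)"
  define w where "w = Re (\<omega> (star V * V))"
  have "norm (\<nu> x - star ((1 / sqrt w) *\<^sub>R V) * x * ((1 / sqrt w) *\<^sub>R V)) < \<epsilon>" if x: "x \<in> F" for x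
  proof -
    define \<kappa>4 where "\<kappa>4 g h c a = \<kappa> (inv g \<otimes> c) * \<kappa> (inv c \<otimes> (a \<otimes> g)) * \<kappa> (inv (a \<otimes> h) \<otimes> c) * \<kappa> (inv c \<otimes> h)" for g h c a
    have \<kappa>4: "\<kappa> (inv g \<otimes> c) ^ n * \<kappa> (inv c \<otimes> (a \<otimes> g)) ^ n * \<kappa> (inv (a \<otimes> h) \<otimes> c) ^ n * \<kappa> (inv c \<otimes> h) ^ n
      = \<kappa>4 g h c a ^ n" for g h c a
      by (simp add: \<kappa>4_def power_mult_distrib)
    have \<kappa>4_nonneg: "0 \<le> \<kappa>4 g h c a" if "g \<in> carrier G" "h \<in> carrier G" "c \<in> carrier G" "a \<in> carrier G" for g h c a
      using that unfolding \<kappa>4_def by (intro mult_nonneg_nonneg \<kappa>_01[THEN conjunct1]) auto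
    have low: "L * \<beta> g * \<beta> h * \<beta> c * \<beta> a \<le> \<kappa>4 g h c a ^ n"
      if G: "g \<in> carrier G" "h \<in> carrier G" "c \<in> carrier G" "a \<in> carrier G" for g h c a
    proof (cases "\<forall>u\<in>{g, h, c, a}. norm (\<alpha> u s0 - s0) < \<eta>")
      case True
      \<comment> \<open>The products a g and a h move s0 by up to 2 \<eta>, so each of the four
        arguments of \<kappa> combines displacements of at most 3 \<eta>. Four factors of at least 1
        - \<delta>/8 give 1 - \<delta>/2 by Bernoulli's inequality.\<close>
      have sum: "norm (\<alpha> (a \<otimes> u) s0 - s0) \<le> 2 * \<eta>" if u: "u \<in> {g, h}" for u
      proof -
        have uG: "u \<in> carrier G" using u G by auto
        have "\<alpha> (a \<otimes> u) s0 - s0 = \<alpha> a (\<alpha> u s0 - s0) + (\<alpha> a s0 - s0)"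
          using uG G by (simp add: act_mult act_diff)
        also have "norm \<dots> \<le> \<eta> + \<eta>"
          using True u G by (intro norm_triangle_le add_mono) auto
        finally show ?thesis by simp
      qed
      have near: "norm (\<alpha> u s0 - s0) \<le> 1 * \<eta>" if "u \<in> {g, h, c, a}" for u
        using True that by force
      have "1 - \<delta>/8 \<le> \<kappa> (inv g \<otimes> c)" by (rule \<kappa>_near[of _ _ 1 1]) (use G near in auto)
      moreover have "1 - \<delta>/8 \<le> \<kappa> (inv c \<otimes> (a \<otimes> g))" by (rule \<kappa>_near[of _ _ 1 2]) (use G near sum in auto)
      moreover have "1 - \<delta>/8 \<le> \<kappa> (inv (a \<otimes> h) \<otimes> c)" by (rule \<kappa>_near[of _ _ 2 1]) (use G near sum in auto)
      moreover have "1 - \<delta>/8 \<le> \<kappa> (inv c \<otimes> h)" by (rule \<kappa>_near[of _ _ 1 1]) (use G near in auto)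
      ultimately have "(1 - \<delta>/8) * (1 - \<delta>/8) * (1 - \<delta>/8) * (1 - \<delta>/8) \<le> \<kappa>4 g h c a"
        unfolding \<kappa>4_def using \<delta> G by (intro mult_mono mult_nonneg_nonneg \<kappa>_01[THEN conjunct1]) auto
      moreover have "1 - \<delta>/2 \<le> (1 - \<delta>/8) * (1 - \<delta>/8) * (1 - \<delta>/8) * (1 - \<delta>/8)"
        using Bernoulli_inequality[of "- \<delta>/8" 4] \<delta> by (simp add: power4_eq_xxxx)
      ultimately have "L \<le> \<kappa>4 g h c a ^ n"
        unfolding L_def using \<delta> by (intro power_mono) auto
      moreover have "L * \<beta> g * \<beta> h * \<beta> c * \<beta> a \<le> L * 1 * 1 * 1 * 1"
        using L \<beta> by (intro mult_mono mult_nonneg_nonneg) auto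
      ultimately show ?thesis by simp
    next
      case False
      then have "\<beta> g = 0 \<or> \<beta> h = 0 \<or> \<beta> c = 0 \<or> \<beta> a = 0"
        using near_one_eq_0[OF \<eta>] by (fastforce simp: \<beta>_def)
      then show ?thesis using \<kappa>4_nonneg[OF G] by auto
    qed
    have up: "\<kappa>4 g h c a ^ n * norm (\<alpha> a (\<nu> x) - \<nu> x) \<le> \<epsilon>/2 * \<kappa>4 g h c a ^ n + \<rho>"
      if G: "g \<in> carrier G" "h \<in> carrier G" "c \<in> carrier G" "a \<in> carrier G" for g h c a
    proof (cases "norm (\<alpha> a (\<nu> x) - \<nu> x) < \<epsilon>/2")
      case True
      then have "\<kappa>4 g h c a ^ n * norm (\<alpha> a (\<nu> x) - \<nu> x) \<le> \<kappa>4 g h c a ^ n * (\<epsilon>/2)"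
        using \<kappa>4_nonneg[OF G] by (intro mult_left_mono) auto
      then show ?thesis using \<rho> by (simp add: mult.commute)
    next
      case False
      have b: "0 \<le> \<kappa> (inv g \<otimes> c)" "\<kappa> (inv g \<otimes> c) \<le> 1" "0 \<le> \<kappa> (inv c \<otimes> (a \<otimes> g))" "\<kappa> (inv c \<otimes> (a \<otimes> g)) \<le> 1"
        "0 \<le> \<kappa> (inv (a \<otimes> h) \<otimes> c)" "\<kappa> (inv (a \<otimes> h) \<otimes> c) \<le> 1" "0 \<le> \<kappa> (inv c \<otimes> h)" "\<kappa> (inv c \<otimes> h) \<le> 1"
        using G by (auto intro: \<kappa>_01[THEN conjunct1] \<kappa>_01[THEN conjunct2])
      have "\<kappa> (inv g \<otimes> c) \<le> 1 - \<delta> \<or> \<kappa> (inv c \<otimes> (a \<otimes> g)) \<le> 1 - \<delta>"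
        using G x False by (intro \<kappa>_far[of g c a "\<nu> x"]) auto
      then have "\<kappa> (inv g \<otimes> c) * \<kappa> (inv c \<otimes> (a \<otimes> g)) \<le> 1 - \<delta>"
        using mult_left_le[OF b(4,1)] mult_left_le_one_le[OF b(3,1,2)] by linarith
      moreover have "\<kappa>4 g h c a \<le> \<kappa> (inv g \<otimes> c) * \<kappa> (inv c \<otimes> (a \<otimes> g))"
        unfolding \<kappa>4_def mult.assoc[of "_ * _"] using b
        by (intro mult_left_le mult_le_one mult_nonneg_nonneg) auto
      ultimately have "\<kappa>4 g h c a ^ n \<le> (1 - \<delta>) ^ n"
        using \<kappa>4_nonneg[OF G] by (intro power_mono) auto
      moreover have "norm (\<alpha> a (\<nu> x) - \<nu> x) \<le> 2 * Y"
        using norm_triangle_ineq4[of "\<alpha> a (\<nu> x)" "\<nu> x"] Y(2)[OF x] G by simp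
      ultimately have "\<kappa>4 g h c a ^ n * norm (\<alpha> a (\<nu> x) - \<nu> x) \<le> (1 - \<delta>) ^ n * (2 * Y)"
        using \<delta> by (intro mult_mono) auto
      moreover have "0 \<le> \<epsilon>/2 * \<kappa>4 g h c a ^ n"
        using \<epsilon> \<kappa>4_nonneg[OF G] by simp
      ultimately show ?thesis by (simp add: \<rho>_def mult_ac)
    qed
    have c: "controlled (\<nu> x) (\<epsilon>/2) (\<rho> + 2 * \<sigma> * (1 + norm (\<nu> x) + \<epsilon>/2)) (L * \<mu>^4 - 2 * \<sigma>) (star V * x * V) (star V * V)"
      unfolding V_def
    proof (rule controlled_iterated_mean[OF _ s \<tau>(2) \<mu>(1)[folded \<beta>_def]])
      show "0 \<le> \<kappa> g ^ n \<and> \<kappa> g ^ n \<le> 1" if "g \<in> carrier G" for g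
        using \<kappa>_01[OF that] by (simp add: power_le_one)
      show "norm (star W * (\<alpha> g s * z * star (\<alpha> h s)) * W - \<theta> s (E (\<alpha> g s * z * star (\<alpha> h s)))) \<le> \<tau>'"
        if "g \<in> carrier G" "h \<in> carrier G" "z \<in> {1, x}" for g h z
        using that x by (intro W(2)) auto
    qed (use low up W(1) \<epsilon> x \<tau>X[OF x] s\<tau>' in \<open>auto simp: \<kappa>4\<close>)
    define e where "e = \<rho> + 2 * \<sigma> * (1 + norm (\<nu> x) + \<epsilon>/2)"
    have e0: "0 \<le> e" using \<rho> \<sigma> \<epsilon> by (auto simp: e_def intro!: add_nonneg_nonneg mult_nonneg_nonneg)
    have "2 * \<sigma> * (1 + norm (\<nu> x) + \<epsilon>/2) \<le> 2 * \<sigma> * (1 + Y + \<epsilon>/2)"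
      using Y(2)[OF x] \<sigma> by (intro mult_left_mono) auto
    then have e: "e \<le> \<epsilon> * l / 8" using \<rho>_le \<sigma>d by (simp add: e_def)
    have l2: "l / 2 \<le> L * \<mu>^4 - 2 * \<sigma>" using \<sigma> by (simp add: l_def)
    \<comment> \<open>The error consists of \<epsilon>/2 for the elements a that move \<nu>(x) by
      less than \<epsilon>/2, and at most \<epsilon>/4 for everything additive, as e \<le>
      \<epsilon> l/8 is divided by at least l/2.\<close>
    have "norm (star ((1 / sqrt w) *\<^sub>R V) * x * ((1 / sqrt w) *\<^sub>R V) - \<nu> x) \<le> \<epsilon>/2 + e / (L * \<mu>^4 - 2 * \<sigma>)"
      unfolding w_def using c l2 l e0 by (intro controlled_normalise) (auto simp: e_def)
    also have "e / (L * \<mu>^4 - 2 * \<sigma>) \<le> e / (l / 2)"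
      using l2 l e0 by (intro divide_left_mono) auto
    also have "e / (l / 2) \<le> \<epsilon> / 4"
      using e l by (simp add: field_simps)
    also have "\<epsilon> / 2 + \<epsilon> / 4 < \<epsilon>" using \<epsilon> by simp
    finally show ?thesis by (simp add: norm_minus_commute)
  qed
  moreover have "(1 / sqrt w) *\<^sub>R V \<in> B"
    unfolding V_def by (intro B.scaleR_in E_in)
  ultimately show ?thesis by blast
qed

end

theorem theorem6p1:
  fixes G :: "('g, 'm) monoid_scheme"
    and T :: "'g topology"
    and \<alpha> :: "'g \<Rightarrow> 'a::unital_cstar_algebra \<Rightarrow> 'a"
    and \<nu> :: "'a \<Rightarrow> 'a"
  assumes "compact_group G T" and "second_countable T"
    and "separable_space (euclidean :: 'a topology)"
    and "group_action_on_cstar G T \<alpha>"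
    and "faithful_action G \<alpha>" and "minimal_action G \<alpha>"
    and "kirchberg_algebra (fixed_point_algebra G \<alpha>)"
    and "unital_completely_positive \<nu>" and "equivariant G \<alpha> \<nu>"
  shows "\<forall>F \<epsilon>. finite F \<and> 0 < \<epsilon> \<longrightarrow>
    (\<exists>V\<in>fixed_point_algebra G \<alpha>. \<forall>x\<in>F. norm (\<nu> x - star V * x * V) < \<epsilon>)"
proof -
  interpret topological_group G T
    using assms(1) by (simp add: compact_group_def)
  have aut: "bij (\<alpha> g)" "complex_linear_on UNIV (\<alpha> g)" "\<alpha> g (x * y) = \<alpha> g x * \<alpha> g y" "\<alpha> g (star x) = star (\<alpha> g x)"
    if "g \<in> carrier G" for g x y
    using assms(4) that unfolding group_action_on_cstar_def hom_def Aut_group_def by auto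
  have mult: "\<alpha> (g \<otimes>\<^bsub>G\<^esub> h) x = \<alpha> g (\<alpha> h x)" if "g \<in> carrier G" "h \<in> carrier G" for g h x
    using assms(4) that unfolding group_action_on_cstar_def hom_def Aut_group_def by auto
  \<comment> \<open>The image of the neutral element is idempotent and, being injective, the
    identity.\<close>
  have "\<alpha> \<one>\<^bsub>G\<^esub> (\<alpha> \<one>\<^bsub>G\<^esub> x) = \<alpha> \<one>\<^bsub>G\<^esub> x" for x
    using mult[of "\<one>\<^bsub>G\<^esub>" "\<one>\<^bsub>G\<^esub>"] by simp
  then have one: "\<alpha> \<one>\<^bsub>G\<^esub> x = x" for x
    using aut(1)[OF one_closed] by (meson bij_is_inj injD)
  \<comment> \<open>Compactness of the group and point-norm continuity are combined here into
    compact orbits, which is the form in which the sequel uses them.\<close>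
  have cpt: "compact ((\<lambda>g. \<alpha> g x) ` carrier G)" for x
  proof -
    have "compactin T (carrier G)"
      using assms(1) by (simp add: compact_group_def compact_space_def topspace_eq_carrier)
    moreover have "continuous_map T euclidean (\<lambda>g. \<alpha> g x)"
      using assms(4) by (simp add: group_action_on_cstar_def)
    ultimately have "compactin euclidean ((\<lambda>g. \<alpha> g x) ` carrier G)"
      by (rule image_compactin)
    then show ?thesis by simp
  qed
  have sep: "\<exists>D :: 'a set. countable D \<and> closure D = UNIV"
    using assms(3) by (auto simp: separable_space_def)
  interpret kirchberg_action G \<alpha>
  proof unfold_locales
    show "\<alpha> g (x + y) = \<alpha> g x + \<alpha> g y" "\<alpha> g (c *\<^sub>C x) = c *\<^sub>C \<alpha> g x" if "g \<in> carrier G" for g c x y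
      using aut(2)[OF that] by (auto simp: complex_linear_on_def)
    show "simple_cstar (fixed_point_algebra G \<alpha>)" "purely_infinite (fixed_point_algebra G \<alpha>)"
      "nuclear_cstar (fixed_point_algebra G \<alpha>)"
      using assms(7) by (simp_all add: kirchberg_algebra_def)
    show "relative_commutant (fixed_point_algebra G \<alpha>) = range (\<lambda>c. c *\<^sub>C 1)"
      using assms(6) by (simp add: minimal_action_def)
  qed (simp_all add: mult one aut cpt sep)
  obtain S \<omega> where S: "\<And>n. S n \<in> isom" "\<And>y. (\<lambda>n. star (S n) * y * S n) \<longlonglongrightarrow> \<omega> y *\<^sub>C 1"
    by (rule scalar_compression_sequence) (rule that)
  interpret equivariant_map G \<alpha> S \<omega> \<nu>
  proof unfold_locales
    show "\<nu> (\<alpha> g x) = \<alpha> g (\<nu> x)" if "g \<in> carrier G" for g x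
      using assms(9) that unfolding equivariant_def by (metis comp_apply)
  qed (use S assms(8) in \<open>auto simp: unital_completely_positive_def\<close>)
  show ?thesis
    using approximation_by_conjugation by blast
qed

end
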